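(* Let $n\ge4$ and $m\ge1$, let $\mathrm{Conf}(m,\mathbb{R}^n)$ be the configuration space of $m$ pairwise distinct points in $\mathbb{R}^n$, let $\bar{\mathcal D}(m)$ be Kontsevich's differential graded algebra of oriented diagrams (for $\mathbb{R}^n$), and let $$\omega=\sum_{\Gamma\in\mathcal{B}(m)}I(\Gamma)\otimes\frac{[\Gamma^*]}{|\mathrm{Aut}(\Gamma)|}\in C^*_{dR}(\mathrm{Conf}(m,\mathbb{R}^n))\otimes\Omega(\bar{\mathcal D}(m)^* ).$$ The transport $T_\omega$ of $\omega$ induces a holonomy 3-functor, i.e. a Gray functor $$\mathrm{Hol}^3_\omega\colon\mathcal{P}_3(\mathrm{Conf}(m,\mathbb{R}^n))\to\mathcal{C}_3(\bar{\mathcal D}(m)^* ),$$ sending each point to $*$, each 1-track $[\gamma]$ to $\langle T_\omega,\gamma\rangle$, each laminated 2-track $[g]$ to $\langle T_\omega,g\rangle$, and each 3-track $[J]$ to the class of $\langle T_\omega,J\rangle$ in $\Omega^2(\bar{\mathcal D}(m)^* )/d_\Omega\Omega^{1,2}(\bar{\mathcal D}(m)^* )$.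
   Context: All vector spaces, algebras and coalgebras are over $\mathbb{R}$. Write $M=\mathrm{Conf}(m,\mathbb{R}^n)$ and $C=\bar{\mathcal D}(m)^*$ (graded dual). **Diagrams.** A diagram $\Gamma$ is a finite graph with $m$ external vertices labelled $1,\dots,m$, finitely many internal vertices, and edges; it is admissible if it has no loops (edges joining a vertex to itself), no multiple edges, all internal vertices have valence $\ge3$, and every internal vertex is connected by a path of edges to an external vertex. Its degree is $(n-1)\cdot\#\{\text{edges}\}-n\cdot\#\{\text{internal vertices}\}$. An orientation of $\Gamma$ is an ordering of the set of edges and internal vertices together with a direction of each edge, modulo signs: edges have degree $n-1$ and internal vertices degree $-n$, permutations act with the Koszul sign, reversing an edge multiplies by $(-1)^n$. $\bar{\mathcal D}(m)$ is the vector space spanned by oriented admissible diagrams up to isomorphism fixing external vertices, modulo the relation that opposite orientations differ by $-1$ (non-admissible diagrams are set to zero). The product glues diagrams along external vertices (concatenating orientations); the unit is the diagram without edges. The differential, of degree $+1$, is a signed sum over edges $e$ with at least one internal endpoint $v$ of the diagrams $\Gamma/e$ obtained by contracting $e$ (with non-admissible results zero), where $\Gamma/e$ is oriented by writing the orientation of $\Gamma$ as $e, v,\dots$ with $e$ directed toward $v$ and deleting $e$ and $v$; there is one overall sign convention, fixed so that the map $I$ below commutes with differentials. For $n\ge4$ each graded piece is finite-dimensional, so the graded dual $\bar{\mathcal D}(m)^*$ is a coaugmented differential graded coalgebra (differential $\partial f=f\circ d$, coproduct dual to the product, no extra signs), with positive-degree part starting in degree $\ge 2$. $I\colon\bar{\mathcal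 D}(m)\to C^*_{dR}(M)$ is the formality integration map: $I(\Gamma)$ is the integral, along the fibers of the projection from the configuration space of the external and internal vertices (Fulton–MacPherson compactified) to $\mathrm{Conf}(m,\mathbb{R}^n)$ forgetting internal vertices, of the product over edges $a\to b$ of the pullbacks under $(x_b-x_a)/|x_b-x_a|$ of a fixed normalized rotation-invariant volume form on $S^{n-1}$; it is a morphism of differential graded algebras. $\mathcal{B}(m)$ is a basis of $\bar{\mathcal D}(m)$ obtained by choosing one diagram in each orientation class (among those nonzero); $\mathrm{Aut}(\Gamma)$ is the group of automorphisms of the diagram fixing external vertices; $\Gamma^*\in\bar{\mathcal D}(m)^*$ takes the value $|\mathrm{Aut}(\Gamma)|$ on $\Gamma$ and $0$ on the other basis elements; $[\Gamma^*]$ is the corresponding length-one element $s^{-1}\Gamma^*$ of the cobar complex (zero for the unit diagram). The sum defining $\omega$ is finite because $M$ is finite-dimensional. **Paths.** A $k$-path in $M$ is a smooth map $\alpha\colon[0,1]^k\to M$ for which there is $\varepsilon>0$ such that for each $i$, $\alpha$ does not depend on $t_i$ for $t_i\in[0,\varepsilon]$ nor for $t_i\in[1-\varepsilon,1]$, and such that $\alpha([0,1]^{k-1}\times\{0\})$ and $\alpha([0,1]^{k-1}\times\{1\})$ are single points. It is a $k$-path from $f$ to $g$ if $\alpha(0,-,\dots,-)=f$ and $\alpha(1,-,\dots,-)=g$. The composition $\alpha\circ\beta$ is concatenation (at double speed) in the last coordinate; the whiskerings $\gamma\circ g$, $g\circ\gamma$ of a 2- or 3-path $g$ by a 1-path $\gamma$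 are concatenations in the last coordinate, with $\gamma$ constant in the other coordinates. The vertical composition $g\cdot h$ is concatenation in the second-to-last coordinate; the upward composition $J*K$ of 3-paths $(r,s,t)$ is concatenation in $r$. For 2-paths put $$\begin{pmatrix} & h_2 \\ h_1 & \end{pmatrix}=(h_1\circ h_2(0,-))\cdot(h_1(1,-)\circ h_2),\qquad \begin{pmatrix} h_1 & \\ & h_2 \end{pmatrix}=(h_1(0,-)\circ h_2)\cdot(h_1\circ h_2(1,-)).$$ **Homotopies.** A rank-1 homotopy is a 2-path $h$ with $\operatorname{rank}dh<2$ everywhere. A rank-2 homotopy is a 3-path $\alpha$ with $\operatorname{rank}d\alpha<3$ everywhere and $\alpha(-,0,-)$, $\alpha(-,1,-)$ rank-1 homotopies. It is laminated if for all $(r,s)$ at least one of the following holds: (1) for all $t$ there are $(a_t,b_t)\ne(0,0)$ with $a_t\partial_r\alpha+b_t\partial_t\alpha=0$ at $(r,s,t)$; (2) the same with $\partial_s$ in place of $\partial_r$; (3) there are $(a,b)\ne(0,0)$ such that for all $t$, $a\partial_r\alpha+b\partial_s\alpha=0$ at $(r,s,t)$. A good 3-path is a 3-path $J$ with $J(r,0,t)$, $J(r,1,t)$ independent of $r$. A rank-3 homotopy is a 4-path $W(q,r,s,t)$ with $\operatorname{rank}dW<4$ everywhere, $W(-,0,-,-)$, $W(-,1,-,-)$ laminated rank-2 homotopies, and $W(-,r,0,-)$, $W(-,r,1,-)$ independent of $r$ and rank-1 homotopies. A 1-track, laminated 2-track, 3-track is the class of a 1-path up to rank-1 homotopy, a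 2-path up to laminated rank-2 homotopy, a good 3-path up to rank-3 homotopy. **Path 3-groupoid.** $\mathcal{P}_3(M)$ is the Gray 3-groupoid (Faria Martins–Picken) with objects points, 1-morphisms 1-tracks, 2-morphisms $[\gamma]\Rightarrow[\gamma']$ the laminated 2-tracks $[g]$ with $[g(0,-)]=[\gamma]$, $[g(1,-)]=[\gamma']$, and 3-morphisms $[g]\to[h]$ the 3-tracks $[J]$ with $[J(0,-,-)]=[g]$, $[J(1,-,-)]=[h]$; compositions (of 1-tracks, vertical, upward) and whiskerings by 1-tracks (hence the two horizontal compositions) are induced by the operations on paths, choosing strictly composable representatives (by inserting the corresponding homotopies). The interchange 3-cell of $[h_1],[h_2]$, from $\begin{pmatrix} [h_1] & \\ & [h_2] \end{pmatrix}$ to $\begin{pmatrix} & [h_2] \\ {[h_1]} & \end{pmatrix}$, is the class of $(r,s,t)\mapsto h_1(a(r,s),2t)$ for $t\le\frac12$, $h_2(b(r,s),2t-1)$ for $t\ge\frac12$, where $(a,b)\colon[0,1]^2\to[0,1]^2$ is smooth (with collars), equals $(0,0)$ at $s=0$, $(1,1)$ at $s=1$, and runs along the edges $(0,0)\to(0,1)\to(1,1)$ for $r=0$ and $(0,0)\to(1,0)\to(1,1)$ for $r=1$. **Iterated integrals (Chen).** For forms $\omega_1,\dots,\omega_k$ of positive degree on $M$ and a map $\phi\colon U\to\{\text{1-paths from }x_0\text{ to }x_1\}$, $U$ a bounded closed convex region, with smooth adjoint $U\times[0,1]\to M$, let the pullback of $\omega_j$ by $(t_j,x)\mapsto\phi(x)(t_j)$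 be $dt_j\wedge\omega_j'+\omega_j''$ with $\omega_j',\omega_j''$ not involving $dt_j$. Then $(\int\omega_1\cdots\omega_k)_\phi=\int_{0\le t_1\le\dots\le t_k\le1}(\omega_1'\wedge\cdots\wedge\omega_k')\,dt_1\cdots dt_k$, a form on $U$ of degree $\sum\deg\omega_i-k$, and $\langle\int\omega_1\cdots\omega_k,\phi\rangle$ is its integral over $U$ if this degree is $\dim U$, and $0$ otherwise (for $k=0$: $1$ if $\dim U=0$, else $0$). A $k$-path $\alpha$ ($k\ge1$) is regarded as such a $\phi$ with $U=[0,1]^{k-1}$, $x\mapsto\alpha(x,-)$. **Cobar complex and transport.** With $\bar C=\operatorname{coker}(\text{coaugmentation})$, reduced coproduct $\bar\Delta(c)=\sum c_{(1)}\otimes c_{(2)}$ and $(s^{-1}V)_n=V_{n+1}$, $\Omega(C)$ is the tensor algebra $T(s^{-1}\bar C)$ with derivation $d_\Omega(s^{-1}c)=-s^{-1}\partial c+\sum(-1)^{\deg c_{(1)}}s^{-1}c_{(1)}\otimes s^{-1}c_{(2)}$, of degree $-1$; $[c_1|\cdots|c_k]=s^{-1}c_1\otimes\cdots\otimes s^{-1}c_k$; $\Omega^i(C)$ is the degree $i$ part (here $\Omega^0(C)=\mathbb{R}$, and no completion is needed as $C$ is 1-connected); $\Omega^{1,2}(C)=\Omega^1(C)\otimes\Omega^2(C)+\Omega^2(C)\otimes\Omega^1(C)\subset\Omega^3(C)$ (spans of products). The transport is $$T_\omega=\sum_{k\ge0}\sum_{\Gamma_1,\dots,\Gamma_k\in\mathcal{B}(m)}\int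 I(\Gamma_1)\cdots I(\Gamma_k)\otimes\frac{[\Gamma_1^*|\cdots|\Gamma_k^*]}{|\mathrm{Aut}(\Gamma_1)|\cdots|\mathrm{Aut}(\Gamma_k)|},$$ and $\langle T_\omega,\alpha\rangle\in\Omega(C)$ is obtained by replacing each iterated integral by its pairing with $\alpha$. **Target.** $\mathcal{C}_3(C)$ is the Gray 3-category with one object $*$; 1-morphisms elements of $\Omega^0(C)=\mathbb{R}$, composed by multiplication; 2-morphisms $x\Rightarrow y$ the $X\in\Omega^1(C)$ with $d_\Omega X=y-x$ (vertical composition addition; whiskering by $p$ is $pX$, $Xp$); 3-morphisms $X\to Y$ the $\alpha\in\Omega^2(C)/d_\Omega\Omega^{1,2}(C)$ with $d_\Omega\alpha=Y-X$ (upward and vertical compositions addition; whiskering by $p$ is $p\alpha$, $\alpha p$); the interchange 3-cell of $X\colon x\Rightarrow y$, $Y\colon p\Rightarrow q$, from $xY+Xq$ to $Xp+yY$, is the class of $XY$. A Gray functor strictly preserves all this structure. *)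

theory Defs
  imports
    "HOL-Analysis.Analysis"
    "HOL-Analysis.Finite_Function_Topology"
begin

section \<open>Oriented diagrams and Kontsevich's algebra\<close>

datatype 'm vertex = Ext 'm | Inn nat
datatype 'm cell = IVert nat | Edge "'m vertex" "'m vertex"

text \<open>
  An oriented diagram with external vertices \<open>UNIV :: 'm set\<close> is the list of its internal vertices
  and directed edges, in the order prescribed by the orientation.
\<close>

type_synonym 'm odiag = "'m cell list"

fun ends :: "'m cell \<Rightarrow> 'm vertex set" where
  "ends (IVert v) = {}"
| "ends (Edge a b) = {a, b}"

fun vmap :: "(nat \<Rightarrow> nat) \<Rightarrow> 'm vertex \<Rightarrow> 'm vertex" where
  "vmap \<rho> (Ext i) = Ext i"
| "vmap \<rho> (Inn v) = Inn (\<rho> v)"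

fun cmap :: "('m vertex \<Rightarrow> 'm vertex) \<Rightarrow> (nat \<Rightarrow> nat) \<Rightarrow> 'm cell \<Rightarrow> 'm cell" where
  "cmap f \<rho> (IVert v) = IVert (\<rho> v)"
| "cmap f \<rho> (Edge a b) = Edge (f a) (f b)"

definition rename :: "(nat \<Rightarrow> nat) \<Rightarrow> 'm odiag \<Rightarrow> 'm odiag" where
  "rename \<rho> \<Gamma> = map (cmap (vmap \<rho>) \<rho>) \<Gamma>"

definition ivert_list :: "'m odiag \<Rightarrow> nat list" where
  "ivert_list \<Gamma> = concat (map (\<lambda>c. case c of IVert v \<Rightarrow> [v] | Edge a b \<Rightarrow> []) \<Gamma>)"

definition edge_list :: "'m odiag \<Rightarrow> ('m vertex \<times> 'm vertex) list" where
  "edge_list \<Gamma> = concat (map (\<lambda>c. case c of IVert v \<Rightarrow> [] | Edge a b \<Rightarrow> [(a, b)]) \<Gamma>)"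

definition adj :: "'m odiag \<Rightarrow> 'm vertex rel" where
  "adj \<Gamma> = {(a, b). Edge a b \<in> set \<Gamma> \<or> Edge b a \<in> set \<Gamma>}"

definition admissible :: "'m odiag \<Rightarrow> bool" where
  "admissible \<Gamma> \<longleftrightarrow>
     distinct \<Gamma> \<and>
     (\<forall>a b. Edge a b \<in> set \<Gamma> \<longrightarrow> a \<noteq> b \<and> Edge b a \<notin> set \<Gamma>) \<and>
     (\<forall>c\<in>set \<Gamma>. \<forall>v. Inn v \<in> ends c \<longrightarrow> IVert v \<in> set \<Gamma>) \<and>
     (\<forall>v. IVert v \<in> set \<Gamma> \<longrightarrow>
        card {c \<in> set \<Gamma>. Inn v \<in> ends c} \<ge> 3 \<and> (\<exists>i. (Inn v, Ext i) \<in> (adj \<Gamma>)\<^sup>*))"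

definition degree :: "nat \<Rightarrow> 'm odiag \<Rightarrow> int" where
  "degree n \<Gamma> = (int n - 1) * int (length (edge_list \<Gamma>)) - int n * int (length (ivert_list \<Gamma>))"

text \<open>Only the parity of the degree of a cell matters, so \<open>-n\<close> is replaced by \<open>n\<close>.\<close>

fun cdeg :: "nat \<Rightarrow> 'm cell \<Rightarrow> nat" where
  "cdeg n (IVert v) = n"
| "cdeg n (Edge a b) = n - 1"

abbreviation gen :: "'b \<Rightarrow> ('b \<Rightarrow>\<^sub>0 real)" where
  "gen b \<equiv> Poly_Mapping.single b 1"

text \<open>
  \<open>\<D>(m)\<close> is the quotient of the free vector space \<^typ>\<open>'m odiag \<Rightarrow>\<^sub>0 real\<close> by \<open>drel n\<close>.
\<close>

definition drel :: "nat \<Rightarrow> ('m odiag \<Rightarrow>\<^sub>0 real) set" where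
  "drel n = span (
     {gen \<Gamma> |\<Gamma>. \<not> admissible \<Gamma>}
   \<union> {gen (xs @ [c, d] @ ys) - (- 1) ^ (cdeg n c * cdeg n d) *\<^sub>R gen (xs @ [d, c] @ ys) |xs c d ys. True}
   \<union> {gen (xs @ [Edge a b] @ ys) - (- 1) ^ n *\<^sub>R gen (xs @ [Edge b a] @ ys) |xs a b ys. True}
   \<union> {gen \<Gamma> - gen (rename \<rho> \<Gamma>) |\<Gamma> \<rho>. bij \<rho>})"

definition lin :: "('b \<Rightarrow> 'v::real_vector) \<Rightarrow> ('b \<Rightarrow>\<^sub>0 real) \<Rightarrow> 'v" where
  "lin f x = (\<Sum>b\<in>Poly_Mapping.keys x. Poly_Mapping.lookup x b *\<^sub>R f b)"

definition dmult :: "'m odiag \<Rightarrow> 'm odiag \<Rightarrow> 'm odiag" where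
  "dmult \<Gamma> \<Gamma>' = rename (\<lambda>v. 2 * v) \<Gamma> @ rename (\<lambda>v. 2 * v + 1) \<Gamma>'"

text \<open>
  \<open>collapse n xs (u, v) ys\<close> contracts the edge from \<open>u\<close> to the internal vertex \<open>v\<close> standing between
  \<open>xs\<close> and \<open>ys\<close>: the edge and then \<open>v\<close> are moved to the front, with Koszul signs, and deleted.
\<close>

definition collapse :: "nat \<Rightarrow> 'm odiag \<Rightarrow> 'm vertex \<times> nat \<Rightarrow> 'm odiag \<Rightarrow> 'm odiag \<Rightarrow>\<^sub>0 real" where
  "collapse n xs uv ys = (case uv of (u, v) \<Rightarrow>
     (let zs = xs @ ys;
          us = takeWhile (\<lambda>c. c \<noteq> IVert v) zs
      in ((- 1) ^ ((n - 1) * sum_list (map (cdeg n) xs)) * (- 1) ^ (n * sum_list (map (cdeg n) us))) *\<^sub>R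
         gen (map (cmap (\<lambda>w. if w = Inn v then u else w) id) (remove1 (IVert v) zs))))"

fun edge_term :: "nat \<Rightarrow> 'm odiag \<Rightarrow> 'm cell \<Rightarrow> 'm odiag \<Rightarrow> 'm odiag \<Rightarrow>\<^sub>0 real" where
  "edge_term n xs (Edge u (Inn v)) ys = collapse n xs (u, v) ys"
| "edge_term n xs (Edge (Inn v) (Ext i)) ys = (- 1) ^ n *\<^sub>R collapse n xs (Ext i, v) ys"
| "edge_term n xs _ ys = 0"

text \<open>
  The overall sign of the differential is \<open>(-1)\<^sup>n\<close>.  In \<open>form_of\<close> below an internal vertex \<open>v\<close> is
  integrated out by the operator sending \<open>dx\<^sub>v\<^sup>1 \<dots> dx\<^sub>v\<^sup>n \<and> \<beta>\<close> to the integral of \<open>\<beta>\<close>.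
  For this operator Stokes' theorem produces, from the face where \<open>v\<close> approaches \<open>u\<close>, the integral
  of the normalized form over the sphere of directions of \<open>x\<^sub>v - x\<^sub>u\<close>, with sign \<open>(-1)\<^sup>n\<close>.
\<close>

definition ddiff :: "nat \<Rightarrow> ('m odiag \<Rightarrow>\<^sub>0 real) \<Rightarrow> ('m odiag \<Rightarrow>\<^sub>0 real)" where
  "ddiff n = lin (\<lambda>\<Gamma>. (- 1) ^ n *\<^sub>R
     (\<Sum>i<length \<Gamma>. edge_term n (take i \<Gamma>) (\<Gamma> ! i) (drop (Suc i) \<Gamma>)))"

definition diagram_basis :: "nat \<Rightarrow> 'm odiag set \<Rightarrow> bool" where
  "diagram_basis n B \<longleftrightarrow>
     (\<forall>\<Gamma>\<in>B. gen \<Gamma> \<notin> drel n) \<and>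
     (\<forall>\<Gamma>. gen \<Gamma> \<notin> drel n \<longrightarrow> (\<exists>!\<Gamma>'. \<Gamma>' \<in> B \<and> (gen \<Gamma> - gen \<Gamma>' \<in> drel n \<or> gen \<Gamma> + gen \<Gamma>' \<in> drel n)))"

definition aut_card :: "'m odiag \<Rightarrow> nat" where
  "aut_card \<Gamma> =
     (let E = {{a, b} |a b. Edge a b \<in> set \<Gamma>}
      in card {\<rho>. \<rho> permutes {v. IVert v \<in> set \<Gamma>} \<and> (\<lambda>e. vmap \<rho> ` e) ` E = E})"


section \<open>The graded dual and its cobar complex\<close>

type_synonym 'm functional = "('m odiag \<Rightarrow>\<^sub>0 real) \<Rightarrow> real"

text \<open>The part of degree \<open>d\<close> of the graded dual of \<open>\<D>(m)\<close>.\<close>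

definition gdual :: "nat \<Rightarrow> int \<Rightarrow> 'm functional set" where
  "gdual n d = {f. linear f \<and> (\<forall>x\<in>drel n. f x = 0) \<and>
                   (\<forall>\<Gamma>. admissible \<Gamma> \<and> degree n \<Gamma> \<noteq> d \<longrightarrow> f (gen \<Gamma>) = 0)}"

text \<open>
  For \<open>\<Gamma>\<close> in a diagram basis, \<open>dual_elt n \<Gamma>\<close> is \<open>1\<close> on \<open>\<Gamma>\<close> and vanishes on the other basis elements.
\<close>

definition dual_elt :: "nat \<Rightarrow> 'm odiag \<Rightarrow> 'm functional" where
  "dual_elt n \<Gamma> = lin (\<lambda>\<Gamma>'. if gen \<Gamma>' - gen \<Gamma> \<in> drel n then 1
                            else if gen \<Gamma>' + gen \<Gamma> \<in> drel n then - 1 else 0)"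

definition star_elt :: "nat \<Rightarrow> 'm odiag \<Rightarrow> 'm functional" where
  "star_elt n \<Gamma> = (\<lambda>x. real (aut_card \<Gamma>) * dual_elt n \<Gamma> x)"

datatype 'a fword = Word (letters: "'a list")

instantiation fword :: (type) monoid_add
begin
definition "0 = Word []"
definition "v + w = Word (letters v @ letters w)"
instance by standard (auto simp: zero_fword_def plus_fword_def)
end

text \<open>
  The tensor algebra on the desuspension of \<open>coker\<close>(coaugmentation) is the free associative algebra
  on a basis of that space.  We use the duals of the diagrams \<open>\<Gamma> \<noteq> []\<close> of a diagram basis \<open>B\<close> (the empty list is
  the unit diagram); the product of \<open>\<Rightarrow>\<^sub>0\<close> over the monoid of words is concatenation.
\<close>

type_synonym 'm cobar = "'m odiag fword \<Rightarrow>\<^sub>0 real"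

definition letter :: "'m odiag \<Rightarrow> 'm cobar" where
  "letter \<Gamma> = gen (Word [\<Gamma>])"

definition desusp :: "'m odiag set \<Rightarrow> 'm functional \<Rightarrow> 'm cobar" where
  "desusp B c = Sum_any (\<lambda>\<Gamma>. if \<Gamma> \<in> B - {[]} then c (gen \<Gamma>) *\<^sub>R letter \<Gamma> else 0)"

definition Omega :: "nat \<Rightarrow> 'm odiag set \<Rightarrow> int \<Rightarrow> 'm cobar set" where
  "Omega n B i = span {prod_list (map (desusp B) cs) |cs ds.
     list_all2 (\<lambda>c d. c \<in> gdual n d) cs ds \<and> (\<Sum>d\<leftarrow>ds. d - 1) = i}"

definition cobar_gen :: "nat \<Rightarrow> 'm odiag set \<Rightarrow> 'm functional \<Rightarrow> 'm cobar" where
  "cobar_gen n B c =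
     - desusp B (c \<circ> ddiff n) +
     Sum_any (\<lambda>(\<Gamma>, \<Gamma>'). if \<Gamma> \<in> B - {[]} \<and> \<Gamma>' \<in> B - {[]}
        then ((- 1) powi degree n \<Gamma> * c (gen (dmult \<Gamma> \<Gamma>'))) *\<^sub>R (letter \<Gamma> * letter \<Gamma>') else 0)"

fun cobar_word :: "nat \<Rightarrow> 'm odiag set \<Rightarrow> 'm odiag list \<Rightarrow> 'm cobar" where
  "cobar_word n B [] = 0"
| "cobar_word n B (\<Gamma> # w) =
     cobar_gen n B (dual_elt n \<Gamma>) * gen (Word w) +
     (- 1) powi (degree n \<Gamma> - 1) *\<^sub>R (letter \<Gamma> * cobar_word n B w)"

definition d_Omega :: "nat \<Rightarrow> 'm odiag set \<Rightarrow> 'm cobar \<Rightarrow> 'm cobar" where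
  "d_Omega n B = lin (\<lambda>w. cobar_word n B (letters w))"

definition Omega12 :: "nat \<Rightarrow> 'm odiag set \<Rightarrow> 'm cobar set" where
  "Omega12 n B = span ({x * y |x y. x \<in> Omega n B 1 \<and> y \<in> Omega n B 2} \<union>
                       {y * x |x y. x \<in> Omega n B 1 \<and> y \<in> Omega n B 2})"

text \<open>The class of \<open>x\<close> modulo \<open>d_Omega ` Omega12\<close>.\<close>

definition mod12 :: "nat \<Rightarrow> 'm odiag set \<Rightarrow> 'm cobar \<Rightarrow> 'm cobar set" where
  "mod12 n B x = {x + d_Omega n B y |y. y \<in> Omega12 n B}"


section \<open>Differential forms and the integration map\<close>

text \<open>
  A form on a set of points of type \<open>'p\<close> with tangent vectors of type \<open>'w\<close> is a pair of its degree
  and its evaluation on lists of tangent vectors of that length.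
\<close>

type_synonym 'w alt = "nat \<times> ('w list \<Rightarrow> real)"
type_synonym 'p form = "nat \<times> ('p \<Rightarrow> 'p list \<Rightarrow> real)"

definition wedge :: "'w alt \<Rightarrow> 'w alt \<Rightarrow> 'w alt" where
  "wedge \<alpha> \<beta> = (case (\<alpha>, \<beta>) of ((p, f), (q, g)) \<Rightarrow> (p + q, \<lambda>ws.
     (\<Sum>\<pi> | \<pi> permutes {..<p + q}. of_int (sign \<pi>) *
        f (map (\<lambda>i. ws ! \<pi> i) [0..<p]) * g (map (\<lambda>i. ws ! \<pi> i) [p..<p + q]))
     / (fact p * fact q)))"

definition wedges :: "'w alt list \<Rightarrow> 'w alt" where
  "wedges \<alpha>s = foldr wedge \<alpha>s (0, \<lambda>_. 1)"

definition Conf :: "((real ^ 'n) ^ 'm) set" where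
  "Conf = {x. inj (\<lambda>i. x $ i)}"

text \<open>
  The rotation-invariant volume form of total mass \<open>1\<close> on the unit sphere, whose area is
  \<open>n * unit_ball_vol n\<close>.  The order on the index type \<open>'n\<close> fixes the standard orientation; the sphere
  is oriented by the outward normal.
\<close>

definition sphere_form :: "real ^ 'n::{finite,linorder} \<Rightarrow> (real ^ 'n::_) list \<Rightarrow> real" where
  "sphere_form u ws =
     det (\<chi> i. (u # ws) ! card {j. j < i}) / (real CARD('n) * unit_ball_vol (real CARD('n)))"

text \<open>
  Points and tangent vectors of the configuration space of all vertices are functions on vertices.
  \<open>edge_form a b\<close> is the pullback of \<open>sphere_form\<close> by \<open>P \<mapsto> (P b - P a) / |P b - P a|\<close>.
\<close>

definition edge_form :: "'m vertex \<Rightarrow> 'm vertex \<Rightarrow> ('m vertex \<Rightarrow> real ^ 'n::{finite,linorder}) \<Rightarrow>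
    ('m vertex \<Rightarrow> real ^ 'n::_) alt" where
  "edge_form a b P = (CARD('n) - 1, \<lambda>ws.
     sphere_form (sgn (P b - P a)) (map (\<lambda>w. frechet_derivative sgn (at (P b - P a)) (w b - w a)) ws))"

fun config :: "'a ^ 'm \<Rightarrow> (nat \<Rightarrow> 'a) \<Rightarrow> 'm vertex \<Rightarrow> 'a" where
  "config x y (Ext i) = x $ i"
| "config x y (Inn v) = y v"

definition vertex_frame :: "nat \<Rightarrow> ('m vertex \<Rightarrow> real ^ 'n::{finite,linorder}) list" where
  "vertex_frame v =
     map (\<lambda>k u. if u = Inn v then axis k 1 else 0) (sorted_list_of_set (UNIV :: 'n set))"

text \<open>
  Fibre integration along the configurations of the internal vertices; the boundary of the
  compactified fibre is a null set.  The successive operators \<open>\<integral>\<^sub>v\<close>, in the order of the orientation,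
  correspond to the fibre frame in reverse order, placed before the tangent vectors of the base.
\<close>

definition form_of :: "'m::finite odiag \<Rightarrow> ((real ^ 'n::{finite,linorder}) ^ 'm) form" where
  "form_of \<Gamma> = (nat (degree CARD('n) \<Gamma>), \<lambda>x ws.
     LINT y : {y. inj_on (config x y) (range Ext \<union> Inn ` set (ivert_list \<Gamma>))}
            | Pi\<^sub>M (set (ivert_list \<Gamma>)) (\<lambda>_. lborel).
       snd (wedges (map (\<lambda>(a, b). edge_form a b (config x y)) (edge_list \<Gamma>)))
         (concat (map vertex_frame (rev (ivert_list \<Gamma>))) @ map (\<lambda>w. config w (\<lambda>_. 0)) ws))"


section \<open>Paths\<close>

text \<open>
  Points of the cube \<open>[0,1]\<^sup>k\<close> are lists of length \<open>k\<close>, so that \<open>J [r, s, t]\<close> is the value of a 3-path.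
  Values outside the cube are irrelevant.
\<close>

type_synonym 'v path = "real list \<Rightarrow> 'v"

definition cube :: "nat \<Rightarrow> real list set" where
  "cube k = {xs. length xs = k \<and> set xs \<subseteq> {0..1}}"

definition agree :: "nat \<Rightarrow> 'v path \<Rightarrow> 'v path \<Rightarrow> bool" where
  "agree k \<alpha> \<beta> \<longleftrightarrow> (\<forall>xs\<in>cube k. \<alpha> xs = \<beta> xs)"

definition pd :: "nat \<Rightarrow> 'v::real_normed_vector path \<Rightarrow> 'v path" where
  "pd i \<alpha> xs = vector_derivative (\<lambda>u. \<alpha> (xs[i := u])) (at (xs ! i) within {0..1})"

definition smooth_cube :: "nat \<Rightarrow> 'v::real_normed_vector path \<Rightarrow> bool" where
  "smooth_cube k \<alpha> \<longleftrightarrow> (\<forall>is. set is \<subseteq> {..<k} \<longrightarrow>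
     continuous_on {x. \<forall>i. x i \<in> {0..1}} (\<lambda>x. foldr pd is \<alpha> (map x [0..<k])) \<and>
     (\<forall>i<k. \<forall>xs\<in>cube k. (\<lambda>u. foldr pd is \<alpha> (xs[i := u])) differentiable (at (xs ! i) within {0..1})))"

definition collared :: "nat \<Rightarrow> 'v path \<Rightarrow> bool" where
  "collared k \<alpha> \<longleftrightarrow> (\<exists>\<epsilon>>0. \<forall>i<k. \<forall>xs\<in>cube k. \<forall>u\<in>{0..1}. \<forall>v\<in>{0..1}.
     (u \<le> \<epsilon> \<and> v \<le> \<epsilon> \<or> u \<ge> 1 - \<epsilon> \<and> v \<ge> 1 - \<epsilon>) \<longrightarrow> \<alpha> (xs[i := u]) = \<alpha> (xs[i := v]))"

definition kpath :: "'v::real_normed_vector set \<Rightarrow> nat \<Rightarrow> 'v path \<Rightarrow> bool" where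
  "kpath M k \<alpha> \<longleftrightarrow> smooth_cube k \<alpha> \<and> \<alpha> ` cube k \<subseteq> M \<and> collared k \<alpha> \<and>
     (\<forall>c\<in>{0, 1}. \<forall>xs\<in>cube k. \<forall>ys\<in>cube k. last xs = c \<and> last ys = c \<longrightarrow> \<alpha> xs = \<alpha> ys)"

text \<open>The restriction to the face where the \<open>i\<close>-th coordinate is \<open>c\<close>.\<close>

definition face :: "nat \<Rightarrow> real \<Rightarrow> 'v path \<Rightarrow> 'v path" where
  "face i c \<alpha> xs = \<alpha> (take i xs @ c # drop i xs)"

definition pconcat :: "nat \<Rightarrow> 'v path \<Rightarrow> 'v path \<Rightarrow> 'v path" where
  "pconcat i \<alpha> \<beta> xs =
     (if xs ! i \<le> 1/2 then \<alpha> (xs[i := 2 * xs ! i]) else \<beta> (xs[i := 2 * xs ! i - 1]))"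

definition spread :: "'v path \<Rightarrow> 'v path" where
  "spread \<gamma> xs = \<gamma> [last xs]"

definition low_rank :: "nat \<Rightarrow> 'v::euclidean_space path \<Rightarrow> bool" where
  "low_rank k \<alpha> \<longleftrightarrow> (\<forall>xs\<in>cube k. dim ((\<lambda>i. pd i \<alpha> xs) ` {..<k}) < k)"

definition rank1_homotopy :: "'v::euclidean_space set \<Rightarrow> 'v path \<Rightarrow> bool" where
  "rank1_homotopy M h \<longleftrightarrow> kpath M 2 h \<and> low_rank 2 h"

definition rank2_homotopy :: "'v::euclidean_space set \<Rightarrow> 'v path \<Rightarrow> bool" where
  "rank2_homotopy M \<alpha> \<longleftrightarrow> kpath M 3 \<alpha> \<and> low_rank 3 \<alpha> \<and>
     rank1_homotopy M (face 1 0 \<alpha>) \<and> rank1_homotopy M (face 1 1 \<alpha>)"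

definition laminated :: "'v::real_normed_vector path \<Rightarrow> bool" where
  "laminated \<alpha> \<longleftrightarrow> (\<forall>r\<in>{0..1}. \<forall>s\<in>{0..1}.
     (\<forall>t\<in>{0..1}. \<exists>a b. (a, b) \<noteq> (0, 0) \<and> a *\<^sub>R pd 0 \<alpha> [r, s, t] + b *\<^sub>R pd 2 \<alpha> [r, s, t] = 0) \<or>
     (\<forall>t\<in>{0..1}. \<exists>a b. (a, b) \<noteq> (0, 0) \<and> a *\<^sub>R pd 1 \<alpha> [r, s, t] + b *\<^sub>R pd 2 \<alpha> [r, s, t] = 0) \<or>
     (\<exists>a b. (a, b) \<noteq> (0, 0) \<and> (\<forall>t\<in>{0..1}. a *\<^sub>R pd 0 \<alpha> [r, s, t] + b *\<^sub>R pd 1 \<alpha> [r, s, t] = 0)))"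

definition good_3path :: "'v::real_normed_vector set \<Rightarrow> 'v path \<Rightarrow> bool" where
  "good_3path M J \<longleftrightarrow> kpath M 3 J \<and>
     (\<forall>s\<in>{0, 1}. \<forall>r\<in>{0..1}. \<forall>r'\<in>{0..1}. \<forall>t\<in>{0..1}. J [r, s, t] = J [r', s, t])"

definition rank3_homotopy :: "'v::euclidean_space set \<Rightarrow> 'v path \<Rightarrow> bool" where
  "rank3_homotopy M W \<longleftrightarrow> kpath M 4 W \<and> low_rank 4 W \<and>
     (\<forall>c\<in>{0, 1}. rank2_homotopy M (face 1 c W) \<and> laminated (face 1 c W)) \<and>
     (\<forall>c\<in>{0, 1}.
        (\<forall>q\<in>{0..1}. \<forall>r\<in>{0..1}. \<forall>r'\<in>{0..1}. \<forall>t\<in>{0..1}. W [q, r, c, t] = W [q, r', c, t]) \<and>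
        (\<forall>r\<in>{0..1}. rank1_homotopy M (face 1 r (face 2 c W))))"

definition track1 :: "'v::euclidean_space set \<Rightarrow> 'v path \<Rightarrow> 'v path set" where
  "track1 M \<gamma> = {\<gamma>'. \<exists>h. rank1_homotopy M h \<and> agree 1 (face 0 0 h) \<gamma> \<and> agree 1 (face 0 1 h) \<gamma>'}"

definition track2 :: "'v::euclidean_space set \<Rightarrow> 'v path \<Rightarrow> 'v path set" where
  "track2 M g = {g'. \<exists>\<alpha>. rank2_homotopy M \<alpha> \<and> laminated \<alpha> \<and>
     agree 2 (face 0 0 \<alpha>) g \<and> agree 2 (face 0 1 \<alpha>) g'}"

definition track3 :: "'v::euclidean_space set \<Rightarrow> 'v path \<Rightarrow> 'v path set" where
  "track3 M J = {J'. \<exists>W. rank3_homotopy M W \<and> agree 3 (face 0 0 W) J \<and> agree 3 (face 0 1 W) J'}"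


section \<open>Gray 3-categories and Gray functors\<close>

text \<open>
  The operations of a Gray 3-category.  \<open>Hom3\<close> is used for parallel 2-morphisms only.  All
  compositions are written in diagrammatic order.
\<close>

record ('o, 'a, 'b, 'c) gray3 =
  Obj :: "'o set"
  Hom1 :: "'o \<Rightarrow> 'o \<Rightarrow> 'a set"
  Hom2 :: "'a \<Rightarrow> 'a \<Rightarrow> 'b set"
  Hom3 :: "'b \<Rightarrow> 'b \<Rightarrow> 'c set"
  id1 :: "'o \<Rightarrow> 'a"
  id2 :: "'a \<Rightarrow> 'b"
  id3 :: "'b \<Rightarrow> 'c"
  comp1 :: "'a \<Rightarrow> 'a \<Rightarrow> 'a"
  vert2 :: "'b \<Rightarrow> 'b \<Rightarrow> 'b"
  vert3 :: "'c \<Rightarrow> 'c \<Rightarrow> 'c"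
  up3 :: "'c \<Rightarrow> 'c \<Rightarrow> 'c"
  lwhisk2 :: "'a \<Rightarrow> 'b \<Rightarrow> 'b"
  rwhisk2 :: "'b \<Rightarrow> 'a \<Rightarrow> 'b"
  lwhisk3 :: "'a \<Rightarrow> 'c \<Rightarrow> 'c"
  rwhisk3 :: "'c \<Rightarrow> 'a \<Rightarrow> 'c"
  interchange :: "'b \<Rightarrow> 'b \<Rightarrow> 'c"

definition is_cell1 :: "('o, 'a, 'b, 'c) gray3 \<Rightarrow> 'o \<Rightarrow> 'o \<Rightarrow> 'a \<Rightarrow> bool" where
  "is_cell1 G x y f \<longleftrightarrow> x \<in> Obj G \<and> y \<in> Obj G \<and> f \<in> Hom1 G x y"

definition is_cell2 :: "('o, 'a, 'b, 'c) gray3 \<Rightarrow> 'o \<Rightarrow> 'o \<Rightarrow> 'a \<Rightarrow> 'a \<Rightarrow> 'b \<Rightarrow> bool" where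
  "is_cell2 G x y f g A \<longleftrightarrow> is_cell1 G x y f \<and> is_cell1 G x y g \<and> A \<in> Hom2 G f g"

definition is_cell3 ::
    "('o, 'a, 'b, 'c) gray3 \<Rightarrow> 'o \<Rightarrow> 'o \<Rightarrow> 'a \<Rightarrow> 'a \<Rightarrow> 'b \<Rightarrow> 'b \<Rightarrow> 'c \<Rightarrow> bool" where
  "is_cell3 G x y f g A B J \<longleftrightarrow> is_cell2 G x y f g A \<and> is_cell2 G x y f g B \<and> J \<in> Hom3 G A B"

definition gray_functor ::
  "('o, 'a, 'b, 'c) gray3 \<Rightarrow> ('o', 'a', 'b', 'c') gray3 \<Rightarrow>
   ('o \<Rightarrow> 'o') \<Rightarrow> ('a \<Rightarrow> 'a') \<Rightarrow> ('b \<Rightarrow> 'b') \<Rightarrow> ('c \<Rightarrow> 'c') \<Rightarrow> bool" where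
  "gray_functor G H F0 F1 F2 F3 \<longleftrightarrow>
     (\<forall>x\<in>Obj G. F0 x \<in> Obj H \<and> F1 (id1 G x) = id1 H (F0 x)) \<and>
     (\<forall>x y f. is_cell1 G x y f \<longrightarrow>
        is_cell1 H (F0 x) (F0 y) (F1 f) \<and> F2 (id2 G f) = id2 H (F1 f)) \<and>
     (\<forall>x y f g A. is_cell2 G x y f g A \<longrightarrow>
        is_cell2 H (F0 x) (F0 y) (F1 f) (F1 g) (F2 A) \<and> F3 (id3 G A) = id3 H (F2 A)) \<and>
     (\<forall>x y f g A B J. is_cell3 G x y f g A B J \<longrightarrow>
        is_cell3 H (F0 x) (F0 y) (F1 f) (F1 g) (F2 A) (F2 B) (F3 J)) \<and>
     (\<forall>x y z f g. is_cell1 G x y f \<and> is_cell1 G y z g \<longrightarrow>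
        F1 (comp1 G f g) = comp1 H (F1 f) (F1 g)) \<and>
     (\<forall>x y f g h A B. is_cell2 G x y f g A \<and> is_cell2 G x y g h B \<longrightarrow>
        F2 (vert2 G A B) = vert2 H (F2 A) (F2 B)) \<and>
     (\<forall>x y f g h A A' B B' J K. is_cell3 G x y f g A A' J \<and> is_cell3 G x y g h B B' K \<longrightarrow>
        F3 (vert3 G J K) = vert3 H (F3 J) (F3 K)) \<and>
     (\<forall>x y f g A B C J K. is_cell3 G x y f g A B J \<and> is_cell3 G x y f g B C K \<longrightarrow>
        F3 (up3 G J K) = up3 H (F3 J) (F3 K)) \<and>
     (\<forall>x y z f g g' A. is_cell1 G x y f \<and> is_cell2 G y z g g' A \<longrightarrow>
        F2 (lwhisk2 G f A) = lwhisk2 H (F1 f) (F2 A)) \<and>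
     (\<forall>x y z f f' g A. is_cell2 G x y f f' A \<and> is_cell1 G y z g \<longrightarrow>
        F2 (rwhisk2 G A g) = rwhisk2 H (F2 A) (F1 g)) \<and>
     (\<forall>x y z f g g' A B J. is_cell1 G x y f \<and> is_cell3 G y z g g' A B J \<longrightarrow>
        F3 (lwhisk3 G f J) = lwhisk3 H (F1 f) (F3 J)) \<and>
     (\<forall>x y z f f' g A B J. is_cell3 G x y f f' A B J \<and> is_cell1 G y z g \<longrightarrow>
        F3 (rwhisk3 G J g) = rwhisk3 H (F3 J) (F1 g)) \<and>
     (\<forall>x y z f f' g g' A B. is_cell2 G x y f f' A \<and> is_cell2 G y z g g' B \<longrightarrow>
        F3 (interchange G A B) = interchange H (F2 A) (F2 B))"


section \<open>The path 3-groupoid\<close>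

text \<open>
  Reparametrizations of the interchange 3-path: a family of paths \<open>(a, b)\<close> from \<open>(0,0)\<close> to \<open>(1,1)\<close>
  in the square, running through \<open>(0,1)\<close> at \<open>r = 0\<close> and through \<open>(1,0)\<close> at \<open>r = 1\<close>.
\<close>

definition corner_family :: "real path \<Rightarrow> real path \<Rightarrow> bool" where
  "corner_family a b \<longleftrightarrow>
     (\<forall>f\<in>{a, b}. smooth_cube 2 f \<and> collared 2 f \<and> f ` cube 2 \<subseteq> {0..1} \<and>
        (\<forall>r\<in>{0..1}. f [r, 0] = 0 \<and> f [r, 1] = 1) \<and>
        (\<forall>r\<in>{0, 1}. mono_on {0..1} (\<lambda>s. f [r, s]))) \<and>
     (\<exists>c\<in>{0..1}. (\<forall>s\<in>{0..c}. a [0, s] = 0) \<and> (\<forall>s\<in>{c..1}. b [0, s] = 1)) \<and>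
     (\<exists>c\<in>{0..1}. (\<forall>s\<in>{0..c}. b [1, s] = 0) \<and> (\<forall>s\<in>{c..1}. a [1, s] = 1))"

definition interchange_path :: "real path \<Rightarrow> real path \<Rightarrow> 'v path \<Rightarrow> 'v path \<Rightarrow> 'v path" where
  "interchange_path a b h h' xs =
     (let rs = take 2 xs; t = xs ! 2
      in if t \<le> 1/2 then h [a rs, 2 * t] else h' [b rs, 2 * t - 1])"

text \<open>
  The result of an operation on tracks is the union of the tracks obtained from all strictly
  composable representatives; this is a single track because the operations are well defined.
\<close>

definition path3_groupoid ::
    "'v::euclidean_space set \<Rightarrow> ('v, 'v path set, 'v path set, 'v path set) gray3" where
  "path3_groupoid M = \<lparr>
     Obj = M,
     Hom1 = (\<lambda>x y. {track1 M \<gamma> |\<gamma>. kpath M 1 \<gamma> \<and> \<gamma> [0] = x \<and> \<gamma> [1] = y}),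
     Hom2 = (\<lambda>f f'. {track2 M g |g. kpath M 2 g \<and>
               track1 M (face 0 0 g) = f \<and> track1 M (face 0 1 g) = f'}),
     Hom3 = (\<lambda>A A'. {track3 M J |J. good_3path M J \<and>
               track2 M (face 0 0 J) = A \<and> track2 M (face 0 1 J) = A'}),
     id1 = (\<lambda>x. track1 M (\<lambda>_. x)),
     id2 = (\<lambda>f. \<Union>\<gamma>\<in>f. track2 M (spread \<gamma>)),
     id3 = (\<lambda>A. \<Union>g\<in>A. track3 M (\<lambda>xs. g (tl xs))),
     comp1 = (\<lambda>f f'. \<Union>{track1 M (pconcat 0 \<gamma> \<gamma>') |\<gamma> \<gamma>'. \<gamma> \<in> f \<and> \<gamma>' \<in> f' \<and> \<gamma> [1] = \<gamma>' [0]}),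
     vert2 = (\<lambda>A B. \<Union>{track2 M (pconcat 0 g h) |g h. g \<in> A \<and> h \<in> B \<and>
               agree 1 (face 0 1 g) (face 0 0 h)}),
     vert3 = (\<lambda>X Y. \<Union>{track3 M (pconcat 1 J K) |J K. J \<in> X \<and> K \<in> Y \<and>
               agree 2 (face 1 1 J) (face 1 0 K)}),
     up3 = (\<lambda>X Y. \<Union>{track3 M (pconcat 0 J K) |J K. J \<in> X \<and> K \<in> Y \<and>
               agree 2 (face 0 1 J) (face 0 0 K)}),
     lwhisk2 = (\<lambda>f A. \<Union>{track2 M (pconcat 1 (spread \<gamma>) g) |\<gamma> g. \<gamma> \<in> f \<and> g \<in> A \<and> \<gamma> [1] = g [0, 0]}),
     rwhisk2 = (\<lambda>A f. \<Union>{track2 M (pconcat 1 g (spread \<gamma>)) |g \<gamma>. g \<in> A \<and> \<gamma> \<in> f \<and> g [0, 1] = \<gamma> [0]}),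
     lwhisk3 = (\<lambda>f X. \<Union>{track3 M (pconcat 2 (spread \<gamma>) J) |\<gamma> J. \<gamma> \<in> f \<and> J \<in> X \<and> \<gamma> [1] = J [0, 0, 0]}),
     rwhisk3 = (\<lambda>X f. \<Union>{track3 M (pconcat 2 J (spread \<gamma>)) |J \<gamma>. J \<in> X \<and> \<gamma> \<in> f \<and> J [0, 0, 1] = \<gamma> [0]}),
     interchange = (\<lambda>A B. \<Union>{track3 M (interchange_path a b h h') |a b h h'. corner_family a b \<and>
               h \<in> A \<and> h' \<in> B \<and> h [0, 1] = h' [0, 0]})\<rparr>"


section \<open>The Gray 3-category of the cobar complex\<close>

definition cobar_gray :: "nat \<Rightarrow> 'm odiag set \<Rightarrow> (unit, 'm cobar, 'm cobar, 'm cobar set) gray3" where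
  "cobar_gray n B = \<lparr>
     Obj = UNIV,
     Hom1 = (\<lambda>_ _. Omega n B 0),
     Hom2 = (\<lambda>x y. {X \<in> Omega n B 1. d_Omega n B X = y - x}),
     Hom3 = (\<lambda>X Y. {mod12 n B \<alpha> |\<alpha>. \<alpha> \<in> Omega n B 2 \<and> d_Omega n B \<alpha> = Y - X}),
     id1 = (\<lambda>_. 1),
     id2 = (\<lambda>_. 0),
     id3 = (\<lambda>_. mod12 n B 0),
     comp1 = (*),
     vert2 = (+),
     vert3 = (\<lambda>S T. \<Union>\<alpha>\<in>S. \<Union>\<beta>\<in>T. mod12 n B (\<alpha> + \<beta>)),
     up3 = (\<lambda>S T. \<Union>\<alpha>\<in>S. \<Union>\<beta>\<in>T. mod12 n B (\<alpha> + \<beta>)),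
     lwhisk2 = (*),
     rwhisk2 = (*),
     lwhisk3 = (\<lambda>p S. \<Union>\<alpha>\<in>S. mod12 n B (p * \<alpha>)),
     rwhisk3 = (\<lambda>S p. \<Union>\<alpha>\<in>S. mod12 n B (\<alpha> * p)),
     interchange = (\<lambda>X Y. mod12 n B (X * Y))\<rparr>"


section \<open>Iterated integrals and transport\<close>

text \<open>
  For a \<open>(p+1)\<close>-path \<open>\<alpha>\<close>, regarded as a map from \<open>U = [0,1]\<^sup>p\<close> to 1-paths, the form \<open>\<omega>'\<close> is the
  pullback of \<open>\<omega>\<close> by \<open>\<alpha>\<close> with \<open>\<partial>\<^sub>t\<close> inserted first; it is evaluated on lists of coordinate directions of \<open>U\<close>.
\<close>

definition contracted :: "nat \<Rightarrow> 'v::real_normed_vector path \<Rightarrow> 'v form \<Rightarrow> real list \<Rightarrow> nat alt" where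
  "contracted p \<alpha> \<omega> xs =
     (fst \<omega> - 1, \<lambda>is. snd \<omega> (\<alpha> xs) (pd p \<alpha> xs # map (\<lambda>i. pd i \<alpha> xs) is))"

definition iterated_integral :: "nat \<Rightarrow> 'v::real_normed_vector path \<Rightarrow> 'v form list \<Rightarrow> real" where
  "iterated_integral p \<alpha> \<omega>s =
     (let k = length \<omega>s
      in if (\<Sum>\<omega>\<leftarrow>\<omega>s. fst \<omega> - 1) = p
         then LINT x : {x. \<forall>i<p. x i \<in> {0..1}} | Pi\<^sub>M {..<p} (\<lambda>_. lborel).
                (LINT t : {t. (\<forall>j<k. t j \<in> {0..1}) \<and> (\<forall>i<k. \<forall>j<k. i \<le> j \<longrightarrow> t i \<le> t j)}
                        | Pi\<^sub>M {..<k} (\<lambda>_. lborel).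
                   snd (wedges (map (\<lambda>j. contracted p \<alpha> (\<omega>s ! j) (map x [0..<p] @ [t j])) [0..<k]))
                     [0..<p])
         else 0)"

text \<open>The transport of \<open>\<Sum>i\<in>S. \<omega> i \<otimes> a i\<close>, paired with a \<open>(p+1)\<close>-path; only finitely many terms
  are nonzero in the case of interest.\<close>

definition transport ::
    "'i set \<Rightarrow> ('i \<Rightarrow> 'v::real_normed_vector form) \<Rightarrow> ('i \<Rightarrow> 'm cobar) \<Rightarrow> nat \<Rightarrow> 'v path \<Rightarrow> 'm cobar" where
  "transport S \<omega> a p \<alpha> = Sum_any (\<lambda>is. if set is \<subseteq> S
     then iterated_integral p \<alpha> (map \<omega> is) *\<^sub>R prod_list (map a is) else 0)"

definition omega_coeff :: "nat \<Rightarrow> 'm odiag set \<Rightarrow> 'm odiag \<Rightarrow> 'm cobar" where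
  "omega_coeff n B \<Gamma> = (1 / real (aut_card \<Gamma>)) *\<^sub>R desusp B (star_elt n \<Gamma>)"

definition T_omega :: "'m::finite odiag set \<Rightarrow> nat \<Rightarrow>
    ((real ^ 'n::{finite,linorder}) ^ 'm) path \<Rightarrow> 'm cobar" where
  "T_omega B k \<alpha> = transport B form_of (omega_coeff CARD('n) B) (k - 1) \<alpha>"

end

theory Submission
  imports Defs
begin

text \<open>
  An admissible diagram other than the unit has degree at least 3, with equality only for a single edge
  between external vertices and \<open>n = 4\<close>.  Hence \<open>\<Omega>\<^sup>1 = 0\<close> and \<open>\<Omega>\<^sup>1\<^sup>,\<^sup>2 = 0\<close>, the transport is 1 on 1-paths and 0 on 2-paths, and on
  3-paths it only involves the integrals of the volume form of the 3-sphere, pulled back along the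
  direction maps \<open>(x\<^sub>j - x\<^sub>i) / |x\<^sub>j - x\<^sub>i|\<close>.  This form is closed and its pullback to a 4-cube of rank below 4
  vanishes, so Stokes' theorem equates the integrals over the two ends of a rank-3 homotopy: its
  remaining sides have rank below 3.  The integral is additive under all three concatenations and vanishes on
  3-paths on which \<open>\<partial>\<^sub>r\<close> and \<open>\<partial>\<^sub>s\<close> are proportional, such as identities, whiskering paths and interchange paths.
  It remains to find composable representatives of the tracks to be composed; they are obtained by grafting
  the connecting homotopies onto the collars of given representatives.
\<close>

section \<open>Smooth maps on cubes\<close>

text \<open>Two features of the definitions shape the proof. A composition of tracks is a union over
  all strictly composable representatives, so it would be empty if there were none. And
  \<open>Hol3\<close> is taken to be the image of a track under \<open>T_omega B 3\<close>, which is
  a singleton once the integral is invariant, as are the \<open>mod12\<close> classes. Functoriality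
  then means that each such union is nonempty and that \<open>T_omega B 3\<close> is constant on it.
  The configuration space is in general not convex, so maps into it cannot be averaged. Smooth
  gluing is therefore written in the ambient vector space as a sum of two maps minus a common term,
  arranged so that at each point of the cube this term cancels one of the two maps; the collars
  leave room for the transition functions. Concatenation and both graftings use this device. The
  degree bound comes from valence: every internal vertex has at least three edge ends, and few
  internal vertices joined by simple edges cannot absorb them among themselves, which forces enough
  edges to external vertices.\<close>

lemma cube_nth: "xs \<in> cube k \<Longrightarrow> i < k \<Longrightarrow> xs ! i \<in> {0..1}"
  by (force simp: cube_def)

lemma cube_length: "xs \<in> cube k \<Longrightarrow> length xs = k"
  by (simp add: cube_def)

lemma cube_iff: "xs \<in> cube k \<longleftrightarrow> length xs = k \<and> (\<forall>i<k. xs ! i \<in> {0..1})"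
  by (auto simp: cube_def set_conv_nth)

lemma cube_update: "xs \<in> cube k \<Longrightarrow> u \<in> {0..1} \<Longrightarrow> xs[i := u] \<in> cube k"
  unfolding cube_iff by (metis length_list_update nth_list_update_eq nth_list_update_neq)

lemma cube_map: "(\<And>j. j < k \<Longrightarrow> f j \<in> {0..1}) \<Longrightarrow> map f [0..<k] \<in> cube k"
  by (auto simp: cube_iff)

lemma cube_map_nth: "xs \<in> cube k \<Longrightarrow> map ((!) xs) [0..<k] = xs"
  by (metis cube_length map_nth)

text \<open>Continuity on the cube is expressed on sequences with the product topology;
  \<open>map x [0..<k]\<close> forgets the coordinates from \<open>k\<close> on. The same set occurs
  in \<open>smooth_cube\<close>.\<close>

definition boxf :: "(nat \<Rightarrow> real) set" where
  "boxf = {x. \<forall>i. x i \<in> {0..1}}"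

definition contc :: "nat \<Rightarrow> 'v::real_normed_vector path \<Rightarrow> bool" where
  "contc k \<alpha> \<longleftrightarrow> continuous_on boxf (\<lambda>x. \<alpha> (map x [0..<k]))"

definition diffc :: "nat \<Rightarrow> 'v::real_normed_vector path \<Rightarrow> bool" where
  "diffc k \<alpha> \<longleftrightarrow> (\<forall>i<k. \<forall>xs\<in>cube k.
     (\<lambda>u. \<alpha> (xs[i := u])) differentiable (at (xs ! i) within {0..1}))"

text \<open>\<open>smooth_cube\<close> quantifies over all lists of directions, which offers no
  induction. This recursion on the order of differentiability peels off one derivative at a time, so
  that closure properties follow from the rules for first derivatives.\<close>

fun Cn :: "nat \<Rightarrow> nat \<Rightarrow> 'v::real_normed_vector path \<Rightarrow> bool" where
  "Cn k 0 \<alpha> \<longleftrightarrow> contc k \<alpha>"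
| "Cn k (Suc N) \<alpha> \<longleftrightarrow> contc k \<alpha> \<and> diffc k \<alpha> \<and> (\<forall>i<k. Cn k N (pd i \<alpha>))"

lemma Cn_contc: "Cn k N \<alpha> \<Longrightarrow> contc k \<alpha>"
  by (cases N) auto

lemma Cn_Suc_imp: "Cn k (Suc N) \<alpha> \<Longrightarrow> Cn k N \<alpha>"
  by (induction N arbitrary: \<alpha>) auto

text \<open>\<open>foldr pd\<close> applies the last direction of the list first, so the list is
  split at its end: \<open>foldr pd (js @ [j]) \<alpha>\<close> is
  \<open>foldr pd js (pd j \<alpha>)\<close>.\<close>

lemma Cn_foldr:
  "Cn k N \<alpha> \<longleftrightarrow> (\<forall>is. set is \<subseteq> {..<k} \<longrightarrow>
     (length is \<le> N \<longrightarrow> contc k (foldr pd is \<alpha>)) \<and> (length is < N \<longrightarrow> diffc k (foldr pd is \<alpha>)))"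
proof (induction N arbitrary: \<alpha>)
  case 0 show ?case by auto
next
  case (Suc N)
  show ?case (is "_ \<longleftrightarrow> (\<forall>is. ?P is)")
  proof
    assume a: "Cn k (Suc N) \<alpha>"
    show "\<forall>is. ?P is"
    proof
      fix "is" show "?P is"
      proof (cases "is" rule: rev_cases)
        case Nil then show ?thesis using a by simp
      next
        case (snoc js j)
        then show ?thesis using a Suc.IH[of "pd j \<alpha>"] by auto
      qed
    qed
  next
    assume b: "\<forall>is. ?P is"
    have "Cn k N (pd i \<alpha>)" if "i < k" for i
      unfolding Suc.IH
    proof (intro allI impI)
      fix js assume "set js \<subseteq> {..<k}"
      then show "(length js \<le> N \<longrightarrow> contc k (foldr pd js (pd i \<alpha>))) \<and>
           (length js < N \<longrightarrow> diffc k (foldr pd js (pd i \<alpha>)))"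
        using b[rule_format, of "js @ [i]"] that by auto
    qed
    then show "Cn k (Suc N) \<alpha>" using b[rule_format, of "[]"] by auto
  qed
qed

lemma smooth_cube_Cn: "smooth_cube k \<alpha> \<longleftrightarrow> (\<forall>N. Cn k N \<alpha>)"
proof
  assume "smooth_cube k \<alpha>"
  then show "\<forall>N. Cn k N \<alpha>"
    unfolding Cn_foldr by (auto simp: smooth_cube_def contc_def diffc_def boxf_def)
next
  assume a: "\<forall>N. Cn k N \<alpha>"
  show "smooth_cube k \<alpha>" unfolding smooth_cube_def
  proof (intro allI impI)
    fix "is" :: "nat list" assume "set is \<subseteq> {..<k}"
    then have "contc k (foldr pd is \<alpha>)" "diffc k (foldr pd is \<alpha>)"
      using a[rule_format, of "Suc (length is)"] unfolding Cn_foldr by auto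
    then show "continuous_on {x. \<forall>i. x i \<in> {0..1}} (\<lambda>x. foldr pd is \<alpha> (map x [0..<k])) \<and>
     (\<forall>i<k. \<forall>xs\<in>cube k. (\<lambda>u. foldr pd is \<alpha> (xs[i := u])) differentiable (at (xs ! i) within {0..1}))"
      by (simp add: contc_def diffc_def boxf_def)
  qed
qed

lemma smooth_Cn: "smooth_cube k \<alpha> \<Longrightarrow> Cn k N \<alpha>"
  by (simp add: smooth_cube_Cn)

lemma smooth_contc: "smooth_cube k \<alpha> \<Longrightarrow> contc k \<alpha>"
  using smooth_Cn[of k \<alpha> 0] by simp

lemma smooth_diffc: "smooth_cube k \<alpha> \<Longrightarrow> diffc k \<alpha>"
  using smooth_Cn[of k \<alpha> "Suc 0"] by simp

lemma smooth_pd: "smooth_cube k \<alpha> \<Longrightarrow> i < k \<Longrightarrow> smooth_cube k (pd i \<alpha>)"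
  unfolding smooth_cube_Cn by (metis Cn.simps(2))

lemma pd_has_derivative:
  assumes "diffc k \<alpha>" "i < k" "xs \<in> cube k"
  shows "((\<lambda>u. \<alpha> (xs[i := u])) has_vector_derivative pd i \<alpha> xs) (at (xs ! i) within {0..1})"
  using assms unfolding pd_def diffc_def by (simp add: vector_derivative_works[symmetric])

lemma pd_has_derivative_at:
  assumes "diffc k \<alpha>" "i < k" "xs \<in> cube k" "u \<in> {0..1}"
  shows "((\<lambda>u. \<alpha> (xs[i := u])) has_vector_derivative pd i \<alpha> (xs[i := u])) (at u within {0..1})"
proof -
  have "xs[i := u] \<in> cube k" using assms cube_update by blast
  from pd_has_derivative[OF assms(1,2) this] show ?thesis
    using assms by (simp add: cube_length)
qed

text \<open>Derivatives within a nondegenerate interval are unique, including the one-sided ones at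
  its ends.\<close>

lemma pd_eqI:
  assumes "((\<lambda>u. \<alpha> (xs[i := u])) has_vector_derivative D) (at (xs ! i) within {0..1})"
    and "xs \<in> cube k" "i < k"
  shows "pd i \<alpha> xs = D"
  unfolding pd_def
  using vector_derivative_within_cbox[of 0 1 "xs ! i" "\<lambda>u. \<alpha> (xs[i := u])" D]
    assms(1) cube_nth[OF assms(2,3)] by (simp add: box_real)

lemma agree_sym: "agree k \<alpha> \<beta> \<Longrightarrow> agree k \<beta> \<alpha>"
  by (simp add: agree_def)

lemma contc_cong: "agree k \<alpha> \<beta> \<Longrightarrow> contc k \<alpha> \<Longrightarrow> contc k \<beta>"
  unfolding contc_def agree_def
  by (subst continuous_on_cong[OF refl, where g="\<lambda>x. \<alpha> (map x [0..<k])"]) (auto simp: boxf_def cube_map)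

lemma has_vd_cong:
  assumes "agree k \<alpha> \<beta>" "i < k" "xs \<in> cube k"
  shows "((\<lambda>u. \<alpha> (xs[i := u])) has_vector_derivative D) (at (xs ! i) within {0..1}) \<longleftrightarrow>
         ((\<lambda>u. \<beta> (xs[i := u])) has_vector_derivative D) (at (xs ! i) within {0..1})"
proof -
  have "\<And>u. u \<in> {0..1} \<Longrightarrow> \<alpha> (xs[i := u]) = \<beta> (xs[i := u])"
    using assms cube_update by (auto simp: agree_def)
  then show ?thesis
    using cube_nth[OF assms(3,2)] has_vector_derivative_transform by (smt (verit, best))
qed

lemma pd_cong: "agree k \<alpha> \<beta> \<Longrightarrow> i < k \<Longrightarrow> xs \<in> cube k \<Longrightarrow> pd i \<alpha> xs = pd i \<beta> xs"
  unfolding pd_def vector_derivative_def using has_vd_cong by metis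

lemma agree_pd: "agree k \<alpha> \<beta> \<Longrightarrow> i < k \<Longrightarrow> agree k (pd i \<alpha>) (pd i \<beta>)"
  using pd_cong unfolding agree_def by blast

lemma diffc_iff: "diffc k \<alpha> \<longleftrightarrow> (\<forall>i<k. \<forall>xs\<in>cube k. \<exists>D.
     ((\<lambda>u. \<alpha> (xs[i := u])) has_vector_derivative D) (at (xs ! i) within {0..1}))"
  unfolding diffc_def by (metis differentiableI_vector vector_derivative_works)

lemma diffc_cong: "agree k \<alpha> \<beta> \<Longrightarrow> diffc k \<alpha> \<Longrightarrow> diffc k \<beta>"
  unfolding diffc_iff using has_vd_cong by blast

text \<open>Values outside the cube are arbitrary and identities between paths hold on the cube
  only; this transfers differentiability along such identities.\<close>

lemma Cn_cong: "agree k \<alpha> \<beta> \<Longrightarrow> Cn k N \<alpha> \<Longrightarrow> Cn k N \<beta>"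
proof (induction N arbitrary: \<alpha> \<beta>)
  case 0 then show ?case using contc_cong by auto
next
  case (Suc N)
  then show ?case using contc_cong diffc_cong agree_pd by (metis Cn.simps(2))
qed

lemma smooth_cong: "agree k \<alpha> \<beta> \<Longrightarrow> smooth_cube k \<alpha> \<Longrightarrow> smooth_cube k \<beta>"
  unfolding smooth_cube_Cn using Cn_cong by blast

text \<open>The candidate derivatives \<beta> may differ from \<open>pd\<close> outside the cube, so
  their regularity is carried over by \<open>Cn_cong\<close>.\<close>

lemma Cn_SucI:
  assumes "contc k \<alpha>"
    and "\<And>i xs. i < k \<Longrightarrow> xs \<in> cube k \<Longrightarrow>
      ((\<lambda>u. \<alpha> (xs[i := u])) has_vector_derivative \<beta> i xs) (at (xs ! i) within {0..1})"
    and "\<And>i. i < k \<Longrightarrow> Cn k N (\<beta> i)"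
  shows "Cn k (Suc N) \<alpha>"
proof -
  have "agree k (\<beta> i) (pd i \<alpha>)" if "i < k" for i
    unfolding agree_def using pd_eqI[OF assms(2)] that by (metis (no_types))
  then show ?thesis using assms Cn_cong by (auto simp: diffc_iff) blast+
qed

lemma contc_cont1:
  assumes "diffc k \<alpha>" "i < k" "xs \<in> cube k"
  shows "continuous_on {0..1} (\<lambda>u. \<alpha> (xs[i := u]))"
  unfolding continuous_on_eq_continuous_within
  using pd_has_derivative_at[OF assms] has_vector_derivative_continuous by blast

section \<open>Composition with coordinate functions and the chain rule\<close>

lemma boxf_map: "x \<in> boxf \<Longrightarrow> map x [0..<k] \<in> cube k"
  by (rule cube_map) (auto simp: boxf_def)

text \<open>Continuity into \<open>boxf\<close> is tested coordinatewise; the coordinates from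
  \<open>l\<close> on are filled with 0.\<close>

lemma contc_comp_on:
  assumes "contc l \<alpha>" "\<And>j. j < l \<Longrightarrow> continuous_on S (\<phi> j)"
    and "\<And>j p. j < l \<Longrightarrow> p \<in> S \<Longrightarrow> \<phi> j p \<in> {0..1}"
  shows "continuous_on S (\<lambda>p. \<alpha> (map (\<lambda>j. \<phi> j p) [0..<l]))"
proof -
  let ?g = "\<lambda>p j. if j < l then \<phi> j p else 0"
  have "continuous_on S ?g"
  proof (rule continuous_on_coordinatewise_then_product)
    fix i show "continuous_on S (\<lambda>p. if i < l then \<phi> i p else 0)"
      using assms(2)[of i] by (cases "i < l") auto
  qed
  moreover have "?g ` S \<subseteq> boxf" using assms(3) by (auto simp: boxf_def)
  ultimately have "continuous_on S (\<lambda>p. \<alpha> (map (?g p) [0..<l]))"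
    using continuous_on_compose2[of boxf "\<lambda>x. \<alpha> (map x [0..<l])" S ?g] assms(1)
    by (simp add: contc_def)
  moreover have "map (?g p) [0..<l] = map (\<lambda>j. \<phi> j p) [0..<l]" for p by simp
  ultimately show ?thesis by simp
qed

lemma continuous_on_if_const:
  "(P \<Longrightarrow> continuous_on S f) \<Longrightarrow> (\<not> P \<Longrightarrow> continuous_on S g) \<Longrightarrow> continuous_on S (\<lambda>x. if P then f x else g x)"
  by (cases P) simp_all

text \<open>Only partial derivatives are given, so the coordinates are released one after another.
  At stage \<open>m\<close> there are two variables: \<open>u\<close>, moving the first
  \<open>m\<close> coordinates, with derivative known by induction, and the coordinate
  \<open>m\<close> itself. Existence of the first partial derivative and continuity of the second
  give total differentiability; then \<open>c m u\<close> is substituted for the second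
  variable.\<close>

lemma chain_rule_cube:
  fixes \<alpha> :: "'v::real_normed_vector path"
  assumes \<alpha>: "diffc l \<alpha>" "\<And>j. j < l \<Longrightarrow> contc l (pd j \<alpha>)"
    and c: "\<And>j. j < l \<Longrightarrow> (c j has_vector_derivative c' j) (at u0 within {0..1})"
    and cont: "\<And>j. j < l \<Longrightarrow> continuous_on {0..1} (c j)"
    and ran: "\<And>j u. j < l \<Longrightarrow> u \<in> {0..1} \<Longrightarrow> c j u \<in> {0..1}"
    and u0: "u0 \<in> {0..1}"
  shows "((\<lambda>u. \<alpha> (map (\<lambda>j. c j u) [0..<l])) has_vector_derivative
     (\<Sum>j<l. c' j *\<^sub>R pd j \<alpha> (map (\<lambda>j. c j u0) [0..<l]))) (at u0 within {0..1})"
proof -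
  \<comment> \<open>Coordinates below \<open>m\<close> follow the curve, coordinate \<open>m\<close>
    is \<open>y\<close>, the others rest at their values at \<open>u0\<close>.\<close>
  define pt where "pt m u y = map (\<lambda>j. if j < m then c j u else if j = m then y else c j u0) [0..<l]" for m u y
  have ptc: "pt m u y \<in> cube l" if "u \<in> {0..1}" "y \<in> {0..1}" for m u y
    unfolding pt_def by (rule cube_map) (use ran u0 that in auto)
  have "((\<lambda>u. \<alpha> (map (\<lambda>j. if j < m then c j u else c j u0) [0..<l])) has_vector_derivative
     (\<Sum>j<m. c' j *\<^sub>R pd j \<alpha> (map (\<lambda>j. c j u0) [0..<l]))) (at u0 within {0..1})" if "m \<le> l" for m
    using that
  proof (induction m)
    case 0 show ?case by simp
  next
    case (Suc m)
    then have m: "m < l" by simp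
    let ?D = "\<Sum>j<m. c' j *\<^sub>R pd j \<alpha> (map (\<lambda>j. c j u0) [0..<l])"
    let ?f = "\<lambda>u y. \<alpha> (pt m u y)"
    let ?fy = "\<lambda>u y. blinfun_scaleR_left (pd m \<alpha> (pt m u y))"
    let ?y0 = "c m u0"
    have y0: "?y0 \<in> {0..1}" using ran m u0 by blast
    have pteq: "pt m u (c m u0) = map (\<lambda>j. if j < m then c j u else c j u0) [0..<l]" for u
      unfolding pt_def by (intro map_cong) auto
    have pteq0: "pt m u0 (c m u0) = map (\<lambda>j. c j u0) [0..<l]"
      unfolding pt_def by (intro map_cong) auto
    have pteq1: "pt m u (c m u) = map (\<lambda>j. if j < Suc m then c j u else c j u0) [0..<l]" for u
      unfolding pt_def by (intro map_cong) (auto simp: less_Suc_eq)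
    have ptupd: "(pt m u y)[m := z] = pt m u z" for u y z
      unfolding pt_def using m by (intro nth_equalityI) (auto simp: nth_list_update)
    have ptm: "pt m u y ! m = y" for u y unfolding pt_def using m by simp
    have fx: "((\<lambda>u. ?f u ?y0) has_derivative (\<lambda>h. h *\<^sub>R ?D)) (at u0 within {0..1})"
      using Suc by (simp add: pteq has_vector_derivative_def)
    have fy: "((\<lambda>y. ?f u y) has_derivative blinfun_apply (?fy u y)) (at y within {0..1})"
      if "u \<in> {0..1}" "y \<in> {0..1}" for u y
      using pd_has_derivative[OF \<alpha>(1) m ptc[OF that, of m]]
      by (simp add: ptupd ptm has_vector_derivative_def)
    have "continuous_on ({0..1} \<times> {0..1}) (\<lambda>p. pd m \<alpha> (map (\<lambda>j. if j < m then c j (fst p) else if j = m then snd p else c j u0) [0..<l]))"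
    proof (rule contc_comp_on[OF \<alpha>(2)[OF m]])
      fix j assume j: "j < l"
      have "continuous_on ({0..1} \<times> {0..1::real}) (\<lambda>p. c j (fst p))"
        by (rule continuous_on_compose2[OF cont[OF j]]) (auto intro: continuous_intros)
      moreover have "continuous_on ({0..1} \<times> {0..1::real}) (\<lambda>p. snd p)"
        by (intro continuous_intros)
      moreover have "continuous_on ({0..1::real} \<times> {0..1::real}) (\<lambda>p. c j u0)"
        by (rule continuous_on_const)
      ultimately show "continuous_on ({0..1} \<times> {0..1}) (\<lambda>p. if j < m then c j (fst p) else if j = m then snd p else c j u0)"
        by (intro continuous_on_if_const)
      show "(if j < m then c j (fst p) else if j = m then snd p else c j u0) \<in> {0..1}" if "p \<in> {0..1} \<times> {0..1}" for p
        using ran[OF j, of "fst p"] ran[OF j u0] that by (cases p) simp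
    qed
    then have "continuous_on ({0..1} \<times> {0..1}) (\<lambda>p. pd m \<alpha> (pt m (fst p) (snd p)))"
      by (simp add: pt_def)
    then have "continuous_on ({0..1} \<times> {0..1}) (\<lambda>p. ?fy (fst p) (snd p))"
      by (intro continuous_intros)
    then have fyc: "continuous (at (u0, ?y0) within {0..1} \<times> {0..1}) (\<lambda>(u, y). ?fy u y)"
      using y0 u0 by (simp add: continuous_on_eq_continuous_within split_beta')
    have tot: "((\<lambda>(u, y). ?f u y) has_derivative (\<lambda>(tx, ty). tx *\<^sub>R ?D + ?fy u0 ?y0 ty)) (at (u0, ?y0) within {0..1} \<times> {0..1})"
      by (rule has_derivative_partialsI[OF fx fy fyc y0]) auto
    have 1: "((\<lambda>u. (u, c m u)) has_derivative (\<lambda>h. (h, h *\<^sub>R c' m))) (at u0 within {0..1})"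
      using c[OF m] by (auto intro!: derivative_eq_intros simp: has_vector_derivative_def)
    have "(\<lambda>u. (u, c m u)) ` {0..1} \<subseteq> {0..1} \<times> {0..1}" using ran[OF m] by blast
    from has_derivative_in_compose[OF 1 has_derivative_subset[OF tot this]]
    have "((\<lambda>u. ?f u (c m u)) has_derivative
       (\<lambda>h. h *\<^sub>R ?D + ?fy u0 ?y0 (h *\<^sub>R c' m))) (at u0 within {0..1})"
      by simp
    then show ?case
      by (simp add: has_vector_derivative_def pteq1 pteq0 algebra_simps)
  qed
  moreover have "map (\<lambda>j. if j < l then c j u else c j u0) [0..<l] = map (\<lambda>j. c j u) [0..<l]" for u
    by simp
  ultimately show ?thesis
    by (metis (no_types, lifting) ext order_refl)
qed

section \<open>Smooth steps\<close>

text \<open>The classes C^N on the real line. They serve to show that the transition functions are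
  smooth before these are composed with coordinates of the cube.\<close>

fun Rn :: "nat \<Rightarrow> (real \<Rightarrow> real) \<Rightarrow> bool" where
  "Rn 0 f \<longleftrightarrow> continuous_on UNIV f"
| "Rn (Suc N) f \<longleftrightarrow> (\<exists>f'. (\<forall>x. (f has_real_derivative f' x) (at x)) \<and> Rn N f')"

lemma Rn_continuous: "Rn N f \<Longrightarrow> continuous_on UNIV f"
  by (cases N) (auto simp: continuous_on_eq_continuous_at intro: DERIV_isCont)

lemma Rn_Suc_imp: "Rn (Suc N) f \<Longrightarrow> Rn N f"
proof (induction N arbitrary: f)
  case 0 show ?case using Rn_continuous[OF 0] by simp
next
  case (Suc N)
  from Suc.prems obtain f' where f': "\<forall>x. (f has_real_derivative f' x) (at x)" "Rn (Suc N) f'"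
    unfolding Rn.simps(2)[of "Suc N"] by blast
  from f'(1) Suc.IH[OF f'(2)] show ?case unfolding Rn.simps(2) by blast
qed

lemma Rn_SucE:
  assumes "Rn (Suc N) f"
  obtains f' where "\<And>x. (f has_real_derivative f' x) (at x)" "Rn N f'" "Rn N f"
  using assms Rn_Suc_imp[OF assms] that by auto

lemma Rn_SucI: "(\<And>x. (f has_real_derivative f' x) (at x)) \<Longrightarrow> Rn N f' \<Longrightarrow> Rn (Suc N) f"
  by auto

lemma Rn_const: "Rn N (\<lambda>_. c)"
proof (induction N arbitrary: c)
  case (Suc N)
  show ?case by (rule Rn_SucI[OF DERIV_const Suc])
qed simp

lemma Rn_ident: "Rn N (\<lambda>x. x)"
proof (cases N)
  case (Suc M)
  show ?thesis unfolding Suc by (rule Rn_SucI[OF DERIV_ident Rn_const])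
qed simp

lemma Rn_add: "Rn N f \<Longrightarrow> Rn N g \<Longrightarrow> Rn N (\<lambda>x. f x + g x)"
proof (induction N arbitrary: f g)
  case 0 then show ?case by (simp add: continuous_on_add)
next
  case (Suc N)
  from Suc.prems(1) obtain f' where f: "\<And>x. (f has_real_derivative f' x) (at x)" "Rn N f'" "Rn N f"
    by (erule Rn_SucE)
  from Suc.prems(2) obtain g' where g: "\<And>x. (g has_real_derivative g' x) (at x)" "Rn N g'" "Rn N g"
    by (erule Rn_SucE)
  show ?case using DERIV_add[OF f(1) g(1)] Suc.IH[OF f(2) g(2)] by (rule Rn_SucI)
qed

lemma Rn_mult: "Rn N f \<Longrightarrow> Rn N g \<Longrightarrow> Rn N (\<lambda>x. f x * g x)"
proof (induction N arbitrary: f g)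
  case 0 then show ?case by (simp add: continuous_on_mult)
next
  case (Suc N)
  from Suc.prems(1) obtain f' where f: "\<And>x. (f has_real_derivative f' x) (at x)" "Rn N f'" "Rn N f"
    by (erule Rn_SucE)
  from Suc.prems(2) obtain g' where g: "\<And>x. (g has_real_derivative g' x) (at x)" "Rn N g'" "Rn N g"
    by (erule Rn_SucE)
  show ?case using DERIV_mult[OF f(1) g(1)] Rn_add[OF Suc.IH[OF f(2) g(3)] Suc.IH[OF g(2) f(3)]] by (rule Rn_SucI)
qed

lemma Rn_inverse: "Rn N f \<Longrightarrow> (\<And>x. f x \<noteq> 0) \<Longrightarrow> Rn N (\<lambda>x. inverse (f x))"
proof (induction N arbitrary: f)
  case 0 then show ?case by (simp add: continuous_on_inverse)
next
  case (Suc N)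
  from Suc.prems(1) obtain f' where f: "\<And>x. (f has_real_derivative f' x) (at x)" "Rn N f'" "Rn N f"
    by (erule Rn_SucE)
  note i = Suc.IH[OF f(3) Suc.prems(2)]
  have "((\<lambda>x. inverse (f x)) has_real_derivative - 1 * (inverse (f x) * f' x * inverse (f x))) (at x)" for x
    by (rule DERIV_cong[OF DERIV_inverse'[OF f(1) Suc.prems(2)]]) simp
  then show ?case
    using Rn_mult[OF Rn_const Rn_mult[OF Rn_mult[OF i f(2)] i]] by (rule Rn_SucI)
qed

lemma Rn_compose: "Rn N f \<Longrightarrow> Rn N g \<Longrightarrow> Rn N (\<lambda>x. f (g x))"
proof (induction N arbitrary: f g)
  case 0 then show ?case by (auto intro: continuous_on_compose2)
next
  case (Suc N)
  from Suc.prems(1) obtain f' where f: "\<And>x. (f has_real_derivative f' x) (at x)" "Rn N f'" "Rn N f"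
    by (erule Rn_SucE)
  from Suc.prems(2) obtain g' where g: "\<And>x. (g has_real_derivative g' x) (at x)" "Rn N g'" "Rn N g"
    by (erule Rn_SucE)
  show ?case using DERIV_chain2[OF f(1) g(1)] Rn_mult[OF Suc.IH[OF f(2) g(3)] g(2)] by (rule Rn_SucI)
qed

text \<open>Powers of 1/x times exp(-1/x), continued by 0. Derivatives of members are linear
  combinations of members, so smoothness follows by an induction that treats all \<open>j\<close> at
  once.\<close>

definition flat :: "nat \<Rightarrow> real \<Rightarrow> real" where
  "flat j x = (if x > 0 then (1 / x) ^ j * exp (- (1 / x)) else 0)"

lemma flat_tendsto: "(flat j \<longlongrightarrow> 0) (at_right 0)"
proof -
  have "((\<lambda>y::real. y ^ j / exp y) \<longlongrightarrow> 0) at_top" by (rule tendsto_power_div_exp_0)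
  moreover have "filterlim (\<lambda>x::real. 1 / x) at_top (at_right 0)"
    using filterlim_inverse_at_top_right by (simp add: inverse_eq_divide)
  ultimately have "((\<lambda>x::real. (1 / x) ^ j / exp (1 / x)) \<longlongrightarrow> 0) (at_right 0)"
    by (rule filterlim_compose)
  then show ?thesis
    by (rule Lim_transform_eventually)
      (auto simp: flat_def exp_minus divide_inverse eventually_at_right_less intro!: eventually_mono[OF eventually_at_right_less])
qed

lemma flat_deriv:
  "(flat j has_real_derivative (- real j) * flat (j + 1) x + flat (j + 2) x) (at x)"
proof -
  consider "x > 0" | "x < 0" | "x = 0" by linarith
  then show ?thesis
  proof cases
    case 1
    have r: "((\<lambda>x. 1 / x) has_real_derivative - ((1 / x) ^ 2)) (at x)"
      using 1 by (auto intro!: derivative_eq_intros simp: power2_eq_square)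
    have p: "((\<lambda>x. (1 / x) ^ j) has_real_derivative - real j * (1 / x) ^ (j + 1)) (at x)"
    proof (cases j)
      case (Suc n)
      show ?thesis unfolding Suc
        by (rule DERIV_cong[OF DERIV_power_Suc[OF r]]) (simp add: power2_eq_square algebra_simps diff_divide_distrib add_divide_distrib)
    qed simp
    have q: "((\<lambda>x. exp (- (1 / x))) has_real_derivative exp (- (1 / x)) * (1 / x) ^ 2) (at x)"
      by (rule DERIV_cong[OF DERIV_chain2[OF DERIV_exp DERIV_minus[OF r]]]) simp
    have "((\<lambda>x. (1 / x) ^ j * exp (- (1 / x))) has_real_derivative
        (- real j) * flat (j + 1) x + flat (j + 2) x) (at x)"
      by (rule DERIV_cong[OF DERIV_mult[OF p q]]) (use 1 in \<open>simp add: flat_def power_add power2_eq_square algebra_simps\<close>)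
    then show ?thesis
      by (rule has_field_derivative_transform_within_open[where S="{0<..}"]) (use 1 in \<open>auto simp: flat_def\<close>)
  next
    case 2
    have "((\<lambda>x. 0) has_real_derivative (- real j) * flat (j + 1) x + flat (j + 2) x) (at x)"
      using 2 by (simp add: flat_def)
    then show ?thesis
      by (rule has_field_derivative_transform_within_open[where S="{..<0}"]) (use 2 in \<open>auto simp: flat_def\<close>)
  next
    case 3
    \<comment> \<open>At 0 the difference quotient from the right is \<open>flat (Suc j)\<close>,
      which tends to 0.\<close>
    have "((\<lambda>h. flat j h / h) \<longlongrightarrow> 0) (at_right 0)"
      using flat_tendsto[of "Suc j"]
      by (rule Lim_transform_eventually) (auto simp: flat_def intro!: eventually_mono[OF eventually_at_right_less])
    moreover have "((\<lambda>h. flat j h / h) \<longlongrightarrow> 0) (at_left 0)"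
      by (rule Lim_transform_eventually[OF tendsto_const])
        (auto simp: flat_def eventually_at_left_field intro: exI[of _ "-1"])
    ultimately have "((\<lambda>h. flat j h / h) \<longlongrightarrow> 0) (at 0)"
      by (simp add: filterlim_split_at)
    then show ?thesis using 3 by (simp add: DERIV_def flat_def)
  qed
qed

lemma Rn_flat: "Rn N (flat j)"
proof (induction N arbitrary: j)
  case 0
  show ?case using flat_deriv DERIV_isCont by (simp add: continuous_on_eq_continuous_at) blast
next
  case (Suc N)
  show ?case using flat_deriv[of j] Rn_add[OF Rn_mult[OF Rn_const Suc] Suc] by (rule Rn_SucI)
qed

lemma flat0_mono: "x \<le> y \<Longrightarrow> flat 0 x \<le> flat 0 y"
  by (auto simp: flat_def frac_le)

text \<open>The usual smooth transition f(y) / (f(y) + f(1 - y)) with f = \<open>flat 0\<close>; for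
  \<open>a < b\<close> it is 0 up to \<open>a\<close> and 1 from \<open>b\<close> on.\<close>

definition step :: "real \<Rightarrow> real \<Rightarrow> real \<Rightarrow> real" where
  "step a b x = (let y = (x - a) / (b - a) in flat 0 y * inverse (flat 0 y + flat 0 (1 - y)))"

lemma step_denom_pos: "flat 0 y + flat 0 (1 - y) > 0"
  by (auto simp: flat_def intro: add_pos_pos)

lemma Rn_step: "Rn N (step a b)"
proof -
  have 1: "Rn N (\<lambda>x. (x - a) / (b - a))"
    using Rn_mult[OF Rn_add[OF Rn_ident Rn_const[of N "- a"]] Rn_const[of N "1 / (b - a)"]] by simp
  have 2: "Rn N (\<lambda>y. flat 0 y * inverse (flat 0 y + flat 0 (1 - y)))"
  proof (intro Rn_mult Rn_inverse Rn_add Rn_flat)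
    show "Rn N (\<lambda>y. flat 0 (1 - y))"
      using Rn_compose[OF Rn_flat Rn_add[OF Rn_const[of N 1] Rn_mult[OF Rn_const[of N "-1"] Rn_ident]]] by simp
    show "flat 0 y + flat 0 (1 - y) \<noteq> 0" for y using step_denom_pos[of y] by simp
  qed
  show ?thesis using Rn_compose[OF 2 1] by (simp add: step_def[abs_def] Let_def)
qed

lemma step_eq0: "a < b \<Longrightarrow> x \<le> a \<Longrightarrow> step a b x = 0"
  using divide_nonpos_pos[of "x - a" "b - a"] by (simp add: step_def Let_def flat_def)

lemma step_eq1:
  assumes "a < b" "b \<le> x" shows "step a b x = 1"
proof -
  have "(x - a) / (b - a) \<ge> 1" using assms by (simp add: field_simps)
  then show ?thesis by (simp add: step_def Let_def flat_def)
qed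

lemma step_range: "step a b x \<in> {0..1}"
proof -
  define y where "y = (x - a) / (b - a)"
  have "flat 0 y \<ge> 0" "flat 0 (1 - y) \<ge> 0" by (auto simp: flat_def)
  then show ?thesis using step_denom_pos[of y]
    by (simp add: step_def Let_def y_def[symmetric] field_simps)
qed

text \<open>Cross-multiplied, the inequality is f(y) f(1 - y') \<le> f(y') f(1 - y). Monotonicity is
  demanded of the boundary curves of a \<open>corner_family\<close>.\<close>

lemma step_mono:
  assumes "a < b" "x \<le> x'" shows "step a b x \<le> step a b x'"
proof -
  define y y' where "y = (x - a) / (b - a)" and "y' = (x' - a) / (b - a)"
  have "y \<le> y'" using assms by (simp add: y_def y'_def divide_right_mono)
  then have m: "flat 0 y \<le> flat 0 y'" "flat 0 (1 - y') \<le> flat 0 (1 - y)" by (auto intro: flat0_mono)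
  have nn: "flat 0 z \<ge> 0" for z by (auto simp: flat_def)
  have "flat 0 y * flat 0 (1 - y') \<le> flat 0 y' * flat 0 (1 - y)"
    using m nn by (intro mult_mono) auto
  then have "flat 0 y / (flat 0 y + flat 0 (1 - y)) \<le> flat 0 y' / (flat 0 y' + flat 0 (1 - y'))"
    using step_denom_pos[of y] step_denom_pos[of y'] by (simp add: frac_le_eq field_simps)
  then show ?thesis by (simp add: step_def Let_def y_def y'_def divide_inverse)
qed

section \<open>Calculus on cubes\<close>

lemma contc_const: "contc k (\<lambda>_. c)"
  by (simp add: contc_def)

lemma contc_add: "contc k \<alpha> \<Longrightarrow> contc k \<beta> \<Longrightarrow> contc k (\<lambda>xs. \<alpha> xs + \<beta> xs)"
  unfolding contc_def by (rule continuous_on_add)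

lemma contc_bounded_linear: "bounded_linear f \<Longrightarrow> contc k \<alpha> \<Longrightarrow> contc k (\<lambda>xs. f (\<alpha> xs))"
  unfolding contc_def by (rule bounded_linear.continuous_on)

lemma contc_bounded_bilinear:
  "bounded_bilinear p \<Longrightarrow> contc k \<alpha> \<Longrightarrow> contc k \<beta> \<Longrightarrow> contc k (\<lambda>xs. p (\<alpha> xs) (\<beta> xs))"
  unfolding contc_def by (rule bounded_bilinear.continuous_on)

lemma contc_nth: "i < k \<Longrightarrow> contc k (\<lambda>xs. xs ! i)"
  using continuous_on_subset[OF continuous_on_product_coordinates subset_UNIV]
  by (simp add: contc_def)

lemma Cn_const: "Cn k N (\<lambda>_. c)"
proof (induction N arbitrary: c)
  case (Suc N) then show ?case
    by (intro Cn_SucI[where \<beta>="\<lambda>_ _. 0"]) (auto simp: contc_const)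
qed (simp add: contc_const)

lemma Cn_SucD:
  assumes "Cn k (Suc N) \<alpha>"
  shows "contc k \<alpha>" "diffc k \<alpha>" "\<And>i. i < k \<Longrightarrow> Cn k N (pd i \<alpha>)" "Cn k N \<alpha>"
    "\<And>i. i < k \<Longrightarrow> contc k (pd i \<alpha>)"
  using assms Cn_Suc_imp[OF assms] Cn_contc by auto

lemma Cn_add: "Cn k N \<alpha> \<Longrightarrow> Cn k N \<beta> \<Longrightarrow> Cn k N (\<lambda>xs. \<alpha> xs + \<beta> xs)"
proof (induction N arbitrary: \<alpha> \<beta>)
  case 0 then show ?case by (simp add: contc_add)
next
  case (Suc N)
  note a = Cn_SucD[OF Suc.prems(1)] and b = Cn_SucD[OF Suc.prems(2)]
  show ?case
    using contc_add[OF a(1) b(1)]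
      has_vector_derivative_add[OF pd_has_derivative[OF a(2)] pd_has_derivative[OF b(2)]]
      Suc.IH[OF a(3) b(3)]
    by (rule Cn_SucI)
qed

lemma Cn_bounded_linear: "bounded_linear f \<Longrightarrow> Cn k N \<alpha> \<Longrightarrow> Cn k N (\<lambda>xs. f (\<alpha> xs))"
proof (induction N arbitrary: \<alpha>)
  case 0 then show ?case by (simp add: contc_bounded_linear)
next
  case (Suc N)
  note a = Cn_SucD[OF Suc.prems(2)]
  show ?case
    using contc_bounded_linear[OF Suc.prems(1) a(1)]
      bounded_linear.has_vector_derivative[OF Suc.prems(1) pd_has_derivative[OF a(2)]]
      Suc.IH[OF Suc.prems(1) a(3)]
    by (rule Cn_SucI)
qed

lemma Cn_bounded_bilinear:
  assumes "bounded_bilinear p"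
  shows "Cn k N \<alpha> \<Longrightarrow> Cn k N \<beta> \<Longrightarrow> Cn k N (\<lambda>xs. p (\<alpha> xs) (\<beta> xs))"
proof (induction N arbitrary: \<alpha> \<beta>)
  case 0 then show ?case by (simp add: contc_bounded_bilinear assms)
next
  case (Suc N)
  note a = Cn_SucD[OF Suc.prems(1)] and b = Cn_SucD[OF Suc.prems(2)]
  show ?case
  proof (rule Cn_SucI[where \<beta>="\<lambda>i xs. p (\<alpha> xs) (pd i \<beta> xs) + p (pd i \<alpha> xs) (\<beta> xs)"])
    fix i xs assume i: "i < k" and xs: "xs \<in> cube k"
    show "((\<lambda>u. p (\<alpha> (xs[i := u])) (\<beta> (xs[i := u]))) has_vector_derivative
       p (\<alpha> xs) (pd i \<beta> xs) + p (pd i \<alpha> xs) (\<beta> xs)) (at (xs ! i) within {0..1})"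
      using bounded_bilinear.has_vector_derivative[OF assms pd_has_derivative[OF a(2) i xs] pd_has_derivative[OF b(2) i xs]]
      by simp
  next
    show "contc k (\<lambda>xs. p (\<alpha> xs) (\<beta> xs))"
      by (rule contc_bounded_bilinear[OF assms a(1) b(1)])
    show "Cn k N (\<lambda>xs. p (\<alpha> xs) (pd i \<beta> xs) + p (pd i \<alpha> xs) (\<beta> xs))" if "i < k" for i
      by (rule Cn_add[OF Suc.IH[OF a(4) b(3)[OF that]] Suc.IH[OF a(3)[OF that] b(4)]])
  qed
qed

lemma Cn_scaleR: "Cn k N a \<Longrightarrow> Cn k N \<alpha> \<Longrightarrow> Cn k N (\<lambda>xs. a xs *\<^sub>R \<alpha> xs)"
  by (rule Cn_bounded_bilinear[OF bounded_bilinear_scaleR])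

lemma Cn_mult: "Cn k N a \<Longrightarrow> Cn k N b \<Longrightarrow> Cn k N (\<lambda>xs. a xs * b xs :: real)"
  by (rule Cn_bounded_bilinear[OF bounded_bilinear_mult])

lemma Cn_inner: "Cn k N a \<Longrightarrow> Cn k N b \<Longrightarrow> Cn k N (\<lambda>xs. inner (a xs) (b xs))"
  by (rule Cn_bounded_bilinear[OF bounded_bilinear_inner])

lemma Cn_minus: "Cn k N a \<Longrightarrow> Cn k N (\<lambda>xs. - a xs)"
  by (rule Cn_bounded_linear[OF bounded_linear_minus[OF bounded_linear_ident]])

lemma Cn_diff: "Cn k N \<alpha> \<Longrightarrow> Cn k N \<beta> \<Longrightarrow> Cn k N (\<lambda>xs. \<alpha> xs - \<beta> xs)"
  using Cn_add[of k N \<alpha> "\<lambda>xs. - \<beta> xs"] Cn_minus[of k N \<beta>] by simp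

lemma Cn_sum: "(\<And>i. i \<in> I \<Longrightarrow> Cn k N (f i)) \<Longrightarrow> Cn k N (\<lambda>xs. \<Sum>i\<in>I. f i xs)"
  by (induction I rule: infinite_finite_induct) (auto intro: Cn_add Cn_const)

lemma Cn_nth: "i < k \<Longrightarrow> Cn k N (\<lambda>xs. xs ! i)"
proof (cases N)
  case (Suc M)
  assume i: "i < k"
  show ?thesis unfolding Suc
  proof (rule Cn_SucI[where \<beta>="\<lambda>j xs. if j = i then 1 else 0"])
    fix j and xs :: "real list" assume "j < k" "xs \<in> cube k"
    then show "((\<lambda>u. xs[j := u] ! i) has_vector_derivative (if j = i then 1 else 0)) (at (xs ! j) within {0..1})"
      using i by (cases "j = i") (auto simp: cube_length)
  qed (auto simp: contc_nth i Cn_const)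
qed (simp add: contc_nth)

lemma contc_comp:
  assumes "contc l \<alpha>" "\<And>j. j < l \<Longrightarrow> contc k (\<phi> j)"
    and "\<And>j xs. j < l \<Longrightarrow> xs \<in> cube k \<Longrightarrow> \<phi> j xs \<in> {0..1}"
  shows "contc k (\<lambda>xs. \<alpha> (map (\<lambda>j. \<phi> j xs) [0..<l]))"
  unfolding contc_def using assms(2,3)
  by (intro contc_comp_on[OF assms(1), where \<phi>="\<lambda>j x. \<phi> j (map x [0..<k])"])
    (simp_all add: contc_def boxf_map)

lemma pd_comp_has:
  assumes "diffc l \<alpha>" "\<And>j. j < l \<Longrightarrow> contc l (pd j \<alpha>)" "\<And>j. j < l \<Longrightarrow> diffc k (\<phi> j)"
    and "\<And>j xs. j < l \<Longrightarrow> xs \<in> cube k \<Longrightarrow> \<phi> j xs \<in> {0..1}"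
    and "i < k" "xs \<in> cube k"
  shows "((\<lambda>u. \<alpha> (map (\<lambda>j. \<phi> j (xs[i := u])) [0..<l])) has_vector_derivative
    (\<Sum>j<l. pd i (\<phi> j) xs *\<^sub>R pd j \<alpha> (map (\<lambda>j. \<phi> j xs) [0..<l]))) (at (xs ! i) within {0..1})"
proof -
  have "((\<lambda>u. \<alpha> (map (\<lambda>j. \<phi> j (xs[i := u])) [0..<l])) has_vector_derivative
    (\<Sum>j<l. pd i (\<phi> j) xs *\<^sub>R pd j \<alpha> (map (\<lambda>j. \<phi> j (xs[i := xs ! i])) [0..<l]))) (at (xs ! i) within {0..1})"
    by (rule chain_rule_cube[OF assms(1,2) pd_has_derivative[OF assms(3) assms(5,6)]
          contc_cont1[OF assms(3) assms(5,6)] assms(4)[OF _ cube_update[OF assms(6)]]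
          cube_nth[OF assms(6,5)]])
  then show ?thesis by simp
qed

text \<open>The chain rule expresses the derivatives by composites of \<open>pd j \<alpha>\<close>
  with the same \<phi>, so the induction generalizes over \<alpha>.\<close>

lemma Cn_comp:
  assumes "\<And>j xs. j < l \<Longrightarrow> xs \<in> cube k \<Longrightarrow> \<phi> j xs \<in> {0..1}"
  shows "Cn l N \<alpha> \<Longrightarrow> (\<And>j. j < l \<Longrightarrow> Cn k N (\<phi> j)) \<Longrightarrow> Cn k N (\<lambda>xs. \<alpha> (map (\<lambda>j. \<phi> j xs) [0..<l]))"
proof (induction N arbitrary: \<alpha>)
  case 0
  then have "contc l \<alpha>" "\<And>j. j < l \<Longrightarrow> contc k (\<phi> j)" by auto
  from contc_comp[OF this assms] show ?case by simp
next
  case (Suc N)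
  note a = Cn_SucD[OF Suc.prems(1)] and p = Cn_SucD[OF Suc.prems(2)]
  show ?case
  proof (rule Cn_SucI[where \<beta>="\<lambda>i xs. \<Sum>j<l. pd i (\<phi> j) xs *\<^sub>R pd j \<alpha> (map (\<lambda>j. \<phi> j xs) [0..<l])"])
    show "contc k (\<lambda>xs. \<alpha> (map (\<lambda>j. \<phi> j xs) [0..<l]))"
      by (rule contc_comp[OF a(1) p(1) assms])
  next
    fix i xs assume "i < k" "xs \<in> cube k"
    then show "((\<lambda>u. \<alpha> (map (\<lambda>j. \<phi> j (xs[i := u])) [0..<l])) has_vector_derivative
       (\<Sum>j<l. pd i (\<phi> j) xs *\<^sub>R pd j \<alpha> (map (\<lambda>j. \<phi> j xs) [0..<l]))) (at (xs ! i) within {0..1})"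
      by (intro pd_comp_has[OF a(2,5) p(2) assms])
  next
    fix i assume "i < k"
    then show "Cn k N (\<lambda>xs. \<Sum>j<l. pd i (\<phi> j) xs *\<^sub>R pd j \<alpha> (map (\<lambda>j. \<phi> j xs) [0..<l]))"
      by (intro Cn_sum Cn_scaleR Suc.IH a(3) p(3,4)) simp_all
  qed
qed

lemma contc_real: "continuous_on UNIV (f :: real \<Rightarrow> real) \<Longrightarrow> contc k \<phi> \<Longrightarrow> contc k (\<lambda>xs. f (\<phi> xs))"
  unfolding contc_def by (rule continuous_on_compose2) auto

lemma Cn_real: "Rn N f \<Longrightarrow> Cn k N \<phi> \<Longrightarrow> Cn k N (\<lambda>xs. f (\<phi> xs))"
proof (induction N arbitrary: f)
  case 0 then show ?case by (simp add: contc_real)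
next
  case (Suc N)
  from Suc.prems(1) obtain f' where f: "\<And>x. (f has_real_derivative f' x) (at x)" "Rn N f'" "Rn N f"
    by (erule Rn_SucE)
  note p = Cn_SucD[OF Suc.prems(2)]
  show ?case
  proof (rule Cn_SucI[where \<beta>="\<lambda>i xs. pd i \<phi> xs * f' (\<phi> xs)"])
    show "contc k (\<lambda>xs. f (\<phi> xs))" by (rule contc_real[OF Rn_continuous[OF f(3)] p(1)])
    fix i assume i: "i < k"
    show "Cn k N (\<lambda>xs. pd i \<phi> xs * f' (\<phi> xs))" by (rule Cn_mult[OF p(3)[OF i] Suc.IH[OF f(2) p(4)]])
    fix xs assume xs: "xs \<in> cube k"
    from field_vector_diff_chain_within[OF pd_has_derivative[OF p(2) i xs], of f "f' (\<phi> xs)"]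
    show "((\<lambda>u. f (\<phi> (xs[i := u]))) has_vector_derivative pd i \<phi> xs * f' (\<phi> xs)) (at (xs ! i) within {0..1})"
      using f(1) by (simp add: o_def has_field_derivative_at_within)
  qed
qed

lemma contc_powr:
  fixes \<phi> :: "real path"
  assumes "\<And>xs. xs \<in> cube k \<Longrightarrow> \<phi> xs > 0" "contc k \<phi>"
  shows "contc k (\<lambda>xs. \<phi> xs powr a)"
  using assms boxf_map unfolding contc_def by (intro continuous_intros) fastforce+

text \<open>Differentiation lowers the exponent, so the induction generalizes over \<open>a\<close>.
  The exponent -1/2 serves to normalize vectors in \<open>smooth_direction\<close>.\<close>

lemma Cn_powr:
  fixes \<phi> :: "real path"
  assumes pos: "\<And>xs. xs \<in> cube k \<Longrightarrow> \<phi> xs > 0"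
  shows "Cn k N \<phi> \<Longrightarrow> Cn k N (\<lambda>xs. \<phi> xs powr a)"
proof (induction N arbitrary: a)
  case 0 then show ?case using contc_powr[OF pos] by simp
next
  case (Suc N)
  note p = Cn_SucD[OF Suc.prems]
  show ?case
  proof (rule Cn_SucI[where \<beta>="\<lambda>i xs. pd i \<phi> xs * (a * \<phi> xs powr (a - 1))"])
    show "contc k (\<lambda>xs. \<phi> xs powr a)" by (rule contc_powr[OF pos p(1)])
    fix i assume i: "i < k"
    show "Cn k N (\<lambda>xs. pd i \<phi> xs * (a * \<phi> xs powr (a - 1)))"
      by (intro Cn_mult p(3) i Cn_const Suc.IH p(4))
    fix xs assume xs: "xs \<in> cube k"
    have "((\<lambda>y. y powr a) has_real_derivative a * \<phi> xs powr (a - 1)) (at (\<phi> xs))"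
      using has_real_derivative_powr[OF pos[OF xs]] by blast
    from field_vector_diff_chain_within[OF pd_has_derivative[OF p(2) i xs], of "\<lambda>y. y powr a" "a * \<phi> xs powr (a - 1)"] this
    show "((\<lambda>u. \<phi> (xs[i := u]) powr a) has_vector_derivative pd i \<phi> xs * (a * \<phi> xs powr (a - 1))) (at (xs ! i) within {0..1})"
      by (simp add: o_def has_field_derivative_at_within)
  qed
qed

lemma smooth_const: "smooth_cube k (\<lambda>_. c)"
  and smooth_add: "smooth_cube k \<alpha> \<Longrightarrow> smooth_cube k \<beta> \<Longrightarrow> smooth_cube k (\<lambda>xs. \<alpha> xs + \<beta> xs)"
  and smooth_diff: "smooth_cube k \<alpha> \<Longrightarrow> smooth_cube k \<beta> \<Longrightarrow> smooth_cube k (\<lambda>xs. \<alpha> xs - \<beta> xs)"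
  and smooth_mult: "smooth_cube k a \<Longrightarrow> smooth_cube k b \<Longrightarrow> smooth_cube k (\<lambda>xs. a xs * b xs :: real)"
  and smooth_nth: "i < k \<Longrightarrow> smooth_cube k (\<lambda>xs. xs ! i)"
  and smooth_step: "smooth_cube k a \<Longrightarrow> smooth_cube k (\<lambda>xs. step p q (a xs))"
  and smooth_bounded_linear: "bounded_linear f \<Longrightarrow> smooth_cube k \<alpha> \<Longrightarrow> smooth_cube k (\<lambda>xs. f (\<alpha> xs))"
  by (simp_all add: smooth_cube_Cn Cn_const Cn_add Cn_diff Cn_scaleR Cn_mult Cn_nth Cn_real Rn_step Cn_bounded_linear)

lemma smooth_comp:
  "smooth_cube l \<alpha> \<Longrightarrow> (\<And>j. j < l \<Longrightarrow> smooth_cube k (\<phi> j)) \<Longrightarrow>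
   (\<And>j xs. j < l \<Longrightarrow> xs \<in> cube k \<Longrightarrow> \<phi> j xs \<in> {0..1}) \<Longrightarrow>
   smooth_cube k (\<lambda>xs. \<alpha> (map (\<lambda>j. \<phi> j xs) [0..<l]))"
  unfolding smooth_cube_Cn using Cn_comp by blast

lemma pd_comp:
  assumes "smooth_cube l \<alpha>" "\<And>j. j < l \<Longrightarrow> smooth_cube k (\<phi> j)"
    "\<And>j xs. j < l \<Longrightarrow> xs \<in> cube k \<Longrightarrow> \<phi> j xs \<in> {0..1}" "i < k" "xs \<in> cube k"
  shows "pd i (\<lambda>xs. \<alpha> (map (\<lambda>j. \<phi> j xs) [0..<l])) xs =
    (\<Sum>j<l. pd i (\<phi> j) xs *\<^sub>R pd j \<alpha> (map (\<lambda>j. \<phi> j xs) [0..<l]))"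
  by (rule pd_eqI[OF pd_comp_has[OF smooth_diffc[OF assms(1)] smooth_contc[OF smooth_pd[OF assms(1)]]
      smooth_diffc[OF assms(2)] assms(3,4,5)] assms(5,4)])

lemma pd_add:
  assumes "smooth_cube k \<alpha>" "smooth_cube k \<beta>" "i < k" "xs \<in> cube k"
  shows "pd i (\<lambda>xs. \<alpha> xs + \<beta> xs) xs = pd i \<alpha> xs + pd i \<beta> xs"
  by (rule pd_eqI[OF has_vector_derivative_add[OF pd_has_derivative[OF smooth_diffc[OF assms(1)] assms(3,4)]
      pd_has_derivative[OF smooth_diffc[OF assms(2)] assms(3,4)]] assms(4,3)])

lemma pd_diff:
  assumes "smooth_cube k \<alpha>" "smooth_cube k \<beta>" "i < k" "xs \<in> cube k"
  shows "pd i (\<lambda>xs. \<alpha> xs - \<beta> xs) xs = pd i \<alpha> xs - pd i \<beta> xs"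
  by (rule pd_eqI[OF has_vector_derivative_diff[OF pd_has_derivative[OF smooth_diffc[OF assms(1)] assms(3,4)]
      pd_has_derivative[OF smooth_diffc[OF assms(2)] assms(3,4)]] assms(4,3)])

lemma pd_const:
  assumes "\<And>u. u \<in> {0..1} \<Longrightarrow> \<alpha> (xs[i := u]) = c" "xs \<in> cube k" "i < k"
  shows "pd i \<alpha> xs = 0"
proof (rule pd_eqI[OF _ assms(2,3)])
  show "((\<lambda>u. \<alpha> (xs[i := u])) has_vector_derivative 0) (at (xs ! i) within {0..1})"
    using has_vector_derivative_transform[OF cube_nth[OF assms(2,3)], of "\<lambda>u. \<alpha> (xs[i := u])" "\<lambda>_. c" 0] assms(1) by simp
qed

lemma pd_nth: "xs \<in> cube k \<Longrightarrow> i < k \<Longrightarrow> j < k \<Longrightarrow> pd i (\<lambda>xs. xs ! j) xs = (if i = j then 1 else 0)"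
  by (rule pd_eqI) (auto simp: cube_length)

lemma map_upt_3: "[\<phi> 0, \<phi> (Suc 0), \<phi> 2] = map \<phi> [0..<3]"
  and map_upt_2: "[\<phi> 0, \<phi> (Suc 0)] = map \<phi> [0..<2]"
  by (simp_all add: upt_rec numeral_3_eq_3 numeral_2_eq_2)

lemma smooth_comp3:
  assumes "smooth_cube 3 \<alpha>" "smooth_cube k a" "smooth_cube k b" "smooth_cube k c"
    "\<And>xs. xs \<in> cube k \<Longrightarrow> a xs \<in> {0..1} \<and> b xs \<in> {0..1} \<and> c xs \<in> {0..1}"
  shows "smooth_cube k (\<lambda>xs. \<alpha> [a xs, b xs, c xs])"
    and "i < k \<Longrightarrow> xs \<in> cube k \<Longrightarrow> pd i (\<lambda>xs. \<alpha> [a xs, b xs, c xs]) xs =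
      pd i a xs *\<^sub>R pd 0 \<alpha> [a xs, b xs, c xs] + pd i b xs *\<^sub>R pd 1 \<alpha> [a xs, b xs, c xs]
      + pd i c xs *\<^sub>R pd 2 \<alpha> [a xs, b xs, c xs]"
proof -
  let ?p = "\<lambda>j. if j = 0 then a else if j = 1 then b else c"
  have e: "map (\<lambda>j. ?p j xs) [0..<3] = [a xs, b xs, c xs]" for xs
    by (subst map_upt_3[symmetric]) simp
  show "smooth_cube k (\<lambda>xs. \<alpha> [a xs, b xs, c xs])"
    using smooth_comp[of 3 \<alpha> k ?p] assms by (simp add: e)
  show "i < k \<Longrightarrow> xs \<in> cube k \<Longrightarrow> pd i (\<lambda>xs. \<alpha> [a xs, b xs, c xs]) xs =
      pd i a xs *\<^sub>R pd 0 \<alpha> [a xs, b xs, c xs] + pd i b xs *\<^sub>R pd 1 \<alpha> [a xs, b xs, c xs]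
      + pd i c xs *\<^sub>R pd 2 \<alpha> [a xs, b xs, c xs]"
    using pd_comp[of 3 \<alpha> k ?p i xs] assms by (simp add: e numeral_3_eq_3 numeral_2_eq_2)
qed

lemma smooth_comp2:
  assumes "smooth_cube 2 \<alpha>" "smooth_cube k a" "smooth_cube k b"
    "\<And>xs. xs \<in> cube k \<Longrightarrow> a xs \<in> {0..1} \<and> b xs \<in> {0..1}"
  shows "smooth_cube k (\<lambda>xs. \<alpha> [a xs, b xs])"
    and "i < k \<Longrightarrow> xs \<in> cube k \<Longrightarrow> pd i (\<lambda>xs. \<alpha> [a xs, b xs]) xs =
      pd i a xs *\<^sub>R pd 0 \<alpha> [a xs, b xs] + pd i b xs *\<^sub>R pd 1 \<alpha> [a xs, b xs]"
proof -
  let ?p = "\<lambda>j. if j = 0 then a else b"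
  have e: "map (\<lambda>j. ?p j xs) [0..<2] = [a xs, b xs]" for xs
    by (subst map_upt_2[symmetric]) simp
  show "smooth_cube k (\<lambda>xs. \<alpha> [a xs, b xs])"
    using smooth_comp[of 2 \<alpha> k ?p] assms by (simp add: e)
  show "i < k \<Longrightarrow> xs \<in> cube k \<Longrightarrow> pd i (\<lambda>xs. \<alpha> [a xs, b xs]) xs =
      pd i a xs *\<^sub>R pd 0 \<alpha> [a xs, b xs] + pd i b xs *\<^sub>R pd 1 \<alpha> [a xs, b xs]"
    using pd_comp[of 2 \<alpha> k ?p i xs] assms by (simp add: e numeral_2_eq_2)
qed

lemma smooth_comp1:
  assumes "smooth_cube 1 \<alpha>" "smooth_cube k a" "\<And>xs. xs \<in> cube k \<Longrightarrow> a xs \<in> {0..1}"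
  shows "smooth_cube k (\<lambda>xs. \<alpha> [a xs])"
  using smooth_comp[of 1 \<alpha> k "\<lambda>_. a"] assms by simp

lemma smooth_update:
  assumes "smooth_cube k \<alpha>" "smooth_cube k a" "\<And>xs. xs \<in> cube k \<Longrightarrow> a xs \<in> {0..1}"
  shows "smooth_cube k (\<lambda>xs. \<alpha> (xs[i := a xs]))"
proof -
  let ?p = "\<lambda>j xs. if j = i then a xs else xs ! j"
  have "smooth_cube k (?p j)" if "j < k" for j
    using that assms(2) smooth_nth by (cases "j = i") auto
  then have "smooth_cube k (\<lambda>xs. \<alpha> (map (\<lambda>j. ?p j xs) [0..<k]))"
    by (intro smooth_comp assms(1)) (use assms(3) cube_nth in auto)
  moreover have "map (\<lambda>j. ?p j xs) [0..<k] = xs[i := a xs]" if "xs \<in> cube k" for xs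
    using that by (intro nth_equalityI) (auto simp: cube_length nth_list_update)
  ultimately show ?thesis by (elim smooth_cong[rotated]) (simp add: agree_def)
qed

section \<open>Linear dependence and collars\<close>

text \<open>Dependence of an indexed family, in contrast to \<open>dependent\<close> for sets: a
  repeated vector counts. This is what rank below \<open>k\<close> means for \<open>k\<close>
  partial derivatives.\<close>

definition dep :: "nat \<Rightarrow> (nat \<Rightarrow> 'v::real_vector) \<Rightarrow> bool" where
  "dep k V \<longleftrightarrow> (\<exists>c. (\<exists>i<k. c i \<noteq> 0) \<and> (\<Sum>i<k. c i *\<^sub>R V i) = 0)"

lemma depI: "i < k \<Longrightarrow> c i \<noteq> 0 \<Longrightarrow> (\<Sum>i<k. c i *\<^sub>R V i) = 0 \<Longrightarrow> dep k V"
  unfolding dep_def by blast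

lemma dep_dim:
  fixes V :: "nat \<Rightarrow> 'v::euclidean_space"
  shows "dim (V ` {..<k}) < k \<longleftrightarrow> dep k V"
proof
  assume a: "dim (V ` {..<k}) < k"
  show "dep k V"
  proof (cases "inj_on V {..<k}")
    case False
    then obtain i j where ij: "i < k" "j < k" "i \<noteq> j" "V i = V j" by (auto simp: inj_on_def)
    let ?c = "\<lambda>l. if l = i then 1 else if l = j then - 1 else 0 :: real"
    have "(\<Sum>l<k. ?c l *\<^sub>R V l) = (\<Sum>l\<in>{i, j}. ?c l *\<^sub>R V l)"
      using ij by (intro sum.mono_neutral_right) auto
    also have "\<dots> = 0" using ij by simp
    finally show ?thesis using ij by (intro depI[of i _ ?c]) auto
  next
    case True
    have "card (V ` {..<k}) = k" using card_image[OF True] by simp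
    then have "dependent (V ` {..<k})"
      using a dim_eq_card_independent[of "V ` {..<k}"] by auto
    then obtain u where u: "\<exists>v\<in>V ` {..<k}. u v \<noteq> 0" "(\<Sum>v\<in>V ` {..<k}. u v *\<^sub>R v) = 0"
      using real_vector.dependent_finite[of "V ` {..<k}"] by auto
    have "(\<Sum>i<k. u (V i) *\<^sub>R V i) = 0" using u(2) by (simp add: sum.reindex[OF True])
    with u(1) show ?thesis unfolding dep_def by (intro exI[of _ "\<lambda>i. u (V i)"]) auto
  qed
next
  assume "dep k V"
  then obtain c i where c: "i < k" "c i \<noteq> 0" "(\<Sum>i<k. c i *\<^sub>R V i) = 0" unfolding dep_def by blast
  let ?S = "V ` ({..<k} - {i})"
  have "c i *\<^sub>R V i = - (\<Sum>l\<in>{..<k} - {i}. c l *\<^sub>R V l)"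
    using c(1,3) by (simp add: sum.remove[of "{..<k}" i] eq_neg_iff_add_eq_0)
  also have "\<dots> \<in> span ?S" by (intro span_neg span_sum span_scale span_base) auto
  finally have "V i \<in> span ?S"
    using span_scale[of _ ?S "1 / c i"] c(2) by fastforce
  then have "span (V ` {..<k}) = span ?S"
    using c(1) span_redundant[of "V i" ?S] by (metis image_insert insert_Diff lessThan_iff)
  then have "dim (V ` {..<k}) = dim ?S" by (metis dim_span)
  also have "\<dots> \<le> card ?S" by (rule dim_le_card') simp
  also have "\<dots> \<le> card ({..<k} - {i})" by (rule card_image_le) simp
  finally show "dim (V ` {..<k}) < k" using c(1) by simp
qed

lemma low_rank_iff: "low_rank k \<alpha> \<longleftrightarrow> (\<forall>xs\<in>cube k. dep k (\<lambda>i. pd i \<alpha> xs))"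
  unfolding low_rank_def dep_dim ..

lemma dep_zero: "i < k \<Longrightarrow> V i = 0 \<Longrightarrow> dep k V"
  by (rule depI[of i k "\<lambda>j. if j = i then 1 else 0"]) (auto intro!: sum.neutral)

lemma dep_pair:
  assumes "i < k" "j < k" "i \<noteq> j" "a *\<^sub>R V i + b *\<^sub>R V j = 0" "(a, b) \<noteq> (0, 0)"
  shows "dep k V"
proof -
  let ?c = "\<lambda>l. if l = i then a else if l = j then b else 0"
  have "(\<Sum>l<k. ?c l *\<^sub>R V l) = (\<Sum>l\<in>{i, j}. ?c l *\<^sub>R V l)"
    using assms by (intro sum.mono_neutral_right) auto
  then have "(\<Sum>l<k. ?c l *\<^sub>R V l) = 0" using assms by simp
  then show ?thesis using assms depI[of i k ?c V] depI[of j k ?c V] by auto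
qed

lemma dep_collinear:
  assumes "i < k" "j < k" "i \<noteq> j" "V i = x *\<^sub>R v" "V j = y *\<^sub>R v"
  shows "dep k V"
proof (cases "x = 0")
  case True then show ?thesis using assms dep_zero[of i k V] by simp
next
  case False
  then show ?thesis using assms dep_pair[of i k j y V "- x"] by simp
qed

text \<open>Reparametrizing one coordinate multiplies one partial derivative by a scalar. If the
  scalar is 0, dependence is trivial; otherwise one coefficient of the relation is divided by
  it.\<close>

lemma dep_scale:
  assumes "dep k V" "i < k" "V' i = m *\<^sub>R V i" "\<And>j. j < k \<Longrightarrow> j \<noteq> i \<Longrightarrow> V' j = V j"
  shows "dep k V'"
proof (cases "m = 0")
  case True then show ?thesis using assms dep_zero[of i k V'] by simp
next
  case False
  from assms(1) obtain c j where c: "j < k" "c j \<noteq> 0" "(\<Sum>i<k. c i *\<^sub>R V i) = 0" unfolding dep_def by blast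
  have "(\<Sum>l<k. (if l = i then c l / m else c l) *\<^sub>R V' l) = (\<Sum>i<k. c i *\<^sub>R V i)"
    using False assms by (intro sum.cong) auto
  then show ?thesis using c False by (intro depI[of j k "\<lambda>l. if l = i then c l / m else c l"]) auto
qed

lemma cube4E:
  assumes "xs \<in> cube 4"
  obtains q r s t where "xs = [q, r, s, t]" "q \<in> {0..1}" "r \<in> {0..1}" "s \<in> {0..1}" "t \<in> {0..1}"
proof -
  have "length xs = Suc (Suc (Suc (Suc 0)))" using assms by (simp add: cube_def)
  then show ?thesis using that assms by (auto simp: cube_def length_Suc_conv)
qed

lemma cube3E:
  assumes "xs \<in> cube 3"
  obtains r s t where "xs = [r, s, t]" "r \<in> {0..1}" "s \<in> {0..1}" "t \<in> {0..1}"
proof -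
  have "length xs = Suc (Suc (Suc 0))" using assms by (simp add: cube_def)
  then show ?thesis using that assms by (auto simp: cube_def length_Suc_conv)
qed

lemma cube2E:
  assumes "xs \<in> cube 2"
  obtains s t where "xs = [s, t]" "s \<in> {0..1}" "t \<in> {0..1}"
proof -
  have "length xs = Suc (Suc 0)" using assms by (simp add: cube_def)
  then show ?thesis using that assms by (auto simp: cube_def length_Suc_conv)
qed

lemma cube1E:
  assumes "xs \<in> cube 1"
  obtains t where "xs = [t]" "t \<in> {0..1}"
proof -
  have "length xs = Suc 0" using assms by (simp add: cube_def)
  then show ?thesis using that assms by (auto simp: cube_def length_Suc_conv)
qed

lemma cube_lit: "[t] \<in> cube 1 \<longleftrightarrow> t \<in> {0..1}" "[s, t] \<in> cube 2 \<longleftrightarrow> s \<in> {0..1} \<and> t \<in> {0..1}"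
  "[r, s, t] \<in> cube 3 \<longleftrightarrow> r \<in> {0..1} \<and> s \<in> {0..1} \<and> t \<in> {0..1}"
  "[q, r, s, t] \<in> cube 4 \<longleftrightarrow> q \<in> {0..1} \<and> r \<in> {0..1} \<and> s \<in> {0..1} \<and> t \<in> {0..1}"
  by (auto simp: cube_def)

text \<open>Each alternative of lamination makes two of the three partial derivatives dependent at
  every point.\<close>

lemma laminated_low_rank:
  assumes "laminated \<alpha>" shows "low_rank 3 \<alpha>"
  unfolding low_rank_iff
proof
  fix xs :: "real list" assume "xs \<in> cube 3"
  then obtain r s t where xs: "xs = [r, s, t]" and r: "r \<in> {0..1}" "s \<in> {0..1}" "t \<in> {0..1}"
    by (rule cube3E)
  let ?V = "\<lambda>i. pd i \<alpha> [r, s, t]"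
  have "\<exists>i j a b. i < 3 \<and> j < 3 \<and> i \<noteq> j \<and> (a, b) \<noteq> (0, 0) \<and> a *\<^sub>R ?V i + b *\<^sub>R ?V j = 0"
    using assms[unfolded laminated_def, rule_format, OF r(1,2)]
  proof (elim disjE)
    assume "\<forall>t\<in>{0..1}. \<exists>a b. (a, b) \<noteq> (0, 0) \<and> a *\<^sub>R pd 0 \<alpha> [r, s, t] + b *\<^sub>R pd 2 \<alpha> [r, s, t] = 0"
    from bspec[OF this r(3)] show ?thesis by - (rule exI[of _ 0], rule exI[of _ 2], simp)
  next
    assume "\<forall>t\<in>{0..1}. \<exists>a b. (a, b) \<noteq> (0, 0) \<and> a *\<^sub>R pd 1 \<alpha> [r, s, t] + b *\<^sub>R pd 2 \<alpha> [r, s, t] = 0"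
    from bspec[OF this r(3)] show ?thesis by - (rule exI[of _ 1], rule exI[of _ 2], simp)
  next
    assume "\<exists>a b. (a, b) \<noteq> (0, 0) \<and> (\<forall>t\<in>{0..1}. a *\<^sub>R pd 0 \<alpha> [r, s, t] + b *\<^sub>R pd 1 \<alpha> [r, s, t] = 0)"
    then obtain a b where "(a, b) \<noteq> (0, 0)" "a *\<^sub>R ?V 0 + b *\<^sub>R ?V 1 = 0" using r(3) by blast
    then show ?thesis by - (rule exI[of _ 0], rule exI[of _ 1], rule exI[of _ a], rule exI[of _ b], simp)
  qed
  then show "dep 3 (\<lambda>i. pd i \<alpha> xs)"
    unfolding xs using dep_pair by metis
qed

section \<open>Collars of explicit width and coordinate changes that respect them\<close>

definition ecollared :: "real \<Rightarrow> nat \<Rightarrow> 'v path \<Rightarrow> bool" where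
  "ecollared \<epsilon> k \<alpha> \<longleftrightarrow> (\<forall>i<k. \<forall>xs\<in>cube k. \<forall>u\<in>{0..1}. \<forall>v\<in>{0..1}.
     (u \<le> \<epsilon> \<and> v \<le> \<epsilon> \<or> u \<ge> 1 - \<epsilon> \<and> v \<ge> 1 - \<epsilon>) \<longrightarrow> \<alpha> (xs[i := u]) = \<alpha> (xs[i := v]))"

lemma collared_iff: "collared k \<alpha> \<longleftrightarrow> (\<exists>\<epsilon>>0. ecollared \<epsilon> k \<alpha>)"
  by (simp add: collared_def ecollared_def)

lemma ecollared_mono: "ecollared \<epsilon> k \<alpha> \<Longrightarrow> \<delta> \<le> \<epsilon> \<Longrightarrow> ecollared \<delta> k \<alpha>"
  unfolding ecollared_def by (smt (verit, best))

lemma collared_obtain: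
  assumes "collared k \<alpha>" "collared l \<beta>"
  obtains \<epsilon> where "0 < \<epsilon>" "\<epsilon> < 1 / 4" "ecollared \<epsilon> k \<alpha>" "ecollared \<epsilon> l \<beta>"
proof -
  from assms obtain a b where ab: "a > 0" "b > 0" "ecollared a k \<alpha>" "ecollared b l \<beta>" by (auto simp: collared_iff)
  let ?e = "min (min a b) (1 / 8)"
  show ?thesis
    by (rule that[of ?e]) (use ab in \<open>auto intro: ecollared_mono\<close>)
qed

text \<open>The pairs of values of one coordinate that a map with collars of width \<epsilon> cannot
  distinguish.\<close>

definition near :: "real \<Rightarrow> real \<Rightarrow> real \<Rightarrow> bool" where
  "near \<epsilon> u v \<longleftrightarrow> u = v \<or> u \<le> \<epsilon> \<and> v \<le> \<epsilon> \<or> u \<ge> 1 - \<epsilon> \<and> v \<ge> 1 - \<epsilon>"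

text \<open>A collar lets a single coordinate move, so the coordinates are exchanged one at a time,
  through the intermediate points \<open>z m\<close>.\<close>

lemma ecollared_near:
  assumes "ecollared \<epsilon> k \<alpha>" "xs \<in> cube k" "ys \<in> cube k" "\<And>j. j < k \<Longrightarrow> near \<epsilon> (xs ! j) (ys ! j)"
  shows "\<alpha> xs = \<alpha> ys"
proof -
  define z where "z m = map (\<lambda>j. if j < m then ys ! j else xs ! j) [0..<k]" for m
  have zc: "z m \<in> cube k" for m
    unfolding z_def by (rule cube_map) (use assms cube_nth in metis)
  have "\<alpha> xs = \<alpha> (z m)" if "m \<le> k" for m
    using that
  proof (induction m)
    case 0 show ?case using cube_map_nth[OF assms(2)] by (simp add: z_def)
  next
    case (Suc m)
    then have m: "m < k" by simp
    have 1: "z m = (z m)[m := xs ! m]" "z (Suc m) = (z m)[m := ys ! m]"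
      by (auto simp: z_def nth_list_update less_Suc_eq intro!: nth_equalityI)
    have "\<alpha> ((z m)[m := xs ! m]) = \<alpha> ((z m)[m := ys ! m])"
      using assms(1) m zc[of m] cube_nth[OF assms(2) m] cube_nth[OF assms(3) m] assms(4)[OF m]
      unfolding ecollared_def near_def by metis
    then show ?case using Suc 1 by simp
  qed
  from this[of k] have "\<alpha> xs = \<alpha> (z k)" by simp
  also have "z k = map ((!) ys) [0..<k]" by (simp add: z_def)
  finally show ?thesis using cube_map_nth[OF assms(3)] by simp
qed

text \<open>The condition on coordinate functions under which the composite with a collared map is
  collared. Collared functions satisfy it, and so do the coordinates themselves, which are not
  collared.\<close>

definition tame :: "nat \<Rightarrow> real path \<Rightarrow> bool" where
  "tame k \<phi> \<longleftrightarrow> (\<forall>\<epsilon>>0. \<exists>\<delta>>0. \<forall>i<k. \<forall>xs\<in>cube k. \<forall>u\<in>{0..1}. \<forall>v\<in>{0..1}.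
     (u \<le> \<delta> \<and> v \<le> \<delta> \<or> u \<ge> 1 - \<delta> \<and> v \<ge> 1 - \<delta>) \<longrightarrow> near \<epsilon> (\<phi> (xs[i := u])) (\<phi> (xs[i := v])))"

lemma tame_collared: "collared k \<phi> \<Longrightarrow> tame k \<phi>"
  unfolding tame_def collared_def near_def by blast

lemma tame_nth: "j < k \<Longrightarrow> tame k (\<lambda>xs. xs ! j)"
  unfolding tame_def
proof (intro allI impI)
  fix \<epsilon> :: real assume "\<epsilon> > 0" "j < k"
  then show "\<exists>\<delta>>0. \<forall>i<k. \<forall>xs\<in>cube k. \<forall>u\<in>{0..1}. \<forall>v\<in>{0..1}.
     (u \<le> \<delta> \<and> v \<le> \<delta> \<or> u \<ge> 1 - \<delta> \<and> v \<ge> 1 - \<delta>) \<longrightarrow> near \<epsilon> (xs[i := u] ! j) (xs[i := v] ! j)"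
    by (intro exI[of _ \<epsilon>]) (auto simp: near_def nth_list_update cube_length)
qed

lemma collared_const: "collared k (\<lambda>_. c)"
  unfolding collared_def by (auto intro: exI[of _ 1])

lemma collared_comb:
  assumes "collared k \<alpha>" "collared k \<beta>" shows "collared k (\<lambda>xs. F (\<alpha> xs) (\<beta> xs))"
proof -
  from collared_obtain[OF assms] obtain \<epsilon> where "0 < \<epsilon>" "ecollared \<epsilon> k \<alpha>" "ecollared \<epsilon> k \<beta>" by metis
  then show ?thesis unfolding collared_def ecollared_def by (intro exI[of _ \<epsilon>]) metis
qed

lemma collared_step:
  assumes "0 < p" "p < q" "q < 1" "j < k"
  shows "collared k (\<lambda>xs. step p q (xs ! j))"
proof -
  let ?e = "min p (1 - q)"
  have "step p q u = step p q v" if "u \<le> ?e \<and> v \<le> ?e \<or> 1 - ?e \<le> u \<and> 1 - ?e \<le> v" for u v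
  proof -
    have "u \<le> p \<and> v \<le> p \<or> q \<le> u \<and> q \<le> v" using that by linarith
    then show ?thesis using assms step_eq0[of p q] step_eq1[of p q] by metis
  qed
  moreover have "?e > 0" using assms by simp
  ultimately show ?thesis unfolding collared_def using assms(4)
    by (intro exI[of _ ?e]) (simp add: nth_list_update cube_length)
qed

text \<open>The width is the minimum over the finitely many coordinate functions; the 1 inserted in
  \<open>\<delta>\<close> covers \<open>l = 0\<close>.\<close>

lemma collared_comp:
  assumes "collared l \<alpha>" "\<And>j. j < l \<Longrightarrow> tame k (\<phi> j)"
    "\<And>j xs. j < l \<Longrightarrow> xs \<in> cube k \<Longrightarrow> \<phi> j xs \<in> {0..1}"
  shows "collared k (\<lambda>xs. \<alpha> (map (\<lambda>j. \<phi> j xs) [0..<l]))"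
proof -
  from assms(1) obtain \<epsilon> where \<epsilon>: "\<epsilon> > 0" "ecollared \<epsilon> l \<alpha>" by (auto simp: collared_iff)
  have "\<exists>\<delta>>0. \<forall>i<k. \<forall>xs\<in>cube k. \<forall>u\<in>{0..1}. \<forall>v\<in>{0..1}.
     (u \<le> \<delta> \<and> v \<le> \<delta> \<or> u \<ge> 1 - \<delta> \<and> v \<ge> 1 - \<delta>) \<longrightarrow> near \<epsilon> (\<phi> j (xs[i := u])) (\<phi> j (xs[i := v]))" if "j < l" for j
    using assms(2)[OF that] \<epsilon>(1) unfolding tame_def by blast
  then obtain d where d: "\<And>j. j < l \<Longrightarrow> d j > 0" "\<And>j i xs u v. j < l \<Longrightarrow> i < k \<Longrightarrow> xs \<in> cube k \<Longrightarrow> u \<in> {0..1} \<Longrightarrow> v \<in> {0..1} \<Longrightarrow>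
     (u \<le> d j \<and> v \<le> d j \<or> u \<ge> 1 - d j \<and> v \<ge> 1 - d j) \<Longrightarrow> near \<epsilon> (\<phi> j (xs[i := u])) (\<phi> j (xs[i := v]))"
    by metis
  define \<delta> where "\<delta> = Min (insert 1 (d ` {..<l}))"
  have \<delta>: "\<delta> > 0" "\<And>j. j < l \<Longrightarrow> \<delta> \<le> d j" using d(1) by (auto simp: \<delta>_def)
  show ?thesis unfolding collared_iff
  proof (intro exI[of _ \<delta>] conjI \<delta>(1))
    show "ecollared \<delta> k (\<lambda>xs. \<alpha> (map (\<lambda>j. \<phi> j xs) [0..<l]))"
      unfolding ecollared_def
    proof (intro allI impI ballI)
      fix i xs and u v :: real
      assume i: "i < k" and xs: "xs \<in> cube k" and uv: "u \<in> {0..1}" "v \<in> {0..1}"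
        and n: "u \<le> \<delta> \<and> v \<le> \<delta> \<or> 1 - \<delta> \<le> u \<and> 1 - \<delta> \<le> v"
      show "\<alpha> (map (\<lambda>j. \<phi> j (xs[i := u])) [0..<l]) = \<alpha> (map (\<lambda>j. \<phi> j (xs[i := v])) [0..<l])"
      proof (rule ecollared_near[OF \<epsilon>(2)])
        show "map (\<lambda>j. \<phi> j (xs[i := u])) [0..<l] \<in> cube l" "map (\<lambda>j. \<phi> j (xs[i := v])) [0..<l] \<in> cube l"
          using assms(3) cube_update[OF xs] uv by (auto intro!: cube_map)
        fix j assume j: "j < l"
        have "u \<le> d j \<and> v \<le> d j \<or> u \<ge> 1 - d j \<and> v \<ge> 1 - d j" using n \<delta>(2)[OF j] by linarith
        from d(2)[OF j i xs uv this] j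
        show "near \<epsilon> (map (\<lambda>j. \<phi> j (xs[i := u])) [0..<l] ! j) (map (\<lambda>j. \<phi> j (xs[i := v])) [0..<l] ! j)" by simp
      qed
    qed
  qed
qed

lemma collared_comp3:
  assumes "collared 3 \<alpha>" "tame k a" "tame k b" "tame k c"
    "\<And>xs. xs \<in> cube k \<Longrightarrow> a xs \<in> {0..1} \<and> b xs \<in> {0..1} \<and> c xs \<in> {0..1}"
  shows "collared k (\<lambda>xs. \<alpha> [a xs, b xs, c xs])"
proof -
  let ?p = "\<lambda>j. if j = 0 then a else if j = 1 then b else c"
  have e: "map (\<lambda>j. ?p j xs) [0..<3] = [a xs, b xs, c xs]" for xs
    by (subst map_upt_3[symmetric]) simp
  show ?thesis using collared_comp[of 3 \<alpha> k ?p] assms by (simp add: e)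
qed

lemma collared_comp2:
  assumes "collared 2 \<alpha>" "tame k a" "tame k b"
    "\<And>xs. xs \<in> cube k \<Longrightarrow> a xs \<in> {0..1} \<and> b xs \<in> {0..1}"
  shows "collared k (\<lambda>xs. \<alpha> [a xs, b xs])"
proof -
  let ?p = "\<lambda>j. if j = 0 then a else b"
  have e: "map (\<lambda>j. ?p j xs) [0..<2] = [a xs, b xs]" for xs
    by (subst map_upt_2[symmetric]) simp
  show ?thesis using collared_comp[of 2 \<alpha> k ?p] assms by (simp add: e)
qed

lemma kpathI:
  assumes "smooth_cube k \<alpha>" "\<And>xs. xs \<in> cube k \<Longrightarrow> \<alpha> xs \<in> M" "collared k \<alpha>"
    "\<And>xs ys. xs \<in> cube k \<Longrightarrow> ys \<in> cube k \<Longrightarrow> last xs = last ys \<Longrightarrow> last xs \<in> {0, 1} \<Longrightarrow> \<alpha> xs = \<alpha> ys"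
  shows "kpath M k \<alpha>"
proof -
  have "\<alpha> xs = \<alpha> ys" if "c \<in> {0, 1}" "xs \<in> cube k" "ys \<in> cube k" "last xs = c \<and> last ys = c" for c xs ys
    by (rule assms(4)) (use that in simp_all)
  then show ?thesis unfolding kpath_def using assms(1-3) by blast
qed

lemma kpathD:
  assumes "kpath M k \<alpha>"
  shows "smooth_cube k \<alpha>" "\<And>xs. xs \<in> cube k \<Longrightarrow> \<alpha> xs \<in> M" "collared k \<alpha>"
    "\<And>xs ys. xs \<in> cube k \<Longrightarrow> ys \<in> cube k \<Longrightarrow> last xs = last ys \<Longrightarrow> last xs \<in> {0, 1} \<Longrightarrow> \<alpha> xs = \<alpha> ys"
proof -
  show "smooth_cube k \<alpha>" "collared k \<alpha>" "\<And>xs. xs \<in> cube k \<Longrightarrow> \<alpha> xs \<in> M"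
    using assms unfolding kpath_def by blast+
  fix xs ys assume "xs \<in> cube k" "ys \<in> cube k" "last xs = last ys" "last xs \<in> {0, 1}"
  then show "\<alpha> xs = \<alpha> ys" using assms unfolding kpath_def by metis
qed

text \<open>The last coordinate has to be preserved, because a k-path is constant on each of the two
  faces of that coordinate.\<close>

lemma kpath_comp:
  assumes "kpath M l \<alpha>" "0 < l" "0 < k" "\<And>j. j < l \<Longrightarrow> smooth_cube k (\<phi> j)" "\<And>j. j < l \<Longrightarrow> tame k (\<phi> j)"
    "\<And>j xs. j < l \<Longrightarrow> xs \<in> cube k \<Longrightarrow> \<phi> j xs \<in> {0..1}"
    "\<And>xs. xs \<in> cube k \<Longrightarrow> \<phi> (l - 1) xs = last xs"
  shows "kpath M k (\<lambda>xs. \<alpha> (map (\<lambda>j. \<phi> j xs) [0..<l]))"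
proof (rule kpathI)
  note c = cube_map[of l "\<lambda>j. \<phi> j _", OF assms(6)]
  show "smooth_cube k (\<lambda>xs. \<alpha> (map (\<lambda>j. \<phi> j xs) [0..<l]))"
    by (rule smooth_comp[OF kpathD(1)[OF assms(1)] assms(4,6)])
  show "collared k (\<lambda>xs. \<alpha> (map (\<lambda>j. \<phi> j xs) [0..<l]))"
    by (rule collared_comp[OF kpathD(3)[OF assms(1)] assms(5,6)])
  show "\<alpha> (map (\<lambda>j. \<phi> j xs) [0..<l]) \<in> M" if "xs \<in> cube k" for xs
    by (rule kpathD(2)[OF assms(1) c[OF _ that]])
  have l: "last (map (\<lambda>j. \<phi> j xs) [0..<l]) = last xs" if "xs \<in> cube k" for xs
    using assms(2) assms(7)[OF that] by (simp add: last_map)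
  fix xs ys assume a: "xs \<in> cube k" "ys \<in> cube k" "last xs = last ys" "last xs \<in> {0, 1}"
  show "\<alpha> (map (\<lambda>j. \<phi> j xs) [0..<l]) = \<alpha> (map (\<lambda>j. \<phi> j ys) [0..<l])"
    by (rule kpathD(4)[OF assms(1) c[OF _ a(1)] c[OF _ a(2)]]) (use l a in auto)
qed

lemma kpath_cong: "agree k \<alpha> \<beta> \<Longrightarrow> kpath M k \<alpha> \<Longrightarrow> kpath M k \<beta>"
proof -
  assume a: "agree k \<alpha> \<beta>" "kpath M k \<alpha>"
  have "collared k \<beta>" using kpathD(3)[OF a(2)] a(1) cube_update unfolding collared_def agree_def by metis
  then show ?thesis
    using a(1) kpathD(2,4)[OF a(2)] unfolding agree_def
    by (intro kpathI smooth_cong[OF a(1) kpathD(1)[OF a(2)]]) metis+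
qed

lemma last_cube: "xs \<in> cube k \<Longrightarrow> 0 < k \<Longrightarrow> last xs = xs ! (k - 1)"
  by (metis cube_length last_conv_nth length_greater_0_conv)

lemma kpath_tl:
  assumes "kpath M k g" "0 < k" shows "kpath M (Suc k) (\<lambda>xs. g (tl xs))"
proof (rule kpath_cong)
  show "kpath M (Suc k) (\<lambda>xs. g (map (\<lambda>j. xs ! Suc j) [0..<k]))"
    using assms by (intro kpath_comp) (auto simp: last_cube intro!: smooth_nth tame_nth dest: cube_nth)
  have "map (\<lambda>j. xs ! Suc j) [0..<k] = tl xs" if "xs \<in> cube (Suc k)" for xs
    using that by (intro nth_equalityI) (auto simp: cube_length nth_tl)
  then show "agree (Suc k) (\<lambda>xs. g (map (\<lambda>j. xs ! Suc j) [0..<k])) (\<lambda>xs. g (tl xs))"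
    by (simp add: agree_def)
qed

lemma kpath_spread:
  assumes "kpath M 1 \<gamma>" "0 < k" shows "kpath M k (spread \<gamma>)"
proof (rule kpath_cong)
  show "kpath M k (\<lambda>xs. \<gamma> (map (\<lambda>j. xs ! (k - 1)) [0..<1]))"
    using assms by (intro kpath_comp) (auto simp: last_cube intro!: smooth_nth tame_nth dest: cube_nth[of _ k "k - 1"])
  show "agree k (\<lambda>xs. \<gamma> (map (\<lambda>j. xs ! (k - 1)) [0..<1])) (spread \<gamma>)"
    using assms by (simp add: agree_def spread_def last_cube)
qed

text \<open>With \<open>i < k\<close> the last coordinate of the face is still the last coordinate
  of \<open>W\<close>, so constancy at its two ends is inherited.\<close>

lemma kpath_face:
  assumes "kpath M (Suc k) W" "i < k" "c \<in> {0..1}"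
  shows "kpath M k (face i c W)"
proof (rule kpath_cong)
  let ?p = "\<lambda>j xs. if j < i then xs ! j else if j = i then c else xs ! (j - 1)"
  have s: "smooth_cube k (?p j)" "tame k (?p j)" if "j < Suc k" for j
    using that assms(2) smooth_nth[of j k] smooth_nth[of "j - 1" k] tame_nth[of j k] tame_nth[of "j - 1" k]
      smooth_const tame_collared[OF collared_const]
    by (cases "j < i"; cases "j = i"; force)+
  show "kpath M k (\<lambda>xs. W (map (\<lambda>j. ?p j xs) [0..<Suc k]))"
  proof (intro kpath_comp assms(1) s)
    fix j xs assume j: "j < Suc k" and xs: "xs \<in> cube k"
    show "?p j xs \<in> {0..1}" using cube_nth[OF xs, of j] cube_nth[OF xs, of "j - 1"] j assms(2,3) by auto
  qed (use assms(2) in \<open>auto simp: last_cube\<close>)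
  have "map (\<lambda>j. ?p j xs) [0..<Suc k] = take i xs @ c # drop i xs" if "xs \<in> cube k" for xs
    using that assms(2) by (intro nth_equalityI) (auto simp: cube_length nth_append nth_Cons' simp del: upt_Suc)
  then show "agree k (\<lambda>xs. W (map (\<lambda>j. ?p j xs) [0..<Suc k])) (face i c W)"
    by (simp add: agree_def face_def)
qed

lemma pd_face:
  assumes "length xs = k" "i \<le> k" "j < k"
  shows "pd j (face i c W) xs = pd (if j < i then j else Suc j) W (take i xs @ c # drop i xs)"
proof (cases "j < i")
  case True
  have "(take i xs @ c # drop i xs)[j := u] = take i (xs[j := u]) @ c # drop i (xs[j := u])" for u
    using True assms by (simp add: list_update_append take_update_swap drop_update_cancel)
  then show ?thesis using True assms by (simp add: pd_def face_def nth_append)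
next
  case False
  have "(take i xs @ c # drop i xs)[Suc j := u] = take i (xs[j := u]) @ c # drop i (xs[j := u])" for u
    using False assms by (simp add: list_update_append drop_update_swap Suc_diff_le)
  then show ?thesis using False assms by (simp add: pd_def face_def nth_append Suc_diff_le)
qed

lemma pd_tl_0: "xs \<in> cube (Suc k) \<Longrightarrow> pd 0 (\<lambda>xs. g (tl xs)) xs = 0"
  by (rule pd_const[where c="g (tl xs)" and k="Suc k"]) (cases xs; simp)+

section \<open>Reparametrization and concatenation\<close>

lemma cube_lit1: "[t] \<in> cube (Suc 0) \<longleftrightarrow> t \<in> {0..1}"
  by (auto simp: cube_def)

lemma pd_update_other:
  assumes "i \<noteq> j" "length xs = k" "i < k"
  shows "pd i (\<lambda>xs. \<alpha> (xs[j := a (xs ! j)])) xs = pd i \<alpha> (xs[j := a (xs ! j)])"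
  using assms by (simp add: pd_def list_update_swap[of i j])

lemma pd_update_same:
  assumes "diffc k \<alpha>" "j < k" "xs \<in> cube k" "\<And>u. u \<in> {0..1} \<Longrightarrow> a u \<in> {0..1}"
    and "(a has_real_derivative a') (at (xs ! j) within {0..1})"
  shows "pd j (\<lambda>xs. \<alpha> (xs[j := a (xs ! j)])) xs = a' *\<^sub>R pd j \<alpha> (xs[j := a (xs ! j)])"
proof (rule pd_eqI[OF _ assms(3,2)])
  let ?x = "xs ! j"
  have x: "?x \<in> {0..1}" using cube_nth assms(2,3) by blast
  have "((\<lambda>u. \<alpha> (xs[j := u])) has_vector_derivative pd j \<alpha> (xs[j := a ?x])) (at (a ?x) within a ` {0..1})"
    using pd_has_derivative_at[OF assms(1-3) assms(4)[OF x]]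
    by (rule has_vector_derivative_within_subset) (use assms(4) in blast)
  from vector_diff_chain_within[OF assms(5)[unfolded has_real_derivative_iff_has_vector_derivative] this]
  have "((\<lambda>u. \<alpha> (xs[j := a u])) has_vector_derivative a' *\<^sub>R pd j \<alpha> (xs[j := a ?x])) (at ?x within {0..1})"
    by (simp add: o_def)
  then show "((\<lambda>u. \<alpha> ((xs[j := u])[j := a ((xs[j := u]) ! j)])) has_vector_derivative
      a' *\<^sub>R pd j \<alpha> (xs[j := a ?x])) (at ?x within {0..1})"
    using assms(2,3) by (simp add: cube_length)
qed

lemma pd_reparam:
  assumes "smooth_cube k \<alpha>" "j < k" "smooth_cube 1 (\<lambda>xs. a (xs ! 0))" "\<And>u. u \<in> {0..1} \<Longrightarrow> a u \<in> {0..1}"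
    "xs \<in> cube k"
  shows "\<exists>m. pd j (\<lambda>xs. \<alpha> (xs[j := a (xs ! j)])) xs = m *\<^sub>R pd j \<alpha> (xs[j := a (xs ! j)])"
proof -
  have x: "[xs ! j] \<in> cube 1" using cube_nth[OF assms(5,2)] by (simp add: cube_lit1)
  have "(a has_real_derivative pd 0 (\<lambda>xs. a (xs ! 0)) [xs ! j]) (at (xs ! j) within {0..1})"
    using pd_has_derivative[OF smooth_diffc[OF assms(3)] _ x, of 0]
    by (simp add: has_real_derivative_iff_has_vector_derivative)
  from pd_update_same[OF smooth_diffc[OF assms(1)] assms(2,5,4) this] show ?thesis by blast
qed

lemma kpath_reparam:
  assumes "kpath M k \<alpha>" "j < k - 1" "smooth_cube 1 (\<lambda>xs. a (xs ! 0))" "tame 1 (\<lambda>xs. a (xs ! 0))"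
    "\<And>u. u \<in> {0..1} \<Longrightarrow> a u \<in> {0..1}"
  shows "kpath M k (\<lambda>xs. \<alpha> (xs[j := a (xs ! j)]))"
proof (rule kpath_cong)
  have j: "j < k" using assms(2) by simp
  let ?p = "\<lambda>l xs. if l = j then a (xs ! j) else xs ! l"
  have s: "smooth_cube k (\<lambda>xs. a (xs ! j))"
    using smooth_comp1[OF assms(3) smooth_nth[OF j]] cube_nth[OF _ j] by simp
  have t: "tame k (\<lambda>xs. a (xs ! j))" unfolding tame_def
  proof (intro allI impI)
    fix \<epsilon> :: real assume "\<epsilon> > 0"
    then obtain \<delta> where \<delta>: "\<delta> > 0" and d: "\<And>xs u v. xs \<in> cube 1 \<Longrightarrow> u \<in> {0..1} \<Longrightarrow> v \<in> {0..1} \<Longrightarrow>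
      u \<le> \<delta> \<and> v \<le> \<delta> \<or> u \<ge> 1 - \<delta> \<and> v \<ge> 1 - \<delta> \<Longrightarrow> near \<epsilon> (a (xs[0 := u] ! 0)) (a (xs[0 := v] ! 0))"
      using assms(4) unfolding tame_def by (metis less_one)
    have d': "near \<epsilon> (a u) (a v)" if "u \<in> {0..1}" "v \<in> {0..1}" "u \<le> \<delta> \<and> v \<le> \<delta> \<or> u \<ge> 1 - \<delta> \<and> v \<ge> 1 - \<delta>" for u v
      using d[of "[0]" u v] that by (simp add: cube_lit1)
    show "\<exists>\<delta>>0. \<forall>i<k. \<forall>xs\<in>cube k. \<forall>u\<in>{0..1}. \<forall>v\<in>{0..1}.
     (u \<le> \<delta> \<and> v \<le> \<delta> \<or> u \<ge> 1 - \<delta> \<and> v \<ge> 1 - \<delta>) \<longrightarrow> near \<epsilon> (a (xs[i := u] ! j)) (a (xs[i := v] ! j))"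
    proof (intro exI[of _ \<delta>] conjI \<delta> allI impI ballI)
      fix i xs and u v :: real
      assume "i < k" "xs \<in> cube k" "u \<in> {0..1}" "v \<in> {0..1}" "u \<le> \<delta> \<and> v \<le> \<delta> \<or> u \<ge> 1 - \<delta> \<and> v \<ge> 1 - \<delta>"
      then show "near \<epsilon> (a (xs[i := u] ! j)) (a (xs[i := v] ! j))"
        using d'[of u v] by (cases "i = j") (simp_all add: cube_length near_def)
    qed
  qed
  show "kpath M k (\<lambda>xs. \<alpha> (map (\<lambda>l. ?p l xs) [0..<k]))"
  proof (intro kpath_comp assms(1))
    fix l assume "l < k"
    then show "smooth_cube k (?p l)" "tame k (?p l)"
      using s t smooth_nth tame_nth by (cases "l = j"; simp)+
    show "?p l xs \<in> {0..1}" if "xs \<in> cube k" for xs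
      using cube_nth[OF that] \<open>l < k\<close> assms(5) j by simp
  qed (use assms(2) in \<open>simp_all add: last_cube\<close>)
  have "map (\<lambda>l. ?p l xs) [0..<k] = xs[j := a (xs ! j)]" if "xs \<in> cube k" for xs
    using that by (intro nth_equalityI) (auto simp: cube_length nth_list_update)
  then show "agree k (\<lambda>xs. \<alpha> (map (\<lambda>l. ?p l xs) [0..<k])) (\<lambda>xs. \<alpha> (xs[j := a (xs ! j)]))"
    by (simp add: agree_def)
qed

lemma low_rank_reparam:
  assumes "smooth_cube k \<alpha>" "j < k" "smooth_cube 1 (\<lambda>xs. a (xs ! 0))" "\<And>u. u \<in> {0..1} \<Longrightarrow> a u \<in> {0..1}"
    "low_rank k \<alpha>"
  shows "low_rank k (\<lambda>xs. \<alpha> (xs[j := a (xs ! j)]))"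
  unfolding low_rank_iff
proof
  fix xs assume xs: "xs \<in> cube k"
  from pd_reparam[OF assms(1-4) xs] obtain m where
    m: "pd j (\<lambda>xs. \<alpha> (xs[j := a (xs ! j)])) xs = m *\<^sub>R pd j \<alpha> (xs[j := a (xs ! j)])" by blast
  have "dep k (\<lambda>i. pd i \<alpha> (xs[j := a (xs ! j)]))"
    using assms(5) cube_update[OF xs assms(4)[OF cube_nth[OF xs assms(2)]]] unfolding low_rank_iff by blast
  then show "dep k (\<lambda>i. pd i (\<lambda>xs. \<alpha> (xs[j := a (xs ! j)])) xs)"
  proof (rule dep_scale[OF _ assms(2)])
    show "pd j (\<lambda>xs. \<alpha> (xs[j := a (xs ! j)])) xs = m *\<^sub>R pd j \<alpha> (xs[j := a (xs ! j)])" by (rule m)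
  qed (rule pd_update_other[OF _ cube_length[OF xs]])
qed

section \<open>Concatenation of paths\<close>

lemma kpath_agree_face:
  assumes "agree (k - 1) (face i 1 \<alpha>) (face i 0 \<beta>)" "i < k" "xs \<in> cube k"
  shows "\<alpha> (xs[i := 1]) = \<beta> (xs[i := 0])"
proof -
  let ?ys = "take i xs @ drop (Suc i) xs"
  have l: "length xs = k" using assms(3) cube_length by blast
  have "set ?ys \<subseteq> set xs" by (auto dest: in_set_takeD in_set_dropD)
  then have "?ys \<in> cube (k - 1)" using assms(2,3) l by (auto simp: cube_def)
  then have "face i 1 \<alpha> ?ys = face i 0 \<beta> ?ys" using assms(1) by (simp add: agree_def)
  then show ?thesis using assms(2) l by (simp add: face_def upd_conv_take_nth_drop)
qed

text \<open>The definition by cases is replaced by one formula: \<alpha> along a smooth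
  \<open>c1\<close>, plus \<beta> along a smooth \<open>c2\<close>, minus the common face. On the
  first half \<open>c2\<close> is 0 and \<beta> cancels against the face; on the second half
  \<open>c1\<close> is 1 and \<alpha> does. The parameters 2 x and 2 x - 1 are modified only where
  the collars hide it.\<close>

lemma pconcat_smooth:
  assumes "smooth_cube k \<alpha>" "smooth_cube k \<beta>" "collared k \<alpha>" "collared k \<beta>" "i < k"
    and eq: "\<And>xs. xs \<in> cube k \<Longrightarrow> \<alpha> (xs[i := 1]) = \<beta> (xs[i := 0])"
  shows "smooth_cube k (pconcat i \<alpha> \<beta>)"
proof -
  from collared_obtain[OF assms(3,4)] obtain \<epsilon> where \<epsilon>: "0 < \<epsilon>" "\<epsilon> < 1 / 4" "ecollared \<epsilon> k \<alpha>" "ecollared \<epsilon> k \<beta>" .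
  \<comment> \<open>Equal to 2 x up to (1 - \<epsilon>) / 2; from there to 1/2 it stays between 2 x
    and 1, hence inside the collar of \<alpha>; from 1/2 on it is 1. \<open>c2\<close> is its mirror
    image for \<beta>.\<close>
  define c1 where "c1 x = 2 * x + (1 - 2 * x) * step ((1 - \<epsilon>) / 2) (1 / 2) x" for x
  define c2 where "c2 x = (2 * x - 1) * step (1 / 2) ((1 + \<epsilon>) / 2) x" for x
  have c1: "c1 x \<in> {0..1}" "x \<le> 1 / 2 \<Longrightarrow> near \<epsilon> (c1 x) (2 * x)" "1 / 2 \<le> x \<Longrightarrow> c1 x = 1" if "x \<in> {0..1}" for x
  proof -
    let ?s = "step ((1 - \<epsilon>) / 2) (1 / 2) x"
    have s: "?s \<in> {0..1}" by (rule step_range)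
    show e1: "1 / 2 \<le> x \<Longrightarrow> c1 x = 1" using \<epsilon>(1) by (simp add: c1_def step_eq1)
    have le: "2 * x \<le> c1 x \<and> c1 x \<le> 1" if "x \<le> 1 / 2"
    proof -
      have "0 \<le> (1 - 2 * x) * ?s" using that s by simp
      moreover have "(1 - 2 * x) * ?s \<le> (1 - 2 * x) * 1" using that s by (intro mult_left_mono) auto
      ultimately show ?thesis by (simp add: c1_def)
    qed
    then show "c1 x \<in> {0..1}" using that e1 by (cases "x \<le> 1 / 2") auto
    show "near \<epsilon> (c1 x) (2 * x)" if h: "x \<le> 1 / 2"
    proof (cases "x \<le> (1 - \<epsilon>) / 2")
      case True then show ?thesis using \<epsilon>(1) by (simp add: c1_def step_eq0 near_def)
    next
      case False then show ?thesis using le[OF h] by (simp add: near_def field_simps)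
    qed
  qed
  have c2: "c2 x \<in> {0..1}" "x \<le> 1 / 2 \<Longrightarrow> c2 x = 0" "1 / 2 \<le> x \<Longrightarrow> near \<epsilon> (c2 x) (2 * x - 1)" if "x \<in> {0..1}" for x
  proof -
    let ?s = "step (1 / 2) ((1 + \<epsilon>) / 2) x"
    have s: "?s \<in> {0..1}" by (rule step_range)
    show e1: "x \<le> 1 / 2 \<Longrightarrow> c2 x = 0" using \<epsilon>(1) by (simp add: c2_def step_eq0)
    have le: "0 \<le> c2 x \<and> c2 x \<le> 2 * x - 1" if "1 / 2 \<le> x"
    proof -
      have "0 \<le> (2 * x - 1) * ?s" using that s by simp
      moreover have "(2 * x - 1) * ?s \<le> (2 * x - 1) * 1" using that s by (intro mult_left_mono) auto
      ultimately show ?thesis by (simp add: c2_def)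
    qed
    then show "c2 x \<in> {0..1}" using that e1 by (cases "x \<le> 1 / 2") auto
    show "near \<epsilon> (c2 x) (2 * x - 1)" if h: "1 / 2 \<le> x"
    proof (cases "x \<ge> (1 + \<epsilon>) / 2")
      case True then show ?thesis using \<epsilon>(1) by (simp add: c2_def step_eq1 near_def)
    next
      case False then show ?thesis using le[OF h] by (simp add: near_def field_simps)
    qed
  qed
  have x: "xs ! i \<in> {0..1}" if "xs \<in> cube k" for xs by (rule cube_nth[OF that assms(5)])
  have near: "\<gamma> (xs[i := u]) = \<gamma> (xs[i := v])"
    if "ecollared \<epsilon> k \<gamma>" "xs \<in> cube k" "near \<epsilon> u v" "u \<in> {0..1}" "v \<in> {0..1}" for \<gamma> :: "'a path" and xs u v
    using that(1)[unfolded ecollared_def, rule_format, OF assms(5) that(2,4,5)] that(3)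
    unfolding near_def by blast
  let ?f = "\<lambda>xs. \<alpha> (xs[i := c1 (xs ! i)]) + \<beta> (xs[i := c2 (xs ! i)]) - \<beta> (xs[i := 0])"
  have "smooth_cube k ?f"
  proof -
    have s: "smooth_cube k (\<lambda>xs. c1 (xs ! i))" "smooth_cube k (\<lambda>xs. c2 (xs ! i))"
      unfolding c1_def c2_def
      by (intro smooth_add smooth_diff smooth_mult smooth_const smooth_step smooth_nth assms(5))+
    show ?thesis
      by (rule smooth_diff[OF smooth_add[OF smooth_update[OF assms(1) s(1) c1(1)[OF x]]
              smooth_update[OF assms(2) s(2) c2(1)[OF x]]] smooth_update[OF assms(2) smooth_const]]) simp_all
  qed
  moreover have "?f xs = pconcat i \<alpha> \<beta> xs" if xs: "xs \<in> cube k" for xs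
  proof (cases "xs ! i \<le> 1 / 2")
    case True
    have "\<alpha> (xs[i := c1 (xs ! i)]) = \<alpha> (xs[i := 2 * xs ! i])"
      by (rule near[OF \<epsilon>(3) xs]) (use c1[OF x[OF xs]] x[OF xs] True in auto)
    then show ?thesis using True c2(2)[OF x[OF xs]] by (simp add: pconcat_def)
  next
    case False
    have "\<beta> (xs[i := c2 (xs ! i)]) = \<beta> (xs[i := 2 * xs ! i - 1])"
      by (rule near[OF \<epsilon>(4) xs]) (use c2[OF x[OF xs]] x[OF xs] False in auto)
    then show ?thesis using False c1(3)[OF x[OF xs]] eq[OF xs] by (simp add: pconcat_def)
  qed
  ultimately show ?thesis by (elim smooth_cong[rotated]) (simp add: agree_def)
qed

text \<open>In the direction of concatenation the collars are traversed at double speed, so their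
  width is halved.\<close>

lemma pconcat_collared:
  assumes "collared k \<alpha>" "collared k \<beta>" "i < k"
  shows "collared k (pconcat i \<alpha> \<beta>)"
proof -
  from collared_obtain[OF assms(1,2)] obtain \<epsilon> where \<epsilon>: "0 < \<epsilon>" "\<epsilon> < 1 / 4" "ecollared \<epsilon> k \<alpha>" "ecollared \<epsilon> k \<beta>" .
  have "ecollared (\<epsilon> / 2) k (pconcat i \<alpha> \<beta>)"
    unfolding ecollared_def
  proof (intro allI impI ballI)
    fix j xs and u v :: real
    assume j: "j < k" and xs: "xs \<in> cube k" and uv: "u \<in> {0..1}" "v \<in> {0..1}"
      and n: "u \<le> \<epsilon> / 2 \<and> v \<le> \<epsilon> / 2 \<or> 1 - \<epsilon> / 2 \<le> u \<and> 1 - \<epsilon> / 2 \<le> v"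
    have l: "length xs = k" using xs cube_length by blast
    show "pconcat i \<alpha> \<beta> (xs[j := u]) = pconcat i \<alpha> \<beta> (xs[j := v])"
    proof (cases "i = j")
      case True
      from n show ?thesis
      proof
        assume "u \<le> \<epsilon> / 2 \<and> v \<le> \<epsilon> / 2"
        moreover from this have "\<alpha> (xs[j := 2 * u]) = \<alpha> (xs[j := 2 * v])"
          using \<epsilon> j xs uv unfolding ecollared_def by (auto dest!: spec[of _ j])
        ultimately show ?thesis using True l j \<epsilon> by (simp add: pconcat_def)
      next
        assume a: "1 - \<epsilon> / 2 \<le> u \<and> 1 - \<epsilon> / 2 \<le> v"
        moreover from this have "\<beta> (xs[j := 2 * u - 1]) = \<beta> (xs[j := 2 * v - 1])"
          using \<epsilon> j xs uv unfolding ecollared_def by (auto dest!: spec[of _ j])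
        ultimately show ?thesis using True l j \<epsilon> by (simp add: pconcat_def)
      qed
    next
      case False
      have e: "u \<le> \<epsilon> \<and> v \<le> \<epsilon> \<or> u \<ge> 1 - \<epsilon> \<and> v \<ge> 1 - \<epsilon>" using n \<epsilon> by linarith
      have c: "\<gamma> (xs[i := w, j := u]) = \<gamma> (xs[i := w, j := v])" if "ecollared \<epsilon> k \<gamma>" "w \<in> {0..1}" for \<gamma> :: "'a path" and w
        using that(1) j cube_update[OF xs that(2), of i] uv e unfolding ecollared_def by blast
      have "xs ! i \<in> {0..1}" using xs assms(3) cube_nth by blast
      then show ?thesis using False c[OF \<epsilon>(3), of "2 * xs ! i"] c[OF \<epsilon>(4), of "2 * xs ! i - 1"]
        by (simp add: pconcat_def list_update_swap[of i j])
    qed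
  qed
  then show ?thesis using \<epsilon>(1) collared_iff by (metis half_gt_zero)
qed

lemma pconcat_kpath:
  assumes "kpath M k \<alpha>" "kpath M k \<beta>" "i < k"
    and eq: "\<And>xs. xs \<in> cube k \<Longrightarrow> \<alpha> (xs[i := 1]) = \<beta> (xs[i := 0])"
  shows "kpath M k (pconcat i \<alpha> \<beta>)"
proof (rule kpathI)
  note a = kpathD[OF assms(1)] and b = kpathD[OF assms(2)]
  show "smooth_cube k (pconcat i \<alpha> \<beta>)" by (rule pconcat_smooth[OF a(1) b(1) a(3) b(3) assms(3) eq])
  show "collared k (pconcat i \<alpha> \<beta>)" by (rule pconcat_collared[OF a(3) b(3) assms(3)])
  have x: "xs ! i \<in> {0..1}" if "xs \<in> cube k" for xs by (rule cube_nth[OF that assms(3)])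
  have u1: "xs[i := 2 * xs ! i] \<in> cube k" if "xs \<in> cube k" "xs ! i \<le> 1 / 2" for xs
    using cube_update[OF that(1)] x[OF that(1)] that(2) by simp
  have u2: "xs[i := 2 * xs ! i - 1] \<in> cube k" if "xs \<in> cube k" "\<not> xs ! i \<le> 1 / 2" for xs
    using cube_update[OF that(1)] x[OF that(1)] that(2) by simp
  show "pconcat i \<alpha> \<beta> xs \<in> M" if "xs \<in> cube k" for xs
    using a(2)[OF u1] b(2)[OF u2] that by (simp add: pconcat_def)
  have k: "0 < k" using assms(3) by simp
  have l: "last (xs[i := u]) = (if i = k - 1 then u else last xs)" if "xs \<in> cube k" "u \<in> {0..1}" for xs u
    using last_cube[OF that(1) k] last_cube[OF cube_update[OF that] k] assms(3) cube_length[OF that(1)] by auto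
  fix xs ys assume xs: "xs \<in> cube k" and ys: "ys \<in> cube k" and e: "last xs = last ys" "last xs \<in> {0, 1}"
  show "pconcat i \<alpha> \<beta> xs = pconcat i \<alpha> \<beta> ys"
  proof (cases "i = k - 1")
    case True
    have l1: "last (zs[i := u]) = u" if "zs \<in> cube k" "u \<in> {0..1}" for zs u
      using l[OF that] True by simp
    have "xs ! i = last xs" "ys ! i = last xs" using last_cube[OF _ k] xs ys True e by auto
    moreover have "\<alpha> (xs[i := 0]) = \<alpha> (ys[i := 0])"
      using xs ys by (intro a(4) cube_update) (simp_all add: l1)
    moreover have "\<beta> (xs[i := 1]) = \<beta> (ys[i := 1])"
      using xs ys by (intro b(4) cube_update) (simp_all add: l1)
    ultimately show ?thesis using e(2) by (auto simp: pconcat_def)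
  next
    case False
    \<comment> \<open>If the concatenation is not in the last coordinate, both maps are constant on
      the face in question, and \<open>eq\<close> makes the two constants agree.\<close>
    have al: "\<alpha> (zs[i := u]) = \<alpha> (zs'[i := v])" and bl: "\<beta> (zs[i := u]) = \<beta> (zs'[i := v])"
      if "zs \<in> {xs, ys}" "zs' \<in> {xs, ys}" "u \<in> {0..1}" "v \<in> {0..1}" for zs zs' u v
      using that xs ys e False by (auto intro!: a(4) b(4) cube_update simp: l)
    have ab: "\<alpha> (zs[i := u]) = \<beta> (zs'[i := v])" if "zs \<in> {xs, ys}" "zs' \<in> {xs, ys}" "u \<in> {0..1}" "v \<in> {0..1}" for zs zs' u v
    proof -
      have "\<alpha> (zs[i := u]) = \<alpha> (xs[i := 1])" using that by (intro al) auto
      also have "\<dots> = \<beta> (xs[i := 0])" by (rule eq[OF xs])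
      also have "\<dots> = \<beta> (zs'[i := v])" using that by (intro bl) auto
      finally show ?thesis .
    qed
    show ?thesis
      using x[OF xs] x[OF ys] al[of xs ys "2 * xs ! i" "2 * ys ! i"] bl[of xs ys "2 * xs ! i - 1" "2 * ys ! i - 1"]
        ab[of xs ys "2 * xs ! i" "2 * ys ! i - 1"] ab[of ys xs "2 * ys ! i" "2 * xs ! i - 1"]
      unfolding pconcat_def by (auto simp: not_le)
  qed
qed

lemma pd_collar:
  assumes "ecollared \<epsilon> k \<alpha>" "\<epsilon> > 0" "i < k" "xs \<in> cube k" "xs ! i < \<epsilon> \<or> xs ! i > 1 - \<epsilon>"
  shows "pd i \<alpha> xs = 0"
proof (rule pd_eqI[OF _ assms(4,3)])
  let ?x = "xs ! i"
  have x: "?x \<in> {0..1}" by (rule cube_nth[OF assms(4,3)])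
  define S where "S = (if ?x < \<epsilon> then {..<\<epsilon>} else {1 - \<epsilon><..})"
  have S: "open S" "?x \<in> S" using assms(5) by (auto simp: S_def)
  have "\<alpha> (xs[i := u]) = \<alpha> (xs[i := ?x])" if "u \<in> S" "u \<in> {0..1}" for u
    using assms(1,3,4) x that assms(5) unfolding ecollared_def S_def
    by (metis greaterThan_iff lessThan_iff less_imp_le)
  then have "((\<lambda>u. \<alpha> (xs[i := u])) has_vector_derivative 0) (at ?x within {0..1} \<inter> S)"
    using has_vector_derivative_transform[of ?x "{0..1} \<inter> S" "\<lambda>u. \<alpha> (xs[i := u])" "\<lambda>_. \<alpha> xs" 0] x S by simp
  moreover have "at ?x within {0..1} \<inter> S = at ?x within {0..1}"
    by (rule at_within_nhd[OF S(2,1)]) auto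
  ultimately show "((\<lambda>u. \<alpha> (xs[i := u])) has_vector_derivative 0) (at ?x within {0..1})" by simp
qed

text \<open>The factor 2 is the speed in direction \<open>i\<close>. At the seam the collars make
  both formulas 0 in that direction, so both can be claimed there.\<close>

lemma pd_pconcat:
  assumes "smooth_cube k \<alpha>" "smooth_cube k \<beta>" "collared k \<alpha>" "collared k \<beta>" "i < k" "j < k"
    and eq: "\<And>xs. xs \<in> cube k \<Longrightarrow> \<alpha> (xs[i := 1]) = \<beta> (xs[i := 0])"
    and xs: "xs \<in> cube k"
  shows "xs ! i \<le> 1 / 2 \<Longrightarrow> pd j (pconcat i \<alpha> \<beta>) xs = (if j = i then 2 else 1) *\<^sub>R pd j \<alpha> (xs[i := 2 * xs ! i])"
    and "xs ! i \<ge> 1 / 2 \<Longrightarrow> pd j (pconcat i \<alpha> \<beta>) xs = (if j = i then 2 else 1) *\<^sub>R pd j \<beta> (xs[i := 2 * xs ! i - 1])"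
proof -
  from collared_obtain[OF assms(3,4)] obtain \<epsilon> where \<epsilon>: "0 < \<epsilon>" "\<epsilon> < 1 / 4" "ecollared \<epsilon> k \<alpha>" "ecollared \<epsilon> k \<beta>" .
  let ?x = "xs ! i"
  have l: "length xs = k" by (rule cube_length[OF xs])
  have x: "?x \<in> {0..1}" by (rule cube_nth[OF xs assms(5)])
  have pc: "pconcat i \<alpha> \<beta> (ys[i := u]) = \<alpha> (ys[i := 2 * u])" if "u \<le> 1 / 2" "length ys = k" for ys u
    using that assms(5) by (simp add: pconcat_def)
  have pc': "pconcat i \<alpha> \<beta> (ys[i := u]) = \<beta> (ys[i := 2 * u - 1])" if "u \<ge> 1 / 2" "ys \<in> cube k" for ys u
  proof (cases "u = 1 / 2")
    case True
    show ?thesis unfolding True using assms(5) eq[OF that(2)] cube_length[OF that(2)] by (simp add: pconcat_def)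
  qed (use that assms(5) cube_length[OF that(2)] in \<open>simp add: pconcat_def\<close>)
  \<comment> \<open>Near 1/2 the concatenation is constant in direction \<open>i\<close>, since both
    collars carry the value at the seam.\<close>
  have mid: "pd i (pconcat i \<alpha> \<beta>) xs = 0" if "?x = 1 / 2"
  proof (rule pd_eqI[OF _ xs assms(5)])
    let ?S = "{1 / 2 - \<epsilon> / 2 <..< 1 / 2 + \<epsilon> / 2}"
    have "pconcat i \<alpha> \<beta> (xs[i := u]) = \<alpha> (xs[i := 1])" if u: "u \<in> ?S" for u
    proof (cases "u \<le> 1 / 2")
      case True
      then have "\<alpha> (xs[i := 2 * u]) = \<alpha> (xs[i := 1])"
        using \<epsilon>(1,2,3) u assms(5) xs unfolding ecollared_def by (auto dest!: spec[of _ i])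
      then show ?thesis using pc[OF True l] by simp
    next
      case False
      then have "\<beta> (xs[i := 2 * u - 1]) = \<beta> (xs[i := 0])"
        using \<epsilon>(1,2,4) u assms(5) xs unfolding ecollared_def by (auto dest!: spec[of _ i])
      then show ?thesis using pc'[OF _ xs, of u] False eq[OF xs] by simp
    qed
    note const = this
    have mem: "?x \<in> ?S" using \<epsilon>(1) that by simp
    have "((\<lambda>u. pconcat i \<alpha> \<beta> (xs[i := u])) has_vector_derivative 0) (at ?x within ?S)"
      by (rule has_vector_derivative_transform[OF mem const has_vector_derivative_const])
    moreover note mem
    ultimately show "((\<lambda>u. pconcat i \<alpha> \<beta> (xs[i := u])) has_vector_derivative 0) (at ?x within {0..1})"
      by (metis at_within_open has_vector_derivative_at_within open_greaterThanLessThan)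
  qed
  have one: "pd i \<alpha> (xs[i := 1]) = 0" "pd i \<beta> (xs[i := 0]) = 0"
    by (intro pd_collar[OF \<epsilon>(3,1) assms(5)] pd_collar[OF \<epsilon>(4,1) assms(5)] cube_update[OF xs];
        simp add: \<epsilon>(1) l assms(5))+
  show "pd j (pconcat i \<alpha> \<beta>) xs = (if j = i then 2 else 1) *\<^sub>R pd j \<alpha> (xs[i := 2 * ?x])" if h: "?x \<le> 1 / 2"
  proof (cases "j = i")
    case False
    then show ?thesis using h by (simp add: pd_def pconcat_def list_update_swap[of i j])
  next
    case True
    show ?thesis
    proof (cases "?x = 1 / 2")
      case T: True
      have e: "2 * ?x = 1" using T by simp
      show ?thesis by (simp only: e one(1) mid[OF T] True scaleR_zero_right)
    next
      case False
      with h have lt: "?x < 1 / 2" by simp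
      have m: "2 * ?x \<in> {0..1}" using x lt by simp
      have "((\<lambda>u. \<alpha> (xs[i := u])) has_vector_derivative pd i \<alpha> (xs[i := 2 * ?x])) (at (2 * ?x) within (\<lambda>u. 2 * u) ` {0..1/2})"
        by (rule has_vector_derivative_within_subset[OF pd_has_derivative_at[OF smooth_diffc[OF assms(1)] assms(5) xs m]]) fastforce
      moreover have "((\<lambda>u. 2 * u) has_vector_derivative 2) (at ?x within {0..1/2})"
        unfolding has_real_derivative_iff_has_vector_derivative[symmetric]
        by (rule DERIV_cong[OF DERIV_cmult[OF DERIV_ident]]) simp
      ultimately have "((\<lambda>u. \<alpha> (xs[i := 2 * u])) has_vector_derivative 2 *\<^sub>R pd i \<alpha> (xs[i := 2 * ?x])) (at ?x within {0..1/2})"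
        using vector_diff_chain_within[of "\<lambda>u. 2 * u" 2 ?x "{0..1/2}" "\<lambda>u. \<alpha> (xs[i := u])"] by (simp add: o_def)
      then have "((\<lambda>u. pconcat i \<alpha> \<beta> (xs[i := u])) has_vector_derivative 2 *\<^sub>R pd i \<alpha> (xs[i := 2 * ?x])) (at ?x within {0..1/2})"
        by (rule has_vector_derivative_transform[rotated 2]) (use x h pc[OF _ l] in simp_all)
      moreover have "at ?x within {0..1/2} = at ?x within {0..1}"
        by (rule at_within_nhd[of _ "{..<1/2}"]) (use lt in auto)
      ultimately show ?thesis using pd_eqI[OF _ xs assms(5)] True by simp
    qed
  qed
  show "pd j (pconcat i \<alpha> \<beta>) xs = (if j = i then 2 else 1) *\<^sub>R pd j \<beta> (xs[i := 2 * ?x - 1])" if h: "?x \<ge> 1 / 2"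
  proof (cases "j = i")
    case False
    have "((\<lambda>u. pconcat i \<alpha> \<beta> (xs[j := u])) has_vector_derivative pd j \<beta> (xs[i := 2 * ?x - 1])) (at (xs ! j) within {0..1})"
    proof -
      have c: "xs[i := 2 * ?x - 1] \<in> cube k" using cube_update[OF xs] x h by simp
      have "pconcat i \<alpha> \<beta> (xs[j := u]) = \<beta> (xs[i := 2 * ?x - 1, j := u])" if "u \<in> {0..1}" for u
      proof -
        have "xs[j := u, i := xs[j := u] ! i] = xs[j := u]" by (rule list_update_id)
        then have 1: "xs[j := u, i := ?x] = xs[j := u]" using False by simp
        have 2: "xs[i := 2 * ?x - 1, j := u] = xs[j := u, i := 2 * ?x - 1]"
          using False by (simp add: list_update_swap)
        show ?thesis using pc'[OF h cube_update[OF xs that, of j]] unfolding 1 2 .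
      qed
      note e = this
      have "((\<lambda>u. \<beta> (xs[i := 2 * ?x - 1, j := u])) has_vector_derivative pd j \<beta> (xs[i := 2 * ?x - 1])) (at (xs ! j) within {0..1})"
        using pd_has_derivative[OF smooth_diffc[OF assms(2)] assms(6) c] False by simp
      then show ?thesis by (rule has_vector_derivative_transform[rotated 2]) (rule cube_nth[OF xs assms(6)], rule e)
    qed
    from pd_eqI[OF this xs assms(6)] False show ?thesis by simp
  next
    case True
    show ?thesis
    proof (cases "?x = 1 / 2")
      case T: True
      have e: "2 * ?x - 1 = 0" using T by simp
      show ?thesis by (simp only: e one(2) mid[OF T] True scaleR_zero_right)
    next
      case False
      with h have lt: "?x > 1 / 2" by simp
      have m: "2 * ?x - 1 \<in> {0..1}" using x lt by simp
      have "((\<lambda>u. \<beta> (xs[i := u])) has_vector_derivative pd i \<beta> (xs[i := 2 * ?x - 1])) (at (2 * ?x - 1) within (\<lambda>u. 2 * u - 1) ` {1/2..1})"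
        by (rule has_vector_derivative_within_subset[OF pd_has_derivative_at[OF smooth_diffc[OF assms(2)] assms(5) xs m]]) fastforce
      moreover have "((\<lambda>u. 2 * u - 1) has_vector_derivative 2) (at ?x within {1/2..1})"
        unfolding has_real_derivative_iff_has_vector_derivative[symmetric]
        by (rule DERIV_cong[OF DERIV_diff[OF DERIV_cmult[OF DERIV_ident] DERIV_const]]) simp
      ultimately have "((\<lambda>u. \<beta> (xs[i := 2 * u - 1])) has_vector_derivative 2 *\<^sub>R pd i \<beta> (xs[i := 2 * ?x - 1])) (at ?x within {1/2..1})"
        using vector_diff_chain_within[of "\<lambda>u. 2 * u - 1" 2 ?x "{1/2..1}" "\<lambda>u. \<beta> (xs[i := u])"] by (simp add: o_def)
      then have "((\<lambda>u. pconcat i \<alpha> \<beta> (xs[i := u])) has_vector_derivative 2 *\<^sub>R pd i \<beta> (xs[i := 2 * ?x - 1])) (at ?x within {1/2..1})"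
        by (rule has_vector_derivative_transform[rotated 2]) (use x h pc'[OF _ xs] in simp_all)
      moreover have "at ?x within {1/2..1} = at ?x within {0..1}"
        by (rule at_within_nhd[of _ "{1/2<..}"]) (use lt in auto)
      ultimately show ?thesis using pd_eqI[OF _ xs assms(5)] True by simp
    qed
  qed
qed

lemma low_rank_pconcat:
  fixes \<alpha> \<beta> :: "'v::euclidean_space path"
  assumes "smooth_cube k \<alpha>" "smooth_cube k \<beta>" "collared k \<alpha>" "collared k \<beta>" "i < k"
    and eq: "\<And>xs. xs \<in> cube k \<Longrightarrow> \<alpha> (xs[i := 1]) = \<beta> (xs[i := 0])"
    and "low_rank k \<alpha>" "low_rank k \<beta>"
  shows "low_rank k (pconcat i \<alpha> \<beta>)"
  unfolding low_rank_iff
proof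
  fix xs assume xs: "xs \<in> cube k"
  have x: "xs ! i \<in> {0..1}" by (rule cube_nth[OF xs assms(5)])
  note p = pd_pconcat[OF assms(1-5) _ eq xs]
  show "dep k (\<lambda>j. pd j (pconcat i \<alpha> \<beta>) xs)"
  proof (cases "xs ! i \<le> 1 / 2")
    case True
    have "dep k (\<lambda>j. pd j \<alpha> (xs[i := 2 * xs ! i]))"
      using assms(7) cube_update[OF xs] x True unfolding low_rank_iff by simp
    then show ?thesis
    proof (rule dep_scale[OF _ assms(5), where m=2])
      show "pd i (pconcat i \<alpha> \<beta>) xs = 2 *\<^sub>R pd i \<alpha> (xs[i := 2 * xs ! i])"
        using p(1)[OF assms(5) _ True] by simp
      show "pd j (pconcat i \<alpha> \<beta>) xs = pd j \<alpha> (xs[i := 2 * xs ! i])" if "j < k" "j \<noteq> i" for j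
        using p(1)[OF that(1) _ True] that(2) by simp
    qed
  next
    case False
    then have h: "xs ! i \<ge> 1 / 2" by simp
    have "dep k (\<lambda>j. pd j \<beta> (xs[i := 2 * xs ! i - 1]))"
      using assms(8) cube_update[OF xs] x h unfolding low_rank_iff by simp
    then show ?thesis
    proof (rule dep_scale[OF _ assms(5), where m=2])
      show "pd i (pconcat i \<alpha> \<beta>) xs = 2 *\<^sub>R pd i \<beta> (xs[i := 2 * xs ! i - 1])"
        using p(2)[OF assms(5) _ h] by simp
      show "pd j (pconcat i \<alpha> \<beta>) xs = pd j \<beta> (xs[i := 2 * xs ! i - 1])" if "j < k" "j \<noteq> i" for j
        using p(2)[OF that(1) _ h] that(2) by simp
    qed
  qed
qed

section \<open>Tracks\<close>

lemma low_rank_cong: "agree k \<alpha> \<beta> \<Longrightarrow> low_rank k \<alpha> \<Longrightarrow> low_rank k \<beta>"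
proof -
  assume a: "agree k \<alpha> \<beta>" "low_rank k \<alpha>"
  have "(\<lambda>i. pd i \<alpha> xs) ` {..<k} = (\<lambda>i. pd i \<beta> xs) ` {..<k}" if "xs \<in> cube k" for xs
    by (intro image_cong refl pd_cong[OF a(1) _ that]) simp
  then show ?thesis using a(2) by (simp add: low_rank_def)
qed

lemma laminated_cong: "agree 3 \<alpha> \<beta> \<Longrightarrow> laminated \<alpha> \<Longrightarrow> laminated \<beta>"
proof -
  assume a: "agree 3 \<alpha> \<beta>" "laminated \<alpha>"
  have "pd i \<alpha> [r, s, t] = pd i \<beta> [r, s, t]" if "i < 3" "r \<in> {0..1}" "s \<in> {0..1}" "t \<in> {0..1}" for i r s t
    by (rule pd_cong[OF a(1) that(1)]) (use that in \<open>simp add: cube_lit\<close>)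
  from this[of 0] this[of 1] this[of 2] show ?thesis
    using a(2) unfolding laminated_def by simp
qed

lemma face_in_cube: "xs \<in> cube k \<Longrightarrow> i \<le> k \<Longrightarrow> c \<in> {0..1} \<Longrightarrow> take i xs @ c # drop i xs \<in> cube (Suc k)"
  by (auto simp: cube_def dest: in_set_takeD in_set_dropD)

lemma rank1_cong: "agree 2 \<alpha> \<beta> \<Longrightarrow> rank1_homotopy M \<alpha> \<Longrightarrow> rank1_homotopy M \<beta>"
  unfolding rank1_homotopy_def using kpath_cong low_rank_cong by blast

lemma agree_trans: "agree k \<alpha> \<beta> \<Longrightarrow> agree k \<beta> \<gamma> \<Longrightarrow> agree k \<alpha> \<gamma>"
  by (simp add: agree_def)

lemma agree_refl: "agree k \<alpha> \<alpha>"
  by (simp add: agree_def)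

lemma agree1I: "(\<And>t. t \<in> {0..1} \<Longrightarrow> \<alpha> [t] = \<beta> [t]) \<Longrightarrow> agree 1 \<alpha> \<beta>"
  unfolding agree_def by (metis cube1E)

lemma agree2I: "(\<And>s t. s \<in> {0..1} \<Longrightarrow> t \<in> {0..1} \<Longrightarrow> \<alpha> [s, t] = \<beta> [s, t]) \<Longrightarrow> agree 2 \<alpha> \<beta>"
  unfolding agree_def by (metis cube2E)

lemma agree3I: "(\<And>r s t. r \<in> {0..1} \<Longrightarrow> s \<in> {0..1} \<Longrightarrow> t \<in> {0..1} \<Longrightarrow> \<alpha> [r, s, t] = \<beta> [r, s, t]) \<Longrightarrow> agree 3 \<alpha> \<beta>"
  unfolding agree_def by (metis cube3E)

lemma agree1D: "agree 1 \<alpha> \<beta> \<Longrightarrow> t \<in> {0..1} \<Longrightarrow> \<alpha> [t] = \<beta> [t]"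
  unfolding agree_def using cube_lit(1) by blast

lemma agree2D: "agree 2 \<alpha> \<beta> \<Longrightarrow> s \<in> {0..1} \<Longrightarrow> t \<in> {0..1} \<Longrightarrow> \<alpha> [s, t] = \<beta> [s, t]"
  unfolding agree_def using cube_lit(2) by blast

lemma agree3D: "agree 3 \<alpha> \<beta> \<Longrightarrow> r \<in> {0..1} \<Longrightarrow> s \<in> {0..1} \<Longrightarrow> t \<in> {0..1} \<Longrightarrow> \<alpha> [r, s, t] = \<beta> [r, s, t]"
  unfolding agree_def using cube_lit(3) by blast

lemma face_lit: "face 0 c \<alpha> xs = \<alpha> (c # xs)" "face 1 c \<alpha> (x # xs) = \<alpha> (x # c # xs)"
  "face (Suc 0) c \<alpha> (x # xs) = \<alpha> (x # c # xs)" "face 2 c \<alpha> (x # y # xs) = \<alpha> (x # y # c # xs)"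
  by (simp_all add: face_def numeral_2_eq_2)

lemma kpath_face_2:
  assumes "kpath M 2 g" "c \<in> {0..1}" shows "kpath M 1 (face 0 c g)"
proof (rule kpath_face)
  show "kpath M (Suc 1) g" unfolding Suc_1 by (rule assms(1))
qed (use assms(2) in simp_all)

lemma kpath_face_3:
  assumes "kpath M 3 g" "i < 2" "c \<in> {0..1}" shows "kpath M 2 (face i c g)"
proof (rule kpath_face)
  have e: "Suc 2 = 3" by simp
  show "kpath M (Suc 2) g" unfolding e by (rule assms(1))
qed (use assms(2,3) in simp_all)

lemma kpath_face_4:
  assumes "kpath M 4 g" "i < 3" "c \<in> {0..1}" shows "kpath M 3 (face i c g)"
proof (rule kpath_face)
  have e: "Suc 3 = 4" by simp
  show "kpath M (Suc 3) g" unfolding e by (rule assms(1))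
qed (use assms(2,3) in simp_all)

lemma low_rank_tl: "low_rank (Suc k) (\<lambda>xs. g (tl xs))"
  unfolding low_rank_iff
proof
  fix xs assume "xs \<in> cube (Suc k)"
  then show "dep (Suc k) (\<lambda>i. pd i (\<lambda>xs. g (tl xs)) xs)"
    by (intro dep_zero[of 0] pd_tl_0) simp_all
qed

lemma rank1_const: "kpath M 1 \<gamma> \<Longrightarrow> rank1_homotopy M (\<lambda>xs. \<gamma> (tl xs))"
  unfolding rank1_homotopy_def using kpath_tl[of M 1 \<gamma>] low_rank_tl[of 1 \<gamma>] by (simp add: numeral_2_eq_2)

text \<open>The constant homotopy does not move with its first coordinate, so the third alternative
  of lamination holds with coefficients (1, 0).\<close>

lemma rank2_const:
  assumes "kpath M 2 g"
  shows "rank2_homotopy M (\<lambda>xs. g (tl xs))" "laminated (\<lambda>xs. g (tl xs))"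
proof -
  have "rank1_homotopy M (face 1 c (\<lambda>xs. g (tl xs)))" if "c \<in> {0..1}" for c
    by (rule rank1_cong[OF _ rank1_const[OF kpath_face_2[OF assms that]]], rule agree2I) (simp add: face_lit)
  then show "rank2_homotopy M (\<lambda>xs. g (tl xs))"
    unfolding rank2_homotopy_def using kpath_tl[OF assms] low_rank_tl[of 2 g] by (simp add: numeral_3_eq_3)
  have "pd 0 (\<lambda>xs. g (tl xs)) [r, s, t] = 0" if "r \<in> {0..1}" "s \<in> {0..1}" "t \<in> {0..1}" for r s t
    by (rule pd_tl_0[of _ 2]) (use that in \<open>simp add: cube_def\<close>)
  then show "laminated (\<lambda>xs. g (tl xs))" unfolding laminated_def
    by (intro ballI disjI2 exI[of _ 1] exI[of _ 0]) simp
qed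

text \<open>Goodness of \<open>J\<close> supplies the independence of the second coordinate on the
  faces of the third one.\<close>

lemma rank3_const:
  assumes "good_3path M J"
  shows "rank3_homotopy M (\<lambda>xs. J (tl xs))"
proof -
  have k: "kpath M 3 J" using assms by (simp add: good_3path_def)
  have 1: "rank2_homotopy M (face 1 c (\<lambda>xs. J (tl xs))) \<and> laminated (face 1 c (\<lambda>xs. J (tl xs)))" if "c \<in> {0..1}" for c
  proof -
    have a: "agree 3 (\<lambda>xs. face 0 c J (tl xs)) (face 1 c (\<lambda>xs. J (tl xs)))"
      by (rule agree3I) (simp add: face_lit)
    have g: "kpath M 2 (face 0 c J)" by (rule kpath_face_3[OF k _ that]) simp
    have k3: "kpath M 3 (face 1 c (\<lambda>xs. J (tl xs)))"
      by (rule kpath_cong[OF a]) (use rank2_const(1)[OF g] in \<open>simp add: rank2_homotopy_def\<close>)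
    have l: "laminated (face 1 c (\<lambda>xs. J (tl xs)))" by (rule laminated_cong[OF a rank2_const(2)[OF g]])
    have "rank1_homotopy M (face 1 d (face 1 c (\<lambda>xs. J (tl xs))))" if d: "d \<in> {0..1}" for d
      by (rule rank1_cong[OF _ rank1_const[OF kpath_face_2[OF g d]]], rule agree2I) (simp add: face_lit)
    then show ?thesis using k3 l laminated_low_rank[OF l] by (simp add: rank2_homotopy_def)
  qed
  have 2: "rank1_homotopy M (face 1 r (face 2 c (\<lambda>xs. J (tl xs))))" if "r \<in> {0..1}" "c \<in> {0..1}" for r c
    by (rule rank1_cong[OF _ rank1_const[OF kpath_face_2[OF kpath_face_3[OF k _ that(2), of 1] that(1)]]], rule agree2I)
      (simp_all add: face_lit)
  have "kpath M 4 (\<lambda>xs. J (tl xs))" using kpath_tl[OF k] by (simp add: eval_nat_numeral)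
  moreover have "low_rank 4 (\<lambda>xs. J (tl xs))" using low_rank_tl[of 3 J] by (simp add: eval_nat_numeral)
  moreover have "\<forall>c\<in>{0, 1}. \<forall>q\<in>{0..1}. \<forall>r\<in>{0..1}. \<forall>r'\<in>{0..1}. \<forall>t\<in>{0..1}. J (tl [q, r, c, t]) = J (tl [q, r', c, t])"
    using assms unfolding good_3path_def list.sel by blast
  moreover have "\<forall>c\<in>{0, 1}. rank2_homotopy M (face 1 c (\<lambda>xs. J (tl xs))) \<and> laminated (face 1 c (\<lambda>xs. J (tl xs)))"
    using 1[of 0] 1[of 1] by simp
  moreover have "\<forall>c\<in>{0, 1}. \<forall>r\<in>{0..1}. rank1_homotopy M (face 1 r (face 2 c (\<lambda>xs. J (tl xs))))"
    using 2[where c=0] 2[where c=1] by simp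
  ultimately show ?thesis unfolding rank3_homotopy_def by blast
qed

lemma track1_refl:
  assumes a: "kpath M 1 \<gamma>" shows "\<gamma> \<in> track1 M \<gamma>"
proof -
  have "agree 1 (face 0 c (\<lambda>xs. \<gamma> (tl xs))) \<gamma>" for c by (rule agree1I) (simp add: face_lit)
  then show ?thesis unfolding track1_def using rank1_const[OF a] by blast
qed

lemma track2_refl:
  assumes a: "kpath M 2 g" shows "g \<in> track2 M g"
proof -
  have "agree 2 (face 0 c (\<lambda>xs. g (tl xs))) g" for c by (rule agree2I) (simp add: face_lit)
  then show ?thesis unfolding track2_def using rank2_const[OF a] by blast
qed

lemma track3_refl:
  assumes a: "good_3path M J" shows "J \<in> track3 M J"
proof -
  have "agree 3 (face 0 c (\<lambda>xs. J (tl xs))) J" for c by (rule agree3I) (simp add: face_lit)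
  then show ?thesis unfolding track3_def using rank3_const[OF a] by blast
qed

lemma rank3_indep:
  assumes "rank3_homotopy M W" "c \<in> {0, 1}" "q \<in> {0..1}" "r \<in> {0..1}" "r' \<in> {0..1}" "t \<in> {0..1}"
  shows "W [q, r, c, t] = W [q, r', c, t]"
proof -
  have "\<forall>q\<in>{0..1}. \<forall>r\<in>{0..1}. \<forall>r'\<in>{0..1}. \<forall>t\<in>{0..1}. W [q, r, c, t] = W [q, r', c, t]"
    by (rule bspec[OF assms(1)[unfolded rank3_homotopy_def, THEN conjunct2, THEN conjunct2, THEN conjunct2] assms(2), THEN conjunct1])
  then show ?thesis using assms(3-6) by blast
qed

lemma rank3_good:
  assumes "rank3_homotopy M W" "q \<in> {0..1}" shows "good_3path M (face 0 q W)"
proof -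
  have "kpath M 4 W" using assms(1) by (simp add: rank3_homotopy_def)
  then have "kpath M 3 (face 0 q W)" by (rule kpath_face_4) (use assms(2) in simp_all)
  moreover have "face 0 q W [r, s, t] = face 0 q W [r', s, t]"
    if "s \<in> {0, 1}" "r \<in> {0..1}" "r' \<in> {0..1}" "t \<in> {0..1}" for r r' s t
    unfolding face_lit by (rule rank3_indep[OF assms(1) that(1) assms(2) that(2-4)])
  ultimately show ?thesis unfolding good_3path_def by blast
qed

text \<open>The parameter change of the homotopies constructed below; it gives them collars in the
  homotopy parameter. Any two transition points strictly inside the unit interval would do. The
  sides of those homotopies become given homotopies run along \<open>mu\<close>, which the next two
  lemmas admit.\<close>

definition mu :: "real \<Rightarrow> real" where "mu = step (1 / 3) (2 / 3)"

lemma mu: "smooth_cube 1 (\<lambda>xs. mu (xs ! 0))" "tame 1 (\<lambda>xs. mu (xs ! 0))" "mu u \<in> {0..1}" "mu 0 = 0" "mu 1 = 1"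
proof -
  show "smooth_cube 1 (\<lambda>xs. mu (xs ! 0))" unfolding mu_def by (rule smooth_step[OF smooth_nth]) simp
  show "tame 1 (\<lambda>xs. mu (xs ! 0))" unfolding mu_def by (rule tame_collared, rule collared_step) simp_all
  show "mu u \<in> {0..1}" unfolding mu_def by (rule step_range)
  show "mu 0 = 0" "mu 1 = 1" by (simp_all add: mu_def step_eq0 step_eq1)
qed

lemma rank1_mu:
  assumes "rank1_homotopy M h" shows "rank1_homotopy M (\<lambda>xs. h (xs[0 := mu (xs ! 0)]))"
proof -
  have k: "kpath M 2 h" and l: "low_rank 2 h" using assms by (auto simp: rank1_homotopy_def)
  show ?thesis unfolding rank1_homotopy_def
    by (rule conjI, rule kpath_reparam[OF k _ mu(1,2,3)], simp, rule low_rank_reparam[OF kpathD(1)[OF k] _ mu(1,3) l], simp)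
qed

text \<open>The derivative in the homotopy parameter is multiplied by \<open>m\<close>, which does
  not depend on t. If \<open>m\<close> is 0, the third alternative holds with coefficients (1, 0).
  Otherwise the first coefficient is divided by \<open>m\<close> and stays independent of t where
  this is required.\<close>

lemma rank2_mu:
  assumes "rank2_homotopy M \<alpha>" "laminated \<alpha>"
  shows "rank2_homotopy M (\<lambda>xs. \<alpha> (xs[0 := mu (xs ! 0)]))" "laminated (\<lambda>xs. \<alpha> (xs[0 := mu (xs ! 0)]))"
proof -
  let ?b = "\<lambda>xs. \<alpha> (xs[0 := mu (xs ! 0)])"
  have k: "kpath M 3 \<alpha>" and l: "low_rank 3 \<alpha>" and f: "rank1_homotopy M (face 1 0 \<alpha>)" "rank1_homotopy M (face 1 1 \<alpha>)"
    using assms(1) by (auto simp: rank2_homotopy_def)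
  have f': "rank1_homotopy M (face 1 c ?b)" if "rank1_homotopy M (face 1 c \<alpha>)" for c
    by (rule rank1_cong[OF _ rank1_mu[OF that]], rule agree2I) (simp add: face_lit)
  have "kpath M 3 ?b" by (rule kpath_reparam[OF k _ mu(1,2,3)]) simp
  moreover have "low_rank 3 ?b" by (rule low_rank_reparam[OF kpathD(1)[OF k] _ mu(1,3) l]) simp
  ultimately show "rank2_homotopy M ?b"
    unfolding rank2_homotopy_def using f'[OF f(1)] f'[OF f(2)] by blast
  show "laminated ?b" unfolding laminated_def
  proof (intro ballI)
    fix r s :: real assume rs: "r \<in> {0..1}" "s \<in> {0..1}"
    have x: "[r] \<in> cube 1" using rs by (simp add: cube_lit1)
    define m where "m = pd 0 (\<lambda>xs. mu (xs ! 0)) [r]"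
    have "(mu has_real_derivative m) (at r within {0..1})"
      using pd_has_derivative[OF smooth_diffc[OF mu(1)] _ x, of 0]
      by (simp add: has_real_derivative_iff_has_vector_derivative m_def)
    then have p0: "pd 0 ?b [r, s, t] = m *\<^sub>R pd 0 \<alpha> [mu r, s, t]" if "t \<in> {0..1}" for t
    proof -
      have "[r, s, t] \<in> cube 3" using rs that by (simp add: cube_lit)
      from pd_update_same[where j=0 and a=mu and a'=m, OF smooth_diffc[OF kpathD(1)[OF k]] _ this mu(3)]
      show ?thesis using that \<open>(mu has_real_derivative m) (at r within {0..1})\<close> by simp
    qed
    have pi: "pd 1 ?b [r, s, t] = pd 1 \<alpha> [mu r, s, t]" "pd 2 ?b [r, s, t] = pd 2 \<alpha> [mu r, s, t]" for t
      using pd_update_other[of 1 0 "[r, s, t]" 3 \<alpha> mu] pd_update_other[of 2 0 "[r, s, t]" 3 \<alpha> mu] by simp_all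
    show "(\<forall>t\<in>{0..1}. \<exists>a b. (a, b) \<noteq> (0, 0) \<and> a *\<^sub>R pd 0 ?b [r, s, t] + b *\<^sub>R pd 2 ?b [r, s, t] = 0) \<or>
     (\<forall>t\<in>{0..1}. \<exists>a b. (a, b) \<noteq> (0, 0) \<and> a *\<^sub>R pd 1 ?b [r, s, t] + b *\<^sub>R pd 2 ?b [r, s, t] = 0) \<or>
     (\<exists>a b. (a, b) \<noteq> (0, 0) \<and> (\<forall>t\<in>{0..1}. a *\<^sub>R pd 0 ?b [r, s, t] + b *\<^sub>R pd 1 ?b [r, s, t] = 0))"
    proof (cases "m = 0")
      case True
      have "1 *\<^sub>R pd 0 ?b [r, s, t] + 0 *\<^sub>R pd 1 ?b [r, s, t] = 0" if "t \<in> {0..1}" for t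
        using p0[OF that] True by simp
      moreover have "(1, 0) \<noteq> (0::real, 0::real)" by simp
      ultimately show ?thesis by blast
    next
      case False
      from assms(2)[unfolded laminated_def, rule_format, OF mu(3)[of r] rs(2)] show ?thesis
      proof (elim disjE)
        assume a: "\<forall>t\<in>{0..1}. \<exists>a b. (a, b) \<noteq> (0, 0) \<and> a *\<^sub>R pd 0 \<alpha> [mu r, s, t] + b *\<^sub>R pd 2 \<alpha> [mu r, s, t] = 0"
        show ?thesis
        proof (rule disjI1, rule ballI)
          fix t :: real assume t: "t \<in> {0..1}"
          from a t obtain a b where "(a, b) \<noteq> (0, 0)" "a *\<^sub>R pd 0 \<alpha> [mu r, s, t] + b *\<^sub>R pd 2 \<alpha> [mu r, s, t] = 0" by blast
          then show "\<exists>a b. (a, b) \<noteq> (0, 0) \<and> a *\<^sub>R pd 0 ?b [r, s, t] + b *\<^sub>R pd 2 ?b [r, s, t] = 0"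
            using False by - (rule exI[of _ "a / m"], rule exI[of _ b], simp add: p0[OF t] pi)
        qed
      next
        assume "\<forall>t\<in>{0..1}. \<exists>a b. (a, b) \<noteq> (0, 0) \<and> a *\<^sub>R pd 1 \<alpha> [mu r, s, t] + b *\<^sub>R pd 2 \<alpha> [mu r, s, t] = 0"
        then show ?thesis by (intro disjI2 disjI1) (simp only: pi)
      next
        assume "\<exists>a b. (a, b) \<noteq> (0, 0) \<and> (\<forall>t\<in>{0..1}. a *\<^sub>R pd 0 \<alpha> [mu r, s, t] + b *\<^sub>R pd 1 \<alpha> [mu r, s, t] = 0)"
        then obtain a b where ab: "(a, b) \<noteq> (0, 0)" "\<And>t. t \<in> {0..1} \<Longrightarrow> a *\<^sub>R pd 0 \<alpha> [mu r, s, t] + b *\<^sub>R pd 1 \<alpha> [mu r, s, t] = 0" by blast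
        show ?thesis
        proof (intro disjI2, rule exI[of _ "a / m"], rule exI[of _ b], intro conjI ballI)
          show "(a / m, b) \<noteq> (0, 0)" using ab(1) False by simp
          fix t :: real assume t: "t \<in> {0..1}"
          show "(a / m) *\<^sub>R pd 0 ?b [r, s, t] + b *\<^sub>R pd 1 ?b [r, s, t] = 0"
            using ab(2)[OF t] False by (simp add: p0[OF t] pi[unfolded One_nat_def])
        qed
      qed
    qed
  qed
qed

text \<open>Transitivity of rank-1 homotopy, used to chain three of them in
  \<open>vert3_composable\<close>.\<close>

lemma rank1_trans:
  assumes "rank1_homotopy M h" "rank1_homotopy M h'" "agree 1 (face 0 1 h) (face 0 0 h')"
  shows "rank1_homotopy M (pconcat 0 h h')" "agree 1 (face 0 0 (pconcat 0 h h')) (face 0 0 h)"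
    "agree 1 (face 0 1 (pconcat 0 h h')) (face 0 1 h')"
proof -
  have k: "kpath M 2 h" "kpath M 2 h'" and l: "low_rank 2 h" "low_rank 2 h'" using assms by (auto simp: rank1_homotopy_def)
  have e: "h (xs[0 := 1]) = h' (xs[0 := 0])" if "xs \<in> cube 2" for xs
    using kpath_agree_face[of 2 0 h h' xs] assms(3) that by simp
  show "rank1_homotopy M (pconcat 0 h h')"
    unfolding rank1_homotopy_def
    by (rule conjI, rule pconcat_kpath[OF k _ e], simp_all only: zero_less_numeral,
       rule low_rank_pconcat[OF kpathD(1)[OF k(1)] kpathD(1)[OF k(2)] kpathD(3)[OF k(1)] kpathD(3)[OF k(2)] _ e l],
       simp_all only: zero_less_numeral)
  show "agree 1 (face 0 0 (pconcat 0 h h')) (face 0 0 h)" "agree 1 (face 0 1 (pconcat 0 h h')) (face 0 1 h')"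
    by (rule agree1I, simp add: face_lit pconcat_def)+
qed

section \<open>Grafting homotopies onto collars\<close>

lemma cube_swap_sides:
  fixes \<alpha> :: "'v path"
  assumes "ecollared \<epsilon> k \<alpha>" "i < k" "xs \<in> cube k" "u \<in> {0..1}" "xs ! i = v" "u \<le> \<epsilon> \<and> v \<le> \<epsilon> \<or> u \<ge> 1 - \<epsilon> \<and> v \<ge> 1 - \<epsilon>"
  shows "\<alpha> xs = \<alpha> (xs[i := u])"
proof -
  have v: "v \<in> {0..1}" using cube_nth[OF assms(3,2)] assms(5) by blast
  have "\<alpha> (xs[i := v]) = \<alpha> (xs[i := u])"
    using assms(1)[unfolded ecollared_def, rule_format, OF assms(2,3) v assms(4)] assms(6) by blast
  moreover have "xs[i := v] = xs" using assms(5) list_update_id by metis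
  ultimately show ?thesis by metis
qed

lemma step_diff_range: "step p q x * (1 - step p' q' x') \<in> {0..1}"
  using step_range[of p q x] step_range[of p' q' x'] by (simp add: mult_le_one)

text \<open>The end of \<open>g\<close> is moved along \<open>h\<close> inside the collar of \<open>g\<close>, where \<open>g\<close> is \<open>h(0, -)\<close>: there \<open>\<alpha>\<close> is \<open>h(p, -)\<close>, and
  \<open>p\<close> vanishes outside the collar.\<close>

lemma extend_2path:
  fixes g h :: "'v::euclidean_space path"
  assumes g: "kpath M 2 g" and h: "rank1_homotopy M h" and ag: "agree 1 (face 0 0 h) (face 0 1 g)"
  obtains \<alpha> where "rank2_homotopy M \<alpha>" "laminated \<alpha>" "agree 2 (face 0 0 \<alpha>) g"
    "agree 1 (face 0 1 (face 0 1 \<alpha>)) (face 0 1 h)"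
proof -
  have hk: "kpath M 2 h" using h by (simp add: rank1_homotopy_def)
  note gd = kpathD[OF g] and hd = kpathD[OF hk]
  obtain \<epsilon> where \<epsilon>: "0 < \<epsilon>" "\<epsilon> < 1 / 4" "ecollared \<epsilon> 2 g" "ecollared \<epsilon> 2 h"
    by (rule collared_obtain[OF gd(3) hd(3)])
  \<comment> \<open>It vanishes up to the inner end of the collar of \<open>g\<close> and is 1
    already from 1 - \<epsilon>/2 on, so that it has collars itself.\<close>
  define chi where "chi xs = step (1 - \<epsilon>) (1 - \<epsilon> / 2) (xs ! 1)" for xs :: "real list"
  define p where "p xs = chi xs * mu (xs ! 0)" for xs :: "real list"
  \<comment> \<open>Where \<open>p\<close> is 0 the last two terms cancel and \<open>g\<close>
    remains. In the collar, \<open>g [xs ! 1, xs ! 2]\<close> equals \<open>h [0, xs ! 2]\<close>,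
    and \<open>h [p xs, xs ! 2]\<close> remains.\<close>
  define \<alpha> where "\<alpha> xs = g [xs ! 1, xs ! 2] + h [p xs, xs ! 2] - h [0, xs ! 2]" for xs :: "real list"
  have chir: "chi xs \<in> {0..1}" for xs unfolding chi_def by (rule step_range)
  have pr: "p xs \<in> {0..1}" for xs unfolding p_def using chir[of xs] mu(3)[of "xs ! 0"] by (simp add: mult_le_one)
  have chis: "smooth_cube 3 chi" unfolding chi_def by (rule smooth_step[OF smooth_nth]) simp
  have mus: "smooth_cube 3 (\<lambda>xs. mu (xs ! 0))" unfolding mu_def by (rule smooth_step[OF smooth_nth]) simp
  have ps: "smooth_cube 3 p" unfolding p_def by (rule smooth_mult[OF chis mus])
  have chic: "collared 3 chi" unfolding chi_def by (rule collared_step) (use \<epsilon> in simp_all)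
  have muc: "collared 3 (\<lambda>xs. mu (xs ! 0))" unfolding mu_def by (rule collared_step) simp_all
  have pc: "collared 3 p" unfolding p_def by (rule collared_comb[OF chic muc])
  note n1 = smooth_nth[of 1 3, simplified] and n2 = smooth_nth[of 2 3, simplified]
  note t1 = tame_nth[of 1 3, simplified] and t2 = tame_nth[of 2 3, simplified]
  have in3: "xs ! 1 \<in> {0..1}" "xs ! Suc 0 \<in> {0..1}" "xs ! 2 \<in> {0..1}" if "xs \<in> cube 3" for xs
    using cube_nth[OF that, of 1] cube_nth[OF that, of 2] by simp_all
  have sg: "smooth_cube 3 (\<lambda>xs. g [xs ! Suc 0, xs ! 2])"
    by (rule smooth_comp2(1)[OF gd(1) n1 n2]) (rule conjI[OF in3(2,3)])
  have sh: "smooth_cube 3 (\<lambda>xs. h [p xs, xs ! 2])"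
    by (rule smooth_comp2(1)[OF hd(1) ps n2]) (rule conjI[OF pr in3(3)])
  have sz: "smooth_cube 3 (\<lambda>xs. h [0, xs ! 2])"
    by (rule smooth_comp2(1)[OF hd(1) smooth_const n2]) (use in3(3) in simp)
  have s: "smooth_cube 3 \<alpha>" unfolding \<alpha>_def One_nat_def by (rule smooth_diff[OF smooth_add[OF sg sh] sz])
  have "collared 3 (\<lambda>xs. g [xs ! Suc 0, xs ! 2])"
    by (rule collared_comp2[OF gd(3) t1 t2]) (rule conjI[OF in3(2,3)])
  moreover have "collared 3 (\<lambda>xs. h [p xs, xs ! 2])"
    by (rule collared_comp2[OF hd(3) tame_collared[OF pc] t2]) (rule conjI[OF pr in3(3)])
  moreover have "collared 3 (\<lambda>xs. h [0, xs ! 2])"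
    by (rule collared_comp2[OF hd(3) tame_collared[OF collared_const] t2]) (use in3(3) in simp)
  ultimately have c: "collared 3 \<alpha>" unfolding \<alpha>_def One_nat_def
    by (rule collared_comb[OF collared_comb])
  have p_low: "p [q, x, t] = 0" if "x \<le> 1 - \<epsilon>" for q x t
    using that \<epsilon>(1) by (simp add: p_def chi_def step_eq0)
  have val_low: "\<alpha> [q, x, t] = g [x, t]" if "x \<le> 1 - \<epsilon>" for q x t
    using p_low[OF that] by (simp add: \<alpha>_def)
  have gh: "g [x, t] = h [0, t]" if "x \<ge> 1 - \<epsilon>" "x \<in> {0..1}" "t \<in> {0..1}" for x t
  proof -
    have "g [x, t] = g ([x, t][0 := 1])"
      by (rule cube_swap_sides[OF \<epsilon>(3), where v=x]) (use that \<epsilon> in \<open>simp_all add: cube_lit\<close>)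
    also have "\<dots> = h [0, t]" using agree1D[OF ag that(3)] by (simp add: face_lit)
    finally show ?thesis .
  qed
  have val_high: "\<alpha> [q, x, t] = h [p [q, x, t], t]" if "x \<ge> 1 - \<epsilon>" "x \<in> {0..1}" "t \<in> {0..1}" for q x t
    using gh[OF that] by (simp add: \<alpha>_def)
  have k: "kpath M 3 \<alpha>"
  proof (rule kpathI[OF s _ c])
    fix xs assume "xs \<in> cube 3"
    then obtain q x t where xs: "xs = [q, x, t]" "q \<in> {0..1}" "x \<in> {0..1}" "t \<in> {0..1}" by (rule cube3E)
    show "\<alpha> xs \<in> M"
    proof (cases "x \<le> 1 - \<epsilon>")
      case True
      then show ?thesis using gd(2)[of "[x, t]"] xs val_low by (simp add: cube_lit)
    next
      case False
      have "h [p [q, x, t], t] \<in> M" by (rule hd(2)) (use pr xs(4) in \<open>simp add: cube_lit\<close>)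
      then show ?thesis using False xs val_high by simp
    qed
  next
    fix xs ys assume "xs \<in> cube 3" "ys \<in> cube 3" and l: "last xs = last ys" "last xs \<in> {0, 1}"
    then obtain q x t q' x' t' where xs: "xs = [q, x, t]" "x \<in> {0..1}" "t \<in> {0..1}"
      and ys: "ys = [q', x', t']" "x' \<in> {0..1}" "t' \<in> {0..1}" by (metis cube3E)
    have t: "t' = t" "t \<in> {0, 1}" using l xs ys by auto
    have "g [x, t] = g [x', t]" by (rule gd(4)) (use xs ys t in \<open>simp_all add: cube_lit\<close>)
    moreover have "h [p [q, x, t], t] = h [p [q', x', t], t]"
      by (rule hd(4)) (use pr xs ys t in \<open>simp_all add: cube_lit\<close>)
    ultimately show "\<alpha> xs = \<alpha> ys" using xs ys t by (simp add: \<alpha>_def)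
  qed
  have pdp: "pd i p [q, x, t] = pd i p [q, x, 0]" if "i < 2" for i q x t
    using that by (auto simp: pd_def p_def chi_def less_2_cases_iff)
  have pd\<alpha>: "pd i \<alpha> [q, x, t] = (if i = 1 then pd 0 g [x, t] else 0) + pd i p [q, x, 0] *\<^sub>R pd 0 h [p [q, x, 0], t]"
    if i: "i < 2" and r: "q \<in> {0..1}" "x \<in> {0..1}" "t \<in> {0..1}" for i q x t
  proof -
    have i3: "i < 3" and xs: "[q, x, t] \<in> cube 3" using i r by (simp_all add: cube_lit)
    have pi: "pd i (\<lambda>xs. xs ! 2) [q, x, t] = 0" "pd i (\<lambda>xs. xs ! Suc 0) [q, x, t] = (if i = 1 then 1 else 0)"
      using pd_nth[OF xs i3, of 2] pd_nth[OF xs i3, of 1] i by simp_all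
    have z: "pd i (\<lambda>_. 0::real) [q, x, t] = 0" by (rule pd_const[OF refl xs i3])
    have p0: "p [q, x, t] = p [q, x, 0]" by (simp add: p_def chi_def)
    have "pd i \<alpha> [q, x, t] = pd i (\<lambda>xs. g [xs ! Suc 0, xs ! 2]) [q, x, t] + pd i (\<lambda>xs. h [p xs, xs ! 2]) [q, x, t]
        - pd i (\<lambda>xs. h [0, xs ! 2]) [q, x, t]"
      unfolding \<alpha>_def One_nat_def
      by (subst pd_diff[OF smooth_add[OF sg sh] sz i3 xs], subst pd_add[OF sg sh i3 xs]) (rule refl)
    also have "pd i (\<lambda>xs. g [xs ! Suc 0, xs ! 2]) [q, x, t] = (if i = 1 then pd 0 g [x, t] else 0)"
      by (subst smooth_comp2(2)[OF gd(1) n1 n2 conjI[OF in3(2,3)] i3 xs]) (simp_all add: pi)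
    also have "pd i (\<lambda>xs. h [p xs, xs ! 2]) [q, x, t] = pd i p [q, x, 0] *\<^sub>R pd 0 h [p [q, x, 0], t]"
      by (subst smooth_comp2(2)[OF hd(1) ps n2 conjI[OF pr in3(3)] i3 xs]) (simp_all add: pi pdp[OF i, of q x t] p0)
    also have "pd i (\<lambda>xs. h [0, xs ! 2]) [q, x, t] = 0"
      by (subst smooth_comp2(2)[OF hd(1) smooth_const n2 _ i3 xs]) (use in3(3) in \<open>simp_all add: pi z\<close>)
    finally show ?thesis by simp
  qed
  \<comment> \<open>Where \<open>p\<close> moves with q, the point lies in the collar and the
    derivative of \<open>g\<close> vanishes. Both derivatives are then multiples of
    \<open>pd 0 h\<close> at the same point, and the factors, derivatives of \<open>p\<close>, do
    not depend on t: this is the third alternative.\<close>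
  have lam: "laminated \<alpha>" unfolding laminated_def
  proof (intro ballI disjI2)
    fix q x :: real assume q: "q \<in> {0..1}" and x: "x \<in> {0..1}"
    let ?a = "pd 0 p [q, x, 0]" and ?b = "pd 1 p [q, x, 0]"
    show "\<exists>a b. (a, b) \<noteq> (0, 0) \<and> (\<forall>t\<in>{0..1}. a *\<^sub>R pd 0 \<alpha> [q, x, t] + b *\<^sub>R pd 1 \<alpha> [q, x, t] = 0)"
    proof (cases "?a = 0")
      case True
      have "pd 0 \<alpha> [q, x, t] = 0" if "t \<in> {0..1}" for t using pd\<alpha>[of 0, OF _ q x that] True by simp
      then show ?thesis by - (rule exI[of _ 1], rule exI[of _ 0], simp)
    next
      case False
      have "x > 1 - \<epsilon>"
      proof (rule ccontr)
        assume "\<not> x > 1 - \<epsilon>"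
        then have "pd 0 p [q, x, 0] = 0"
          by (intro pd_const[where c=0 and k=3]) (use q x p_low in \<open>simp_all add: cube_lit\<close>)
        with False show False by simp
      qed
      then have "pd 0 g [x, t] = 0" if "t \<in> {0..1}" for t
        by (intro pd_collar[OF \<epsilon>(3,1)]) (use x that in \<open>simp_all add: cube_lit\<close>)
      then have "?b *\<^sub>R pd 0 \<alpha> [q, x, t] + (- ?a) *\<^sub>R pd 1 \<alpha> [q, x, t] = 0" if "t \<in> {0..1}" for t
        using pd\<alpha>[of 0, OF _ q x that] pd\<alpha>[of 1, OF _ q x that] that by simp
      then show ?thesis using False by - (rule exI[of _ ?b], rule exI[of _ "- ?a"], simp)
    qed
  qed
  have p_one: "p [q, 1, t] = mu q" for q t using \<epsilon> by (simp add: p_def chi_def step_eq1)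
  have "rank1_homotopy M (face 1 0 \<alpha>)"
    by (rule rank1_cong[OF _ rank1_const[OF kpath_face_2[OF g, of 0]]], rule agree2I)
      (use \<epsilon> in \<open>simp_all add: face_lit val_low\<close>)
  moreover have "rank1_homotopy M (face 1 1 \<alpha>)"
    by (rule rank1_cong[OF _ rank1_mu[OF h]], rule agree2I)
      (use \<epsilon> in \<open>simp_all add: face_lit val_high p_one\<close>)
  ultimately have r2: "rank2_homotopy M \<alpha>"
    unfolding rank2_homotopy_def using k laminated_low_rank[OF lam] by blast
  have "agree 2 (face 0 0 \<alpha>) g"
    by (rule agree2I) (simp add: face_lit \<alpha>_def p_def mu(4))
  moreover have "agree 1 (face 0 1 (face 0 1 \<alpha>)) (face 0 1 h)"
    by (rule agree1I) (use \<epsilon> in \<open>simp add: face_lit val_high p_one mu(5)\<close>)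
  ultimately show ?thesis using that[OF r2 lam] by blast
qed

text \<open>The same construction, except that the sides \<open>s = 0\<close> and \<open>s = 1\<close> of \<open>\<alpha>\<close> move as well; to keep all stages of the homotopy good, \<open>p\<close>
  is also nonzero in the collars of these sides, where \<open>J\<close> does not depend on \<open>r\<close> and hence is \<open>\<alpha>(0, -, -)\<close>.\<close>

lemma extend_good_3path:
  fixes J \<alpha> :: "'v::euclidean_space path"
  assumes J: "good_3path M J" and r2: "rank2_homotopy M \<alpha>" and lam: "laminated \<alpha>"
    and ag: "agree 2 (face 0 0 \<alpha>) (face 0 1 J)"
  obtains J' where "J' \<in> track3 M J" "good_3path M J'" "agree 2 (face 0 1 J') (face 0 1 \<alpha>)"
proof -
  have Jk: "kpath M 3 J" using J by (simp add: good_3path_def)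
  have Jg: "J [r, s, t] = J [r', s, t]" if "s \<in> {0, 1}" "r \<in> {0..1}" "r' \<in> {0..1}" "t \<in> {0..1}" for r r' s t
    using J that unfolding good_3path_def by blast
  have hk: "kpath M 3 \<alpha>" using r2 by (simp add: rank2_homotopy_def)
  note gd = kpathD[OF Jk] and hd = kpathD[OF hk]
  obtain \<epsilon> where \<epsilon>: "0 < \<epsilon>" "\<epsilon> < 1 / 4" "ecollared \<epsilon> 3 J" "ecollared \<epsilon> 3 \<alpha>"
    by (rule collared_obtain[OF gd(3) hd(3)])
  \<comment> \<open>\<open>th\<close> switches on near r = 1, while \<open>ka\<close> is 1 between
    the collars in s and 0 near s = 0 and s = 1. Combined, \<open>chi\<close> is a smooth version of
    "r near 1 or s near 0 or 1": it is 1 on these three faces and 0 outside their collars.\<close>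
  define th where "th xs = step (1 - \<epsilon>) (1 - \<epsilon> / 2) (xs ! 1)" for xs :: "real list"
  define ka where "ka xs = step (\<epsilon> / 2) \<epsilon> (xs ! 2) * (1 - step (1 - \<epsilon>) (1 - \<epsilon> / 2) (xs ! 2))" for xs :: "real list"
  define chi where "chi xs = 1 - (1 - th xs) * ka xs" for xs
  define p where "p xs = chi xs * mu (xs ! 0)" for xs :: "real list"
  define W where "W xs = J [xs ! 1, xs ! 2, xs ! 3] + \<alpha> [p xs, xs ! 2, xs ! 3] - \<alpha> [0, xs ! 2, xs ! 3]" for xs :: "real list"
  have thr: "th xs \<in> {0..1}" for xs unfolding th_def by (rule step_range)
  have kar: "ka xs \<in> {0..1}" for xs unfolding ka_def by (rule step_diff_range)
  have chir: "chi xs \<in> {0..1}" for xs unfolding chi_def using thr[of xs] kar[of xs] by (simp add: mult_le_one)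
  have pr: "p xs \<in> {0..1}" for xs unfolding p_def using chir[of xs] mu(3)[of "xs ! 0"] by (simp add: mult_le_one)
  have chis: "smooth_cube 4 chi" unfolding chi_def th_def ka_def
    by (intro smooth_diff smooth_mult smooth_const smooth_step smooth_nth) simp_all
  have mus: "smooth_cube 4 (\<lambda>xs. mu (xs ! 0))" unfolding mu_def by (rule smooth_step[OF smooth_nth]) simp
  have ps: "smooth_cube 4 p" unfolding p_def by (rule smooth_mult[OF chis mus])
  have thc: "collared 4 th" unfolding th_def by (rule collared_step) (use \<epsilon> in simp_all)
  have c2: "collared 4 (\<lambda>xs. step (\<epsilon> / 2) \<epsilon> (xs ! 2))" by (rule collared_step) (use \<epsilon> in simp_all)
  have c3: "collared 4 (\<lambda>xs. step (1 - \<epsilon>) (1 - \<epsilon> / 2) (xs ! 2))" by (rule collared_step) (use \<epsilon> in simp_all)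
  have kac: "collared 4 ka" unfolding ka_def by (rule collared_comb[OF c2 c3])
  have chic: "collared 4 chi" unfolding chi_def by (rule collared_comb[OF thc kac])
  have muc: "collared 4 (\<lambda>xs. mu (xs ! 0))" unfolding mu_def by (rule collared_step) simp_all
  have pc: "collared 4 p" unfolding p_def by (rule collared_comb[OF chic muc])
  have n1: "smooth_cube 4 (\<lambda>xs. xs ! Suc 0)" and n2: "smooth_cube 4 (\<lambda>xs. xs ! 2)" and n3: "smooth_cube 4 (\<lambda>xs. xs ! 3)"
    by (rule smooth_nth, simp)+
  have t1: "tame 4 (\<lambda>xs. xs ! Suc 0)" and t2: "tame 4 (\<lambda>xs. xs ! 2)" and t3: "tame 4 (\<lambda>xs. xs ! 3)"
    by (rule tame_nth, simp)+
  have in4: "xs ! Suc 0 \<in> {0..1}" "xs ! 2 \<in> {0..1}" "xs ! 3 \<in> {0..1}" if "xs \<in> cube 4" for xs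
    by (rule cube_nth[OF that], simp)+
  have z01: "(0::real) \<in> {0..1}" by simp
  have cJ: "xs ! Suc 0 \<in> {0..1} \<and> xs ! 2 \<in> {0..1} \<and> xs ! 3 \<in> {0..1}"
    and c\<alpha>: "p xs \<in> {0..1} \<and> xs ! 2 \<in> {0..1} \<and> xs ! 3 \<in> {0..1}"
    and c0: "(0::real) \<in> {0..1} \<and> xs ! 2 \<in> {0..1} \<and> xs ! 3 \<in> {0..1}" if "xs \<in> cube 4" for xs
    by (intro conjI in4[OF that] pr z01)+
  have sg: "smooth_cube 4 (\<lambda>xs. J [xs ! Suc 0, xs ! 2, xs ! 3])"
    by (rule smooth_comp3(1)[OF gd(1) n1 n2 n3 cJ])
  have sh: "smooth_cube 4 (\<lambda>xs. \<alpha> [p xs, xs ! 2, xs ! 3])"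
    by (rule smooth_comp3(1)[OF hd(1) ps n2 n3 c\<alpha>])
  have sz: "smooth_cube 4 (\<lambda>xs. \<alpha> [0, xs ! 2, xs ! 3])"
    by (rule smooth_comp3(1)[OF hd(1) smooth_const n2 n3 c0])
  have s: "smooth_cube 4 W" unfolding W_def One_nat_def by (rule smooth_diff[OF smooth_add[OF sg sh] sz])
  have "collared 4 (\<lambda>xs. J [xs ! Suc 0, xs ! 2, xs ! 3])"
    by (rule collared_comp3[OF gd(3) t1 t2 t3 cJ])
  moreover have "collared 4 (\<lambda>xs. \<alpha> [p xs, xs ! 2, xs ! 3])"
    by (rule collared_comp3[OF hd(3) tame_collared[OF pc] t2 t3 c\<alpha>])
  moreover have "collared 4 (\<lambda>xs. \<alpha> [0, xs ! 2, xs ! 3])"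
    by (rule collared_comp3[OF hd(3) tame_collared[OF collared_const] t2 t3 c0])
  ultimately have c: "collared 4 W" unfolding W_def One_nat_def
    by (rule collared_comb[OF collared_comb])
  have chi_low: "chi [q, r, x, t] = 0" if "r \<le> 1 - \<epsilon>" "\<epsilon> \<le> x" "x \<le> 1 - \<epsilon>" for q r x t
    using that \<epsilon>(1) by (simp add: chi_def th_def ka_def step_eq0 step_eq1)
  have val_low: "W [q, r, x, t] = J [r, x, t]" if "r \<le> 1 - \<epsilon>" "\<epsilon> \<le> x" "x \<le> 1 - \<epsilon>" for q r x t
    using chi_low[OF that] by (simp add: W_def p_def numeral_3_eq_3)
  have J1: "J [1, x, t] = \<alpha> [0, x, t]" if "x \<in> {0..1}" "t \<in> {0..1}" for x t
    using agree2D[OF ag that] by (simp add: face_lit)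
  have JA: "J [r, x, t] = \<alpha> [0, x, t]" if "r \<ge> 1 - \<epsilon> \<or> x \<le> \<epsilon> \<or> x \<ge> 1 - \<epsilon>" "r \<in> {0..1}" "x \<in> {0..1}" "t \<in> {0..1}" for r x t
  proof -
    have xs: "[r, x, t] \<in> cube 3" "[1, x, t] \<in> cube 3" using that by (simp_all add: cube_lit)
    \<comment> \<open>On the faces s = 0 and s = 1 the path \<open>J\<close> does not depend on r: s
      is moved through its collar to the face, r to 1, and s back again.\<close>
    have sides: "J [r, x, t] = J [1, x, t]" if c: "c \<in> {0, 1}" "c \<le> \<epsilon> \<and> x \<le> \<epsilon> \<or> c \<ge> 1 - \<epsilon> \<and> x \<ge> 1 - \<epsilon>" for c
    proof -
      have "J [r, x, t] = J ([r, x, t][1 := c])"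
        by (rule cube_swap_sides[OF \<epsilon>(3) _ xs(1), where v=x]) (use c in auto)
      also have "\<dots> = J ([1, x, t][1 := c])" using Jg[OF c(1) \<open>r \<in> {0..1}\<close> _ \<open>t \<in> {0..1}\<close>, of 1] by simp
      also have "\<dots> = J [1, x, t]"
        by (rule cube_swap_sides[OF \<epsilon>(3) _ xs(2), where v=x, symmetric]) (use c in auto)
      finally show ?thesis .
    qed
    from that(1) have "J [r, x, t] = J [1, x, t]"
    proof (elim disjE)
      assume "r \<ge> 1 - \<epsilon>"
      then have "J [r, x, t] = J ([r, x, t][0 := 1])"
        by (intro cube_swap_sides[OF \<epsilon>(3) _ xs(1), where v=r]) (use \<epsilon> in auto)
      then show ?thesis by simp
    next
      assume "x \<le> \<epsilon>" then show ?thesis using sides[of 0] \<epsilon>(1) by simp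
    next
      assume "x \<ge> 1 - \<epsilon>" then show ?thesis using sides[of 1] \<epsilon>(1) by simp
    qed
    then show ?thesis using J1[OF that(3,4)] by simp
  qed
  have val_high: "W [q, r, x, t] = \<alpha> [p [q, r, x, t], x, t]"
    if "r \<ge> 1 - \<epsilon> \<or> x \<le> \<epsilon> \<or> x \<ge> 1 - \<epsilon>" "r \<in> {0..1}" "x \<in> {0..1}" "t \<in> {0..1}" for q r x t
    using JA[OF that] by (simp add: W_def numeral_3_eq_3)
  have k: "kpath M 4 W"
  proof (rule kpathI[OF s _ c])
    fix xs assume "xs \<in> cube 4"
    then obtain q r x t where xs: "xs = [q, r, x, t]" "q \<in> {0..1}" "r \<in> {0..1}" "x \<in> {0..1}" "t \<in> {0..1}" by (rule cube4E)
    show "W xs \<in> M"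
    proof (cases "r \<le> 1 - \<epsilon> \<and> \<epsilon> \<le> x \<and> x \<le> 1 - \<epsilon>")
      case True
      then show ?thesis using gd(2)[of "[r, x, t]"] xs val_low by (simp add: cube_lit)
    next
      case False
      have "\<alpha> [p [q, r, x, t], x, t] \<in> M" by (rule hd(2)) (use pr xs in \<open>simp add: cube_lit\<close>)
      then show ?thesis using False xs val_high by auto
    qed
  next
    fix xs ys assume "xs \<in> cube 4" "ys \<in> cube 4" and l: "last xs = last ys" "last xs \<in> {0, 1}"
    then obtain q r x t q' r' x' t' where xs: "xs = [q, r, x, t]" "r \<in> {0..1}" "x \<in> {0..1}" "t \<in> {0..1}"
      and ys: "ys = [q', r', x', t']" "r' \<in> {0..1}" "x' \<in> {0..1}" "t' \<in> {0..1}" by (metis cube4E)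
    have t: "t' = t" "t \<in> {0, 1}" using l xs ys by auto
    have "J [r, x, t] = J [r', x', t]" by (rule gd(4)) (use xs ys t in \<open>simp_all add: cube_lit\<close>)
    moreover have "\<alpha> [p [q, r, x, t], x, t] = \<alpha> [p [q', r', x', t], x', t]"
      by (rule hd(4)) (use pr xs ys t in \<open>simp_all add: cube_lit\<close>)
    moreover have "\<alpha> [0, x, t] = \<alpha> [0, x', t]"
      by (rule hd(4)) (use pr xs ys t in \<open>simp_all add: cube_lit\<close>)
    ultimately show "W xs = W ys" using xs ys t by (simp add: W_def numeral_3_eq_3)
  qed
  have pindep: "p [q, r, x, t] = p [q, r, x, 0]" for q r x t by (simp add: p_def chi_def th_def ka_def)
  have pdp: "pd i p [q, r, x, t] = pd i p [q, r, x, 0]" if "i < 3" for i q r x t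
    using that by (auto simp: pd_def p_def chi_def th_def ka_def numeral_3_eq_3 less_Suc_eq)
  have pdW: "pd i W [q, r, x, t] = (if i = 1 then pd 0 J [r, x, t] else if i = 2 then pd 1 J [r, x, t] + pd 1 \<alpha> [p [q, r, x, 0], x, t] - pd 1 \<alpha> [0, x, t] else 0)
      + pd i p [q, r, x, 0] *\<^sub>R pd 0 \<alpha> [p [q, r, x, 0], x, t]"
    if i: "i < 3" and r: "q \<in> {0..1}" "r \<in> {0..1}" "x \<in> {0..1}" "t \<in> {0..1}" for i q r x t
  proof -
    have i3: "i < 4" and xs: "[q, r, x, t] \<in> cube 4" using i r by (simp_all add: cube_lit)
    have pi: "pd i (\<lambda>xs. xs ! 3) [q, r, x, t] = 0" "pd i (\<lambda>xs. xs ! 2) [q, r, x, t] = (if i = 2 then 1 else 0)"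
      "pd i (\<lambda>xs. xs ! Suc 0) [q, r, x, t] = (if i = 1 then 1 else 0)"
      using pd_nth[OF xs i3, of 3] pd_nth[OF xs i3, of 2] pd_nth[OF xs i3, of 1] i by simp_all
    have z: "pd i (\<lambda>_. 0::real) [q, r, x, t] = 0" by (rule pd_const[OF refl xs i3])
    have ev: "[q, r, x, t] ! Suc 0 = r" "[q, r, x, t] ! 2 = x" "[q, r, x, t] ! 3 = t" by (simp_all add: numeral_3_eq_3)
    have "pd i W [q, r, x, t] = pd i (\<lambda>xs. J [xs ! Suc 0, xs ! 2, xs ! 3]) [q, r, x, t] + pd i (\<lambda>xs. \<alpha> [p xs, xs ! 2, xs ! 3]) [q, r, x, t]
        - pd i (\<lambda>xs. \<alpha> [0, xs ! 2, xs ! 3]) [q, r, x, t]"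
      unfolding W_def One_nat_def
      by (subst pd_diff[OF smooth_add[OF sg sh] sz i3 xs], subst pd_add[OF sg sh i3 xs]) (rule refl)
    also have "pd i (\<lambda>xs. J [xs ! Suc 0, xs ! 2, xs ! 3]) [q, r, x, t] = (if i = 1 then pd 0 J [r, x, t] else if i = 2 then pd 1 J [r, x, t] else 0)"
      by (subst smooth_comp3(2)[OF gd(1) n1 n2 n3 cJ i3 xs]) (simp_all add: pi ev)
    also have "pd i (\<lambda>xs. \<alpha> [p xs, xs ! 2, xs ! 3]) [q, r, x, t] =
      pd i p [q, r, x, 0] *\<^sub>R pd 0 \<alpha> [p [q, r, x, 0], x, t] + (if i = 2 then pd 1 \<alpha> [p [q, r, x, 0], x, t] else 0)"
      by (subst smooth_comp3(2)[OF hd(1) ps n2 n3 c\<alpha> i3 xs]) (simp_all add: pi ev pdp[OF i, of q r x t] pindep[of q r x t])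
    also have "pd i (\<lambda>xs. \<alpha> [0, xs ! 2, xs ! 3]) [q, r, x, t] = (if i = 2 then pd 1 \<alpha> [0, x, t] else 0)"
      by (subst smooth_comp3(2)[OF hd(1) smooth_const n2 n3 c0 i3 xs]) (simp_all add: pi ev z)
    finally show ?thesis by simp
  qed
  have p0_low: "pd 0 p [q, r, x, 0] = 0" if "q \<in> {0..1}" "r \<in> {0..1}" "x \<in> {0..1}" "r \<le> 1 - \<epsilon>" "\<epsilon> \<le> x" "x \<le> 1 - \<epsilon>" for q r x
    by (rule pd_const[where c=0 and k=4]) (use that(1-3) chi_low[OF that(4-6)] in \<open>simp_all add: cube_lit p_def\<close>)
  \<comment> \<open>Outside the three collars \<open>W\<close> does not move with q. Inside them
    \<open>J\<close> does not move with r, and the derivatives of \<open>W\<close> in q and r are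
    both multiples of \<open>pd 0 \<alpha>\<close> at the same point.\<close>
  have lr: "low_rank 4 W" unfolding low_rank_iff
  proof
    fix xs assume "xs \<in> cube 4"
    then obtain q r x t where xs: "xs = [q, r, x, t]" and m: "q \<in> {0..1}" "r \<in> {0..1}" "x \<in> {0..1}" "t \<in> {0..1}" by (rule cube4E)
    show "dep 4 (\<lambda>i. pd i W xs)"
    proof (cases "r \<le> 1 - \<epsilon> \<and> \<epsilon> \<le> x \<and> x \<le> 1 - \<epsilon>")
      case True
      then have "pd 0 W xs = 0" using pdW[OF _ m, of 0] p0_low[OF m(1-3)] xs by simp
      then show ?thesis by (intro dep_zero[of 0]) simp_all
    next
      case False
      have "pd 0 J [r, x, t] = 0"
      proof (cases "r > 1 - \<epsilon>")
        case True then show ?thesis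
          by (intro pd_collar[OF \<epsilon>(3,1)]) (use m in \<open>simp_all add: cube_lit\<close>)
      next
        case F: False
        then have "x \<le> \<epsilon> \<or> x \<ge> 1 - \<epsilon>" using False by linarith
        then show ?thesis
          by (intro pd_const[where c="\<alpha> [0, x, t]" and k=3]) (use m JA in \<open>simp_all add: cube_lit\<close>)
      qed
      then show ?thesis
        by (intro dep_collinear[of 0 4 1 _ "pd 0 p [q, r, x, 0]" "pd 0 \<alpha> [p [q, r, x, 0], x, t]" "pd 1 p [q, r, x, 0]"])
          (simp_all add: xs pdW[OF _ m, of 0, simplified] pdW[OF _ m, of 1, simplified])
    qed
  qed
  have p_one: "p [q, r, x, t] = mu q" if "r = 1 \<or> x = 0 \<or> x = 1" for q r x t
    using that \<epsilon> by (auto simp: p_def chi_def th_def ka_def step_eq1 step_eq0)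
  have W_one: "W [q, r, x, t] = \<alpha> [mu q, x, t]" if "r = 1 \<or> x = 0 \<or> x = 1" "r \<in> {0..1}" "x \<in> {0..1}" "t \<in> {0..1}" for q r x t
  proof -
    have "r \<ge> 1 - \<epsilon> \<or> x \<le> \<epsilon> \<or> x \<ge> 1 - \<epsilon>" using that(1) \<epsilon>(1) by auto
    from val_high[OF this that(2-4)] p_one[OF that(1)] show ?thesis by simp
  qed
  have side: "rank1_homotopy M (face 1 c \<alpha>)" if "c \<in> {0, 1}" for c using r2 that by (auto simp: rank2_homotopy_def)
  have face_mu: "rank1_homotopy M h" if "\<And>q t. q \<in> {0..1} \<Longrightarrow> t \<in> {0..1} \<Longrightarrow> h [q, t] = \<alpha> [mu q, c, t]" "c \<in> {0, 1}" for h c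
    by (rule rank1_cong[OF _ rank1_mu[OF side[OF that(2)]]], rule agree2I) (simp add: face_lit that(1))
  have f1: "rank2_homotopy M (face 1 1 W)" "laminated (face 1 1 W)"
  proof -
    have a: "agree 3 (\<lambda>xs. \<alpha> (xs[0 := mu (xs ! 0)])) (face 1 1 W)"
      by (rule agree3I) (simp add: face_lit W_one)
    show l: "laminated (face 1 1 W)" by (rule laminated_cong[OF a rank2_mu(2)[OF r2 lam]])
    have "rank1_homotopy M (face 1 c (face 1 1 W))" if "c \<in> {0, 1}" for c
      by (rule face_mu[OF _ that]) (use that in \<open>auto simp: face_lit W_one\<close>)
    moreover have "kpath M 3 (face 1 1 W)" by (rule kpath_face_4[OF k]) simp_all
    ultimately show "rank2_homotopy M (face 1 1 W)"
      unfolding rank2_homotopy_def using laminated_low_rank[OF l] by simp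
  qed
  \<comment> \<open>At r = 0 only the collars in s are active. Where \<open>p\<close> moves with q,
    the s-derivatives of \<open>J\<close> and \<alpha> vanish, so the derivatives of
    \<open>W\<close> in q and s are multiples of one vector, with factors independent of t.\<close>
  have f0: "rank2_homotopy M (face 1 0 W)" "laminated (face 1 0 W)"
  proof -
    show l: "laminated (face 1 0 W)" unfolding laminated_def
    proof (intro ballI disjI2)
      fix q x :: real assume q: "q \<in> {0..1}" and x: "x \<in> {0..1}"
      have pf: "pd 0 (face 1 0 W) [q, x, t] = pd 0 W [q, 0, x, t]" "pd 1 (face 1 0 W) [q, x, t] = pd 2 W [q, 0, x, t]" for t
        using pd_face[of "[q, x, t]" 3 1 0 0 W] pd_face[of "[q, x, t]" 3 1 1 0 W] by (simp_all add: numeral_2_eq_2)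
      let ?a = "pd 0 p [q, 0, x, 0]" and ?b = "pd 2 p [q, 0, x, 0]"
      have W0: "pd 0 W [q, 0, x, t] = ?a *\<^sub>R pd 0 \<alpha> [p [q, 0, x, 0], x, t]" if "t \<in> {0..1}" for t
        using pdW[of 0, OF _ q z01 x that] by simp
      show "\<exists>a b. (a, b) \<noteq> (0, 0) \<and> (\<forall>t\<in>{0..1}. a *\<^sub>R pd 0 (face 1 0 W) [q, x, t] + b *\<^sub>R pd 1 (face 1 0 W) [q, x, t] = 0)"
      proof (cases "?a = 0")
        case True
        have "pd 0 W [q, 0, x, t] = 0" if "t \<in> {0..1}" for t using W0[OF that] True by simp
        then show ?thesis unfolding pf by - (rule exI[of _ 1], rule exI[of _ 0], simp)
      next
        case False
        have h: "x < \<epsilon> \<or> x > 1 - \<epsilon>" using p0_low[OF q z01 x] False \<epsilon>(2) by force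
        have "pd 1 J [0, x, t] = 0" "pd 1 \<alpha> [y, x, t] = 0" if "t \<in> {0..1}" "y \<in> {0..1}" for t y
          by (rule pd_collar[OF \<epsilon>(3,1)] pd_collar[OF \<epsilon>(4,1)], simp, use x that h in \<open>simp_all add: cube_lit\<close>)+
        then have "pd 2 W [q, 0, x, t] = ?b *\<^sub>R pd 0 \<alpha> [p [q, 0, x, 0], x, t]" if "t \<in> {0..1}" for t
          using pdW[of 2, OF _ q z01 x that] that pr z01 by simp
        then have "?b *\<^sub>R pd 0 W [q, 0, x, t] + (- ?a) *\<^sub>R pd 2 W [q, 0, x, t] = 0" if "t \<in> {0..1}" for t
          using W0[OF that] that by simp
        then show ?thesis using False unfolding pf by - (rule exI[of _ ?b], rule exI[of _ "- ?a"], simp)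
      qed
    qed
    have "rank1_homotopy M (face 1 c (face 1 0 W))" if "c \<in> {0, 1}" for c
      by (rule face_mu[OF _ that]) (use that in \<open>auto simp: face_lit W_one\<close>)
    moreover have "kpath M 3 (face 1 0 W)" by (rule kpath_face_4[OF k]) simp_all
    ultimately show "rank2_homotopy M (face 1 0 W)"
      unfolding rank2_homotopy_def using laminated_low_rank[OF l] by simp
  qed
  have ind: "W [q, r, c, t] = W [q, r', c, t]" if "c \<in> {0, 1}" "r \<in> {0..1}" "r' \<in> {0..1}" "t \<in> {0..1}" for q r r' c t
    using W_one[of r c t q] W_one[of r' c t q] that by auto
  have r1: "rank1_homotopy M (face 1 r (face 2 c W))" if "c \<in> {0, 1}" "r \<in> {0..1}" for c r
    by (rule face_mu[OF _ that(1)]) (use that in \<open>auto simp: face_lit W_one\<close>)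
  have r3: "rank3_homotopy M W"
  proof -
    have "rank2_homotopy M (face 1 c W) \<and> laminated (face 1 c W)" if "c \<in> {0, 1}" for c
      using f0 f1 that by auto
    then show ?thesis unfolding rank3_homotopy_def using k lr ind r1 by blast
  qed
  have "agree 3 (face 0 0 W) J"
    by (rule agree3I) (simp add: face_lit W_def p_def mu(4) numeral_3_eq_3)
  then have "face 0 1 W \<in> track3 M J" unfolding track3_def using r3 agree_refl by blast
  moreover have "good_3path M (face 0 1 W)" by (rule rank3_good[OF r3]) simp
  moreover have "agree 2 (face 0 1 (face 0 1 W)) (face 0 1 \<alpha>)"
    by (rule agree2I) (simp add: face_lit W_one mu(5))
  ultimately show ?thesis by (rule that)
qed

section \<open>Iterated integrals over cubes\<close>

text \<open>The gauge integral, one coordinate at a time with the first one outermost. It has a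
  value for every function; additivity and Fubini are therefore stated for \<open>contc\<close>
  integrands.\<close>

fun nint :: "nat \<Rightarrow> real path \<Rightarrow> real" where
  "nint 0 f = f []"
| "nint (Suc k) f = integral {0..1} (\<lambda>x. nint k (\<lambda>xs. f (x # xs)))"

lemma contc_integral_last:
  fixes g :: "real path"
  assumes "contc (Suc m) g"
  shows "contc m (\<lambda>ps. integral {0..1} (\<lambda>y. g (ps @ [y])))"
proof -
  have "continuous_on (boxf \<times> {0..1}) (\<lambda>p. g (map (\<lambda>j. if j < m then fst p j else snd p) [0..<Suc m]))"
  proof (rule contc_comp_on[OF assms])
    fix j assume "j < Suc m"
    have "continuous_on (boxf \<times> {0..1::real}) (\<lambda>p. fst p j)"
      by (rule continuous_on_compose2[OF continuous_on_product_coordinates[of j] continuous_on_fst[OF continuous_on_id]]) simp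
    moreover have "continuous_on (boxf \<times> {0..1::real}) (\<lambda>p. snd p)"
      by (rule continuous_on_snd[OF continuous_on_id])
    ultimately show "continuous_on (boxf \<times> {0..1}) (\<lambda>p. if j < m then fst p j else snd p)"
      by (rule continuous_on_if_const)
  qed (auto simp: boxf_def)
  moreover have e: "map (\<lambda>j. if j < m then fst p j else snd p) [0..<Suc m] = map (fst p) [0..<m] @ [snd p]" for p :: "(nat \<Rightarrow> real) \<times> real"
    by simp
  ultimately have "continuous_on (boxf \<times> cbox 0 1) (\<lambda>(x, t). g (map x [0..<m] @ [t]))"
    unfolding e by (simp add: split_beta')
  from integral_continuous_on_param[OF this] show ?thesis by (simp add: contc_def)
qed

lemma contc_nint:
  "contc (m + k) f \<Longrightarrow> contc m (\<lambda>ps. nint k (\<lambda>xs. f (ps @ xs)))"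
proof (induction k arbitrary: m)
  case 0 then show ?case by simp
next
  case (Suc k)
  have "contc (Suc m) (\<lambda>ps. nint k (\<lambda>xs. f (ps @ xs)))" using Suc.IH[of "Suc m"] Suc.prems by simp
  from contc_integral_last[OF this] show ?case by simp
qed

lemma contc_shift:
  assumes "contc (Suc k) f" "y \<in> {0..1}" shows "contc k (\<lambda>xs. f (y # xs))"
proof -
  have "continuous_on boxf (\<lambda>x. f (map (\<lambda>j. if j = 0 then y else x (j - 1)) [0..<Suc k]))"
  proof (rule contc_comp_on[OF assms(1)])
    fix j assume "j < Suc k"
    have "continuous_on boxf (\<lambda>x::nat \<Rightarrow> real. x (j - 1))"
      by (rule continuous_on_subset[OF continuous_on_product_coordinates]) simp
    then show "continuous_on boxf (\<lambda>x. if j = 0 then y else x (j - 1))"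
      by (rule continuous_on_if_const[OF continuous_on_const])
  qed (use assms(2) in \<open>auto simp: boxf_def\<close>)
  moreover have "map (\<lambda>j. if j = 0 then y else x (j - 1)) [0..<Suc k] = y # map x [0..<k]" for x :: "nat \<Rightarrow> real"
    by (simp add: upt_conv_Cons map_Suc_upt[symmetric] comp_def del: upt_Suc)
  ultimately show ?thesis by (simp add: contc_def)
qed

lemma contc_inner_continuous:
  assumes "contc (Suc k) f"
  shows "continuous_on {0..1} (\<lambda>y. nint k (\<lambda>xs. f (y # xs)))"
proof -
  have "contc 1 (\<lambda>ps. nint k (\<lambda>xs. f (ps @ xs)))" using contc_nint[of 1 k f] assms by simp
  from contc_comp_on[OF this, of "{0..1}" "\<lambda>_ y. y"] show ?thesis by simp
qed

lemma contc_inner_integrable: "contc (Suc k) f \<Longrightarrow> (\<lambda>y. nint k (\<lambda>xs. f (y # xs))) integrable_on {0..1}"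
  using contc_inner_continuous integrable_continuous_interval by blast

lemma cube_Cons: "y # xs \<in> cube (Suc k) \<longleftrightarrow> y \<in> {0..1} \<and> xs \<in> cube k"
  by (auto simp: cube_def)

lemma nint_cong: "(\<And>xs. xs \<in> cube k \<Longrightarrow> f xs = g xs) \<Longrightarrow> nint k f = nint k g"
proof (induction k arbitrary: f g)
  case 0 then show ?case by (simp add: cube_def)
next
  case (Suc k)
  have "nint k (\<lambda>xs. f (y # xs)) = nint k (\<lambda>xs. g (y # xs))" if "y \<in> {0..1}" for y
    by (rule Suc.IH, rule Suc.prems) (use that in \<open>simp add: cube_Cons\<close>)
  then show ?case unfolding nint.simps by (rule integral_cong)
qed

lemma nint_zero: "nint k (\<lambda>_. 0) = 0"
  by (induction k) simp_all

lemma nint_add: "contc k f \<Longrightarrow> contc k g \<Longrightarrow> nint k (\<lambda>xs. f xs + g xs) = nint k f + nint k g"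
proof (induction k arbitrary: f g)
  case 0 then show ?case by simp
next
  case (Suc k)
  have "nint k (\<lambda>xs. f (y # xs) + g (y # xs)) = nint k (\<lambda>xs. f (y # xs)) + nint k (\<lambda>xs. g (y # xs))" if "y \<in> {0..1}" for y
    by (rule Suc.IH[OF contc_shift[OF Suc.prems(1) that] contc_shift[OF Suc.prems(2) that]])
  then have "nint (Suc k) (\<lambda>xs. f xs + g xs) = integral {0..1} (\<lambda>y. nint k (\<lambda>xs. f (y # xs)) + nint k (\<lambda>xs. g (y # xs)))"
    unfolding nint.simps by (rule integral_cong)
  also have "\<dots> = nint (Suc k) f + nint (Suc k) g"
    unfolding nint.simps by (rule Henstock_Kurzweil_Integration.integral_add[OF contc_inner_integrable[OF Suc.prems(1)] contc_inner_integrable[OF Suc.prems(2)]])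
  finally show ?case .
qed

lemma nint_cmult: "nint k (\<lambda>xs. c * f xs) = c * nint k f"
  by (induction k arbitrary: f) simp_all

lemma nint_append: "nint (m + k) f = nint m (\<lambda>ps. nint k (\<lambda>xs. f (ps @ xs)))"
  by (induction m arbitrary: f) simp_all

lemma contc_cmult: "contc k f \<Longrightarrow> contc k (\<lambda>xs. c * f xs :: real)"
  unfolding contc_def by (rule continuous_on_mult_left)

lemma nint_diff:
  assumes "contc k f" "contc k g" shows "nint k (\<lambda>xs. f xs - g xs) = nint k f - nint k g"
  using nint_add[OF assms(1) contc_cmult[OF assms(2), of "- 1"]] nint_cmult[of k "- 1" g] by simp

text \<open>The outermost integral moves inwards past one coordinate at a time; each exchange is
  Fubini's theorem for a continuous function of two variables.\<close>

lemma nint_swap: "contc (Suc k) f \<Longrightarrow> nint (Suc k) f = nint k (\<lambda>xs. integral {0..1} (\<lambda>y. f (y # xs)))"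
proof (induction k arbitrary: f)
  case 0 then show ?case by simp
next
  case (Suc k)
  let ?h = "\<lambda>y z. nint k (\<lambda>xs. f (y # z # xs))"
  have "contc 2 (\<lambda>ps. nint k (\<lambda>xs. f (ps @ xs)))" using contc_nint[of 2 k f] Suc.prems by simp
  then have "continuous_on ({0..1} \<times> {0..1}) (\<lambda>p. nint k (\<lambda>xs. f (map (\<lambda>j. if j = 0 then fst p else snd p) [0..<2] @ xs)))"
  proof (rule contc_comp_on)
    show "continuous_on ({0..1} \<times> {0..1}) (\<lambda>p. if j = 0 then fst p else snd p)" for j :: nat
      by (rule continuous_on_if_const[OF continuous_on_fst[OF continuous_on_id] continuous_on_snd[OF continuous_on_id]])
  qed (auto simp: mem_Times_iff)
  then have c: "continuous_on ({0..1} \<times> {0..1}) (\<lambda>p. ?h (fst p) (snd p))"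
    by (simp add: upt_rec numeral_2_eq_2)
  have "nint (Suc (Suc k)) f = integral {0..1} (\<lambda>y. integral {0..1} (\<lambda>z. ?h y z))" by simp
  also have "\<dots> = integral {0..1} (\<lambda>z. integral {0..1} (\<lambda>y. ?h y z))"
    using integral_swap_continuous[of 0 0 1 1 ?h] c by (simp add: split_beta' cbox_Pair_eq)
  also have "\<dots> = integral {0..1} (\<lambda>z. nint k (\<lambda>xs. integral {0..1} (\<lambda>y. f (y # z # xs))))"
  proof (rule integral_cong)
    fix z :: real assume z: "z \<in> {0..1}"
    have "contc (Suc k) (\<lambda>xs. f (map (\<lambda>j. if j = 0 then xs ! 0 else if j = 1 then z else xs ! (j - 1)) [0..<Suc (Suc k)]))"
    proof (rule contc_comp[OF Suc.prems])
      fix j assume j: "j < Suc (Suc k)"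
      show "contc (Suc k) (\<lambda>xs. if j = 0 then xs ! 0 else if j = 1 then z else xs ! (j - 1))"
        using j contc_nth[of 0 "Suc k"] contc_nth[of "j - 1" "Suc k"] contc_const[of "Suc k" z]
        by (cases "j = 0"; cases "j = 1") simp_all
      show "(if j = 0 then xs ! 0 else if j = 1 then z else xs ! (j - 1)) \<in> {0..1}" if "xs \<in> cube (Suc k)" for xs
        using cube_nth[OF that, of 0] cube_nth[OF that, of "j - 1"] j z by (cases "j = 0"; cases "j = 1") simp_all
    qed
    moreover have "map (\<lambda>j. if j = 0 then xs ! 0 else if j = 1 then z else xs ! (j - 1)) [0..<Suc (Suc k)] = hd xs # z # tl xs"
      if "xs \<in> cube (Suc k)" for xs
    proof -
      from that obtain y ys where xs: "xs = y # ys" by (cases xs) (auto simp: cube_def)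
      show ?thesis using that unfolding xs
        by (intro nth_equalityI) (auto simp: cube_def nth_Cons' Suc_diff_Suc numeral_2_eq_2 simp del: upt_Suc)
    qed
    ultimately have "contc (Suc k) (\<lambda>xs. f (hd xs # z # tl xs))"
      by (elim contc_cong[rotated]) (simp add: agree_def)
    from Suc.IH[OF this]
    show "integral {0..1} (\<lambda>y. ?h y z) = nint k (\<lambda>xs. integral {0..1} (\<lambda>y. f (y # z # xs)))" by simp
  qed
  finally show ?case by simp
qed

text \<open>For \<open>k = 0\<close> the first integral is moved to the innermost place and
  evaluated there. Otherwise the outermost coordinate is a parameter, and the induction applies
  inside its integral. The points of the right-hand side are those used by \<open>face k 1\<close>
  and \<open>face k 0\<close>.\<close>

lemma nint_FTC:
  assumes "k \<le> n" "contc (Suc n) F" "contc (Suc n) G"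
    and "\<And>xs. xs \<in> cube (Suc n) \<Longrightarrow> ((\<lambda>u. F (xs[k := u])) has_vector_derivative G xs) (at (xs ! k) within {0..1})"
  shows "nint (Suc n) G = nint n (\<lambda>xs. F (take k xs @ 1 # drop k xs)) - nint n (\<lambda>xs. F (take k xs @ 0 # drop k xs))"
  using assms
proof (induction k arbitrary: n F G)
  case 0
  have "nint (Suc n) G = nint n (\<lambda>xs. integral {0..1} (\<lambda>y. G (y # xs)))" by (rule nint_swap[OF 0(3)])
  also have "\<dots> = nint n (\<lambda>xs. F (1 # xs) - F (0 # xs))"
  proof (rule nint_cong)
    fix xs assume xs: "xs \<in> cube n"
    have "((\<lambda>y. G (y # xs)) has_integral (F (1 # xs) - F (0 # xs))) {0..1}"
    proof (rule fundamental_theorem_of_calculus)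
      fix y :: real assume "y \<in> {0..1}"
      then show "((\<lambda>y. F (y # xs)) has_vector_derivative G (y # xs)) (at y within {0..1})"
        using 0(4)[of "y # xs"] xs by (simp add: cube_Cons)
    qed simp
    then show "integral {0..1} (\<lambda>y. G (y # xs)) = F (1 # xs) - F (0 # xs)" by (rule integral_unique)
  qed
  also have "\<dots> = nint n (\<lambda>xs. F (1 # xs)) - nint n (\<lambda>xs. F (0 # xs))"
    by (rule nint_diff) (rule contc_shift[OF 0(2)], simp)+
  finally show ?case by simp
next
  case (Suc k)
  then obtain m where n: "n = Suc m" and k: "k \<le> m" by (cases n) auto
  have cF: "contc (Suc m) (\<lambda>xs. F (y # xs))" and cG: "contc (Suc m) (\<lambda>xs. G (y # xs))" if "y \<in> {0..1}" for y
    using contc_shift[OF Suc.prems(2) that] contc_shift[OF Suc.prems(3) that] n by simp_all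
  have side: "contc n (\<lambda>xs. F (take (Suc k) xs @ c # drop (Suc k) xs))" if c: "c \<in> {0..1}" for c
  proof -
    have "contc n (\<lambda>xs. F (map (\<lambda>j. if j < Suc k then xs ! j else if j = Suc k then c else xs ! (j - 1)) [0..<Suc n]))"
    proof (rule contc_comp[OF Suc.prems(2)])
      fix j assume j: "j < Suc n"
      show "contc n (\<lambda>xs. if j < Suc k then xs ! j else if j = Suc k then c else xs ! (j - 1))"
        using j Suc.prems(1) contc_nth[of j n] contc_nth[of "j - 1" n] contc_const[of n c]
        by (cases "j < Suc k"; cases "j = Suc k") simp_all
      show "(if j < Suc k then xs ! j else if j = Suc k then c else xs ! (j - 1)) \<in> {0..1}" if "xs \<in> cube n" for xs
        using cube_nth[OF that, of j] cube_nth[OF that, of "j - 1"] j Suc.prems(1) c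
        by (cases "j < Suc k"; cases "j = Suc k") simp_all
    qed
    moreover have "map (\<lambda>j. if j < Suc k then xs ! j else if j = Suc k then c else xs ! (j - 1)) [0..<Suc n] = take (Suc k) xs @ c # drop (Suc k) xs"
      if "xs \<in> cube n" for xs
      using that Suc.prems(1) by (intro nth_equalityI) (auto simp: cube_length nth_append nth_Cons' Suc_diff_Suc numeral_2_eq_2 simp del: upt_Suc)
    ultimately show ?thesis by (elim contc_cong[rotated]) (simp add: agree_def)
  qed
  have "nint (Suc n) G = integral {0..1} (\<lambda>y. nint (Suc m) (\<lambda>xs. G (y # xs)))" by (simp add: n)
  also have "\<dots> = integral {0..1} (\<lambda>y. nint m (\<lambda>xs. F (y # take k xs @ 1 # drop k xs)) - nint m (\<lambda>xs. F (y # take k xs @ 0 # drop k xs)))"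
  proof (rule integral_cong)
    fix y :: real assume y: "y \<in> {0..1}"
    show "nint (Suc m) (\<lambda>xs. G (y # xs)) = nint m (\<lambda>xs. F (y # take k xs @ 1 # drop k xs)) - nint m (\<lambda>xs. F (y # take k xs @ 0 # drop k xs))"
    proof (rule Suc.IH[OF k cF[OF y] cG[OF y]])
      fix xs assume "xs \<in> cube (Suc m)"
      then show "((\<lambda>u. F (y # xs[k := u])) has_vector_derivative G (y # xs)) (at (xs ! k) within {0..1})"
        using Suc.prems(4)[of "y # xs"] y by (simp add: cube_Cons n)
    qed
  qed
  also have "\<dots> = nint n (\<lambda>xs. F (take (Suc k) xs @ 1 # drop (Suc k) xs)) - nint n (\<lambda>xs. F (take (Suc k) xs @ 0 # drop (Suc k) xs))"
    using Henstock_Kurzweil_Integration.integral_diff[OF contc_inner_integrable contc_inner_integrable, OF side[of 1, unfolded n] side[of 0, unfolded n]]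
    by (simp add: n)
  finally show ?case .
qed

lemma contc_update:
  assumes "contc k f" "i < k" "continuous_on UNIV a" "\<And>u. u \<in> {0..1} \<Longrightarrow> a u \<in> {0..1}"
  shows "contc k (\<lambda>xs. f (xs[i := a (xs ! i)]) :: real)"
proof -
  have "contc k (\<lambda>xs. f (map (\<lambda>j. if j = i then a (xs ! i) else xs ! j) [0..<k]))"
  proof (rule contc_comp[OF assms(1)])
    fix j assume j: "j < k"
    show "contc k (\<lambda>xs. if j = i then a (xs ! i) else xs ! j)"
      using contc_real[OF assms(3) contc_nth[OF assms(2)]] contc_nth[OF j] by (cases "j = i") simp_all
    show "(if j = i then a (xs ! i) else xs ! j) \<in> {0..1}" if "xs \<in> cube k" for xs
      using cube_nth[OF that j] assms(4)[OF cube_nth[OF that assms(2)]] by (cases "j = i") simp_all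
  qed
  moreover have "map (\<lambda>j. if j = i then a (xs ! i) else xs ! j) [0..<k] = xs[i := a (xs ! i)]" if "xs \<in> cube k" for xs
    using that by (intro nth_equalityI) (auto simp: cube_length nth_list_update)
  ultimately show ?thesis by (elim contc_cong[rotated]) (simp add: agree_def)
qed

text \<open>The substitutions y / 2 and (y + 1) / 2 with Jacobian 1/2; they undo the double speed of
  \<open>pconcat\<close>.\<close>

lemma integral_halves:
  assumes "continuous_on {0..1} (f :: real \<Rightarrow> real)"
  shows "integral {0..1} f = integral {0..1} (\<lambda>y. 1 / 2 * f (y / 2)) + integral {0..1} (\<lambda>y. 1 / 2 * f ((y + 1) / 2))"
proof -
  have i: "f integrable_on {0..1}" by (rule integrable_continuous_interval[OF assms])
  have i1: "f integrable_on {0..1/2}" "f integrable_on {1/2..1}"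
    by (rule integrable_subinterval_real[OF i], simp)+
  have 1: "((\<lambda>x. f ((1/2) *\<^sub>R x + 0)) has_integral (1 / \<bar>1/2\<bar> ^ DIM(real)) *\<^sub>R integral {0..1/2} f) ((\<lambda>x. (1 / (1/2)) *\<^sub>R x + - ((1 / (1/2)) *\<^sub>R 0)) ` cbox 0 (1/2))"
    by (rule has_integral_affinity[of f "integral {0..1/2} f" 0 "1/2" "1/2" 0]) (use i1(1) in \<open>simp_all add: integrable_integral\<close>)
  have 2: "((\<lambda>x. f ((1/2) *\<^sub>R x + 1/2)) has_integral (1 / \<bar>1/2\<bar> ^ DIM(real)) *\<^sub>R integral {1/2..1} f) ((\<lambda>x. (1 / (1/2)) *\<^sub>R x + - ((1 / (1/2)) *\<^sub>R (1/2))) ` cbox (1/2) 1)"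
    by (rule has_integral_affinity[of f "integral {1/2..1} f" "1/2" 1 "1/2" "1/2"]) (use i1(2) in \<open>simp_all add: integrable_integral\<close>)
  have s1: "(\<lambda>x::real. (1 / (1/2)) *\<^sub>R x + - ((1 / (1/2)) *\<^sub>R 0)) ` cbox 0 (1/2) = {0..1}"
    using image_affinity_atLeastAtMost[of 2 0 0 "1/2"] by simp
  have s2: "(\<lambda>x::real. (1 / (1/2)) *\<^sub>R x + - ((1 / (1/2)) *\<^sub>R (1/2))) ` cbox (1/2) 1 = {0..1}"
    using image_affinity_atLeastAtMost[of 2 "- 1" "1/2" 1] by simp
  have 3: "integral {0..1} (\<lambda>y. f (y / 2)) = 2 * integral {0..1/2} f"
    using integral_unique[OF 1[unfolded s1]] by simp
  have 4: "integral {0..1} (\<lambda>y. f ((y + 1) / 2)) = 2 * integral {1/2..1} f"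
    using integral_unique[OF 2[unfolded s2]] by (simp add: add_divide_distrib)
  have "integral {0..1} f = integral {0..1/2} f + integral {1/2..1} f"
    using Henstock_Kurzweil_Integration.integral_combine[OF _ _ i, of "1/2"] by simp
  then show ?thesis using 3 4 by simp
qed

lemma nint_halves:
  assumes "i < k" "contc k f"
  shows "nint k f = nint k (\<lambda>xs. 1 / 2 * f (xs[i := xs ! i / 2])) + nint k (\<lambda>xs. 1 / 2 * f (xs[i := (xs ! i + 1) / 2]))"
  using assms
proof (induction i arbitrary: k f)
  case 0
  then obtain m where k: "k = Suc m" by (cases k) auto
  have c: "continuous_on {0..1} (\<lambda>y. nint m (\<lambda>xs. f (y # xs)))" using contc_inner_continuous 0(2) k by blast
  show ?case using integral_halves[OF c] unfolding k nint.simps nint_cmult by simp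
next
  case (Suc i)
  then obtain m where k: "k = Suc m" and i: "i < m" by (cases k) auto
  have c: "contc (Suc m) f" using Suc.prems(2) k by simp
  have a1: "contc (Suc m) (\<lambda>xs. 1 / 2 * f (xs[Suc i := xs ! Suc i / 2]))"
    by (rule contc_cmult, rule contc_update[OF c]) (use i in \<open>auto intro!: continuous_intros\<close>)
  have a2: "contc (Suc m) (\<lambda>xs. 1 / 2 * f (xs[Suc i := (xs ! Suc i + 1) / 2]))"
    by (rule contc_cmult, rule contc_update[OF c]) (use i in \<open>auto intro!: continuous_intros\<close>)
  have "nint (Suc m) f = integral {0..1} (\<lambda>y. nint m (\<lambda>xs. 1 / 2 * f (y # xs[i := xs ! i / 2])) + nint m (\<lambda>xs. 1 / 2 * f (y # xs[i := (xs ! i + 1) / 2])))"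
    unfolding nint.simps by (rule integral_cong) (rule Suc.IH[OF i contc_shift[OF c]])
  also have "\<dots> = integral {0..1} (\<lambda>y. nint m (\<lambda>xs. 1 / 2 * f (y # xs[i := xs ! i / 2]))) + integral {0..1} (\<lambda>y. nint m (\<lambda>xs. 1 / 2 * f (y # xs[i := (xs ! i + 1) / 2])))"
    using Henstock_Kurzweil_Integration.integral_add[OF contc_inner_integrable[OF a1] contc_inner_integrable[OF a2]] by simp
  finally show ?case by (simp add: k)
qed

section \<open>Determinants\<close>

text \<open>The position of an index in its order, by which \<open>sphere_form\<close> assigns list
  entries to the rows of its determinant.\<close>

definition rk :: "'n::{finite,linorder} \<Rightarrow> nat" where "rk k = card {j. j < k}"

lemma rk_bij: "bij_betw rk (UNIV :: 'n::{finite,linorder} set) {..<CARD('n)}"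
proof -
  have m: "rk a < rk b" if "a < b" for a b :: 'n
    unfolding rk_def by (rule psubset_card_mono) (use that in \<open>auto intro: less_trans\<close>)
  have inj: "inj (rk :: 'n \<Rightarrow> nat)"
    by (rule injI) (metis m less_irrefl linorder_neqE)
  have "rk k < CARD('n)" for k :: 'n
    unfolding rk_def by (rule psubset_card_mono) auto
  then have "rk ` (UNIV :: 'n set) \<subseteq> {..<CARD('n)}" by auto
  moreover have "card (rk ` (UNIV :: 'n set)) = CARD('n)" by (rule card_image[OF inj])
  ultimately have "rk ` (UNIV :: 'n set) = {..<CARD('n)}" by (intro card_subset_eq) simp_all
  then show ?thesis using inj by (simp add: bij_betw_def)
qed

lemma rk_less: "rk (k :: 'n::{finite,linorder}) < CARD('n)"
  using bij_betwE[OF rk_bij] by auto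

lemma rk_inj: "rk k = rk l \<longleftrightarrow> k = l"
  using bij_betw_imp_inj_on[OF rk_bij] by (auto dest: injD)

lemma rk_surj: "i < CARD('n::{finite,linorder}) \<Longrightarrow> \<exists>k :: 'n. rk k = i"
  using rk_bij[where 'n='n] unfolding bij_betw_def by (metis imageE lessThan_iff)

text \<open>Rows are numbered by naturals, so that they can be addressed like list positions and
  like coordinates of the cube.\<close>

definition Dt :: "(nat \<Rightarrow> real ^ 'n::{finite,linorder}) \<Rightarrow> real" where
  "Dt V = det (\<chi> k. V (rk k))"

lemma Dt_cong:
  fixes V :: "nat \<Rightarrow> real ^ 'n::{finite,linorder}"
  shows "(\<And>i. i < CARD('n) \<Longrightarrow> V i = V' i) \<Longrightarrow> Dt V = Dt V'"
  unfolding Dt_def by (simp add: rk_less)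

lemma Dt_linear:
  fixes V :: "nat \<Rightarrow> real ^ 'n::{finite,linorder}"
  assumes "i < CARD('n)" shows "linear (\<lambda>x. Dt (V(i := x)))"
proof -
  obtain k0 :: 'n where k0: "rk k0 = i" using rk_surj[OF assms] by blast
  have e: "Dt (V(i := x)) = det (\<chi> k. if k = k0 then x else V (rk k))" for x
    unfolding Dt_def by (rule arg_cong[where f=det]) (auto simp: vec_eq_iff k0[symmetric] rk_inj)
  show ?thesis unfolding e
  proof (rule linearI)
    show "det (\<chi> k. if k = k0 then x + y else V (rk k)) = det (\<chi> k. if k = k0 then x else V (rk k)) + det (\<chi> k. if k = k0 then y else V (rk k))" for x y
      by (rule det_row_add)
    show "det (\<chi> k. if k = k0 then c *\<^sub>R x else V (rk k)) = c *\<^sub>R det (\<chi> k. if k = k0 then x else V (rk k))" for c x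
      using det_row_mul[of k0 c "\<lambda>_. x" "\<lambda>k. V (rk k)", unfolded scalar_mult_eq_scaleR] by simp
  qed
qed

lemma Dt_equal:
  fixes V :: "nat \<Rightarrow> real ^ 'n::{finite,linorder}"
  assumes "i < CARD('n)" "j < CARD('n)" "i \<noteq> j" "V i = V j" shows "Dt V = 0"
proof -
  obtain k0 k1 :: 'n where k: "rk k0 = i" "rk k1 = j" using rk_surj[OF assms(1)] rk_surj[OF assms(2)] by blast
  then have "k0 \<noteq> k1" using assms(3) by auto
  then show ?thesis unfolding Dt_def by (rule det_identical_rows) (simp add: row_def k assms(4))
qed

lemma Dt_zero:
  fixes V :: "nat \<Rightarrow> real ^ 'n::{finite,linorder}"
  assumes "i < CARD('n)" "V i = 0" shows "Dt V = 0"
  using linear_0[OF Dt_linear[OF assms(1), of V]] assms(2) by (metis fun_upd_triv)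

text \<open>Polarization of \<open>Dt_equal\<close>: \<open>a + b\<close> is put into both rows and
  expanded.\<close>

lemma Dt_swap:
  fixes V :: "nat \<Rightarrow> real ^ 'n::{finite,linorder}"
  assumes "i < CARD('n)" "j < CARD('n)" "i \<noteq> j" shows "Dt (V(i := a, j := b)) = - Dt (V(i := b, j := a))"
proof -
  note Li = Dt_linear[OF assms(1)] and Lj = Dt_linear[OF assms(2)]
  have z: "Dt (V(i := x, j := x)) = 0" for x by (rule Dt_equal[OF assms]) (use assms in simp)
  have aj: "Dt (V(i := x, j := y + z)) = Dt (V(i := x, j := y)) + Dt (V(i := x, j := z))" for x y z
    by (rule linear_add[OF Lj])
  have ai: "Dt (V(i := x + y, j := z)) = Dt (V(i := x, j := z)) + Dt (V(i := y, j := z))" for x y z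
    using linear_add[OF Li, of "V(j := z)" x y] assms(3) by (simp add: fun_upd_twist[of i j])
  have "0 = Dt (V(i := a + b, j := a + b))" by (rule z[symmetric])
  also have "\<dots> = Dt (V(i := a, j := a + b)) + Dt (V(i := b, j := a + b))" by (rule ai)
  also have "\<dots> = Dt (V(i := a, j := b)) + Dt (V(i := b, j := a))" by (simp only: aj z add_0_left add_0_right)
  finally show ?thesis by simp
qed

text \<open>The linear relation is inserted as row \<open>i\<close> and expanded; every term except
  that of \<open>V i\<close> repeats a row.\<close>

lemma Dt_dep:
  fixes V :: "nat \<Rightarrow> real ^ 'n::{finite,linorder}"
  assumes "dep (CARD('n)) V" shows "Dt V = 0"
proof -
  from assms obtain c i where c: "i < CARD('n)" "c i \<noteq> 0" "(\<Sum>l<CARD('n). c l *\<^sub>R V l) = 0" unfolding dep_def by blast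
  note L = Dt_linear[OF c(1), of V]
  have "0 = Dt (V(i := \<Sum>l<CARD('n). c l *\<^sub>R V l))" unfolding c(3) using linear_0[OF L] by simp
  also have "\<dots> = (\<Sum>l<CARD('n). c l * Dt (V(i := V l)))"
    unfolding linear_sum[OF L] linear_scale[OF L] by simp
  also have "\<dots> = (\<Sum>l<CARD('n). if l = i then c i * Dt V else 0)"
  proof (rule sum.cong[OF refl])
    fix l assume l: "l \<in> {..<CARD('n)}"
    show "c l * Dt (V(i := V l)) = (if l = i then c i * Dt V else 0)"
    proof (cases "l = i")
      case False
      have "Dt (V(i := V l)) = 0" by (rule Dt_equal[of i l]) (use False l c(1) in auto)
      then show ?thesis using False by simp
    qed simp
  qed
  also have "\<dots> = c i * Dt V" using c(1) by simp
  finally show ?thesis using c(2) by simp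
qed

text \<open>The permutation expansion is differentiated factor by factor and regrouped into
  determinants with one differentiated row.\<close>

lemma Dt_derivative:
  fixes V :: "nat \<Rightarrow> real \<Rightarrow> real ^ 'n::{finite,linorder}"
  assumes "\<And>l. l < CARD('n) \<Longrightarrow> (V l has_vector_derivative V' l) (at u within S)"
  shows "((\<lambda>u. Dt (\<lambda>l. V l u)) has_vector_derivative (\<Sum>l<CARD('n). Dt ((\<lambda>l. V l u)(l := V' l)))) (at u within S)"
proof -
  let ?c = "\<lambda>k (p :: 'n \<Rightarrow> 'n) u. V (rk k) u $ p k"
  have comp: "(?c k p has_derivative (\<lambda>h. h * (V' (rk k) $ p k))) (at u within S)" for k p
    using bounded_linear.has_vector_derivative[OF bounded_linear_vec_nth assms[OF rk_less[of k]], of "p k"]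
    by (simp add: has_vector_derivative_def)
  have "((\<lambda>u. \<Sum>p | p permutes UNIV. of_int (sign p) * (\<Prod>k\<in>UNIV. ?c k p u)) has_derivative
     (\<lambda>h. \<Sum>p | p permutes UNIV. of_int (sign p) * (\<Sum>k\<in>UNIV. (h * (V' (rk k) $ p k)) * (\<Prod>k'\<in>UNIV - {k}. ?c k' p u)))) (at u within S)"
    by (intro has_derivative_sum has_derivative_mult_right has_derivative_prod comp)
  moreover have "(\<Sum>p | p permutes (UNIV :: 'n set). of_int (sign p) * (\<Sum>k\<in>UNIV. (h * (V' (rk k) $ p k)) * (\<Prod>k'\<in>UNIV - {k}. ?c k' p u)))
      = h * (\<Sum>l<CARD('n). Dt ((\<lambda>l. V l u)(l := V' l)))" for h
  proof -
    have "(\<Sum>p | p permutes (UNIV :: 'n set). of_int (sign p) * (\<Sum>k\<in>UNIV. (h * (V' (rk k) $ p k)) * (\<Prod>k'\<in>UNIV - {k}. ?c k' p u)))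
      = h * (\<Sum>k\<in>UNIV. \<Sum>p | p permutes (UNIV :: 'n set). of_int (sign p) * ((V' (rk k) $ p k) * (\<Prod>k'\<in>UNIV - {k}. ?c k' p u)))"
      by (subst sum.swap) (simp add: sum_distrib_left mult.assoc mult.left_commute)
    also have "(\<Sum>k\<in>UNIV. \<Sum>p | p permutes (UNIV :: 'n set). of_int (sign p) * ((V' (rk k) $ p k) * (\<Prod>k'\<in>UNIV - {k}. ?c k' p u)))
       = (\<Sum>k\<in>(UNIV :: 'n set). Dt ((\<lambda>l. V l u)(rk k := V' (rk k))))"
    proof (rule sum.cong[OF refl])
      fix k :: 'n
      have "(V' (rk k) $ p k) * (\<Prod>k'\<in>UNIV - {k}. ?c k' p u) = (\<Prod>k'\<in>UNIV. (((\<lambda>l. V l u)(rk k := V' (rk k))) (rk k')) $ p k')" for p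
      proof -
        let ?F = "\<lambda>k'. (((\<lambda>l. V l u)(rk k := V' (rk k))) (rk k')) $ p k'"
        have "(\<Prod>k'\<in>UNIV. ?F k') = ?F k * (\<Prod>k'\<in>UNIV - {k}. ?F k')" by (rule prod.remove) simp_all
        also have "(\<Prod>k'\<in>UNIV - {k}. ?F k') = (\<Prod>k'\<in>UNIV - {k}. ?c k' p u)"
          by (rule prod.cong) (simp_all add: rk_inj)
        finally show ?thesis by simp
      qed
      then show "(\<Sum>p | p permutes (UNIV :: 'n set). of_int (sign p) * ((V' (rk k) $ p k) * (\<Prod>k'\<in>UNIV - {k}. ?c k' p u))) =
         Dt ((\<lambda>l. V l u)(rk k := V' (rk k)))"
        unfolding Dt_def det_def by (simp add: sum_distrib_left)
    qed
    also have "\<dots> = (\<Sum>l<CARD('n). Dt ((\<lambda>l. V l u)(l := V' l)))"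
      by (rule sum.reindex_bij_betw[OF rk_bij])
    finally show ?thesis .
  qed
  ultimately show ?thesis
    by (simp add: has_vector_derivative_def Dt_def det_def)
qed

lemma Dt_continuous:
  fixes V :: "nat \<Rightarrow> 'a::topological_space \<Rightarrow> real ^ 'n::{finite,linorder}"
  assumes "\<And>l. l < CARD('n) \<Longrightarrow> continuous_on S (V l)"
  shows "continuous_on S (\<lambda>u. Dt (\<lambda>l. V l u))"
  unfolding Dt_def det_def
  by (intro continuous_intros) (simp add: continuous_on_component assms rk_less)

lemma contc_Dt:
  fixes V :: "nat \<Rightarrow> (real ^ 'n::{finite,linorder}) path"
  assumes "\<And>l. l < CARD('n) \<Longrightarrow> contc k (V l)"
  shows "contc k (\<lambda>xs. Dt (\<lambda>l. V l xs))"
  using assms unfolding contc_def by (rule Dt_continuous)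

text \<open>Differentiation under the integral sign works up to the boundary of the cube, where
  derivatives are one-sided. The integral of \<open>pd l \<alpha>\<close> over [0, b] in direction
  \<open>l\<close> is a difference of values of \<alpha>; differentiated in direction
  \<open>k\<close> this yields \<open>key\<close>, and \<open>key\<close> differentiated in
  \<open>b\<close> yields the claim.\<close>

lemma pd_symmetric:
  fixes \<alpha> :: "'v::euclidean_space path"
  assumes \<alpha>: "smooth_cube n \<alpha>" and kl: "k < n" "l < n" "k \<noteq> l" and xs: "xs \<in> cube n"
  shows "pd k (pd l \<alpha>) xs = pd l (pd k \<alpha>) xs"
proof -
  let ?pt = "\<lambda>u v. xs[k := u, l := v]"
  have pt: "?pt u v \<in> cube n" if "u \<in> {0..1}" "v \<in> {0..1}" for u v
    using cube_update[OF cube_update[OF xs that(1)] that(2)] .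
  have len: "length xs = n" by (rule cube_length[OF xs])
  have upd: "(?pt u v)[l := w] = ?pt u w" "(?pt u v)[k := w] = ?pt w v" "?pt u v ! k = u" "?pt u v ! l = v" for u v w
    using kl len by (simp_all add: list_update_swap[of k l])
  note sl = smooth_pd[OF \<alpha> kl(2)] and sk = smooth_pd[OF \<alpha> kl(1)]
  have dl: "((\<lambda>v. \<beta> (?pt u v)) has_vector_derivative pd l \<beta> (?pt u v)) (at v within {0..1})"
    if "smooth_cube n \<beta>" "u \<in> {0..1}" "v \<in> {0..1}" for \<beta> :: "'v path" and u v
    using pd_has_derivative[OF smooth_diffc[OF that(1)] kl(2) pt[OF that(2,3)]] by (simp only: upd)
  have dk: "((\<lambda>u. \<beta> (?pt u v)) has_vector_derivative pd k \<beta> (?pt u v)) (at u within {0..1})"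
    if "smooth_cube n \<beta>" "u \<in> {0..1}" "v \<in> {0..1}" for \<beta> :: "'v path" and u v
    using pd_has_derivative[OF smooth_diffc[OF that(1)] kl(1) pt[OF that(2,3)]] by (simp only: upd)
  have cont2: "continuous_on ({0..1} \<times> {0..1}) (\<lambda>p. \<beta> (?pt (fst p) (snd p)))" if "smooth_cube n \<beta>" for \<beta> :: "'v path"
  proof -
    have "continuous_on ({0..1} \<times> {0..1}) (\<lambda>p. \<beta> (map (\<lambda>j. if j = l then snd p else if j = k then fst p else xs ! j) [0..<n]))"
    proof (rule contc_comp_on[OF smooth_contc[OF that]])
      fix j assume j: "j < n"
      show "continuous_on ({0..1} \<times> {0..1}) (\<lambda>p. if j = l then snd p else if j = k then fst p else xs ! j)"
        by (intro continuous_on_if_const continuous_on_fst continuous_on_snd continuous_on_id continuous_on_const)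
      show "(if j = l then snd p else if j = k then fst p else xs ! j) \<in> {0..1}" if "p \<in> {0..1} \<times> {0..1}" for p
        using that cube_nth[OF xs j] by (cases p) simp
    qed
    moreover have "map (\<lambda>j. if j = l then b else if j = k then a else xs ! j) [0..<n] = ?pt a b" for a b
      by (intro nth_equalityI) (auto simp: len nth_list_update)
    ultimately show ?thesis by simp
  qed
  let ?kl = "\<lambda>u v. pd k (pd l \<alpha>) (?pt u v)"
  have skl: "smooth_cube n (pd k (pd l \<alpha>))" by (rule smooth_pd[OF sl kl(1)])
  have c1: "continuous_on {0..1} (\<lambda>v. \<beta> (?pt u v))" if "smooth_cube n \<beta>" "u \<in> {0..1}" for \<beta> :: "'v path" and u
    using dl[OF that] has_vector_derivative_continuous unfolding continuous_on_eq_continuous_within by blast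
  have key: "pd k \<alpha> (?pt u b) - pd k \<alpha> (?pt u 0) = integral {0..b} (?kl u)" if u: "u \<in> {0..1}" and b: "b \<in> {0..1}" for u b
  proof -
    have sub: "{0..b} \<subseteq> {0..1}" using b by simp
    have ftc: "integral {0..b} (\<lambda>v. pd l \<alpha> (?pt u v)) = \<alpha> (?pt u b) - \<alpha> (?pt u 0)" if "u \<in> {0..1}" for u
    proof (rule integral_unique, rule fundamental_theorem_of_calculus)
      show "0 \<le> b" using b by simp
      fix v assume "v \<in> {0..b}"
      then have "v \<in> {0..1}" using sub by blast
      from has_vector_derivative_within_subset[OF dl[OF \<alpha> that this] sub]
      show "((\<lambda>v. \<alpha> (?pt u v)) has_vector_derivative pd l \<alpha> (?pt u v)) (at v within {0..b})" .
    qed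
    have "((\<lambda>u. integral (cbox 0 b) (\<lambda>v. pd l \<alpha> (?pt u v))) has_vector_derivative integral (cbox 0 b) (?kl u)) (at u within {0..1})"
    proof (rule leibniz_rule_vector_derivative[OF _ _ _ u])
      show "((\<lambda>u. pd l \<alpha> (?pt u v)) has_vector_derivative ?kl u v) (at u within {0..1})" if "u \<in> {0..1}" "v \<in> cbox 0 b" for u v
        by (rule dk[OF sl that(1)]) (use that sub in auto)
      show "(\<lambda>v. pd l \<alpha> (?pt u v)) integrable_on cbox 0 b" if "u \<in> {0..1}" for u
        using integrable_continuous_interval[OF continuous_on_subset[OF c1[OF sl that] sub]] by simp
      have "continuous_on ({0..1} \<times> {0..b}) (\<lambda>p. ?kl (fst p) (snd p))"
        by (rule continuous_on_subset[OF cont2[OF skl]]) (use sub in auto)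
      then show "continuous_on ({0..1} \<times> cbox 0 b) (\<lambda>(u, v). ?kl u v)" by (simp add: split_beta')
    qed simp
    then have 1: "((\<lambda>u. integral {0..b} (\<lambda>v. pd l \<alpha> (?pt u v))) has_vector_derivative integral {0..b} (?kl u)) (at u within {0..1})"
      by simp
    have 2: "((\<lambda>u. integral {0..b} (\<lambda>v. pd l \<alpha> (?pt u v))) has_vector_derivative (pd k \<alpha> (?pt u b) - pd k \<alpha> (?pt u 0))) (at u within {0..1})"
    proof (rule has_vector_derivative_transform[OF u ftc])
      have z: "(0::real) \<in> {0..1}" by simp
      show "((\<lambda>u. \<alpha> (?pt u b) - \<alpha> (?pt u 0)) has_vector_derivative (pd k \<alpha> (?pt u b) - pd k \<alpha> (?pt u 0))) (at u within {0..1})"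
        by (rule has_vector_derivative_diff[OF dk[OF \<alpha> u b] dk[OF \<alpha> u z]])
    qed
    show ?thesis
      using vector_derivative_within_closed_interval[OF zero_less_one u 1]
        vector_derivative_within_closed_interval[OF zero_less_one u 2] by simp
  qed
  let ?u = "xs ! k" and ?v = "xs ! l"
  have u: "?u \<in> {0..1}" and v: "?v \<in> {0..1}" using cube_nth[OF xs] kl by blast+
  have 1: "((\<lambda>b. integral {0..b} (?kl ?u)) has_vector_derivative ?kl ?u ?v) (at ?v within {0..1})"
    by (rule integral_has_vector_derivative[OF c1[OF skl u] v])
  have 2: "((\<lambda>b. integral {0..b} (?kl ?u)) has_vector_derivative pd l (pd k \<alpha>) (?pt ?u ?v)) (at ?v within {0..1})"
  proof (rule has_vector_derivative_transform[OF v])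
    show "((\<lambda>b. pd k \<alpha> (?pt ?u b) - pd k \<alpha> (?pt ?u 0)) has_vector_derivative pd l (pd k \<alpha>) (?pt ?u ?v)) (at ?v within {0..1})"
      using has_vector_derivative_diff[OF dl[OF sk u v] has_vector_derivative_const] by simp
    show "integral {0..b} (?kl ?u) = pd k \<alpha> (?pt ?u b) - pd k \<alpha> (?pt ?u 0)" if "b \<in> {0..1}" for b
      by (rule key[OF u that, symmetric])
  qed
  have "?kl ?u ?v = pd l (pd k \<alpha>) (?pt ?u ?v)"
    using vector_derivative_within_closed_interval[OF zero_less_one v 1]
      vector_derivative_within_closed_interval[OF zero_less_one v 2] by simp
  then show ?thesis by simp
qed

section \<open>Comparison with the Lebesgue integral over a product measure\<close>

lemma compact_boxf: "compact boxf"
proof -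
  have "compactin (product_topology (\<lambda>_::nat. euclidean) UNIV) (PiE UNIV (\<lambda>_. {0..1::real}))"
    unfolding compactin_PiE by simp
  moreover have "PiE UNIV (\<lambda>_::nat. {0..1::real}) = boxf" by (auto simp: boxf_def)
  ultimately show ?thesis by (simp add: euclidean_product_topology)
qed

text \<open>Turns the set integrals of \<open>iterated_integral\<close> into \<open>nint\<close>.
  Integrability holds for a bounded measurable function on a set of finite measure; the value is
  found by splitting off the last coordinate with Fubini's theorem.\<close>

lemma LINT_nint:
  fixes f :: "real path"
  assumes "contc k f"
  shows "integrable (Pi\<^sub>M {..<k} (\<lambda>_. lborel)) (\<lambda>x. indicator {x. \<forall>i<k. x i \<in> {0..1}} x *\<^sub>R f (map x [0..<k]))" (is "integrable ?M ?F")
    and "(LINT x : {x. \<forall>i<k. x i \<in> {0..1}} | Pi\<^sub>M {..<k} (\<lambda>_. lborel). f (map x [0..<k])) = nint k f"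
proof -
  have int: "integrable (Pi\<^sub>M {..<k} (\<lambda>_. lborel)) (\<lambda>x. indicator {x. \<forall>i<k. x i \<in> {0..1}} x *\<^sub>R f (map x [0..<k]))"
    if f: "contc k f" for f :: "real path" and k
  proof -
    let ?M = "Pi\<^sub>M {..<k} (\<lambda>_. lborel :: real measure)"
    let ?R = "{x. \<forall>i<k. x i \<in> {0..1::real}}"
    \<comment> \<open>\<open>f\<close> is only controlled on the cube, so measurability is shown for
      its composite with two maps: \<open>?e\<close> extends a point of the product space by 0, and
      \<open>?C\<close> clamps coordinates to the unit interval. On the cube \<open>f\<close> does
      not notice either of them.\<close>
    let ?C = "\<lambda>(x :: nat \<Rightarrow> real) i. max 0 (min 1 (x i))"
    let ?e = "\<lambda>(x :: nat \<Rightarrow> real) i. if i < k then x i else 0"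
    let ?h = "\<lambda>x. f (map x [0..<k])"
    have "continuous_on UNIV (\<lambda>x. ?C x i)" for i
      by (intro continuous_intros continuous_on_product_coordinates)
    then have "continuous_on UNIV ?C" by (rule continuous_on_coordinatewise_then_product)
    moreover have "?C ` UNIV \<subseteq> boxf" by (auto simp: boxf_def)
    ultimately have "continuous_on UNIV (\<lambda>x. ?h (?C x))"
      using continuous_on_compose2[of boxf ?h UNIV ?C] f by (simp add: contc_def)
    then have hm: "(\<lambda>x. ?h (?C x)) \<in> borel_measurable borel" by (rule borel_measurable_continuous_onI)
    have "?e \<in> measurable ?M (Pi\<^sub>M UNIV (\<lambda>_. borel))"
    proof (rule measurable_PiM_single')
      fix i :: nat
      show "(\<lambda>x. ?e x i) \<in> borel_measurable ?M"
      proof (cases "i < k")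
        case True
        have "(\<lambda>x. x i) \<in> measurable ?M lborel" by (rule measurable_component_singleton) (use True in simp)
        then show ?thesis using True by simp
      qed simp
    qed (auto simp: space_PiM)
    then have em: "?e \<in> measurable ?M borel"
      using measurable_cong_sets[OF refl sets_PiM_equal_borel] by blast
    have Rm: "?R \<inter> space ?M \<in> sets ?M"
    proof -
      have "?R \<inter> space ?M = PiE {..<k} (\<lambda>_. {0..1})" by (auto simp: space_PiM PiE_def Pi_def)
      then show ?thesis by (simp add: sets_PiM_I_finite)
    qed
    have cmp: "(\<lambda>x. ?h (?C (?e x))) \<in> borel_measurable ?M" using measurable_compose[OF em hm] .
    have eq: "indicator ?R x *\<^sub>R f (map x [0..<k]) = indicator (?R \<inter> space ?M) x *\<^sub>R ?h (?C (?e x))" if "x \<in> space ?M" for x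
    proof (cases "x \<in> ?R")
      case True
      then have m: "map (?C (?e x)) [0..<k] = map x [0..<k]" by auto
      show ?thesis unfolding m using True that by simp
    qed simp
    obtain D where D: "\<And>y. y \<in> boxf \<Longrightarrow> norm (?h y) \<le> D"
    proof -
      have "compact (?h ` boxf)" using f unfolding contc_def by (rule compact_continuous_image[OF _ compact_boxf])
      then have "bounded (?h ` boxf)" by (rule compact_imp_bounded)
      then show ?thesis using that unfolding bounded_iff by auto
    qed
    have D0: "0 \<le> D" using norm_ge_zero order_trans D[of "\<lambda>_. 0"] by (force simp: boxf_def)
    interpret product_sigma_finite "\<lambda>_::nat. lborel :: real measure" by standard
    have fin: "emeasure ?M (?R \<inter> space ?M) < \<infinity>"
    proof -
      have "?R \<inter> space ?M = PiE {..<k} (\<lambda>_. {0..1})" by (auto simp: space_PiM PiE_def Pi_def)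
      then have "emeasure ?M (?R \<inter> space ?M) = (\<Prod>i<k. emeasure lborel {0..1::real})"
        using emeasure_PiM[of "{..<k}" "\<lambda>_. {0..1}"] by simp
      then show ?thesis by simp
    qed
    have "integrable ?M (\<lambda>x. indicator (?R \<inter> space ?M) x *\<^sub>R ?h (?C (?e x)))"
    proof (rule Bochner_Integration.integrable_bound)
      show "integrable ?M (\<lambda>x. indicator (?R \<inter> space ?M) x *\<^sub>R D)"
        by (rule integrable_scaleR_left, rule integrable_real_indicator[OF Rm fin])
      show "(\<lambda>x. indicator (?R \<inter> space ?M) x *\<^sub>R ?h (?C (?e x))) \<in> borel_measurable ?M"
        using Rm cmp by (intro borel_measurable_scaleR borel_measurable_indicator) simp_all
      have b: "norm (?h (?C y)) \<le> norm D" for y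
      proof -
        have "?C y \<in> boxf" by (auto simp: boxf_def)
        from D[OF this] D0 show ?thesis by simp
      qed
      show "AE x in ?M. norm (indicator (?R \<inter> space ?M) x *\<^sub>R ?h (?C (?e x))) \<le> norm (indicator (?R \<inter> space ?M) x *\<^sub>R D)"
        unfolding norm_scaleR by (intro AE_I2 mult_left_mono[OF b]) simp
    qed
    then show ?thesis by (subst Bochner_Integration.integrable_cong[OF refl eq])
  qed
  show "integrable ?M ?F" by (rule int[OF assms])
  show "(LINT x : {x. \<forall>i<k. x i \<in> {0..1}} | Pi\<^sub>M {..<k} (\<lambda>_. lborel). f (map x [0..<k])) = nint k f"
    using assms
  proof (induction k arbitrary: f)
    case 0
    show ?case
      by (simp add: set_lebesgue_integral_def PiM_empty lebesgue_integral_count_space_finite)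
  next
    case (Suc k)
    interpret product_sigma_finite "\<lambda>_::nat. lborel :: real measure" by standard
    let ?g = "\<lambda>ps. integral {0..1} (\<lambda>y. f (ps @ [y]))"
    let ?R = "\<lambda>k. {x. \<forall>i<k. x i \<in> {0..1::real}}"
    have c: "contc k ?g" by (rule contc_integral_last[OF Suc.prems])
    have S: "{..<Suc k} = insert k {..<k}" by auto
    have inner: "(LINT y|lborel. indicator (?R (Suc k)) (x(k := y)) *\<^sub>R f (map (x(k := y)) [0..<Suc k])) =
        indicator (?R k) x *\<^sub>R ?g (map x [0..<k])" for x
    proof (cases "x \<in> ?R k")
      case True
      have mc: "map x [0..<k] \<in> cube k" using True by (intro cube_map) auto
      have "continuous_on {0..1} (\<lambda>y. f (map (\<lambda>j. if j = k then y else x j) [0..<Suc k]))"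
        using True by (intro contc_comp_on[OF Suc.prems] continuous_on_if_const continuous_on_id continuous_on_const) auto
      moreover have m: "map (\<lambda>j. if j = k then y else x j) [0..<Suc k] = map x [0..<k] @ [y]" for y by simp
      ultimately have "continuous_on {0..1} (\<lambda>y. f (map x [0..<k] @ [y]))" by (simp only: m)
      note si = set_borel_integral_eq_integral(2)[OF borel_integrable_atLeastAtMost'[OF this]]
      have e: "indicator (?R (Suc k)) (x(k := y)) *\<^sub>R f (map (x(k := y)) [0..<Suc k]) = indicator {0..1} y *\<^sub>R f (map x [0..<k] @ [y])" for y
        using True by (auto simp: indicator_def less_Suc_eq)
      show ?thesis unfolding e using si True unfolding set_lebesgue_integral_def by simp
    next
      case False
      then have "x(k := y) \<notin> ?R (Suc k)" for y by (auto simp: less_Suc_eq)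
      then show ?thesis using False by simp
    qed
    have "(LINT x : ?R (Suc k) | Pi\<^sub>M {..<Suc k} (\<lambda>_. lborel). f (map x [0..<Suc k])) =
      (LINT x|Pi\<^sub>M {..<k} (\<lambda>_. lborel). LINT y|lborel. indicator (?R (Suc k)) (x(k := y)) *\<^sub>R f (map (x(k := y)) [0..<Suc k]))"
      unfolding set_lebesgue_integral_def S
      by (rule product_integral_insert) (use int[OF Suc.prems] in \<open>simp_all add: S\<close>)
    also have "\<dots> = (LINT x : ?R k | Pi\<^sub>M {..<k} (\<lambda>_. lborel). ?g (map x [0..<k]))"
      unfolding inner set_lebesgue_integral_def ..
    also have "\<dots> = nint k ?g" by (rule Suc.IH[OF c])
    \<comment> \<open>\<open>nint\<close> splits off the first coordinate, whereas here the last one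
      was split off; \<open>nint_append\<close> reconciles the two.\<close>
    also have "\<dots> = nint (Suc k) f" using nint_append[of k 1 f] by simp
    finally show ?case .
  qed
qed

section \<open>Alternating functions and the wedge product of a single form\<close>

lemma Dt_list_swap:
  fixes u :: "real ^ 'n::{finite,linorder}"
  assumes "CARD('n) = Suc p" "length ws = p" "a < p" "b < p" "a \<noteq> b"
  shows "Dt (\<lambda>l. (u # ws[a := ws ! b, b := ws ! a]) ! l) = - Dt (\<lambda>l. (u # ws) ! l)"
proof -
  let ?V = "\<lambda>l. (u # ws) ! l"
  have "Dt (\<lambda>l. (u # ws[a := ws ! b, b := ws ! a]) ! l) = Dt (?V(Suc a := ws ! b, Suc b := ws ! a))"
    by (rule Dt_cong) (use assms in \<open>auto simp: nth_Cons nth_list_update split: nat.split\<close>)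
  also have "\<dots> = - Dt (?V(Suc a := ws ! a, Suc b := ws ! b))"
    by (rule Dt_swap) (use assms in simp_all)
  also have "?V(Suc a := ws ! a, Suc b := ws ! b) = ?V" by auto
  finally show ?thesis .
qed

text \<open>Permutations are built from transpositions, each of which exchanges two arguments and
  reverses both signs.\<close>

lemma alternating_permutes:
  fixes f :: "'w list \<Rightarrow> real"
  assumes alt: "\<And>ws a b. length ws = p \<Longrightarrow> a < p \<Longrightarrow> b < p \<Longrightarrow> a \<noteq> b \<Longrightarrow> f (ws[a := ws ! b, b := ws ! a]) = - f ws"
    and "\<pi> permutes {..<p}" "length ws = p"
  shows "f (map (\<lambda>i. ws ! \<pi> i) [0..<p]) = of_int (sign \<pi>) * f ws"
proof -
  have "\<forall>ws. length ws = p \<longrightarrow> f (map (\<lambda>i. ws ! \<pi> i) [0..<p]) = of_int (sign \<pi>) * f ws"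
    using assms(2) finite_lessThan[of p]
  proof (induction rule: permutes_induct)
    case id
    show ?case by (metis (mono_tags, lifting) id_apply map_nth mult_1 of_int_1 sign_id map_cong)
  next
    case (swap a b \<rho>)
    have a: "a < p" "b < p" using swap by auto
    show ?case
    proof (intro allI impI)
      fix ws :: "'w list" assume l: "length ws = p"
      let ?ws = "ws[a := ws ! b, b := ws ! a]"
      have "ws ! ((Transposition.transpose a b \<circ> \<rho>) i) = ?ws ! \<rho> i" if "i < p" for i
      proof -
        have "\<rho> i < p" using permutes_in_image[OF swap(4), of i] that by simp
        then show ?thesis using a l by (auto simp: nth_list_update Transposition.transpose_def)
      qed
      then have m: "map (\<lambda>i. ws ! ((Transposition.transpose a b \<circ> \<rho>) i)) [0..<p] = map (\<lambda>i. ?ws ! \<rho> i) [0..<p]" by simp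
      have "f (map (\<lambda>i. ws ! ((Transposition.transpose a b \<circ> \<rho>) i)) [0..<p]) = of_int (sign \<rho>) * f ?ws"
        unfolding m using swap(5)[rule_format, of ?ws] l by simp
      also have "\<dots> = - (of_int (sign \<rho>) * f ws)" using alt[OF l a swap(3)] by simp
      also have "\<dots> = of_int (sign (Transposition.transpose a b \<circ> \<rho>)) * f ws"
        using sign_compose[OF permutation_swap_id permutes_imp_permutation[OF finite_lessThan swap(4)], of a b] swap(3)
        by (simp add: sign_swap_id)
      finally show "f (map (\<lambda>i. ws ! ((Transposition.transpose a b \<circ> \<rho>) i)) [0..<p]) = of_int (sign (Transposition.transpose a b \<circ> \<rho>)) * f ws" .
    qed
  qed
  then show ?thesis using assms(3) by blast
qed

text \<open>\<open>wedges\<close> multiplies with the unit 0-form by summing over all permutations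
  of the arguments; for an alternating form the p! terms are equal and cancel the normalizing
  factor.\<close>

lemma wedges_single:
  fixes f :: "'w list \<Rightarrow> real"
  assumes alt: "\<And>ws a b. length ws = p \<Longrightarrow> a < p \<Longrightarrow> b < p \<Longrightarrow> a \<noteq> b \<Longrightarrow> f (ws[a := ws ! b, b := ws ! a]) = - f ws"
    and l: "length ws = p"
  shows "snd (wedges [(p, f)]) ws = f ws"
proof -
  have "snd (wedges [(p, f)]) ws = (\<Sum>\<pi> | \<pi> permutes {..<p}. of_int (sign \<pi>) * f (map (\<lambda>i. ws ! \<pi> i) [0..<p])) / fact p"
    by (simp add: wedges_def wedge_def)
  also have "(\<Sum>\<pi> | \<pi> permutes {..<p}. of_int (sign \<pi>) * f (map (\<lambda>i. ws ! \<pi> i) [0..<p])) = (\<Sum>\<pi> | \<pi> permutes {..<p}. f ws)"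
  proof (rule sum.cong[OF refl])
    fix \<pi> assume "\<pi> \<in> {\<pi>. \<pi> permutes {..<p}}"
    then have "\<pi> permutes {..<p}" by simp
    from alternating_permutes[of p f, OF alt this l]
    show "of_int (sign \<pi>) * f (map (\<lambda>i. ws ! \<pi> i) [0..<p]) = f ws"
      by (simp add: sign_def)
  qed
  also have "\<dots> = fact p * f ws" using card_permutations[of "{..<p}" p] by simp
  finally show ?thesis by simp
qed

section \<open>Stokes' theorem for the volume form of the sphere\<close>

definition direction :: "'m \<Rightarrow> 'm \<Rightarrow> ((real ^ 'n) ^ 'm) path \<Rightarrow> (real ^ 'n) path" where
  "direction i j J xs = sgn (J xs $ j - J xs $ i)"

abbreviation dsgn :: "real ^ 'n \<Rightarrow> real ^ 'n \<Rightarrow> real ^ 'n" where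
  "dsgn v \<equiv> frechet_derivative sgn (at v)"

lemma sgn_has_derivative:
  fixes v :: "real ^ 'n"
  assumes "v \<noteq> 0" shows "(sgn has_derivative dsgn v) (at v)"
proof -
  have "(\<lambda>v :: real ^ 'n. inverse (norm v) *\<^sub>R v) differentiable (at v)"
    using assms by (intro derivative_intros) simp_all
  moreover have "(\<lambda>v :: real ^ 'n. inverse (norm v) *\<^sub>R v) = sgn" by (simp add: sgn_div_norm fun_eq_iff)
  ultimately show ?thesis by (simp add: frechet_derivative_works)
qed

lemma linear_dsgn: "v \<noteq> 0 \<Longrightarrow> linear (dsgn v)"
  using sgn_has_derivative has_derivative_linear by blast

lemma bounded_linear_nth_diff: "bounded_linear (\<lambda>w :: (real ^ 'n) ^ 'm. w $ j - w $ i)"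
  by (rule bounded_linear_sub[OF bounded_linear_vec_nth bounded_linear_vec_nth])

text \<open>On \<open>Conf\<close> the difference v of two different points of the configuration is
  nonzero, and \<open>sgn v\<close> is the smooth expression (v . v)^(-1/2) v.\<close>

lemma smooth_direction:
  assumes "smooth_cube k J" "\<And>xs. xs \<in> cube k \<Longrightarrow> J xs \<in> Conf" "i \<noteq> j"
  shows "smooth_cube k (direction i j J)"
proof -
  let ?v = "\<lambda>xs. J xs $ j - J xs $ i"
  have nz: "?v xs \<noteq> 0" if "xs \<in> cube k" for xs using assms(2)[OF that] assms(3) by (auto simp: Conf_def dest: injD)
  have sv: "smooth_cube k ?v" by (rule smooth_bounded_linear[OF bounded_linear_nth_diff assms(1)])
  have pos: "?v xs \<bullet> ?v xs > 0" if "xs \<in> cube k" for xs using nz[OF that] by simp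
  have "smooth_cube k (\<lambda>xs. ((?v xs \<bullet> ?v xs) powr (- 1 / 2)) *\<^sub>R ?v xs)"
    unfolding smooth_cube_Cn
    by (intro allI Cn_scaleR Cn_powr[OF pos] Cn_inner smooth_Cn[OF sv]) simp_all
  moreover have "((?v xs \<bullet> ?v xs) powr (- 1 / 2)) *\<^sub>R ?v xs = direction i j J xs" if "xs \<in> cube k" for xs
  proof -
    have "(?v xs \<bullet> ?v xs) powr (- 1 / 2) = inverse (norm (?v xs))"
      using powr_minus[of "?v xs \<bullet> ?v xs" "1 / 2"] powr_half_sqrt[of "?v xs \<bullet> ?v xs"] pos[OF that]
      by (simp add: norm_eq_sqrt_inner)
    then show ?thesis by (simp add: direction_def sgn_div_norm)
  qed
  ultimately show ?thesis by (elim smooth_cong[rotated]) (simp add: agree_def)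
qed

lemma pd_direction:
  assumes "smooth_cube k J" "J xs \<in> Conf" "i \<noteq> j" "l < k" "xs \<in> cube k"
  shows "pd l (direction i j J) xs = dsgn (J xs $ j - J xs $ i) (pd l J xs $ j - pd l J xs $ i)"
proof (rule pd_eqI[OF _ assms(5,4)])
  let ?v = "J xs $ j - J xs $ i"
  have nz: "?v \<noteq> 0" using assms(2,3) by (auto simp: Conf_def dest: injD)
  have "((\<lambda>u. J (xs[l := u]) $ j - J (xs[l := u]) $ i) has_derivative (\<lambda>h. h *\<^sub>R (pd l J xs $ j - pd l J xs $ i))) (at (xs ! l) within {0..1})"
    using bounded_linear.has_vector_derivative[OF bounded_linear_nth_diff pd_has_derivative[OF smooth_diffc[OF assms(1)] assms(4,5)]]
    by (simp add: has_vector_derivative_def)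
  then have "((\<lambda>u. sgn (J (xs[l := u]) $ j - J (xs[l := u]) $ i)) has_derivative (\<lambda>h. dsgn ?v (h *\<^sub>R (pd l J xs $ j - pd l J xs $ i)))) (at (xs ! l) within {0..1})"
    by (rule has_derivative_compose) (use sgn_has_derivative[OF nz] in simp)
  then show "((\<lambda>u. direction i j J (xs[l := u])) has_vector_derivative dsgn ?v (pd l J xs $ j - pd l J xs $ i)) (at (xs ! l) within {0..1})"
    unfolding has_vector_derivative_def direction_def linear_scale[OF linear_dsgn[OF nz]] .
qed

text \<open>\<open>sphere_form\<close> with the base point as row 0, so that the determinant lemmas
  treat the normal and the tangent vectors alike.\<close>

definition sphere_density :: "(nat \<Rightarrow> real ^ 'n::{finite,linorder}) \<Rightarrow> real" where
  "sphere_density V = Dt V / (real CARD('n) * unit_ball_vol (real CARD('n)))"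

lemma sphere_form_density: "sphere_form u ws = sphere_density (\<lambda>l. (u # ws) ! l)"
  by (simp add: sphere_form_def sphere_density_def Dt_def rk_def)

text \<open>Without internal vertices the fibre is a point and fibre integration is evaluation; the
  product over the edges has a single factor, which is alternating.\<close>

lemma form_of_edge:
  fixes x :: "(real ^ 'n::{finite,linorder}) ^ 'm::finite"
  assumes n: "CARD('n) = 4" and x: "x \<in> Conf" and l: "length ws = 3"
  shows "snd (form_of [Edge (Ext i) (Ext j)]) x ws =
    sphere_density (\<lambda>l. (sgn (x $ j - x $ i) # map (\<lambda>w. dsgn (x $ j - x $ i) (w $ j - w $ i)) ws) ! l)"
proof -
  let ?v = "x $ j - x $ i"
  let ?f = "\<lambda>ws :: ('m vertex \<Rightarrow> real ^ 'n::_) list. sphere_form (sgn ?v) (map (\<lambda>w. dsgn ?v (w (Ext j) - w (Ext i))) ws)"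
  have e: "edge_form (Ext i) (Ext j) (config x y) = (3, ?f)" for y
    by (simp add: edge_form_def n)
  have alt: "?f (vs[a := vs ! b, b := vs ! a]) = - ?f vs" if "length vs = 3" "a < 3" "b < 3" "a \<noteq> b" for vs a b
    using Dt_list_swap[of 3 "map (\<lambda>w. dsgn ?v (w (Ext j) - w (Ext i))) vs" a b "sgn ?v"] that n
    by (simp add: sphere_form_density sphere_density_def map_update)
  have inj: "inj_on (config x y) (range Ext)" for y :: "nat \<Rightarrow> real ^ 'n::_"
    using x by (auto simp: inj_on_def Conf_def)
  have w: "snd (wedges [(3, ?f)]) (map (\<lambda>w. config w (\<lambda>_. 0)) ws) = ?f (map (\<lambda>w. config w (\<lambda>_. 0)) ws)"
    by (rule wedges_single[OF alt]) (use l in simp_all)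
  have lists: "ivert_list [Edge (Ext i) (Ext j) :: 'm cell] = []" "edge_list [Edge (Ext i) (Ext j) :: 'm cell] = [(Ext i, Ext j)]"
    by (simp_all add: ivert_list_def edge_list_def)
  have "snd (form_of [Edge (Ext i) (Ext j)]) x ws = ?f (map (\<lambda>w. config w (\<lambda>_. 0)) ws)"
    unfolding form_of_def snd_conv lists
    by (simp add: PiM_empty set_lebesgue_integral_def lebesgue_integral_count_space_finite e w inj)
  also have "\<dots> = sphere_density (\<lambda>l. (sgn ?v # map (\<lambda>w. dsgn ?v (w $ j - w $ i)) ws) ! l)"
    by (simp add: sphere_form_density comp_def)
  finally show ?thesis .
qed

lemma fst_form_of_edge: "fst (form_of [Edge (Ext i) (Ext j)] :: ((real ^ 'n::{finite,linorder}) ^ 'm::finite) form) = CARD('n) - 1"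
  by (simp add: form_of_def degree_def edge_list_def ivert_list_def nat_diff_distrib)

text \<open>The integrand for a single edge. The derivative in t stands before those in r and s, as
  \<open>contracted\<close> inserts it.\<close>

definition pullback :: "'m \<Rightarrow> 'm \<Rightarrow> ((real ^ 'n::{finite,linorder}) ^ 'm) path \<Rightarrow> real path" where
  "pullback i j J xs = sphere_density (\<lambda>l. [direction i j J xs, pd 2 (direction i j J) xs, pd 0 (direction i j J) xs, pd 1 (direction i j J) xs] ! l)"

lemma contc_pullback:
  fixes J :: "((real ^ 'n::{finite,linorder}) ^ 'm) path"
  assumes n: "CARD('n) = 4" and "smooth_cube 3 J" "\<And>xs. xs \<in> cube 3 \<Longrightarrow> J xs \<in> Conf" "i \<noteq> j"
  shows "contc 3 (pullback i j J)"
proof -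
  let ?s = "direction i j J"
  have s: "smooth_cube 3 ?s" by (rule smooth_direction[OF assms(2-4)])
  have c: "contc 3 ?s" "contc 3 (pd 0 ?s)" "contc 3 (pd 1 ?s)" "contc 3 (pd 2 ?s)"
    using smooth_contc[OF s] smooth_contc[OF smooth_pd[OF s]] by simp_all
  have "contc 3 (\<lambda>xs. [?s xs, pd 2 ?s xs, pd 0 ?s xs, pd 1 ?s xs] ! l)" if "l < CARD('n)" for l
  proof -
    have "l = 0 \<or> l = 1 \<or> l = 2 \<or> l = 3" using that n by linarith
    then show ?thesis using c by (elim disjE) (simp_all add: numeral_2_eq_2 numeral_3_eq_3)
  qed
  then have "contc 3 (\<lambda>xs. Dt (\<lambda>l. [?s xs, pd 2 ?s xs, pd 0 ?s xs, pd 1 ?s xs] ! l))" by (rule contc_Dt)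
  from contc_cmult[OF this, of "1 / (real CARD('n) * unit_ball_vol (real CARD('n)))"]
  show ?thesis by (simp add: pullback_def[abs_def] sphere_density_def)
qed

text \<open>The form has degree 3, which meets the degree condition for 3-paths. With one form the
  simplex of times is the unit interval, and the integrals over (r, s) and over t combine to one
  over the 3-cube.\<close>

lemma iterated_integral_edge:
  fixes J :: "((real ^ 'n::{finite,linorder}) ^ 'm::finite) path"
  assumes n: "CARD('n) = 4" and sm: "smooth_cube 3 J" and im: "\<And>xs. xs \<in> cube 3 \<Longrightarrow> J xs \<in> Conf" and ij: "i \<noteq> j"
  shows "iterated_integral 2 J [form_of [Edge (Ext i) (Ext j)]] = nint 3 (pullback i j J)"
proof -
  let ?\<omega> = "form_of [Edge (Ext i) (Ext j)] :: ((real ^ 'n::_) ^ 'm) form"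
  let ?g = "\<lambda>xs. snd (wedges [contracted 2 J ?\<omega> xs]) [0, 1]"
  have f3: "fst ?\<omega> = 3" using fst_form_of_edge[where 'n='n and 'm='m, of i j] n by simp
  have g: "?g xs = pullback i j J xs" if xs: "xs \<in> cube 3" for xs
  proof -
    let ?v = "J xs $ j - J xs $ i"
    let ?W = "\<lambda>is. map (\<lambda>w. dsgn ?v (w $ j - w $ i)) (pd 2 J xs # map (\<lambda>i. pd i J xs) is)"
    let ?f = "\<lambda>is. snd ?\<omega> (J xs) (pd 2 J xs # map (\<lambda>i. pd i J xs) is)"
    have f: "?f is = sphere_density (\<lambda>l. (sgn ?v # ?W is) ! l)" if "length is = 2" for "is"
      using form_of_edge[OF n im[OF xs], of "pd 2 J xs # map (\<lambda>i. pd i J xs) is" i j] that by simp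
    have alt: "?f (is[a := is ! b, b := is ! a]) = - ?f is" if h: "length is = 2" "a < 2" "b < 2" "a \<noteq> b" for "is" a b
    proof -
      have W: "?W (is[a := is ! b, b := is ! a]) = (?W is)[Suc a := ?W is ! Suc b, Suc b := ?W is ! Suc a]"
        using h by (simp add: map_update)
      have l: "length (is[a := is ! b, b := is ! a]) = 2" using h by simp
      have "Dt (\<lambda>l. (sgn ?v # (?W is)[Suc a := ?W is ! Suc b, Suc b := ?W is ! Suc a]) ! l) = - Dt (\<lambda>l. (sgn ?v # ?W is) ! l)"
        by (rule Dt_list_swap[of 3]) (use h n in simp_all)
      then show ?thesis unfolding f[OF l] f[OF h(1)] sphere_density_def W by simp
    qed
    have "?g xs = ?f [0, 1]"
      unfolding contracted_def f3 using wedges_single[of 2 ?f "[0, 1]", OF alt] by simp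
    also have "?f [0, 1] = sphere_density (\<lambda>l. (sgn ?v # ?W [0, 1]) ! l)" by (rule f) simp
    also have "\<dots> = pullback i j J xs"
      unfolding pullback_def
      using pd_direction[OF sm im[OF xs] ij _ xs] by (simp add: direction_def)
    finally show ?thesis .
  qed
  have cp: "contc 3 (pullback i j J)" by (rule contc_pullback[OF n sm im ij])
  have cg: "contc 3 ?g" by (rule contc_cong[OF _ cp]) (unfold agree_def, intro ballI, rule g[symmetric])
  have R: "{t. (\<forall>j<1. t j \<in> {0..1}) \<and> (\<forall>i<1. \<forall>j<1. i \<le> j \<longrightarrow> t i \<le> t j)} = {t :: nat \<Rightarrow> real. \<forall>j<1. t j \<in> {0..1}}" by auto
  have "iterated_integral 2 J [?\<omega>] = (LINT x : {x. \<forall>i<2. x i \<in> {0..1}} | Pi\<^sub>M {..<2} (\<lambda>_. lborel).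
      LINT t : {t. \<forall>j<1. t j \<in> {0..1}} | Pi\<^sub>M {..<1} (\<lambda>_. lborel). ?g (map x [0..<2] @ map t [0..<1]))"
    unfolding iterated_integral_def Let_def using R by (simp add: f3 upt_rec numeral_2_eq_2)
  also have "\<dots> = (LINT x : {x. \<forall>i<2. x i \<in> {0..1}} | Pi\<^sub>M {..<2} (\<lambda>_. lborel). nint 1 (\<lambda>ts. ?g (map x [0..<2] @ ts)))"
  proof -
    have "(LINT t : {t. \<forall>j<1. t j \<in> {0..1}} | Pi\<^sub>M {..<1} (\<lambda>_. lborel). ?g (map x [0..<2] @ map t [0..<1])) = nint 1 (\<lambda>ts. ?g (map x [0..<2] @ ts))"
      if x: "\<forall>i<2. x i \<in> {0..1}" for x :: "nat \<Rightarrow> real"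
    proof (rule LINT_nint(2)[of 1 "\<lambda>ts. ?g (map x [0..<2] @ ts)"])
      have "contc 1 (\<lambda>ts. ?g (map (\<lambda>j. if j < 2 then x j else ts ! 0) [0..<3]))"
      proof (rule contc_comp[OF cg])
        fix j :: nat assume "j < 3"
        show "contc 1 (\<lambda>ts. if j < 2 then x j else ts ! 0)"
          using contc_const[of 1 "x j"] contc_nth[of 0 1] by (cases "j < 2") simp_all
        show "(if j < 2 then x j else ts ! 0) \<in> {0..1}" if "ts \<in> cube 1" for ts
          using x cube_nth[OF that, of 0] by (cases "j < 2") simp_all
      qed
      moreover have "map (\<lambda>j. if j < 2 then x j else ts ! 0) [0..<3] = map x [0..<2] @ ts" if "ts \<in> cube 1" for ts
        using that by (elim cube1E) (simp add: upt_rec numeral_2_eq_2 numeral_3_eq_3)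
      ultimately show "contc 1 (\<lambda>ts. ?g (map x [0..<2] @ ts))" by (elim contc_cong[rotated]) (simp add: agree_def)
    qed
    then show ?thesis unfolding set_lebesgue_integral_def
      by (intro Bochner_Integration.integral_cong refl) (auto simp: indicator_def)
  qed
  also have "\<dots> = nint 2 (\<lambda>ps. nint 1 (\<lambda>ts. ?g (ps @ ts)))"
    by (rule LINT_nint(2)) (rule contc_nint, use cg in simp)
  also have "\<dots> = nint (2 + 1) ?g" by (rule nint_append[symmetric])
  also have "\<dots> = nint 3 (pullback i j J)"
  proof -
    have e: "(2::nat) + 1 = 3" by simp
    show ?thesis unfolding e by (rule nint_cong[OF g])
  qed
  finally show ?thesis .
qed

lemma pullback_cong:
  assumes "agree 3 J J'" "xs \<in> cube 3" shows "pullback i j J xs = pullback i j J' xs"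
proof -
  have a: "agree 3 (direction i j J) (direction i j J')" using assms(1) by (simp add: agree_def direction_def)
  then have "direction i j J xs = direction i j J' xs" using assms(2) by (simp add: agree_def)
  then show ?thesis unfolding pullback_def using pd_cong[OF a _ assms(2)] by simp
qed

text \<open>The differential of the direction map is linear, so it preserves the relation between
  the derivatives in r and s, and two rows of the determinant are dependent.\<close>

lemma pullback_flat:
  fixes J :: "((real ^ 'n::{finite,linorder}) ^ 'm) path"
  assumes n: "CARD('n) = 4" and sm: "smooth_cube 3 J" and im: "J xs \<in> Conf" and ij: "i \<noteq> j" and xs: "xs \<in> cube 3"
    and flat: "a *\<^sub>R pd 0 J xs + b *\<^sub>R pd 1 J xs = 0" "(a, b) \<noteq> (0, 0)"
  shows "pullback i j J xs = 0"
proof -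
  let ?v = "J xs $ j - J xs $ i"
  have nz: "?v \<noteq> 0" using im ij by (auto simp: Conf_def dest: injD)
  let ?L = "\<lambda>w. dsgn ?v (w $ j - w $ i)"
  have lin: "linear ?L"
    using linear_compose[OF bounded_linear.linear[OF bounded_linear_nth_diff] linear_dsgn[OF nz]] by (simp add: comp_def)
  have "a *\<^sub>R ?L (pd 0 J xs) + b *\<^sub>R ?L (pd 1 J xs) = ?L (a *\<^sub>R pd 0 J xs + b *\<^sub>R pd 1 J xs)"
    by (simp only: linear_add[OF lin] linear_scale[OF lin])
  also have "\<dots> = 0" unfolding flat(1) by (rule linear_0[OF lin])
  finally have z: "a *\<^sub>R pd 0 (direction i j J) xs + b *\<^sub>R pd 1 (direction i j J) xs = 0"
    using pd_direction[OF sm im ij _ xs, of 0] pd_direction[OF sm im ij _ xs, of 1] by simp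
  have "dep (CARD('n)) (\<lambda>l. [direction i j J xs, pd 2 (direction i j J) xs, pd 0 (direction i j J) xs, pd 1 (direction i j J) xs] ! l)"
    by (rule dep_pair[of 2 _ 3 a _ b]) (use n z flat(2) in \<open>simp_all add: numeral_2_eq_2 numeral_3_eq_3\<close>)
  then show ?thesis unfolding pullback_def sphere_density_def by (simp add: Dt_dep)
qed

text \<open>Concatenation doubles exactly one partial derivative, hence one row and the determinant;
  the factor 1/2 is the Jacobian from \<open>nint_halves\<close>.\<close>

lemma pullback_pconcat:
  fixes J K :: "((real ^ 'n::{finite,linorder}) ^ 'm) path"
  assumes n: "CARD('n) = 4" and J: "kpath Conf 3 J" and K: "kpath Conf 3 K" and ij: "i \<noteq> j" and l: "l < 3"
    and eq: "\<And>xs. xs \<in> cube 3 \<Longrightarrow> J (xs[l := 1]) = K (xs[l := 0])" and xs: "xs \<in> cube 3"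
  shows "1 / 2 * pullback i j (pconcat l J K) (xs[l := xs ! l / 2]) = pullback i j J xs"
    and "1 / 2 * pullback i j (pconcat l J K) (xs[l := (xs ! l + 1) / 2]) = pullback i j K xs"
proof -
  note Jd = kpathD[OF J] and Kd = kpathD[OF K]
  let ?P = "pconcat l J K"
  have Pk: "kpath Conf 3 ?P" by (rule pconcat_kpath[OF J K l eq])
  note Pd = kpathD[OF Pk]
  have len: "length xs = 3" by (rule cube_length[OF xs])
  have x: "xs ! l \<in> {0..1}" by (rule cube_nth[OF xs l])
  have half: "1 / 2 * pullback i j ?P ys = pullback i j H xs"
    if ys: "ys \<in> cube 3" and H: "kpath Conf 3 H" and val: "?P ys = H xs"
      and pds: "\<And>k. k < 3 \<Longrightarrow> pd k ?P ys = (if k = l then 2 else 1) *\<^sub>R pd k H xs" for ys H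
  proof -
    note Hd = kpathD[OF H]
    let ?v = "H xs $ j - H xs $ i"
    have nz: "?v \<noteq> 0" using Hd(2)[OF xs] ij by (auto simp: Conf_def dest: injD)
    have pdir: "pd k (direction i j ?P) ys = (if k = l then 2 else 1) *\<^sub>R pd k (direction i j H) xs" if k: "k < 3" for k
    proof -
      have "pd k (direction i j ?P) ys = dsgn ?v (pd k ?P ys $ j - pd k ?P ys $ i)"
        using pd_direction[OF Pd(1) Pd(2)[OF ys] ij k ys] val by simp
      also have "\<dots> = dsgn ?v ((if k = l then 2 else 1) *\<^sub>R (pd k H xs $ j - pd k H xs $ i))"
        by (simp add: pds[OF k] scaleR_right_diff_distrib)
      also have "\<dots> = (if k = l then 2 else 1) *\<^sub>R dsgn ?v (pd k H xs $ j - pd k H xs $ i)"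
        by (rule linear_scale[OF linear_dsgn[OF nz]])
      also have "dsgn ?v (pd k H xs $ j - pd k H xs $ i) = pd k (direction i j H) xs"
        by (rule pd_direction[OF Hd(1) Hd(2)[OF xs] ij k xs, symmetric])
      finally show ?thesis .
    qed
    let ?V = "\<lambda>q. [direction i j H xs, pd 2 (direction i j H) xs, pd 0 (direction i j H) xs, pd 1 (direction i j H) xs] ! q"
    \<comment> \<open>The row holding the derivative in direction \<open>l\<close>:
      \<open>pullback\<close> lists the directions 2, 0, 1 in rows 1, 2, 3.\<close>
    define p where "p = (if l = 2 then 1 else if l = 0 then 2 else 3 :: nat)"
    have lv: "l = 0 \<or> l = 1 \<or> l = 2" using l by linarith
    have p4: "p < CARD('n)" using n by (simp add: p_def)
    have pe: "p \<noteq> 0" "1 = p \<longleftrightarrow> 2 = l" "2 = p \<longleftrightarrow> 0 = l" "3 = p \<longleftrightarrow> 1 = l" using lv by (auto simp: p_def)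
    have d0: "direction i j ?P ys = direction i j H xs" using val by (simp add: direction_def)
    have pd012: "pd 0 (direction i j ?P) ys = (if 0 = l then 2 else 1) *\<^sub>R pd 0 (direction i j H) xs"
      "pd 1 (direction i j ?P) ys = (if 1 = l then 2 else 1) *\<^sub>R pd 1 (direction i j H) xs"
      "pd 2 (direction i j ?P) ys = (if 2 = l then 2 else 1) *\<^sub>R pd 2 (direction i j H) xs" by (rule pdir, simp)+
    have "Dt (\<lambda>q. [direction i j ?P ys, pd 2 (direction i j ?P) ys, pd 0 (direction i j ?P) ys, pd 1 (direction i j ?P) ys] ! q) = Dt (?V(p := 2 *\<^sub>R ?V p))"
    proof (rule Dt_cong)
      fix q assume "q < CARD('n)"
      then have "q = 0 \<or> q = 1 \<or> q = 2 \<or> q = 3" using n by linarith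
      then show "[direction i j ?P ys, pd 2 (direction i j ?P) ys, pd 0 (direction i j ?P) ys, pd 1 (direction i j ?P) ys] ! q = (?V(p := 2 *\<^sub>R ?V p)) q"
        using lv unfolding d0 pd012 p_def by (elim disjE) (simp_all add: numeral_2_eq_2 numeral_3_eq_3)
    qed
    also have "\<dots> = 2 * Dt ?V" using linear_scale[OF Dt_linear[OF p4, of ?V], of 2 "?V p"] by (simp add: fun_upd_triv)
    finally show ?thesis by (simp add: pullback_def sphere_density_def)
  qed
  show "1 / 2 * pullback i j ?P (xs[l := xs ! l / 2]) = pullback i j J xs"
  proof (rule half[OF _ J])
    show c: "xs[l := xs ! l / 2] \<in> cube 3" using cube_update[OF xs] x by simp
    have u: "xs[l := xs ! l / 2] ! l = xs ! l / 2" "xs[l := xs ! l / 2, l := 2 * (xs[l := xs ! l / 2] ! l)] = xs" using l len by simp_all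
    have le: "xs[l := xs ! l / 2] ! l \<le> 1 / 2" using x u by simp
    show "?P (xs[l := xs ! l / 2]) = J xs" using le u(2) by (simp add: pconcat_def)
    show "pd k ?P (xs[l := xs ! l / 2]) = (if k = l then 2 else 1) *\<^sub>R pd k J xs" if "k < 3" for k
      using pd_pconcat(1)[OF Jd(1) Kd(1) Jd(3) Kd(3) l that eq c le] unfolding u(2) by simp
  qed
  show "1 / 2 * pullback i j ?P (xs[l := (xs ! l + 1) / 2]) = pullback i j K xs"
  proof (rule half[OF _ K])
    let ?ys = "xs[l := (xs ! l + 1) / 2]"
    show c: "?ys \<in> cube 3" using cube_update[OF xs] x by simp
    have u1: "?ys ! l = (xs ! l + 1) / 2" using l len by simp
    have "2 * (?ys ! l) - 1 = xs ! l" unfolding u1 by (simp add: field_simps)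
    then have "?ys[l := 2 * (?ys ! l) - 1] = xs" by (simp only: list_update_overwrite list_update_id)
    note u = u1 this
    have ge: "?ys ! l \<ge> 1 / 2" using x u by simp
    show "?P ?ys = K xs"
    proof (cases "?ys ! l \<le> 1 / 2")
      case True
      then have z: "?ys ! l = 1 / 2" "xs ! l = 0" using ge u(1) by simp_all
      have "?P ?ys = J (xs[l := 1])" unfolding pconcat_def z(1) using l len z by simp
      also have "\<dots> = K (xs[l := 0])" by (rule eq[OF xs])
      also have "xs[l := 0] = xs" using z(2) list_update_id by metis
      finally show ?thesis .
    next
      case False then show ?thesis using u(2) by (simp add: pconcat_def)
    qed
    show "pd k ?P ?ys = (if k = l then 2 else 1) *\<^sub>R pd k K xs" if "k < 3" for k
      using pd_pconcat(2)[OF Jd(1) Kd(1) Jd(3) Kd(3) l that eq c ge] unfolding u(2) by simp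
  qed
qed

lemma integral_pconcat:
  fixes J K :: "((real ^ 'n::{finite,linorder}) ^ 'm) path"
  assumes n: "CARD('n) = 4" and J: "kpath Conf 3 J" and K: "kpath Conf 3 K" and ij: "i \<noteq> j" and l: "l < 3"
    and eq: "\<And>xs. xs \<in> cube 3 \<Longrightarrow> J (xs[l := 1]) = K (xs[l := 0])"
  shows "nint 3 (pullback i j (pconcat l J K)) = nint 3 (pullback i j J) + nint 3 (pullback i j K)"
proof -
  have Pk: "kpath Conf 3 (pconcat l J K)" by (rule pconcat_kpath[OF J K l eq])
  have c: "contc 3 (pullback i j (pconcat l J K))" by (rule contc_pullback[OF n kpathD(1,2)[OF Pk] ij])
  show ?thesis unfolding nint_halves[OF l c]
    using nint_cong[OF pullback_pconcat(1)[OF n J K ij l eq]] nint_cong[OF pullback_pconcat(2)[OF n J K ij l eq]] by simp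
qed

section \<open>Stokes' theorem on a rank-3 homotopy\<close>

lemma dep_linear: "dep k V \<Longrightarrow> linear L \<Longrightarrow> dep k (\<lambda>i. L (V i))"
proof -
  assume "dep k V" and L: "linear L"
  then obtain c i where c: "i < k" "c i \<noteq> 0" "(\<Sum>i<k. c i *\<^sub>R V i) = 0" unfolding dep_def by blast
  have "(\<Sum>i<k. c i *\<^sub>R L (V i)) = L (\<Sum>i<k. c i *\<^sub>R V i)"
    by (simp add: linear_sum[OF L] linear_scale[OF L])
  then show ?thesis using c linear_0[OF L] by (intro depI[of i k c]) simp_all
qed

lemma dep_cong: "dep k V \<Longrightarrow> (\<And>i. i < k \<Longrightarrow> V i = V' i) \<Longrightarrow> dep k V'"
  unfolding dep_def by simp

text \<open>One further vector raises the dimension of the span by at most one. The omitted index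
  \<open>i\<close> is the coordinate fixed by \<open>face i\<close>, as in
  \<open>pd_face\<close>.\<close>

lemma dep_skip:
  fixes V :: "nat \<Rightarrow> 'v::euclidean_space"
  assumes "dep k (\<lambda>l. V (if l < i then l else Suc l))" "i \<le> k"
  shows "dep (Suc k) V"
proof -
  let ?W = "\<lambda>l. V (if l < i then l else Suc l)"
  have "V ` {..<Suc k} \<subseteq> insert (V i) (?W ` {..<k})"
  proof
    fix x assume "x \<in> V ` {..<Suc k}"
    then obtain l where l: "l < Suc k" "x = V l" by auto
    consider "l < i" | "l = i" | "l > i" by linarith
    then show "x \<in> insert (V i) (?W ` {..<k})"
    proof cases
      case 1 then show ?thesis using l assms(2) by (intro insertI2 image_eqI[of _ _ l]) auto
    next
      case 3 then show ?thesis using l by (intro insertI2 image_eqI[of _ _ "l - 1"]) auto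
    qed (use l in simp)
  qed
  then have "dim (V ` {..<Suc k}) \<le> dim (insert (V i) (?W ` {..<k}))" by (rule dim_subset)
  also have "\<dots> \<le> dim (?W ` {..<k}) + 1" by (simp add: dim_insert)
  also have "\<dots> < Suc k" using assms(1) unfolding dep_dim[symmetric] by simp
  finally show ?thesis unfolding dep_dim .
qed

lemma antisymmetric_sum:
  fixes X :: "nat \<Rightarrow> nat \<Rightarrow> real"
  assumes "\<And>k l. k < N \<Longrightarrow> l < N \<Longrightarrow> X k l = - X l k"
  shows "(\<Sum>k<N. \<Sum>l<N. X k l) = 0"
proof -
  have "(\<Sum>k<N. \<Sum>l<N. X k l) = (\<Sum>l<N. \<Sum>k<N. X k l)" by (rule sum.swap)
  also have "\<dots> = (\<Sum>l<N. \<Sum>k<N. - X l k)" by (intro sum.cong refl assms) auto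
  finally show ?thesis by (simp add: sum_negf)
qed

text \<open>The pullback of the volume form of the sphere to a 4-cube is closed: its exterior derivative
  reduces to a determinant of the derivatives of the direction map, which vanishes on maps of rank below 4,
  and to second derivatives, which cancel in pairs.\<close>

lemma closed_form_sum:
  fixes s :: "(real ^ 'n::{finite,linorder}) path"
  assumes n: "CARD('n) = 4" and s: "smooth_cube 4 s" and xs: "xs \<in> cube 4" and dep: "dep 4 (\<lambda>l. pd l s xs)"
  shows "(\<Sum>k<4. \<Sum>l<4. Dt (((\<lambda>q. pd q s xs)(k := s xs))(l := (if l = k then pd k s xs else pd k (pd l s) xs)))) = 0"
proof -
  let ?P = "\<lambda>q. pd q s xs"
  \<comment> \<open>Row \<open>k\<close> is the position and row \<open>l\<close> is differentiated
    in direction \<open>k\<close>. For \<open>l = k\<close> the derivative of the position restores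
    row \<open>k\<close>, so every diagonal term is the determinant of all first
    derivatives.\<close>
  let ?X = "\<lambda>k l. Dt ((?P(k := s xs))(l := (if l = k then pd k s xs else pd k (pd l s) xs)))"
  have D0: "Dt ?P = 0" by (rule Dt_dep) (simp add: n dep)
  have anti: "?X k l = - ?X l k" if "k < 4" "l < 4" for k l
  proof (cases "l = k")
    case True
    have "?P(k := ?P k) = ?P" by (rule fun_upd_triv)
    then show ?thesis using D0 True by simp
  next
    case False
    have "?X k l = Dt (?P(k := s xs, l := pd k (pd l s) xs))" using False by simp
    also have "\<dots> = - Dt (?P(k := pd k (pd l s) xs, l := s xs))"
      by (rule Dt_swap) (use that False n in simp_all)
    also have "?P(k := pd k (pd l s) xs, l := s xs) = ?P(l := s xs, k := pd l (pd k s) xs)"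
      using False pd_symmetric[OF s that _ xs] by (simp add: fun_upd_twist)
    also have "Dt \<dots> = ?X l k" using False by simp
    finally show ?thesis .
  qed
  show ?thesis by (rule antisymmetric_sum[OF anti])
qed

text \<open>After integration, the vanishing sum of \<open>closed_form_sum\<close> leaves only
  faces. In direction 1 they have rank below 3, in direction 2 they do not depend on r, in direction
  3 they are single points; so the two faces in direction 0 have equal integrals.\<close>

lemma rank3_integral_invariant:
  fixes W :: "((real ^ 'n::{finite,linorder}) ^ 'm::finite) path"
  assumes n: "CARD('n) = 4" and W: "rank3_homotopy Conf W" and ij: "i \<noteq> j"
  shows "nint 3 (pullback i j (face 0 0 W)) = nint 3 (pullback i j (face 0 1 W))"
proof -
  have k: "kpath Conf 4 W" and lr: "low_rank 4 W" and side: "\<And>c. c \<in> {0, 1} \<Longrightarrow> low_rank 3 (face 1 c W)"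
    using W by (auto simp: rank3_homotopy_def rank2_homotopy_def)
  note Wd = kpathD[OF k]
  let ?s = "direction i j W"
  have s: "smooth_cube 4 ?s" by (rule smooth_direction[OF Wd(1,2) ij])
  have nz: "W xs $ j - W xs $ i \<noteq> 0" if "xs \<in> cube 4" for xs
    using Wd(2)[OF that] ij by (auto simp: Conf_def dest: injD)
  let ?L = "\<lambda>xs w. dsgn (W xs $ j - W xs $ i) (w $ j - w $ i)"
  have L: "linear (?L xs)" if "xs \<in> cube 4" for xs
    using linear_compose[OF bounded_linear.linear[OF bounded_linear_nth_diff] linear_dsgn[OF nz[OF that]]] by (simp add: comp_def)
  have ps: "pd l ?s xs = ?L xs (pd l W xs)" if "l < 4" "xs \<in> cube 4" for l xs
    by (rule pd_direction[OF Wd(1) Wd(2)[OF that(2)] ij that])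
  have sdep: "dep 4 (\<lambda>l. pd l ?s xs)" if xs: "xs \<in> cube 4" for xs
  proof (rule dep_cong[OF dep_linear[OF _ L[OF xs]]])
    show "dep 4 (\<lambda>l. pd l W xs)" using lr xs unfolding low_rank_iff by blast
    show "?L xs (pd l W xs) = pd l ?s xs" if "l < 4" for l by (rule ps[OF that xs, symmetric])
  qed
  \<comment> \<open>Replacing row \<open>k\<close> in place, instead of moving the position to the
    front, accounts for the signs of the exterior derivative. \<open>G k\<close> is the derivative
    of \<open>F k\<close> in direction \<open>k\<close>.\<close>
  define F where "F k xs = Dt ((\<lambda>q. pd q ?s xs)(k := ?s xs))" for k xs
  define G where "G k xs = (\<Sum>l<4. Dt (((\<lambda>q. pd q ?s xs)(k := ?s xs))(l := (if l = k then pd k ?s xs else pd k (pd l ?s) xs))))" for k xs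
  have c1: "contc 4 (\<lambda>xs. ((\<lambda>q. pd q ?s xs)(k := ?s xs)) q)" if "q < 4" for k q
    using smooth_contc[OF s] smooth_contc[OF smooth_pd[OF s that]] by (cases "q = k") simp_all
  have cF: "contc 4 (F k)" if "k < 4" for k
    unfolding F_def by (rule contc_Dt) (use c1 n in simp)
  have cG: "contc 4 (G k)" if "k < 4" for k
  proof -
    have "contc 4 (\<lambda>xs. Dt (((\<lambda>q. pd q ?s xs)(k := ?s xs))(l := (if l = k then pd k ?s xs else pd k (pd l ?s) xs))))" if l: "l < 4" for l
    proof (rule contc_Dt)
      fix q assume "q < CARD('n)"
      then have q: "q < 4" using n by simp
      show "contc 4 (\<lambda>xs. (((\<lambda>q. pd q ?s xs)(k := ?s xs))(l := (if l = k then pd k ?s xs else pd k (pd l ?s) xs))) q)"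
      proof (cases "q = l")
        case True
        then show ?thesis
          using smooth_contc[OF smooth_pd[OF s \<open>k < 4\<close>]] smooth_contc[OF smooth_pd[OF smooth_pd[OF s l] \<open>k < 4\<close>]]
          by (cases "l = k") simp_all
      next
        case False then show ?thesis using c1[OF q, of k] by simp
      qed
    qed
    then have "Cn 4 0 (G k)" unfolding G_def by (intro Cn_sum) simp
    then show ?thesis by simp
  qed
  have deriv: "((\<lambda>u. F k (xs[k := u])) has_vector_derivative G k xs) (at (xs ! k) within {0..1})"
    if k: "k < 4" and xs: "xs \<in> cube 4" for k xs
  proof -
    let ?V = "\<lambda>q u. ((\<lambda>q. pd q ?s (xs[k := u]))(k := ?s (xs[k := u]))) q"
    let ?V' = "\<lambda>l. if l = k then pd k ?s xs else pd k (pd l ?s) xs"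
    have "((\<lambda>u. Dt (\<lambda>q. ?V q u)) has_vector_derivative (\<Sum>l<CARD('n). Dt ((\<lambda>q. ?V q (xs ! k))(l := ?V' l)))) (at (xs ! k) within {0..1})"
    proof (rule Dt_derivative)
      fix l assume "l < CARD('n)"
      then have l: "l < 4" using n by simp
      show "(?V l has_vector_derivative ?V' l) (at (xs ! k) within {0..1})"
        using pd_has_derivative[OF smooth_diffc[OF s] k xs] pd_has_derivative[OF smooth_diffc[OF smooth_pd[OF s l]] k xs]
        by (cases "l = k") simp_all
    qed
    from this[unfolded n list_update_id] show ?thesis unfolding F_def G_def .
  qed
  have FTC: "nint 4 (G k) = nint 3 (\<lambda>xs. F k (take k xs @ 1 # drop k xs)) - nint 3 (\<lambda>xs. F k (take k xs @ 0 # drop k xs))"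
    if k: "k < 4" for k
  proof -
    have e: "Suc 3 = (4::nat)" by simp
    have k3: "k \<le> 3" using k by simp
    from nint_FTC[of k 3 "F k" "G k", unfolded e, OF k3 cF[OF k] cG[OF k] deriv[OF k]] show ?thesis .
  qed
  have in4: "take k xs @ c # drop k xs \<in> cube 4" if "k < 4" "xs \<in> cube 3" "c \<in> {0, 1}" for k xs and c :: real
    using face_in_cube[of xs 3 k c] that by auto
  have W0: "pd l ?s z = 0" if "z \<in> cube 4" "l < 4" "pd l W z = 0" for l z
    using ps[OF that(2,1)] linear_0[OF L[OF that(1)]] that(3) by simp
  \<comment> \<open>Low rank of the side makes the derivatives in directions 0, 2, 3 dependent;
    \<open>dep_skip\<close> adds the position as row 1.\<close>
  have b1: "F 1 (take 1 xs @ c # drop 1 xs) = 0" if xs: "xs \<in> cube 3" and c: "c \<in> {0, 1}" for xs c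
  proof -
    let ?z = "take 1 xs @ c # drop 1 xs"
    have z: "?z \<in> cube 4" by (rule in4[OF _ xs c]) simp
    have "dep 3 (\<lambda>l. pd l (face 1 c W) xs)" using side[OF c] xs unfolding low_rank_iff by blast
    then have "dep 3 (\<lambda>l. ?L ?z (pd l (face 1 c W) xs))" by (rule dep_linear[OF _ L[OF z]])
    then have "dep 3 (\<lambda>l. ((\<lambda>q. pd q ?s ?z)(1 := ?s ?z)) (if l < 1 then l else Suc l))"
    proof (rule dep_cong)
      fix l :: nat assume l: "l < 3"
      have m: "(if l < 1 then l else Suc l) < 4" "(if l < 1 then l else Suc l) \<noteq> 1" using l by auto
      have e: "pd l (face 1 c W) xs = pd (if l < 1 then l else Suc l) W ?z"
        by (rule pd_face[OF cube_length[OF xs] _ l]) simp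
      show "?L ?z (pd l (face 1 c W) xs) = ((\<lambda>q. pd q ?s ?z)(1 := ?s ?z)) (if l < 1 then l else Suc l)"
        unfolding fun_upd_other[OF m(2)] e by (rule ps[OF m(1) z, symmetric])
    qed
    then have "dep (Suc 3) ((\<lambda>q. pd q ?s ?z)(1 := ?s ?z))" by (rule dep_skip) simp
    then show ?thesis unfolding F_def by (intro Dt_dep) (simp add: n)
  qed
  have b2: "F 2 (take 2 xs @ c # drop 2 xs) = 0" if xs: "xs \<in> cube 3" and c: "c \<in> {0, 1}" for xs c
  proof -
    let ?z = "take 2 xs @ c # drop 2 xs"
    have z: "?z \<in> cube 4" by (rule in4[OF _ xs c]) simp
    obtain q r t where e: "xs = [q, r, t]" "q \<in> {0..1}" "r \<in> {0..1}" "t \<in> {0..1}" using xs by (rule cube3E)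
    have "pd 1 W ?z = 0"
    proof (rule pd_const[OF _ z])
      fix u :: real assume "u \<in> {0..1}"
      then have "W [q, u, c, t] = W [q, 0, c, t]" using e c by (intro rank3_indep[OF W c]) simp_all
      then show "W (?z[1 := u]) = W [q, 0, c, t]" unfolding e(1) by (simp add: numeral_2_eq_2)
    qed simp
    then have "pd 1 ?s ?z = 0" by (intro W0[OF z]) simp_all
    then show ?thesis unfolding F_def by (intro Dt_zero[of 1]) (simp_all add: n)
  qed
  have b3: "F 3 (take 3 xs @ c # drop 3 xs) = 0" if xs: "xs \<in> cube 3" and c: "c \<in> {0, 1}" for xs c
  proof -
    let ?z = "take 3 xs @ c # drop 3 xs"
    have z: "?z \<in> cube 4" by (rule in4[OF _ xs c]) simp
    obtain q r t where e: "xs = [q, r, t]" using xs by (rule cube3E)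
    have ze: "?z = [q, r, t, c]" unfolding e by (simp add: numeral_3_eq_3)
    have "pd 0 W ?z = 0"
    proof (rule pd_const[OF _ z])
      fix u :: real assume "u \<in> {0..1}"
      then show "W (?z[0 := u]) = W ?z"
        by (intro Wd(4) cube_update[OF z] z) (use c in \<open>simp_all add: ze\<close>)
    qed simp
    then have "pd 0 ?s ?z = 0" by (intro W0[OF z]) simp_all
    then show ?thesis unfolding F_def by (intro Dt_zero[of 0]) (simp_all add: n)
  qed
  have vanish: "nint 4 (G k) = 0" if "k \<in> {1, 2, 3}" for k
  proof -
    have k: "k < 4" using that by auto
    have "F k (take k xs @ c # drop k xs) = 0" if "xs \<in> cube 3" "c \<in> {0, 1}" for xs c
      using \<open>k \<in> {1, 2, 3}\<close> b1[OF that] b2[OF that] b3[OF that] by auto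
    then have "nint 3 (\<lambda>xs. F k (take k xs @ c # drop k xs)) = 0" if "c \<in> {0, 1}" for c
      using nint_cong[of 3 "\<lambda>xs. F k (take k xs @ c # drop k xs)" "\<lambda>_. 0"] nint_zero[of 3] that by simp
    then show ?thesis using FTC[OF k] by simp
  qed
  have "nint 4 (\<lambda>xs. G 0 xs + (G 1 xs + (G 2 xs + G 3 xs))) = nint 4 (\<lambda>_. 0)"
  proof (rule nint_cong)
    fix xs assume xs: "xs \<in> cube 4"
    from closed_form_sum[OF n s xs sdep[OF xs]]
    have "(\<Sum>k<4. G k xs) = 0" unfolding G_def .
    then show "G 0 xs + (G 1 xs + (G 2 xs + G 3 xs)) = 0" by (simp add: eval_nat_numeral)
  qed
  moreover have "nint 4 (\<lambda>xs. G 0 xs + (G 1 xs + (G 2 xs + G 3 xs))) = nint 4 (G 0) + (nint 4 (G 1) + (nint 4 (G 2) + nint 4 (G 3)))"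
    using nint_add[OF cG[of 0] contc_add[OF cG[of 1] contc_add[OF cG[of 2] cG[of 3]]]]
      nint_add[OF cG[of 1] contc_add[OF cG[of 2] cG[of 3]]] nint_add[OF cG[of 2] cG[of 3]] by simp
  ultimately have "nint 4 (G 0) = 0" using vanish[of 1] vanish[of 2] vanish[of 3] nint_zero[of 4] by simp
  then have F0: "nint 3 (\<lambda>xs. F 0 (1 # xs)) = nint 3 (\<lambda>xs. F 0 (0 # xs))" using FTC[of 0] by simp
  \<comment> \<open>\<open>pullback\<close> has the derivative in t before those in r and s,
    \<open>F 0\<close> has it after them; moving it past two rows is an even permutation.\<close>
  have pb: "pullback i j (face 0 c W) xs = F 0 (c # xs) / (real CARD('n) * unit_ball_vol (real CARD('n)))"
    if xs: "xs \<in> cube 3" and c: "c \<in> {0, 1}" for xs c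
  proof -
    have fs: "direction i j (face 0 c W) = face 0 c ?s" by (simp add: fun_eq_iff direction_def face_def)
    have pf: "pd l (face 0 c ?s) xs = pd (Suc l) ?s (c # xs)" if "l < 3" for l
      using pd_face[OF cube_length[OF xs] _ that, of 0 c ?s] by simp
    let ?u = "?s (c # xs)" and ?a = "pd 1 ?s (c # xs)" and ?b = "pd 2 ?s (c # xs)" and ?c = "pd 3 ?s (c # xs)"
    have "pullback i j (face 0 c W) xs = sphere_density (\<lambda>l. [?u, ?c, ?a, ?b] ! l)"
      unfolding pullback_def fs using pf[of 0] pf[of 1] pf[of 2] by (simp add: face_lit numeral_2_eq_2 numeral_3_eq_3)
    moreover have "Dt (\<lambda>l. [?u, ?c, ?a, ?b] ! l) = - Dt (\<lambda>l. [?u, ?a, ?c, ?b] ! l)"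
      using Dt_list_swap[of 3 "[?a, ?c, ?b]" 0 1 ?u] n by simp
    moreover have "Dt (\<lambda>l. [?u, ?a, ?c, ?b] ! l) = - Dt (\<lambda>l. [?u, ?a, ?b, ?c] ! l)"
      using Dt_list_swap[of 3 "[?a, ?b, ?c]" 1 2 ?u] n by (simp add: numeral_2_eq_2)
    moreover have "Dt (\<lambda>l. [?u, ?a, ?b, ?c] ! l) = F 0 (c # xs)" unfolding F_def
    proof (rule Dt_cong)
      fix l assume "l < CARD('n)"
      then have "l = 0 \<or> l = 1 \<or> l = 2 \<or> l = 3" using n by linarith
      then show "[?u, ?a, ?b, ?c] ! l = ((\<lambda>q. pd q ?s (c # xs))(0 := ?u)) l"
        by (elim disjE) simp_all
    qed
    ultimately show ?thesis by (simp add: sphere_density_def)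
  qed
  have "nint 3 (pullback i j (face 0 c W)) = (1 / (real CARD('n) * unit_ball_vol (real CARD('n)))) * nint 3 (\<lambda>xs. F 0 (c # xs))" if "c \<in> {0, 1}" for c
    using nint_cong[of 3 "pullback i j (face 0 c W)" "\<lambda>xs. (1 / (real CARD('n) * unit_ball_vol (real CARD('n)))) * F 0 (c # xs)"] pb[OF _ that]
    by (simp only: nint_cmult) (simp add: nint_cmult)
  from this[of 0] this[of 1] show ?thesis using F0 by simp
qed

section \<open>Diagrams of low degree\<close>

lemma lin_superset:
  assumes "finite S" "Poly_Mapping.keys x \<subseteq> S"
  shows "lin f x = (\<Sum>b\<in>S. Poly_Mapping.lookup x b *\<^sub>R f b)"
  unfolding lin_def
  by (rule sum.mono_neutral_left) (use assms in \<open>auto simp: in_keys_iff\<close>)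

lemma lookup_scaleR_poly: "Poly_Mapping.lookup (c *\<^sub>R x) b = c * Poly_Mapping.lookup (x :: 'b \<Rightarrow>\<^sub>0 real) b"
proof -
  have "{i. c * Poly_Mapping.lookup x i \<noteq> 0} \<subseteq> Poly_Mapping.keys x" by (auto simp: in_keys_iff)
  then have "finite {i. c * Poly_Mapping.lookup x i \<noteq> 0}" by (rule finite_subset) simp
  then show ?thesis by (simp add: scaleR_poly_mapping_def Abs_poly_mapping_inverse)
qed

lemma linear_lin: "linear (lin f)"
proof (rule linearI)
  fix x y :: "'a \<Rightarrow>\<^sub>0 real" and c :: real
  let ?S = "Poly_Mapping.keys x \<union> Poly_Mapping.keys y"
  have "lin f (x + y) = (\<Sum>b\<in>?S. Poly_Mapping.lookup (x + y) b *\<^sub>R f b)"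
    by (rule lin_superset) (use Poly_Mapping.keys_add[of x y] in auto)
  also have "\<dots> = lin f x + lin f y"
    by (simp add: lin_superset[of ?S] lookup_add scaleR_left_distrib sum.distrib)
  finally show "lin f (x + y) = lin f x + lin f y" .
  have "lin f (c *\<^sub>R x) = (\<Sum>b\<in>Poly_Mapping.keys x. Poly_Mapping.lookup (c *\<^sub>R x) b *\<^sub>R f b)"
    by (rule lin_superset) (auto simp: in_keys_iff lookup_scaleR_poly)
  then show "lin f (c *\<^sub>R x) = c *\<^sub>R lin f x"
    by (simp add: lin_def scaleR_sum_right lookup_scaleR_poly)
qed

lemma lin_gen: "lin f (gen b) = f b"
  by (simp add: lin_def)

lemma subspace_drel: "subspace (drel n)"
  unfolding drel_def by (rule subspace_span)

text \<open>Every generating relation is a single diagram or compares two diagrams with equally many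
  cells, so \<open>drel\<close> contains the homogeneous parts of its elements with respect to the
  number of cells.\<close>

lemma drel_length_part:
  assumes "x \<in> drel n"
  shows "lin (\<lambda>\<Gamma>. if length \<Gamma> = k then gen \<Gamma> else 0) x \<in> drel n" (is "?P x \<in> _")
  using assms unfolding drel_def
proof (induction rule: span_induct)
  case base
  show ?case
    using linear_subspace_vimage[OF linear_lin[of "\<lambda>\<Gamma>. if length \<Gamma> = k then gen \<Gamma> else 0"] subspace_drel[of n]]
    by (simp add: drel_def vimage_def)
next
  case (step x)
  interpret P: linear ?P by (rule linear_lin)
  have z: "0 \<in> drel n" using subspace_drel by (rule subspace_0)
  have b: "y \<in> drel n" if "y \<in> {gen \<Gamma> |\<Gamma>. \<not> admissible \<Gamma>}
   \<union> {gen (xs @ [c, d] @ ys) - (- 1) ^ (cdeg n c * cdeg n d) *\<^sub>R gen (xs @ [d, c] @ ys) |xs c d ys. True}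
   \<union> {gen (xs @ [Edge a b] @ ys) - (- 1) ^ n *\<^sub>R gen (xs @ [Edge b a] @ ys) |xs a b ys. True}
   \<union> {gen \<Gamma> - gen (rename \<rho> \<Gamma>) |\<Gamma> \<rho>. bij \<rho>}" for y
    unfolding drel_def by (rule span_base[OF that])
  have "?P x = x \<or> ?P x = 0"
  proof -
    have "(\<exists>\<Delta>. x = gen \<Delta>) \<or> (\<exists>a b k. length a = length b \<and> x = gen a - k *\<^sub>R gen b)"
      using step
    proof (elim UnE)
      assume "x \<in> {gen (xs @ [c, d] @ ys) - (- 1) ^ (cdeg n c * cdeg n d) *\<^sub>R gen (xs @ [d, c] @ ys) |xs c d ys. True}"
      then obtain xs c d ys where "x = gen (xs @ [c, d] @ ys) - (- 1) ^ (cdeg n c * cdeg n d) *\<^sub>R gen (xs @ [d, c] @ ys)" by blast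
      moreover have "length (xs @ [c, d] @ ys) = length (xs @ [d, c] @ ys)" by simp
      ultimately show ?thesis by blast
    next
      assume "x \<in> {gen (xs @ [Edge a b] @ ys) - (- 1) ^ n *\<^sub>R gen (xs @ [Edge b a] @ ys) |xs a b ys. True}"
      then obtain xs a b ys where "x = gen (xs @ [Edge a b] @ ys) - (- 1) ^ n *\<^sub>R gen (xs @ [Edge b a] @ ys)" by blast
      moreover have "length (xs @ [Edge a b] @ ys) = length (xs @ [Edge b a] @ ys)" by simp
      ultimately show ?thesis by blast
    next
      assume "x \<in> {gen \<Gamma> - gen (rename \<rho> \<Gamma>) |\<Gamma> \<rho>. bij \<rho>}"
      then obtain a \<rho> where "x = gen a - 1 *\<^sub>R gen (rename \<rho> a)" by auto
      moreover have "length a = length (rename \<rho> a)" by (simp add: rename_def)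
      ultimately show ?thesis by blast
    qed blast
    then show ?thesis
    proof (elim disjE exE conjE)
      fix \<Delta> assume x: "x = gen \<Delta>"
      show ?thesis unfolding x lin_gen by (cases "length \<Delta> = k") simp_all
    next
      fix a b c assume l: "length a = length b" and x: "x = gen a - c *\<^sub>R gen b"
      have "?P x = ?P (gen a) - c *\<^sub>R ?P (gen b)" unfolding x by (simp only: P.diff P.scale)
      then show ?thesis unfolding x lin_gen l by (cases "length b = k") simp_all
    qed
  qed
  then have "?P x \<in> drel n"
  proof
    assume e: "?P x = x" show ?thesis unfolding e by (rule b[OF step])
  next
    assume e: "?P x = 0" show ?thesis unfolding e by (rule z)
  qed
  then show ?case unfolding drel_def .
qed

text \<open>Otherwise the projection to lists as long as \<Gamma> would put
  \<open>gen \<Gamma>\<close> itself into \<open>drel\<close>. Counting cells distinguishes diagrams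
  in the quotient without an explicit description of it.\<close>

lemma gen_rel_length:
  assumes "gen \<Gamma>' - gen \<Gamma> \<in> drel n \<or> gen \<Gamma>' + gen \<Gamma> \<in> drel n" "gen \<Gamma> \<notin> drel n"
  shows "length \<Gamma>' = length \<Gamma>"
proof (rule ccontr)
  assume ne: "length \<Gamma>' \<noteq> length \<Gamma>"
  let ?P = "lin (\<lambda>\<Delta>. if length \<Delta> = length \<Gamma> then gen \<Delta> else 0)"
  interpret P: linear ?P by (rule linear_lin)
  have e: "?P (gen \<Gamma>' - gen \<Gamma>) = - gen \<Gamma>" "?P (gen \<Gamma>' + gen \<Gamma>) = gen \<Gamma>"
    using ne unfolding P.diff P.add lin_gen by simp_all
  from assms(1) have "- gen \<Gamma> \<in> drel n \<or> gen \<Gamma> \<in> drel n"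
    using drel_length_part[of "gen \<Gamma>' - gen \<Gamma>" n "length \<Gamma>"] drel_length_part[of "gen \<Gamma>' + gen \<Gamma>" n "length \<Gamma>"]
    unfolding e by blast
  then show False using assms(2) subspace_neg[OF subspace_drel[of n], of "- gen \<Gamma>"] by auto
qed

section \<open>Dual functionals of diagrams\<close>

definition dsign :: "nat \<Rightarrow> 'm odiag \<Rightarrow> 'm odiag \<Rightarrow> real" where
  "dsign n \<Gamma> \<Gamma>' = (if gen \<Gamma>' - gen \<Gamma> \<in> drel n then 1 else if gen \<Gamma>' + gen \<Gamma> \<in> drel n then - 1 else 0)"

lemma dual_elt_gen: "dual_elt n \<Gamma> (gen \<Gamma>') = dsign n \<Gamma> \<Gamma>'"
  by (simp add: dual_elt_def lin_gen dsign_def)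

lemma linear_dual_elt: "linear (dual_elt n \<Gamma>)"
  unfolding dual_elt_def by (rule linear_lin)

lemma drel_cancel:
  "x - y \<in> drel n \<Longrightarrow> y - z \<in> drel n \<Longrightarrow> x - z \<in> drel n"
  "x - y \<in> drel n \<Longrightarrow> y + z \<in> drel n \<Longrightarrow> x + z \<in> drel n"
  using subspace_add[OF subspace_drel[of n], of "x - y" "y - z"] subspace_add[OF subspace_drel[of n], of "x - y" "y + z"]
  by (simp_all add: algebra_simps)

lemma drel_neg: "x \<in> drel n \<longleftrightarrow> - x \<in> drel n"
  using subspace_neg[OF subspace_drel[of n], of x] subspace_neg[OF subspace_drel[of n], of "- x"] by auto

text \<open>Half the difference of the two elements is \<open>gen \<Gamma>\<close>.\<close>

lemma not_both_signs:
  assumes "gen \<Gamma> \<notin> drel n" "x - gen \<Gamma> \<in> drel n" "x + gen \<Gamma> \<in> drel n" shows False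
proof -
  have "(1 / 2) *\<^sub>R ((x + gen \<Gamma>) - (x - gen \<Gamma>)) \<in> drel n"
    by (intro subspace_scale[OF subspace_drel] subspace_diff[OF subspace_drel] assms)
  moreover have "(1 / 2) *\<^sub>R ((x + gen \<Gamma>) - (x - gen \<Gamma>)) = gen \<Gamma>"
    by (simp add: scaleR_right_diff_distrib scaleR_right_distrib flip: scaleR_left_distrib)
  ultimately show False using assms(1) by simp
qed

lemma dsign_same:
  assumes "gen a - gen b \<in> drel n" shows "dsign n \<Gamma> a = dsign n \<Gamma> b"
proof -
  have r: "gen b - gen a \<in> drel n" using assms drel_neg[of "gen a - gen b"] by simp
  have "gen a - gen \<Gamma> \<in> drel n \<longleftrightarrow> gen b - gen \<Gamma> \<in> drel n" "gen a + gen \<Gamma> \<in> drel n \<longleftrightarrow> gen b + gen \<Gamma> \<in> drel n"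
    using drel_cancel[OF assms] drel_cancel[OF r] by blast+
  then show ?thesis by (simp add: dsign_def)
qed

lemma dsign_opposite:
  assumes "gen a + gen b \<in> drel n" "gen \<Gamma> \<notin> drel n" shows "dsign n \<Gamma> a = - dsign n \<Gamma> b"
proof -
  have *: "gen x - gen \<Gamma> \<in> drel n \<longleftrightarrow> gen y + gen \<Gamma> \<in> drel n" if "gen x + gen y \<in> drel n" for x y
  proof -
    have "gen x + gen y - (gen x - gen \<Gamma>) = gen y + gen \<Gamma>" "gen x + gen y - (gen y + gen \<Gamma>) = gen x - gen \<Gamma>"
      by (simp_all add: algebra_simps)
    then show ?thesis using subspace_diff[OF subspace_drel that] by metis
  qed
  have "gen b + gen a \<in> drel n" using assms(1) by (simp add: add.commute)
  from *[OF assms(1)] *[OF this] show ?thesis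
    using not_both_signs[OF assms(2)] by (auto simp: dsign_def)
qed

text \<open>\<open>dual_elt\<close> is prescribed on all diagrams, so it has to be checked on the
  relations: a non-admissible diagram is not equivalent to \<Gamma> up to sign, and the other
  relations identify diagrams up to a sign that \<open>dsign\<close> respects.\<close>

lemma dual_elt_drel:
  assumes g: "gen \<Gamma> \<notin> drel n" and x: "x \<in> drel n"
  shows "dual_elt n \<Gamma> x = 0"
proof -
  let ?D = "dual_elt n \<Gamma>"
  interpret D: linear ?D by (rule linear_dual_elt)
  let ?G = "{gen \<Gamma> |\<Gamma>. \<not> admissible \<Gamma>}
   \<union> {gen (xs @ [c, d] @ ys) - (- 1) ^ (cdeg n c * cdeg n d) *\<^sub>R gen (xs @ [d, c] @ ys) |xs c d ys. True}
   \<union> {gen (xs @ [Edge a b] @ ys) - (- 1) ^ n *\<^sub>R gen (xs @ [Edge b a] @ ys) |xs a b ys. True}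
   \<union> {gen \<Gamma> - gen (rename \<rho> \<Gamma>) |\<Gamma> \<rho>. bij \<rho>}"
  have sgn: "?D (gen a - (- 1) ^ k *\<^sub>R gen b) = 0" if "gen a - (- 1) ^ k *\<^sub>R gen b \<in> ?G" for a b k
  proof -
    have "gen a - (- 1) ^ k *\<^sub>R gen b \<in> drel n" unfolding drel_def by (rule span_base[OF that])
    then show ?thesis using dsign_same[of a b n] dsign_opposite[of a b n, OF _ g]
      by (cases "even k") (auto simp: D.diff D.add D.scale dual_elt_gen)
  qed
  have "?D y = 0" if y: "y \<in> ?G" for y
  proof -
    consider (adm) \<Delta> where "y = gen \<Delta>" "\<not> admissible \<Delta>"
      | (sign) a b k where "y = gen a - (- 1) ^ k *\<^sub>R gen b"
      using y
    proof (elim UnE)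
      assume "y \<in> {gen \<Gamma> - gen (rename \<rho> \<Gamma>) |\<Gamma> \<rho>. bij \<rho>}"
      then obtain a \<rho> where "y = gen a - (- 1) ^ 0 *\<^sub>R gen (rename \<rho> a)" by auto
      then show ?thesis by (rule sign)
    qed (use that in blast)+
    then show ?thesis
    proof cases
      case adm
      have "gen \<Delta> \<in> drel n" unfolding drel_def by (rule span_base) (use adm in blast)
      then have "gen \<Delta> - gen \<Gamma> \<notin> drel n" "gen \<Delta> + gen \<Gamma> \<notin> drel n"
        using g subspace_diff[OF subspace_drel, of "gen \<Delta>" n "gen \<Delta> - gen \<Gamma>"]
          subspace_diff[OF subspace_drel, of "gen \<Delta> + gen \<Gamma>" n "gen \<Delta>"] by auto
      then show ?thesis by (simp add: adm dual_elt_gen dsign_def)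
    next
      case sign then show ?thesis using sgn[of a k b] y by simp
    qed
  qed
  then show ?thesis
    using linear_eq_0_on_span[OF linear_dual_elt, of ?G n \<Gamma> x] x unfolding drel_def by blast
qed

lemma dual_elt_length: "gen \<Gamma> \<notin> drel n \<Longrightarrow> length \<Gamma>' \<noteq> length \<Gamma> \<Longrightarrow> dual_elt n \<Gamma> (gen \<Gamma>') = 0"
  unfolding dual_elt_gen dsign_def using gen_rel_length by (metis (full_types))

lemma basis_admissible:
  assumes "diagram_basis n B" "\<Gamma> \<in> B" shows "gen \<Gamma> \<notin> drel n" "admissible \<Gamma>"
proof -
  show g: "gen \<Gamma> \<notin> drel n" using assms by (simp add: diagram_basis_def)
  show "admissible \<Gamma>"
  proof (rule ccontr)
    assume "\<not> admissible \<Gamma>"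
    then have "gen \<Gamma> \<in> drel n" unfolding drel_def by (intro span_base) blast
    then show False using g by simp
  qed
qed

text \<open>A basis has one diagram per orientation class, so no other member is equivalent to
  \<Gamma> up to sign.\<close>

lemma dual_elt_basis:
  assumes "diagram_basis n B" "\<Gamma> \<in> B" "\<Gamma>' \<in> B"
  shows "dual_elt n \<Gamma> (gen \<Gamma>') = (if \<Gamma>' = \<Gamma> then 1 else 0)"
proof -
  have z: "0 \<in> drel n" using subspace_0[OF subspace_drel] .
  have ex: "\<exists>!\<Gamma>''. \<Gamma>'' \<in> B \<and> (gen \<Gamma>' - gen \<Gamma>'' \<in> drel n \<or> gen \<Gamma>' + gen \<Gamma>'' \<in> drel n)"
    using assms(1) basis_admissible(1)[OF assms(1,3)] unfolding diagram_basis_def by blast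
  have "\<Gamma>' = \<Gamma>" if "gen \<Gamma>' - gen \<Gamma> \<in> drel n \<or> gen \<Gamma>' + gen \<Gamma> \<in> drel n"
    using ex assms(2,3) that z by (metis diff_self)
  then show ?thesis using z by (auto simp: dual_elt_gen dsign_def)
qed

lemma desusp_scaled_dual:
  assumes "diagram_basis n B" "\<Gamma> \<in> B" "\<Gamma> \<noteq> []"
  shows "desusp B (\<lambda>x. c * dual_elt n \<Gamma> x) = c *\<^sub>R letter \<Gamma>"
proof -
  have "desusp B (\<lambda>x. c * dual_elt n \<Gamma> x) = Sum_any (\<lambda>\<Gamma>'. if \<Gamma>' = \<Gamma> then c *\<^sub>R letter \<Gamma> else 0)"
    unfolding desusp_def
    by (rule arg_cong[where f=Sum_any]) (use assms in \<open>auto simp: fun_eq_iff dual_elt_basis[OF assms(1,2)]\<close>)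
  also have "\<dots> = c *\<^sub>R letter \<Gamma>"
    by (subst Sum_any.expand_superset[where A="{\<Gamma>}"]) auto
  finally show ?thesis .
qed

lemma desusp_zero: "(\<And>\<Gamma>. \<Gamma> \<in> B \<Longrightarrow> \<Gamma> \<noteq> [] \<Longrightarrow> c (gen \<Gamma>) = 0) \<Longrightarrow> desusp B c = 0"
  unfolding desusp_def by (simp add: if_distrib cong: if_cong)

text \<open>Among the basis elements this functional is nonzero at most on the unit diagram, which
  \<open>desusp\<close> omits.\<close>

lemma omega_coeff_unit:
  assumes "diagram_basis n B" "[] \<in> B" shows "omega_coeff n B [] = 0"
proof -
  have "desusp B (star_elt n []) = 0"
    by (rule desusp_zero) (simp add: star_elt_def dual_elt_basis[OF assms])
  then show ?thesis by (simp add: omega_coeff_def)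
qed

section \<open>Counting cells of admissible diagrams\<close>

lemma edge_list_length: "length (edge_list \<Gamma>) = length (filter (\<lambda>c. \<exists>a b. c = Edge a b) \<Gamma>)"
  unfolding edge_list_def by (induction \<Gamma>) (auto split: cell.splits)

lemma ivert_list_length: "length (ivert_list \<Gamma>) = length (filter (\<lambda>c. \<exists>v. c = IVert v) \<Gamma>)"
  unfolding ivert_list_def by (induction \<Gamma>) (auto split: cell.splits)

lemma filter_length_card: "distinct xs \<Longrightarrow> length (filter P xs) = card {x \<in> set xs. P x}"
  by (metis distinct_card distinct_filter set_filter)

text \<open>A path from an internal to an external vertex has a first step that leaves the internal
  vertices.\<close>

lemma adj_crossing:
  assumes "(u, w) \<in> (adj \<Gamma>)\<^sup>*" "u = Inn v" "w = Ext i"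
  shows "\<exists>a b x j. Edge a b \<in> set \<Gamma> \<and> {a, b} = {Inn x, Ext j}"
proof -
  have "(\<exists>x. w = Inn x) \<or> (\<exists>a b x j. Edge a b \<in> set \<Gamma> \<and> {a, b} = {Inn x, Ext j})"
    using assms(1,2)
  proof (induction rule: rtrancl_induct)
    case base then show ?case by simp
  next
    case (step y z)
    from step.IH[OF step.prems] show ?case
    proof
      assume "\<exists>x. y = Inn x"
      then obtain x where y: "y = Inn x" by blast
      have e: "Edge y z \<in> set \<Gamma> \<or> Edge z y \<in> set \<Gamma>" using step.hyps(2) by (simp add: adj_def)
      show ?thesis
      proof (cases z)
        case (Ext j)
        from e show ?thesis
        proof
          assume "Edge y z \<in> set \<Gamma>" then show ?thesis using y Ext by blast
        next
          assume "Edge z y \<in> set \<Gamma>"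
          moreover have "{z, y} = {Inn x, Ext j}" using y Ext by blast
          ultimately show ?thesis by blast
        qed
      next
        case (Inn x') then show ?thesis by blast
      qed
    qed blast
  qed
  then show ?thesis using assms(3) by auto
qed

text \<open>\<open>V\<close> is the number of internal vertices and \<open>e\<^sub>i\<close> the number of edges with exactly \<open>i\<close> internal endpoints.\<close>

lemma degree_arith:
  fixes n V e0 e1 e2 :: nat
  assumes n: "n \<ge> 4" and a: "3 * V \<le> e1 + 2 * e2" "2 * e2 \<le> V * (V - 1)" "V > 0 \<Longrightarrow> e1 > 0"
    "V = 0 \<Longrightarrow> e1 = 0" "V = 0 \<Longrightarrow> e0 > 0"
  shows "(int n - 1) * int (e0 + e1 + e2) - int n * int V \<ge> 3"
    "(int n - 1) * int (e0 + e1 + e2) - int n * int V = 3 \<Longrightarrow> n = 4 \<and> e0 + e1 + e2 + V = 1"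
proof -
  \<comment> \<open>With E edges this reads 3 E \<ge> 4 V + 3, the case n = 4 of the claim. In
    general the degree is (n - 4)(E - V) + (3 E - 4 V).\<close>
  have *: "3 * (e0 + e1 + e2) \<ge> 4 * V + 3 \<and> (3 * (e0 + e1 + e2) = 4 * V + 3 \<longrightarrow> e0 + e1 + e2 + V = 1)"
  proof (cases "V = 0")
    case True then show ?thesis using a by auto
  next
    case False
    \<comment> \<open>With one edge to an external vertex and at most three internal vertices, 3 V
      edge ends do not fit: simple edges provide at most 1 + V (V - 1) of them.\<close>
    have "e1 \<ge> 2 \<or> V \<ge> 4"
    proof (rule ccontr)
      assume "\<not> ?thesis"
      then have "e1 = 1" "V \<in> {1, 2, 3}" using False a(3) by auto
      then show False using a(1,2) by auto
    qed
    moreover have "e1 > 0" using a(3) False by simp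
    moreover have "V \<ge> 1" using False by simp
    ultimately have "V + 3 * e1 > 6" by (elim disjE) linarith+
    \<comment> \<open>Valence bounds the last summand from below by 9 V, and
      \<open>V + 3 * e1 > 6\<close> then makes the inequality strict.\<close>
    moreover have "6 * (e0 + e1 + e2) = 6 * e0 + 3 * e1 + 3 * (e1 + 2 * e2)" by simp
    ultimately have "6 * (e0 + e1 + e2) > 8 * V + 6" using mult_le_mono2[OF a(1), of 3] by linarith
    then show ?thesis by linarith
  qed
  have p: "e0 + e1 + e2 \<ge> V + 1" using conjunct1[OF *] by presburger
  have e: "(int n - 1) * int (e0 + e1 + e2) - int n * int V
      = (int n - 4) * (int (e0 + e1 + e2) - int V) + (3 * int (e0 + e1 + e2) - 4 * int V)"
    by (simp add: algebra_simps)
  have q: "(int n - 4) * (int (e0 + e1 + e2) - int V) \<ge> int n - 4"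
    using mult_left_mono[of 1 "int (e0 + e1 + e2) - int V" "int n - 4"] n p by simp
  have ge: "3 * int (e0 + e1 + e2) - 4 * int V \<ge> 3" using conjunct1[OF *] by linarith
  show "(int n - 1) * int (e0 + e1 + e2) - int n * int V \<ge> 3"
    unfolding e using q ge n by linarith
  assume "(int n - 1) * int (e0 + e1 + e2) - int n * int V = 3"
  then have "n = 4" "3 * int (e0 + e1 + e2) - 4 * int V = 3" unfolding e using q ge n by linarith+
  moreover from this have "3 * (e0 + e1 + e2) = 4 * V + 3" by linarith
  ultimately show "n = 4 \<and> e0 + e1 + e2 + V = 1" using * by blast
qed

text \<open>Supplies the hypotheses of \<open>degree_arith\<close>: valence gives the first by
  double counting, absence of multiple edges the second, and connection to external vertices the
  third.\<close>

lemma degree_ge_3: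
  fixes \<Gamma> :: "'m odiag"
  assumes adm: "admissible \<Gamma>" and ne: "\<Gamma> \<noteq> []" and n: "n \<ge> 4"
  shows "degree n \<Gamma> \<ge> 3" "degree n \<Gamma> = 3 \<Longrightarrow> n = 4 \<and> length \<Gamma> = 1"
proof -
  have d: "distinct \<Gamma>" and ed: "\<And>a b. Edge a b \<in> set \<Gamma> \<Longrightarrow> a \<noteq> b \<and> Edge b a \<notin> set \<Gamma>"
    and iv: "\<And>c v. c \<in> set \<Gamma> \<Longrightarrow> Inn v \<in> ends c \<Longrightarrow> IVert v \<in> set \<Gamma>"
    and val: "\<And>v. IVert v \<in> set \<Gamma> \<Longrightarrow> card {c \<in> set \<Gamma>. Inn v \<in> ends c} \<ge> 3"
    and con: "\<And>v. IVert v \<in> set \<Gamma> \<Longrightarrow> \<exists>i. (Inn v, Ext i) \<in> (adj \<Gamma>)\<^sup>*"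
    using adm unfolding admissible_def by blast+
  define V where "V = {v. IVert v \<in> set \<Gamma>}"
  define I where "I c = {v. Inn v \<in> ends c}" for c :: "'m cell"
  define E where "E k = {c \<in> set \<Gamma>. (\<exists>a b. c = Edge a b) \<and> card (I c) = k}" for k
  have Ve: "{c \<in> set \<Gamma>. \<exists>v. c = IVert v} = IVert ` V" by (auto simp: V_def)
  have "finite (IVert ` V :: 'm cell set)" unfolding Ve[symmetric] by simp
  then have fV: "finite V" by (rule finite_imageD) (simp add: inj_on_def)
  have lV: "length (ivert_list \<Gamma>) = card V"
    unfolding ivert_list_length filter_length_card[OF d] Ve by (rule card_image) (simp add: inj_on_def)
  have fE: "finite (E k)" for k by (simp add: E_def)
  have If: "finite (I c)" "card (I c) \<le> 2" if "\<exists>a b. c = Edge a b" for c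
  proof -
    from that obtain a b where c: "c = Edge a b" by blast
    have s: "Inn ` I c \<subseteq> {a, b}" by (auto simp: I_def c)
    then have "finite (Inn ` I c :: 'm vertex set)" by (rule finite_subset) simp
    then show f: "finite (I c)" by (rule finite_imageD) (simp add: inj_on_def)
    have "card (I c) = card (Inn ` I c :: 'm vertex set)" by (rule card_image[symmetric]) (simp add: inj_on_def)
    also have "\<dots> \<le> card {a, b}" by (rule card_mono[OF _ s]) simp
    also have "\<dots> \<le> 2" by (cases "a = b") simp_all
    finally show "card (I c) \<le> 2" .
  qed
  have split: "{c \<in> set \<Gamma>. \<exists>a b. c = Edge a b} = E 0 \<union> E 1 \<union> E 2"
  proof (rule set_eqI)
    fix c
    show "c \<in> {c \<in> set \<Gamma>. \<exists>a b. c = Edge a b} \<longleftrightarrow> c \<in> E 0 \<union> E 1 \<union> E 2"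
    proof (cases "\<exists>a b. c = Edge a b")
      case True
      have "card (I c) = 0 \<or> card (I c) = 1 \<or> card (I c) = 2" using If(2)[OF True] by linarith
      then show ?thesis using True by (elim disjE) (simp_all add: E_def)
    qed (simp add: E_def)
  qed
  have disj: "E 0 \<inter> E 1 = {}" "(E 0 \<union> E 1) \<inter> E 2 = {}" by (auto simp: E_def)
  have lE: "length (edge_list \<Gamma>) = card (E 0) + card (E 1) + card (E 2)"
    unfolding edge_list_length filter_length_card[OF d] split
    using card_Un_disjoint[OF finite_UnI[OF fE fE] fE disj(2)] card_Un_disjoint[OF fE fE disj(1)] by simp
  have Iv: "I c \<subseteq> V" if "c \<in> set \<Gamma>" for c using iv[OF that] by (auto simp: I_def V_def)
  \<comment> \<open>Incidences of internal vertices with edges are counted by vertices and then by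
    edges.\<close>
  have "3 * card V = (\<Sum>v\<in>V. 3)" by simp
  also have "\<dots> \<le> (\<Sum>v\<in>V. card {c \<in> set \<Gamma>. Inn v \<in> ends c})" by (rule sum_mono) (simp add: V_def val)
  also have "\<dots> = (\<Sum>v\<in>V. \<Sum>c\<in>set \<Gamma>. if Inn v \<in> ends c then 1 else 0)"
    by (intro sum.cong refl) (simp add: sum.If_cases Int_def)
  also have "\<dots> = (\<Sum>c\<in>set \<Gamma>. \<Sum>v\<in>V. if Inn v \<in> ends c then 1 else 0)" by (rule sum.swap)
  also have "\<dots> = (\<Sum>c\<in>set \<Gamma>. card (I c))"
  proof (rule sum.cong[OF refl])
    fix c assume "c \<in> set \<Gamma>"
    then have "V \<inter> {v. Inn v \<in> ends c} = I c" using Iv by (auto simp: I_def)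
    then show "(\<Sum>v\<in>V. if Inn v \<in> ends c then 1 else 0) = card (I c)" by (simp add: sum.If_cases fV)
  qed
  also have "\<dots> = (\<Sum>c\<in>E 0 \<union> E 1 \<union> E 2. card (I c))"
  proof (rule sum.mono_neutral_right)
    show "\<forall>c\<in>set \<Gamma> - (E 0 \<union> E 1 \<union> E 2). card (I c) = 0"
    proof
      fix c assume "c \<in> set \<Gamma> - (E 0 \<union> E 1 \<union> E 2)"
      then have "\<not> (\<exists>a b. c = Edge a b)" unfolding split[symmetric] by blast
      then show "card (I c) = 0" by (cases c) (simp_all add: I_def)
    qed
  qed (auto simp: E_def)
  also have "\<dots> = (\<Sum>c\<in>E 0. card (I c)) + (\<Sum>c\<in>E 1. card (I c)) + (\<Sum>c\<in>E 2. card (I c))"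
    using sum.union_disjoint[OF finite_UnI[OF fE fE] fE disj(2)] sum.union_disjoint[OF fE fE disj(1)] by metis
  also have "\<dots> = card (E 1) + 2 * card (E 2)" by (simp add: E_def)
  finally have a1: "3 * card V \<le> card (E 1) + 2 * card (E 2)" .
  \<comment> \<open>Multiple edges are excluded in both directions, so an edge between internal
    vertices is determined by its unordered pair of ends; there are at most V choose 2 such
    edges.\<close>
  have "inj_on I (E 2)"
  proof (rule inj_onI)
    fix c d assume c: "c \<in> E 2" and d: "d \<in> E 2" and eq: "I c = I d"
    have form: "\<exists>a b. c = Edge (Inn a) (Inn b) \<and> I c = {a, b}" if "c \<in> E 2" for c
    proof -
      from that obtain x y where c: "c = Edge x y" "card (I c) = 2" "c \<in> set \<Gamma>" by (auto simp: E_def)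
      show ?thesis
      proof (cases x; cases y)
        fix a b assume "x = Inn a" "y = Inn b"
        then show ?thesis using c by (auto simp: I_def)
      next
        fix a i assume "x = Inn a" "y = Ext i"
        then have "I c = {a}" using c by (auto simp: I_def)
        then show ?thesis using c(2) by simp
      next
        fix a i assume "x = Ext i" "y = Inn a"
        then have "I c = {a}" using c by (auto simp: I_def)
        then show ?thesis using c(2) by simp
      next
        fix i j assume "x = Ext i" "y = Ext j"
        then have "I c = {}" using c by (auto simp: I_def)
        then show ?thesis using c(2) by simp
      qed
    qed
    from form[OF c] form[OF d] obtain a b a' b' where f: "c = Edge (Inn a) (Inn b)" "I c = {a, b}"
      "d = Edge (Inn a') (Inn b')" "I d = {a', b'}" by blast
    have "a = a' \<and> b = b' \<or> a = b' \<and> b = a'" using f(2,4) eq doubleton_eq_iff[of a b a' b'] by blast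
    moreover have "c \<in> set \<Gamma>" "d \<in> set \<Gamma>" using c d by (auto simp: E_def)
    ultimately show "c = d" using ed f(1,3) by metis
  qed
  moreover have "I ` E 2 \<subseteq> {A. A \<subseteq> V \<and> card A = 2}" using Iv by (auto simp: E_def)
  ultimately have "card (E 2) \<le> card {A. A \<subseteq> V \<and> card A = 2}"
    by (rule card_inj_on_le) (use fV in simp)
  also have "\<dots> = card V * (card V - 1) div 2" by (simp add: n_subsets[OF fV] choose_two)
  finally have a2: "2 * card (E 2) \<le> card V * (card V - 1)" by linarith
  have a3: "card (E 1) > 0" if "card V > 0"
  proof -
    from that fV obtain v where "v \<in> V" by (metis card_gt_0_iff ex_in_conv)
    then obtain i where "(Inn v, Ext i) \<in> (adj \<Gamma>)\<^sup>*" using con by (auto simp: V_def)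
    from adj_crossing[OF this refl refl] obtain a b x j where c: "Edge a b \<in> set \<Gamma>" "{a, b} = {Inn x, Ext j}" by blast
    have "I (Edge a b) = {x}" using c(2) by (auto simp: I_def)
    then have "Edge a b \<in> E 1" using c(1) by (simp add: E_def)
    then show ?thesis using fE[of 1] by (auto simp: card_gt_0_iff)
  qed
  have V0: "I c = {}" if "card V = 0" "c \<in> set \<Gamma>" for c using Iv[OF that(2)] that(1) fV by simp
  have a4: "card (E 1) = 0" if "card V = 0"
  proof -
    have "E 1 = {}" using V0[OF that] by (auto simp: E_def)
    then show ?thesis by simp
  qed
  have a5: "card (E 0) > 0" if "card V = 0"
  proof -
    obtain c where c: "c \<in> set \<Gamma>" using ne by (cases \<Gamma>) auto
    have "\<exists>a b. c = Edge a b"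
    proof (cases c)
      case (IVert v) then have "v \<in> V" using c by (simp add: V_def)
      then show ?thesis using that fV by simp
    qed blast
    then have "c \<in> E 0" using c V0[OF that c] by (simp add: E_def)
    then show ?thesis using fE[of 0] by (auto simp: card_gt_0_iff)
  qed
  have D: "degree n \<Gamma> = (int n - 1) * int (card (E 0) + card (E 1) + card (E 2)) - int n * int (card V)"
    by (simp add: degree_def lE lV)
  have len: "length \<Gamma> = card (E 0) + card (E 1) + card (E 2) + card V"
  proof -
    have "length \<Gamma> = length (edge_list \<Gamma>) + length (ivert_list \<Gamma>)"
      unfolding edge_list_def ivert_list_def by (induction \<Gamma>) (auto split: cell.splits)
    then show ?thesis using lE lV by simp
  qed
  note ar = degree_arith[OF n a1 a2 a3 a4 a5]
  show "degree n \<Gamma> \<ge> 3" unfolding D by (rule ar(1))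
  show "degree n \<Gamma> = 3 \<Longrightarrow> n = 4 \<and> length \<Gamma> = 1" unfolding D len by (rule ar(2))
qed

text \<open>An internal vertex would need valence 3, and an edge with an internal end would need
  that vertex as a second cell.\<close>

lemma admissible_single:
  assumes "admissible \<Gamma>" "length \<Gamma> = 1"
  obtains i j where "i \<noteq> j" "\<Gamma> = [Edge (Ext i) (Ext j)]"
proof -
  from assms(2) obtain c where c: "\<Gamma> = [c]" by (auto simp: length_Suc_conv)
  have iv: "\<And>v. Inn v \<in> ends c \<Longrightarrow> IVert v = c"
    and val: "\<And>v. IVert v = c \<Longrightarrow> card {d \<in> {c}. Inn v \<in> ends d} \<ge> 3"
    and ed: "\<And>a b. c = Edge a b \<Longrightarrow> a \<noteq> b"
  proof -
    have A: "\<forall>a b. Edge a b \<in> {c} \<longrightarrow> a \<noteq> b \<and> Edge b a \<notin> {c}"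
      "\<forall>d\<in>{c}. \<forall>v. Inn v \<in> ends d \<longrightarrow> IVert v \<in> {c}"
      "\<forall>v. IVert v \<in> {c} \<longrightarrow> card {d \<in> {c}. Inn v \<in> ends d} \<ge> 3 \<and> (\<exists>i. (Inn v, Ext i) \<in> (adj [c])\<^sup>*)"
      using assms(1) unfolding admissible_def c list.set by blast+
    show "IVert v = c" if "Inn v \<in> ends c" for v using A(2) that by simp
    show "card {d \<in> {c}. Inn v \<in> ends d} \<ge> 3" if "IVert v = c" for v using A(3) that by blast
    show "a \<noteq> b" if "c = Edge a b" for a b using A(1) that by blast
  qed
  have le: "card {d \<in> {c}. Inn v \<in> ends d} \<le> 1" for v
    by (rule order_trans[OF card_mono[of "{c}"]]) auto
  have "IVert v \<noteq> c" for v
  proof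
    assume "IVert v = c"
    from val[OF this] le[of v] show False by linarith
  qed
  then have ni: "Inn v \<notin> ends c" and nv: "c \<noteq> IVert v" for v using iv[of v] by auto
  obtain a b where e: "c = Edge a b"
  proof (cases c)
    case (IVert v) with nv show ?thesis by blast
  qed (rule that)
  have "Inn v \<noteq> a \<and> Inn v \<noteq> b" for v using ni[of v] by (simp add: e)
  then obtain i j where ij: "a = Ext i" "b = Ext j" by (metis vertex.exhaust)
  show ?thesis
  proof (rule that)
    show "i \<noteq> j" using ed[OF e] ij by simp
    show "\<Gamma> = [Edge (Ext i) (Ext j)]" using c e ij by simp
  qed
qed

text \<open>The vertex and three edges at it are different cells.\<close>

lemma admissible_ivert_length:
  assumes "admissible \<Gamma>" "IVert v \<in> set \<Gamma>" shows "length \<Gamma> \<ge> 4"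
proof -
  have d: "distinct \<Gamma>" and v: "card {c \<in> set \<Gamma>. Inn v \<in> ends c} \<ge> 3"
    using assms unfolding admissible_def by blast+
  have "card (insert (IVert v) {c \<in> set \<Gamma>. Inn v \<in> ends c}) \<le> card (set \<Gamma>)"
    by (rule card_mono) (use assms(2) in auto)
  then show ?thesis using v distinct_card[OF d] by simp
qed

section \<open>The transport in low degree\<close>

lemma prod_list_zero: "(0 :: 'a::semiring_1) \<in> set xs \<Longrightarrow> prod_list xs = 0"
  by (induction xs) auto

lemma basis_degree:
  assumes "diagram_basis n B" "n \<ge> 4" "\<Gamma> \<in> B" "\<Gamma> \<noteq> []"
  shows "degree n \<Gamma> \<ge> 3" "degree n \<Gamma> = 3 \<Longrightarrow> n = 4 \<and> (\<exists>i j. i \<noteq> j \<and> \<Gamma> = [Edge (Ext i) (Ext j)])"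
proof -
  note adm = basis_admissible(2)[OF assms(1,3)]
  show "degree n \<Gamma> \<ge> 3" by (rule degree_ge_3(1)[OF adm assms(4,2)])
  assume "degree n \<Gamma> = 3"
  from degree_ge_3(2)[OF adm assms(4,2) this] show "n = 4 \<and> (\<exists>i j. i \<noteq> j \<and> \<Gamma> = [Edge (Ext i) (Ext j)])"
    using admissible_single[OF adm] by metis
qed

lemma degree_single: "degree n [Edge a b] = int n - 1"
  by (simp add: degree_def edge_list_def ivert_list_def)

lemma desusp_low_degree:
  assumes "diagram_basis n B" "n \<ge> 4" "c \<in> gdual n d" "desusp B c \<noteq> 0"
  shows "d \<ge> 3"
proof -
  obtain \<Gamma> where g: "\<Gamma> \<in> B" "\<Gamma> \<noteq> []" "c (gen \<Gamma>) \<noteq> 0" using desusp_zero[of B c] assms(4) by blast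
  then have "degree n \<Gamma> = d" using assms(3) basis_admissible(2)[OF assms(1) g(1)] unfolding gdual_def by blast
  then show ?thesis using basis_degree(1)[OF assms(1,2) g(1,2)] by simp
qed

text \<open>Each nonzero factor has degree at least 2 after desuspension, and the empty product has
  degree 0; so a product of degree 1 has a vanishing factor.\<close>

lemma Omega_1:
  assumes "diagram_basis n B" "n \<ge> 4" "x \<in> Omega n B 1"
  shows "x = 0"
proof -
  have *: "(\<exists>c\<in>set cs. desusp B c = 0) \<or> (\<Sum>d\<leftarrow>ds. d - 1) \<ge> 2 * int (length cs)"
    if "list_all2 (\<lambda>c d. c \<in> gdual n d) cs ds" for cs ds
    using that
  proof (induction rule: list_all2_induct)
    case (Cons c cs d ds)
    show ?case
    proof (cases "desusp B c = 0")
      case False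
      from desusp_low_degree[OF assms(1,2) Cons(1) False] Cons(3) show ?thesis by auto
    qed simp
  qed simp
  have "y = 0" if y: "y \<in> {prod_list (map (desusp B) cs) |cs ds.
     list_all2 (\<lambda>c d. c \<in> gdual n d) cs ds \<and> (\<Sum>d\<leftarrow>ds. d - 1) = 1}" for y
  proof -
    from y obtain cs ds where c: "y = prod_list (map (desusp B) cs)" "list_all2 (\<lambda>c d. c \<in> gdual n d) cs ds"
      "(\<Sum>d\<leftarrow>ds. d - 1) = 1" by blast
    have "\<exists>c\<in>set cs. desusp B c = 0"
    proof (rule ccontr)
      assume "\<not> ?thesis"
      then have "2 * int (length cs) \<le> 1" using *[OF c(2)] c(3) by simp
      then have "cs = []" by (cases cs) simp_all
      then show False using c(2,3) by simp
    qed
    then have "0 \<in> set (map (desusp B) cs)" by force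
    then show ?thesis unfolding c(1) by (rule prod_list_zero)
  qed
  then have "Omega n B 1 \<subseteq> span {0}" unfolding Omega_def by (intro span_mono) blast
  then show ?thesis using assms(3) by auto
qed

lemma Omega12_trivial:
  assumes "diagram_basis n B" "n \<ge> 4" shows "Omega12 n B = {0}"
proof -
  have "Omega12 n B \<subseteq> span {0}" unfolding Omega12_def
    by (rule span_mono) (use Omega_1[OF assms] in fastforce)
  moreover have "0 \<in> Omega12 n B" unfolding Omega12_def by (rule span_zero)
  ultimately show ?thesis by auto
qed

lemma linear_d_Omega: "linear (d_Omega n B)"
  unfolding d_Omega_def by (rule linear_lin)

text \<open>Classes are singletons, so 3-morphisms of the target can be handled like
  elements.\<close>

lemma mod12_trivial:
  assumes "diagram_basis n B" "n \<ge> 4" shows "mod12 n B x = {x}"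
  unfolding mod12_def Omega12_trivial[OF assms] using linear_0[OF linear_d_Omega[of n B]] by simp

lemma one_in_Omega_0: "1 \<in> Omega n B 0"
  unfolding Omega_def by (rule span_base) (auto intro!: exI[of _ "[]"])

text \<open>A homogeneous functional of degree 3 is required. The dual of a single edge sees only
  diagrams with one cell, and the admissible ones among these are single edges, which have degree 3
  for n = 4.\<close>

lemma letter_in_Omega_2:
  assumes B: "diagram_basis n B" and n: "n \<ge> 4" and g: "\<Gamma> \<in> B" "\<Gamma> \<noteq> []" "degree n \<Gamma> = 3"
  shows "letter \<Gamma> \<in> Omega n B 2"
proof -
  note gd = basis_admissible(1)[OF B g(1)]
  from basis_degree(2)[OF B n g] obtain i j where ij: "n = 4" "\<Gamma> = [Edge (Ext i) (Ext j)]" by blast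
  have "dual_elt n \<Gamma> \<in> gdual n 3"
    unfolding gdual_def
  proof (intro CollectI conjI ballI allI impI)
    show "linear (dual_elt n \<Gamma>)" by (rule linear_dual_elt)
    show "dual_elt n \<Gamma> x = 0" if "x \<in> drel n" for x by (rule dual_elt_drel[OF gd that])
    fix \<Gamma>' :: "'a odiag" assume a: "admissible \<Gamma>' \<and> degree n \<Gamma>' \<noteq> 3"
    have "length \<Gamma>' \<noteq> length \<Gamma>"
    proof
      assume "length \<Gamma>' = length \<Gamma>"
      then have "length \<Gamma>' = 1" by (simp add: ij)
      from admissible_single[OF conjunct1[OF a] this] obtain i' j' where "\<Gamma>' = [Edge (Ext i') (Ext j')]" by metis
      then have "degree n \<Gamma>' = 3" using degree_single[of n] ij(1) by simp
      then show False using a by simp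
    qed
    then show "dual_elt n \<Gamma> (gen \<Gamma>') = 0" by (rule dual_elt_length[OF gd])
  qed
  moreover have "desusp B (dual_elt n \<Gamma>) = letter \<Gamma>" using desusp_scaled_dual[OF B g(1,2), of 1] by simp
  ultimately show ?thesis unfolding Omega_def
    by (intro span_base CollectI exI[of _ "[dual_elt n \<Gamma>]"] exI[of _ "[3]"]) simp
qed

text \<open>The contracted edge is dropped and at most one further cell, the internal vertex, is
  deleted, whence the 1. The scalar 0 covers cells that cannot be contracted.\<close>

lemma edge_term_form:
  "\<exists>s Z. edge_term n xs c ys = s *\<^sub>R gen Z \<and> (s = 0 \<or> (\<exists>v. Inn v \<in> ends c) \<and> length Z + 1 \<ge> length xs + length ys)"
proof -
  have col: "\<exists>s Z. r *\<^sub>R collapse n xs (u, v) ys = s *\<^sub>R gen Z \<and> length Z + 1 \<ge> length xs + length ys" for r u v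
  proof -
    have "\<exists>s. r *\<^sub>R collapse n xs (u, v) ys = s *\<^sub>R gen (map (cmap (\<lambda>w. if w = Inn v then u else w) id) (remove1 (IVert v) (xs @ ys)))"
      unfolding collapse_def Let_def by simp
    moreover have "length (map (cmap (\<lambda>w. if w = Inn v then u else w) id) (remove1 (IVert v) (xs @ ys))) + 1 \<ge> length xs + length ys"
      by (simp add: length_remove1) arith
    ultimately show ?thesis by blast
  qed
  have z: ?thesis if "edge_term n xs c ys = 0"
    using that by (intro exI[of _ 0] exI[of _ "[]"]) simp
  show ?thesis
  proof (cases c)
    case (IVert v) then show ?thesis by (intro z) simp
  next
    case (Edge a b)
    show ?thesis
    proof (cases b)
      case (Inn v)
      have "edge_term n xs c ys = 1 *\<^sub>R collapse n xs (a, v) ys" using Edge Inn by simp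
      moreover have "\<exists>v. Inn v \<in> ends c" using Edge Inn by auto
      ultimately show ?thesis using col[of 1 a v] by metis
    next
      case b: (Ext j)
      show ?thesis
      proof (cases a)
        case (Inn v)
        have "edge_term n xs c ys = (- 1) ^ n *\<^sub>R collapse n xs (Ext j, v) ys" using Edge b Inn by simp
        moreover have "\<exists>v. Inn v \<in> ends c" using Edge Inn by auto
        ultimately show ?thesis using col[of "(- 1) ^ n" "Ext j" v] by metis
      next
        case (Ext i) then show ?thesis using Edge b by (intro z) simp
      qed
    qed
  qed
qed

text \<open>A contractible edge has an internal end, so the diagram has at least four cells and
  keeps at least two; the dual of a one-cell diagram vanishes on the result.\<close>

lemma dual_elt_edge_terms:
  assumes g: "gen \<Gamma> \<notin> drel n" "length \<Gamma> = 1" and adm: "admissible \<Delta>" and i: "i < length \<Delta>"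
  shows "dual_elt n \<Gamma> (edge_term n (take i \<Delta>) (\<Delta> ! i) (drop (Suc i) \<Delta>)) = 0"
proof -
  obtain s Z where e: "edge_term n (take i \<Delta>) (\<Delta> ! i) (drop (Suc i) \<Delta>) = s *\<^sub>R gen Z"
    and sz: "s = 0 \<or> (\<exists>v. Inn v \<in> ends (\<Delta> ! i)) \<and> length Z + 1 \<ge> length (take i \<Delta>) + length (drop (Suc i) \<Delta>)"
    using edge_term_form by metis
  have "s * dual_elt n \<Gamma> (gen Z) = 0"
  proof (cases "s = 0")
    case False
    then obtain v where v: "Inn v \<in> ends (\<Delta> ! i)" and l: "length Z + 1 \<ge> length \<Delta> - 1" using sz i by auto
    have "IVert v \<in> set \<Delta>" using adm v nth_mem[OF i] unfolding admissible_def by blast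
    then have "length \<Delta> \<ge> 4" by (rule admissible_ivert_length[OF adm])
    then have "length Z \<noteq> length \<Gamma>" using l g(2) by simp
    then show ?thesis using dual_elt_length[OF g(1)] by simp
  qed simp
  then show ?thesis unfolding e linear_scale[OF linear_dual_elt] by simp
qed

text \<open>Neither a contraction nor a product of two diagrams other than the unit produces a
  diagram with one cell, so both parts of the cobar differential vanish.\<close>

lemma d_Omega_letter:
  assumes B: "diagram_basis n B" and g: "\<Gamma> \<in> B" "length \<Gamma> = 1"
  shows "d_Omega n B (letter \<Gamma>) = 0"
proof -
  note gd = basis_admissible(1)[OF B g(1)]
  have ne: "\<Gamma> \<noteq> []" using g(2) by auto
  have "desusp B (dual_elt n \<Gamma> \<circ> ddiff n) = 0"
  proof (rule desusp_zero)
    fix \<Delta> assume d: "\<Delta> \<in> B"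
    have "ddiff n (gen \<Delta>) = (- 1) ^ n *\<^sub>R (\<Sum>i<length \<Delta>. edge_term n (take i \<Delta>) (\<Delta> ! i) (drop (Suc i) \<Delta>))"
      by (simp only: ddiff_def lin_gen)
    then have "dual_elt n \<Gamma> (ddiff n (gen \<Delta>)) =
        (- 1) ^ n *\<^sub>R (\<Sum>i<length \<Delta>. dual_elt n \<Gamma> (edge_term n (take i \<Delta>) (\<Delta> ! i) (drop (Suc i) \<Delta>)))"
      by (simp only: linear_scale[OF linear_dual_elt] linear_sum[OF linear_dual_elt])
    also have "\<dots> = 0"
      using dual_elt_edge_terms[OF gd g(2) basis_admissible(2)[OF B d]] by simp
    finally show "(dual_elt n \<Gamma> \<circ> ddiff n) (gen \<Delta>) = 0" by simp
  qed
  moreover have "(\<lambda>(\<Gamma>1, \<Gamma>2). if \<Gamma>1 \<in> B - {[]} \<and> \<Gamma>2 \<in> B - {[]}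
        then ((- 1) powi degree n \<Gamma>1 * dual_elt n \<Gamma> (gen (dmult \<Gamma>1 \<Gamma>2))) *\<^sub>R (letter \<Gamma>1 * letter \<Gamma>2) else 0) = (\<lambda>_. 0)"
  proof (rule ext, clarify)
    fix \<Gamma>1 \<Gamma>2 :: "'a odiag"
    have "dual_elt n \<Gamma> (gen (dmult \<Gamma>1 \<Gamma>2)) = 0" if "\<Gamma>1 \<noteq> []" "\<Gamma>2 \<noteq> []"
    proof (rule dual_elt_length[OF gd])
      show "length (dmult \<Gamma>1 \<Gamma>2) \<noteq> length \<Gamma>"
        using that g(2) by (cases \<Gamma>1; cases \<Gamma>2) (simp_all add: dmult_def rename_def)
    qed
    then show "(if \<Gamma>1 \<in> B - {[]} \<and> \<Gamma>2 \<in> B - {[]}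
        then ((- 1) powi degree n \<Gamma>1 * dual_elt n \<Gamma> (gen (dmult \<Gamma>1 \<Gamma>2))) *\<^sub>R (letter \<Gamma>1 * letter \<Gamma>2) else 0) = 0" by simp
  qed
  ultimately have "cobar_gen n B (dual_elt n \<Gamma>) = 0"
    unfolding cobar_gen_def by simp
  then show ?thesis unfolding d_Omega_def letter_def lin_gen by simp
qed

lemma aut_card_single:
  fixes i j :: 'm
  shows "aut_card [Edge (Ext i) (Ext j)] = 1"
proof -
  have "{\<rho>. \<rho> permutes {v. IVert v \<in> set [Edge (Ext i) (Ext j) :: 'm cell]} \<and>
     (\<lambda>e. vmap \<rho> ` e) ` {{a, b} |a b. Edge a b \<in> set [Edge (Ext i) (Ext j) :: 'm cell]} = {{a, b} |a b. Edge a b \<in> set [Edge (Ext i) (Ext j) :: 'm cell]}} = {id}"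
    by (auto simp: image_def)
  then show ?thesis unfolding aut_card_def Let_def by simp
qed

lemma omega_coeff_single:
  assumes "diagram_basis n B" "\<Gamma> \<in> B" "\<Gamma> = [Edge (Ext i) (Ext j)]"
  shows "omega_coeff n B \<Gamma> = letter \<Gamma>"
proof -
  have "star_elt n \<Gamma> = (\<lambda>x. 1 * dual_elt n \<Gamma> x)" unfolding star_elt_def assms(3) aut_card_single by simp
  then show ?thesis
    unfolding omega_coeff_def using desusp_scaled_dual[OF assms(1,2), of 1] assms(3) aut_card_single[of i j] by simp
qed

text \<open>By \<open>basis_degree\<close> these are single edges between external vertices, and
  there are none unless n = 4. Their letters are the ones that occur in the transport of
  3-paths.\<close>

definition edge_diagrams :: "nat \<Rightarrow> 'm odiag set \<Rightarrow> 'm odiag set" where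
  "edge_diagrams n B = {\<Gamma> \<in> B. \<Gamma> \<noteq> [] \<and> degree n \<Gamma> = 3}"

lemma finite_edge_diagrams:
  fixes B :: "'m::finite odiag set"
  assumes "diagram_basis n B" "n \<ge> 4" shows "finite (edge_diagrams n B)"
proof (rule finite_subset)
  show "edge_diagrams n B \<subseteq> range (\<lambda>(i, j). [Edge (Ext i) (Ext j)])"
    using basis_degree(2)[OF assms] unfolding edge_diagrams_def by fastforce
qed simp

lemma iterated_integral_empty: "iterated_integral 0 \<alpha> [] = 1"
  by (simp add: iterated_integral_def PiM_empty set_lebesgue_integral_def lebesgue_integral_count_space_finite wedges_def)

text \<open>A nonzero summand avoids the unit diagram, whose coefficient is 0, and meets the degree
  condition of \<open>iterated_integral\<close>. Every form then has degree at least 3 and uses up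
  at least 2 of the \<open>p\<close> dimensions.\<close>

lemma transport_term:
  fixes B :: "'m::finite odiag set" and \<alpha> :: "((real ^ 'n::{finite,linorder}) ^ 'm) path"
  assumes B: "diagram_basis CARD('n) B" and n: "CARD('n) \<ge> 4" and sub: "set is \<subseteq> B"
    and nz: "iterated_integral p \<alpha> (map form_of is) *\<^sub>R prod_list (map (omega_coeff CARD('n) B) is) \<noteq> 0"
  shows "[] \<notin> set is" "(\<Sum>\<Gamma>\<leftarrow>is. nat (degree CARD('n) \<Gamma>) - 1) = p" "p \<ge> 2 * length is"
proof -
  show e: "[] \<notin> set is"
  proof
    assume a: "[] \<in> set is"
    then have "[] \<in> B" using sub by blast
    from omega_coeff_unit[OF B this] a have "0 \<in> set (map (omega_coeff CARD('n) B) is)" by force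
    from prod_list_zero[OF this] nz show False by simp
  qed
  have "(\<Sum>\<omega>\<leftarrow>(map form_of is :: ((real ^ 'n::_) ^ 'm) form list). fst \<omega> - 1) = p"
    using nz by (auto simp: iterated_integral_def Let_def split: if_splits)
  then show s: "(\<Sum>\<Gamma>\<leftarrow>is. nat (degree CARD('n) \<Gamma>) - 1) = p" by (simp add: form_of_def comp_def)
  have "(\<Sum>\<Gamma>\<leftarrow>is. nat (degree CARD('n) \<Gamma>) - 1) \<ge> (\<Sum>\<Gamma>\<leftarrow>is. 2)"
  proof (rule sum_list_mono)
    fix \<Gamma> assume "\<Gamma> \<in> set is"
    then have "degree CARD('n) \<Gamma> \<ge> 3" using basis_degree(1)[OF B n, of \<Gamma>] sub e by blast
    then show "2 \<le> nat (degree CARD('n) \<Gamma>) - 1" by linarith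
  qed
  then show "p \<ge> 2 * length is" unfolding s by (simp add: sum_list_triv)
qed

text \<open>For \<open>p = 0\<close> only the empty word is short enough.\<close>

lemma T_omega_1:
  fixes B :: "'m::finite odiag set" and \<alpha> :: "((real ^ 'n::{finite,linorder}) ^ 'm) path"
  assumes B: "diagram_basis CARD('n) B" and n: "CARD('n) \<ge> 4"
  shows "T_omega B 1 \<alpha> = 1"
proof -
  let ?g = "\<lambda>is. if set is \<subseteq> B then iterated_integral 0 \<alpha> (map form_of is) *\<^sub>R prod_list (map (omega_coeff CARD('n) B) is) else 0"
  have "Sum_any ?g = (\<Sum>is\<in>{[]}. ?g is)"
    by (rule Sum_any.expand_superset) (use transport_term(3)[OF B n, where p=0 and \<alpha>=\<alpha>] in auto)
  then show ?thesis by (simp add: T_omega_def transport_def iterated_integral_empty)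
qed

text \<open>For \<open>p = 1\<close> there is no room for a letter, and the empty word needs
  \<open>p = 0\<close>.\<close>

lemma T_omega_2:
  fixes B :: "'m::finite odiag set" and \<alpha> :: "((real ^ 'n::{finite,linorder}) ^ 'm) path"
  assumes B: "diagram_basis CARD('n) B" and n: "CARD('n) \<ge> 4"
  shows "T_omega B 2 \<alpha> = 0"
proof -
  let ?g = "\<lambda>is. if set is \<subseteq> B then iterated_integral 1 \<alpha> (map form_of is) *\<^sub>R prod_list (map (omega_coeff CARD('n) B) is) else 0"
  have "?g is = 0" for "is"
  proof (rule ccontr)
    assume a: "?g is \<noteq> 0"
    then have s: "set is \<subseteq> B" by (metis (full_types))
    with a have nz: "iterated_integral 1 \<alpha> (map form_of is) *\<^sub>R prod_list (map (omega_coeff CARD('n) B) is) \<noteq> 0" by presburger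
    from transport_term(2,3)[OF B n s nz] show False by (cases "is") simp_all
  qed
  then have z: "?g = (\<lambda>_. 0)" by (rule ext)
  have "T_omega B 2 \<alpha> = Sum_any ?g" by (simp add: T_omega_def transport_def cong: if_cong)
  then show ?thesis unfolding z by simp
qed

text \<open>For \<open>p = 2\<close> a word has exactly one letter, whose diagram has degree
  3.\<close>

lemma T_omega_3:
  fixes B :: "'m::finite odiag set" and \<alpha> :: "((real ^ 'n::{finite,linorder}) ^ 'm) path"
  assumes B: "diagram_basis CARD('n) B" and n: "CARD('n) \<ge> 4"
  shows "T_omega B 3 \<alpha> = (\<Sum>\<Gamma>\<in>edge_diagrams CARD('n) B. iterated_integral 2 \<alpha> [form_of \<Gamma>] *\<^sub>R letter \<Gamma>)"
proof -
  let ?E = "edge_diagrams CARD('n) B"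
  let ?g = "\<lambda>is. if set is \<subseteq> B then iterated_integral 2 \<alpha> (map form_of is) *\<^sub>R prod_list (map (omega_coeff CARD('n) B) is) else 0"
  have "Sum_any ?g = (\<Sum>is\<in>(\<lambda>\<Gamma>. [\<Gamma>]) ` ?E. ?g is)"
  proof (rule Sum_any.expand_superset)
    show "finite ((\<lambda>\<Gamma>. [\<Gamma>]) ` ?E)" by (rule finite_imageI[OF finite_edge_diagrams[OF B n]])
    show "{is. ?g is \<noteq> 0} \<subseteq> (\<lambda>\<Gamma>. [\<Gamma>]) ` ?E"
    proof
      fix "is" assume "is \<in> {is. ?g is \<noteq> 0}"
      then have a: "?g is \<noteq> 0" by blast
      then have s: "set is \<subseteq> B" by (metis (full_types))
      with a have nz: "iterated_integral 2 \<alpha> (map form_of is) *\<^sub>R prod_list (map (omega_coeff CARD('n) B) is) \<noteq> 0" by presburger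
      note t = transport_term[OF B n s nz]
      have "length is = 1" using t(2,3) by (cases "is") auto
      then obtain \<Gamma> where g: "is = [\<Gamma>]" by (auto simp: length_Suc_conv)
      have "nat (degree CARD('n) \<Gamma>) - 1 = 2" using t(2) g by simp
      then have "degree CARD('n) \<Gamma> = 3" by linarith
      then have "\<Gamma> \<in> ?E" using g s t(1) unfolding edge_diagrams_def by simp
      then show "is \<in> (\<lambda>\<Gamma>. [\<Gamma>]) ` ?E" using g by blast
    qed
  qed
  also have "\<dots> = (\<Sum>\<Gamma>\<in>?E. ?g [\<Gamma>])" by (subst sum.reindex) (auto simp: inj_on_def)
  also have "\<dots> = (\<Sum>\<Gamma>\<in>?E. iterated_integral 2 \<alpha> [form_of \<Gamma>] *\<^sub>R letter \<Gamma>)"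
  proof (rule sum.cong[OF refl])
    fix \<Gamma> assume e: "\<Gamma> \<in> ?E"
    then have "omega_coeff CARD('n) B \<Gamma> = letter \<Gamma>"
      using basis_degree(2)[OF B n, of \<Gamma>] omega_coeff_single[OF B, of \<Gamma>] unfolding edge_diagrams_def by blast
    then show "?g [\<Gamma>] = iterated_integral 2 \<alpha> [form_of \<Gamma>] *\<^sub>R letter \<Gamma>" using e by (simp add: edge_diagrams_def)
  qed
  finally show ?thesis by (simp add: T_omega_def transport_def)
qed

lemma T_omega_3_Omega:
  fixes B :: "'m::finite odiag set" and \<alpha> :: "((real ^ 'n::{finite,linorder}) ^ 'm) path"
  assumes B: "diagram_basis CARD('n) B" and n: "CARD('n) \<ge> 4"
  shows "T_omega B 3 \<alpha> \<in> Omega CARD('n) B 2" "d_Omega CARD('n) B (T_omega B 3 \<alpha>) = 0"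
proof -
  show "T_omega B 3 \<alpha> \<in> Omega CARD('n) B 2"
  proof -
    have sub: "subspace (Omega CARD('n) B 2)" unfolding Omega_def by (rule subspace_span)
    show ?thesis unfolding T_omega_3[OF assms]
      by (intro subspace_sum[OF sub] subspace_scale[OF sub] letter_in_Omega_2[OF B n]) (simp_all add: edge_diagrams_def)
  qed
  have "d_Omega CARD('n) B (letter \<Gamma>) = 0" if "\<Gamma> \<in> edge_diagrams CARD('n) B" for \<Gamma>
  proof (rule d_Omega_letter[OF B])
    show "\<Gamma> \<in> B" using that by (simp add: edge_diagrams_def)
    show "length \<Gamma> = 1" using that basis_degree(2)[OF B n, of \<Gamma>] unfolding edge_diagrams_def by fastforce
  qed
  then show "d_Omega CARD('n) B (T_omega B 3 \<alpha>) = 0"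
    unfolding T_omega_3[OF assms] by (simp add: linear_sum[OF linear_d_Omega] linear_scale[OF linear_d_Omega])
qed

section \<open>The transport of 3-tracks\<close>

lemma good_cong: "agree 3 J J' \<Longrightarrow> good_3path M J \<Longrightarrow> good_3path M J'"
proof -
  assume a: "agree 3 J J'" and g: "good_3path M J"
  have "J' [r, s, t] = J' [r', s, t]" if "s \<in> {0, 1}" "r \<in> {0..1}" "r' \<in> {0..1}" "t \<in> {0..1}" for r r' s t
  proof -
    have s: "s \<in> {0..1}" using that(1) by auto
    have "J [r, s, t] = J [r', s, t]" using g that unfolding good_3path_def by blast
    then show ?thesis using agree3D[OF a that(2) s that(4)] agree3D[OF a that(3) s that(4)] by simp
  qed
  then show ?thesis using kpath_cong[OF a] g unfolding good_3path_def by blast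
qed

lemma good_indep: "good_3path M J \<Longrightarrow> s \<in> {0, 1} \<Longrightarrow> r \<in> {0..1} \<Longrightarrow> r' \<in> {0..1} \<Longrightarrow> t \<in> {0..1} \<Longrightarrow> J [r, s, t] = J [r', s, t]"
  unfolding good_3path_def by blast

lemma good_kpath: "good_3path M J \<Longrightarrow> kpath M 3 J"
  by (simp add: good_3path_def)

lemma goodI:
  assumes "kpath M 3 J" "\<And>r s t. s \<in> {0, 1} \<Longrightarrow> r \<in> {0..1} \<Longrightarrow> t \<in> {0..1} \<Longrightarrow> J [r, s, t] = F s t"
  shows "good_3path M J"
  unfolding good_3path_def using assms by simp

text \<open>The existence of an edge diagram forces n = 4, so statements about
  \<open>pullback\<close> are only required in that dimension.\<close>

lemma edge_integral:
  fixes B :: "'m::finite odiag set"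
  assumes B: "diagram_basis CARD('n::{finite,linorder}) B" and n: "CARD('n) \<ge> 4" and g: "\<Gamma> \<in> edge_diagrams CARD('n) B"
  obtains i j where "i \<noteq> j" "CARD('n) = 4"
    "\<And>J :: ((real ^ 'n::_) ^ 'm) path. kpath Conf 3 J \<Longrightarrow> iterated_integral 2 J [form_of \<Gamma>] = nint 3 (pullback i j J)"
proof -
  have g': "\<Gamma> \<in> B" "\<Gamma> \<noteq> []" "degree CARD('n) \<Gamma> = 3" using g by (auto simp: edge_diagrams_def)
  from basis_degree(2)[OF B n g'] obtain i j where ij: "CARD('n) = 4" "i \<noteq> j" "\<Gamma> = [Edge (Ext i) (Ext j)]" by blast
  show ?thesis
  proof (rule that[OF ij(2,1)])
    fix J :: "((real ^ 'n::_) ^ 'm) path" assume J: "kpath Conf 3 J"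
    show "iterated_integral 2 J [form_of \<Gamma>] = nint 3 (pullback i j J)"
      unfolding ij(3) by (rule iterated_integral_edge[OF ij(1) kpathD(1,2)[OF J] ij(2)])
  qed
qed

lemma T_omega_3_eqI:
  fixes B :: "'m::finite odiag set" and J J' :: "((real ^ 'n::{finite,linorder}) ^ 'm) path"
  assumes "diagram_basis CARD('n) B" "CARD('n) \<ge> 4" "kpath Conf 3 J" "kpath Conf 3 J'"
    and "\<And>i j. CARD('n) = 4 \<Longrightarrow> i \<noteq> j \<Longrightarrow> nint 3 (pullback i j J) = nint 3 (pullback i j J')"
  shows "T_omega B 3 J = T_omega B 3 J'"
  unfolding T_omega_3[OF assms(1,2)]
proof (rule sum.cong[OF refl])
  fix \<Gamma> assume "\<Gamma> \<in> edge_diagrams CARD('n) B"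
  from edge_integral[OF assms(1,2) this] obtain i j where ij: "i \<noteq> j" "CARD('n) = 4"
    "\<And>J :: ((real ^ 'n::_) ^ 'm) path. kpath Conf 3 J \<Longrightarrow> iterated_integral 2 J [form_of \<Gamma>] = nint 3 (pullback i j J)" by metis
  show "iterated_integral 2 J [form_of \<Gamma>] *\<^sub>R letter \<Gamma> = iterated_integral 2 J' [form_of \<Gamma>] *\<^sub>R letter \<Gamma>"
    unfolding ij(3)[OF assms(3)] ij(3)[OF assms(4)] assms(5)[OF ij(2,1)] ..
qed

lemma T_omega_3_agree:
  fixes B :: "'m::finite odiag set" and J J' :: "((real ^ 'n::{finite,linorder}) ^ 'm) path"
  assumes "diagram_basis CARD('n) B" "CARD('n) \<ge> 4" "kpath Conf 3 J" "agree 3 J J'"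
  shows "T_omega B 3 J = T_omega B 3 J'"
  by (rule T_omega_3_eqI[OF assms(1-3) kpath_cong[OF assms(4,3)]], rule nint_cong, rule pullback_cong[OF assms(4)])

lemma T_omega_3_track:
  fixes B :: "'m::finite odiag set" and J J' :: "((real ^ 'n::{finite,linorder}) ^ 'm) path"
  assumes B: "diagram_basis CARD('n) B" "CARD('n) \<ge> 4" and J': "J' \<in> track3 Conf J"
  shows "T_omega B 3 J' = T_omega B 3 J"
proof -
  from J' obtain W where W: "rank3_homotopy Conf W" "agree 3 (face 0 0 W) J" "agree 3 (face 0 1 W) J'"
    unfolding track3_def by blast
  have k: "kpath Conf 3 (face 0 q W)" if "q \<in> {0, 1}" for q
    by (rule good_kpath[OF rank3_good[OF W(1)]]) (use that in auto)
  have "T_omega B 3 J' = T_omega B 3 (face 0 1 W)" by (rule T_omega_3_agree[OF B k W(3), symmetric]) simp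
  also have "\<dots> = T_omega B 3 (face 0 0 W)"
    by (rule T_omega_3_eqI[OF B k k]) (simp, simp, rule rank3_integral_invariant[OF _ W(1), symmetric])
  also have "\<dots> = T_omega B 3 J" by (rule T_omega_3_agree[OF B k W(2)]) simp
  finally show ?thesis .
qed

lemma T_omega_3_flat:
  fixes B :: "'m::finite odiag set" and J :: "((real ^ 'n::{finite,linorder}) ^ 'm) path"
  assumes B: "diagram_basis CARD('n) B" "CARD('n) \<ge> 4" and J: "kpath Conf 3 J"
    and flat: "\<And>xs. xs \<in> cube 3 \<Longrightarrow> \<exists>a b. (a, b) \<noteq> (0, 0) \<and> a *\<^sub>R pd 0 J xs + b *\<^sub>R pd 1 J xs = 0"
  shows "T_omega B 3 J = 0"
  unfolding T_omega_3[OF B]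
proof (rule sum.neutral, rule)
  fix \<Gamma> assume "\<Gamma> \<in> edge_diagrams CARD('n) B"
  from edge_integral[OF B this] obtain i j where ij: "i \<noteq> j" "CARD('n) = 4"
    "\<And>J :: ((real ^ 'n::_) ^ 'm) path. kpath Conf 3 J \<Longrightarrow> iterated_integral 2 J [form_of \<Gamma>] = nint 3 (pullback i j J)" by metis
  have "nint 3 (pullback i j J) = nint 3 (\<lambda>_. 0)"
  proof (rule nint_cong)
    fix xs :: "real list" assume xs: "xs \<in> cube 3"
    from flat[OF xs] obtain a b where "(a, b) \<noteq> (0, 0)" "a *\<^sub>R pd 0 J xs + b *\<^sub>R pd 1 J xs = 0" by blast
    then show "pullback i j J xs = 0" by (intro pullback_flat[OF ij(2) kpathD(1)[OF J] kpathD(2)[OF J xs] ij(1) xs])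
  qed
  then show "iterated_integral 2 J [form_of \<Gamma>] *\<^sub>R letter \<Gamma> = 0" unfolding ij(3)[OF J] by (simp add: nint_zero)
qed

lemma T_omega_3_pconcat:
  fixes B :: "'m::finite odiag set" and J K :: "((real ^ 'n::{finite,linorder}) ^ 'm) path"
  assumes B: "diagram_basis CARD('n) B" "CARD('n) \<ge> 4" and J: "kpath Conf 3 J" and K: "kpath Conf 3 K" and l: "l < 3"
    and eq: "\<And>xs. xs \<in> cube 3 \<Longrightarrow> J (xs[l := 1]) = K (xs[l := 0])"
  shows "T_omega B 3 (pconcat l J K) = T_omega B 3 J + T_omega B 3 K"
  unfolding T_omega_3[OF B] sum.distrib[symmetric]
proof (rule sum.cong[OF refl])
  fix \<Gamma> assume "\<Gamma> \<in> edge_diagrams CARD('n) B"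
  from edge_integral[OF B this] obtain i j where ij: "i \<noteq> j" "CARD('n) = 4"
    "\<And>J :: ((real ^ 'n::_) ^ 'm) path. kpath Conf 3 J \<Longrightarrow> iterated_integral 2 J [form_of \<Gamma>] = nint 3 (pullback i j J)" by metis
  have k: "kpath Conf 3 (pconcat l J K)" by (rule pconcat_kpath[OF J K l eq])
  have s: "nint 3 (pullback i j (pconcat l J K)) = nint 3 (pullback i j J) + nint 3 (pullback i j K)"
    by (rule integral_pconcat[OF ij(2) J K ij(1) l eq])
  show "iterated_integral 2 (pconcat l J K) [form_of \<Gamma>] *\<^sub>R letter \<Gamma> =
      iterated_integral 2 J [form_of \<Gamma>] *\<^sub>R letter \<Gamma> + iterated_integral 2 K [form_of \<Gamma>] *\<^sub>R letter \<Gamma>"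
    unfolding ij(3)[OF J] ij(3)[OF K] ij(3)[OF k] s
    by (rule scaleR_left_distrib)
qed

text \<open>The form in which operations on 3-tracks are evaluated. Nonemptiness is essential: the
  image of an empty union would be empty instead of a class.\<close>

lemma image_tracks:
  fixes B :: "'m::finite odiag set" and S :: "((real ^ 'n::{finite,linorder}) ^ 'm) path set set"
  assumes B: "diagram_basis CARD('n) B" "CARD('n) \<ge> 4" and "S \<noteq> {}"
    and S: "\<And>X. X \<in> S \<Longrightarrow> \<exists>P. X = track3 Conf P \<and> good_3path Conf P \<and> T_omega B 3 P = v"
  shows "T_omega B 3 ` \<Union>S = {v}"
proof -
  have "T_omega B 3 ` X = {v}" if "X \<in> S" for X
  proof -
    from S[OF that] obtain P where P: "X = track3 Conf P" "good_3path Conf P" "T_omega B 3 P = v" by blast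
    show ?thesis unfolding P(1) using track3_refl[OF P(2)] T_omega_3_track[OF B, of _ P] P(3) by auto
  qed
  then show ?thesis using \<open>S \<noteq> {}\<close> by (auto simp: image_Union)
qed

section \<open>Endpoints and members of tracks and cells\<close>

lemma rank1_ends:
  assumes "rank1_homotopy M h" "c \<in> {0, 1}" shows "h [1, c] = h [0, c]"
proof -
  have "kpath M 2 h" using assms(1) by (simp add: rank1_homotopy_def)
  from kpathD(4)[OF this, of "[1, c]" "[0, c]"] show ?thesis using assms(2) by (auto simp: cube_lit)
qed

lemma track1_ends:
  assumes "\<gamma>' \<in> track1 M \<gamma>"
  shows "kpath M 1 \<gamma>'" "c \<in> {0, 1} \<Longrightarrow> \<gamma>' [c] = \<gamma> [c]"
proof -
  from assms obtain h where h: "rank1_homotopy M h" "agree 1 (face 0 0 h) \<gamma>" "agree 1 (face 0 1 h) \<gamma>'"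
    unfolding track1_def by blast
  have k: "kpath M 2 h" using h(1) by (simp add: rank1_homotopy_def)
  show "kpath M 1 \<gamma>'" by (rule kpath_cong[OF h(3) kpath_face_2[OF k]]) simp
  assume c: "c \<in> {0, 1}"
  then have "c \<in> {0..1}" by auto
  from agree1D[OF h(2) this] agree1D[OF h(3) this] rank1_ends[OF h(1) c] show "\<gamma>' [c] = \<gamma> [c]"
    by (simp add: face_lit)
qed

lemma kpath_3_ends:
  assumes "kpath M 3 g" "c \<in> {0, 1}" "r \<in> {0..1}" "s \<in> {0..1}" shows "g [r, s, c] = g [0, 0, c]"
  using kpathD(4)[OF assms(1), of "[r, s, c]" "[0, 0, c]"] assms(2-4) by (auto simp: cube_lit)

lemma track2_ends:
  assumes "g' \<in> track2 M g"
  shows "kpath M 2 g'" "c \<in> {0, 1} \<Longrightarrow> g' [0, c] = g [0, c]"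
proof -
  from assms obtain \<alpha> where a: "rank2_homotopy M \<alpha>" "agree 2 (face 0 0 \<alpha>) g" "agree 2 (face 0 1 \<alpha>) g'"
    unfolding track2_def by blast
  have k: "kpath M 3 \<alpha>" using a(1) by (simp add: rank2_homotopy_def)
  show "kpath M 2 g'" by (rule kpath_cong[OF a(3) kpath_face_3[OF k]]) simp_all
  assume c: "c \<in> {0, 1}"
  then have c': "c \<in> {0..1}" by auto
  have z: "(0::real) \<in> {0..1}" "(1::real) \<in> {0..1}" by simp_all
  from agree2D[OF a(2) z(1) c'] agree2D[OF a(3) z(1) c'] kpath_3_ends[OF k c z(2) z(1)] show "g' [0, c] = g [0, c]"
    by (simp add: face_lit)
qed

lemma track3_ends:
  assumes "J' \<in> track3 M J"
  shows "good_3path M J'" "c \<in> {0, 1} \<Longrightarrow> J' [0, 0, c] = J [0, 0, c]"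
proof -
  from assms obtain W where W: "rank3_homotopy M W" "agree 3 (face 0 0 W) J" "agree 3 (face 0 1 W) J'"
    unfolding track3_def by blast
  show "good_3path M J'" by (rule good_cong[OF W(3) rank3_good[OF W(1)]]) simp
  have k: "kpath M 4 W" using W(1) by (simp add: rank3_homotopy_def)
  assume c: "c \<in> {0, 1}"
  then have c': "c \<in> {0..1}" by auto
  have z: "(0::real) \<in> {0..1}" by simp
  have "W [1, 0, 0, c] = W [0, 0, 0, c]" using kpathD(4)[OF k, of "[1, 0, 0, c]" "[0, 0, 0, c]"] c by (auto simp: cube_lit)
  with agree3D[OF W(2) z z c'] agree3D[OF W(3) z z c'] show "J' [0, 0, c] = J [0, 0, c]"
    by (simp add: face_lit)
qed

text \<open>Rank-1 homotopies fix the endpoints, so all members of a 1-track connect the same two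
  points.\<close>

lemma cell1_members:
  assumes "is_cell1 (path3_groupoid M) x y f"
  shows "f \<noteq> {}" "\<gamma> \<in> f \<Longrightarrow> kpath M 1 \<gamma> \<and> \<gamma> [0] = x \<and> \<gamma> [1] = y"
proof -
  from assms obtain \<gamma>0 where g: "f = track1 M \<gamma>0" "kpath M 1 \<gamma>0" "\<gamma>0 [0] = x" "\<gamma>0 [1] = y"
    unfolding is_cell1_def path3_groupoid_def by auto
  show "f \<noteq> {}" using track1_refl[OF g(2)] g(1) by blast
  assume "\<gamma> \<in> f"
  then have "\<gamma> \<in> track1 M \<gamma>0" using g(1) by simp
  from track1_ends(1)[OF this] track1_ends(2)[OF this, of 0] track1_ends(2)[OF this, of 1] g
  show "kpath M 1 \<gamma> \<and> \<gamma> [0] = x \<and> \<gamma> [1] = y" by simp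
qed

lemma cell2_representative:
  assumes "is_cell2 (path3_groupoid M) x y f f' A"
  obtains g where "A = track2 M g" "kpath M 2 g" "track1 M (face 0 0 g) = f" "track1 M (face 0 1 g) = f'"
    "is_cell1 (path3_groupoid M) x y f"
  using assms unfolding is_cell2_def by (auto simp: path3_groupoid_def)

lemma cell2_members:
  assumes "is_cell2 (path3_groupoid M) x y f f' A"
  shows "A \<noteq> {}" "g \<in> A \<Longrightarrow> kpath M 2 g \<and> g [0, 0] = x \<and> g [0, 1] = y"
proof -
  from cell2_representative[OF assms] obtain g0 where g: "A = track2 M g0" "kpath M 2 g0" "track1 M (face 0 0 g0) = f"
    "is_cell1 (path3_groupoid M) x y f" by metis
  show "A \<noteq> {}" using track2_refl[OF g(2)] g(1) by blast
  have z: "(0::real) \<in> {0..1}" by simp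
  have "face 0 0 g0 \<in> f" using track1_refl[OF kpath_face_2[OF g(2) z]] g(3) by simp
  from cell1_members(2)[OF g(4) this] have e: "g0 [0, 0] = x" "g0 [0, 1] = y" by (simp_all add: face_lit)
  assume "g \<in> A"
  then have "g \<in> track2 M g0" using g(1) by simp
  from track2_ends(1)[OF this] track2_ends(2)[OF this, of 0] track2_ends(2)[OF this, of 1] e
  show "kpath M 2 g \<and> g [0, 0] = x \<and> g [0, 1] = y" by simp
qed

lemma cell3_representative:
  assumes "is_cell3 (path3_groupoid M) x y f f' A A' X"
  obtains J where "X = track3 M J" "good_3path M J" "track2 M (face 0 0 J) = A" "track2 M (face 0 1 J) = A'"
    "is_cell2 (path3_groupoid M) x y f f' A" "is_cell2 (path3_groupoid M) x y f f' A'"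
  using assms unfolding is_cell3_def by (auto simp: path3_groupoid_def)

lemma cell3_members:
  assumes "is_cell3 (path3_groupoid M) x y f f' A A' X"
  shows "X \<noteq> {}" "J \<in> X \<Longrightarrow> good_3path M J \<and> J [0, 0, 0] = x \<and> J [0, 0, 1] = y"
proof -
  from cell3_representative[OF assms] obtain J0 where J: "X = track3 M J0" "good_3path M J0" "track2 M (face 0 0 J0) = A"
    "is_cell2 (path3_groupoid M) x y f f' A" by metis
  show "X \<noteq> {}" using track3_refl[OF J(2)] J(1) by blast
  have z: "(0::real) \<in> {0..1}" by simp
  have "face 0 0 J0 \<in> A" using track2_refl[OF kpath_face_3[OF good_kpath[OF J(2)] _ z, of 0]] J(3) by simp
  from cell2_members(2)[OF J(4) this] have e: "J0 [0, 0, 0] = x" "J0 [0, 0, 1] = y" by (simp_all add: face_lit)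
  assume "J \<in> X"
  then have "J \<in> track3 M J0" using J(1) by simp
  from track3_ends(1)[OF this] track3_ends(2)[OF this, of 0] track3_ends(2)[OF this, of 1] e
  show "good_3path M J \<and> J [0, 0, 0] = x \<and> J [0, 0, 1] = y" by simp
qed

section \<open>Compositions of tracks\<close>

lemma good_pconcat_0:
  assumes J: "good_3path M J" and K: "good_3path M K" and ag: "agree 2 (face 0 1 J) (face 0 0 K)"
  shows "xs \<in> cube 3 \<Longrightarrow> J (xs[0 := 1]) = K (xs[0 := 0])" "good_3path M (pconcat 0 J K)"
proof -
  show eq: "J (xs[0 := 1]) = K (xs[0 := 0])" if "xs \<in> cube 3" for xs
    by (rule kpath_agree_face[of 3]) (use ag that in simp_all)
  show "good_3path M (pconcat 0 J K)"
  proof (rule goodI)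
    show "kpath M 3 (pconcat 0 J K)" by (rule pconcat_kpath[OF good_kpath[OF J] good_kpath[OF K] _ eq]) simp_all
    fix r s t :: real assume s: "s \<in> {0, 1}" and r: "r \<in> {0..1}" and t: "t \<in> {0..1}"
    show "pconcat 0 J K [r, s, t] = J [1, s, t]"
    proof (cases "r \<le> 1 / 2")
      case True
      then show ?thesis using good_indep[OF J s, of "2 * r" 1 t] r t by (simp add: pconcat_def)
    next
      case False
      then have "pconcat 0 J K [r, s, t] = K [0, s, t]"
        using good_indep[OF K s, of "2 * r - 1" 0 t] r t by (simp add: pconcat_def)
      also have "\<dots> = J [1, s, t]" using eq[of "[0, s, t]"] s t by (auto simp: cube_lit)
      finally show ?thesis .
    qed
  qed
qed

lemma good_pconcat_1:
  assumes J: "good_3path M J" and K: "good_3path M K" and ag: "agree 2 (face 1 1 J) (face 1 0 K)"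
  shows "xs \<in> cube 3 \<Longrightarrow> J (xs[1 := 1]) = K (xs[1 := 0])" "good_3path M (pconcat 1 J K)"
proof -
  show eq: "J (xs[1 := 1]) = K (xs[1 := 0])" if "xs \<in> cube 3" for xs
    by (rule kpath_agree_face[of 3]) (use ag that in simp_all)
  show "good_3path M (pconcat 1 J K)"
  proof (rule goodI)
    show "kpath M 3 (pconcat 1 J K)" by (rule pconcat_kpath[OF good_kpath[OF J] good_kpath[OF K] _ eq]) simp_all
    fix r s t :: real assume s: "s \<in> {0, 1}" and r: "r \<in> {0..1}" and t: "t \<in> {0..1}"
    show "pconcat 1 J K [r, s, t] = (if s = 0 then J [0, 0, t] else K [0, 1, t])"
      using good_indep[OF J _ r, of 0 0 t] good_indep[OF K _ r, of 1 0 t] s t by (auto simp: pconcat_def)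
  qed
qed

text \<open>The faces of the last coordinate are single points, so one equality of points makes the
  two paths composable.\<close>

lemma good_pconcat_2:
  assumes J: "good_3path M J" and K: "good_3path M K" and e: "J [0, 0, 1] = K [0, 0, 0]"
  shows "xs \<in> cube 3 \<Longrightarrow> J (xs[2 := 1]) = K (xs[2 := 0])" "good_3path M (pconcat 2 J K)"
proof -
  show eq: "J (xs[2 := 1]) = K (xs[2 := 0])" if c: "xs \<in> cube 3" for xs
  proof -
    obtain r s t where x: "xs = [r, s, t]" "r \<in> {0..1}" "s \<in> {0..1}" by (rule cube3E[OF c])
    show ?thesis unfolding x(1)
      using kpath_3_ends[OF good_kpath[OF J] _ x(2,3), of 1] kpath_3_ends[OF good_kpath[OF K] _ x(2,3), of 0] e
      by (simp add: numeral_2_eq_2)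
  qed
  show "good_3path M (pconcat 2 J K)"
  proof (rule goodI)
    show "kpath M 3 (pconcat 2 J K)" by (rule pconcat_kpath[OF good_kpath[OF J] good_kpath[OF K] _ eq]) simp_all
    fix r s t :: real assume s: "s \<in> {0, 1}" and r: "r \<in> {0..1}" and t: "t \<in> {0..1}"
    show "pconcat 2 J K [r, s, t] = (if t \<le> 1 / 2 then J [0, s, 2 * t] else K [0, s, 2 * t - 1])"
      using good_indep[OF J s r, of 0 "2 * t"] good_indep[OF K s r, of 0 "2 * t - 1"] t by (auto simp: pconcat_def numeral_2_eq_2)
  qed
qed

lemma good_tl: "kpath M 2 g \<Longrightarrow> good_3path M (\<lambda>xs. g (tl xs))"
  by (rule goodI[where F="\<lambda>s t. g [s, t]"]) (use kpath_tl[of M 2 g] in \<open>simp_all add: numeral_3_eq_3 numeral_2_eq_2\<close>)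

lemma good_spread: "kpath M 1 \<gamma> \<Longrightarrow> good_3path M (spread \<gamma>)"
  by (rule goodI[where F="\<lambda>s t. \<gamma> [t]"]) (simp_all add: kpath_spread spread_def)

lemma pd_spread: "xs \<in> cube k \<Longrightarrow> Suc i < k \<Longrightarrow> pd i (spread \<gamma>) xs = 0"
proof (rule pd_const)
  assume xs: "xs \<in> cube k" and i: "Suc i < k"
  have ne: "xs \<noteq> []" "i \<noteq> length xs - 1" using cube_length[OF xs] i by auto
  show "spread \<gamma> (xs[i := u]) = spread \<gamma> xs" for u
    unfolding spread_def last_list_update[OF ne(1)] using ne(2) by simp
qed (assumption, rule Suc_lessD)

section \<open>The interchange 3-cell\<close>

definition corner :: "real \<Rightarrow> real \<Rightarrow> real \<Rightarrow> real \<Rightarrow> real path" where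
  "corner p q p' q' xs = (1 - mu (xs ! 0)) * step p q (xs ! 1) + mu (xs ! 0) * step p' q' (xs ! 1)"

lemma corner:
  assumes pq: "0 < p" "p < q" "q < 1" and pq': "0 < p'" "p' < q'" "q' < 1"
  shows "smooth_cube 2 (corner p q p' q')" "collared 2 (corner p q p' q')" "corner p q p' q' xs \<in> {0..1}"
    "corner p q p' q' [r, 0] = 0" "corner p q p' q' [r, 1] = 1"
    "corner p q p' q' [0, s] = step p q s" "corner p q p' q' [1, s] = step p' q' s"
proof -
  have s: "smooth_cube 2 (\<lambda>xs. mu (xs ! 0))" "smooth_cube 2 (\<lambda>xs. step a b (xs ! 1))" for a b
    unfolding mu_def by (rule smooth_step[OF smooth_nth], simp)+
  have "smooth_cube 2 (\<lambda>xs. (1 - mu (xs ! 0)) * step p q (xs ! 1) + mu (xs ! 0) * step p' q' (xs ! 1))"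
    by (rule smooth_add[OF smooth_mult[OF smooth_diff[OF smooth_const s(1)] s(2)] smooth_mult[OF s(1) s(2)]])
  then show "smooth_cube 2 (corner p q p' q')" unfolding corner_def .
  have m: "collared 2 (\<lambda>xs. mu (xs ! 0))" unfolding mu_def by (rule collared_step) simp_all
  have c: "collared 2 (\<lambda>xs. step a b (xs ! 1))" if "0 < a" "a < b" "b < 1" for a b
    by (rule collared_step) (use that in simp_all)
  have "collared 2 (\<lambda>xs. (1 - mu (xs ! 0)) * step p q (xs ! 1) + mu (xs ! 0) * step p' q' (xs ! 1))"
    by (rule collared_comb[where F="(+)"], rule collared_comb[where F="\<lambda>x y. (1 - x) * y", OF m c[OF pq]],
        rule collared_comb[where F="(*)", OF m c[OF pq']])
  then show "collared 2 (corner p q p' q')" unfolding corner_def .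
  have i: "mu (xs ! 0) \<in> {0..1}" "step p q (xs ! 1) \<in> {0..1}" "step p' q' (xs ! 1) \<in> {0..1}" by (rule mu(3) step_range)+
  then have "corner p q p' q' xs \<ge> 0" by (simp add: corner_def)
  moreover have "corner p q p' q' xs \<le> 1"
    unfolding corner_def by (rule convex_bound_le) (use i in simp_all)
  ultimately show "corner p q p' q' xs \<in> {0..1}" by simp
  show "corner p q p' q' [r, 0] = 0" "corner p q p' q' [r, 1] = 1"
    "corner p q p' q' [0, s] = step p q s" "corner p q p' q' [1, s] = step p' q' s"
    using pq pq' by (simp_all add: corner_def step_eq0 step_eq1 mu(4,5))
qed

text \<open>At r = 0 the second function makes its step between 1/5 and 2/5, before the first one
  does so between 3/5 and 4/5; at r = 1 the order is reversed, and 1/2 separates the two steps. An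
  explicit family shows that the union defining \<open>interchange\<close> is not empty.\<close>

lemma corner_family_exists: "\<exists>a b. corner_family a b"
proof -
  let ?a = "corner (3/5) (4/5) (1/5) (2/5)" and ?b = "corner (1/5) (2/5) (3/5) (4/5)"
  have n: "(0::real) < 1/5" "1/5 < (2/5::real)" "2/5 < (1::real)" "(0::real) < 3/5" "3/5 < (4/5::real)" "4/5 < (1::real)" by simp_all
  note a = corner[OF n(4-6) n(1-3)] and b = corner[OF n(1-3) n(4-6)]
  have mono: "mono_on {0..1} (step p q)" if "p < q" for p q
    by (rule mono_onI) (rule step_mono[OF that])
  have m: "mono_on {0..1} (\<lambda>s. ?a [r, s])" "mono_on {0..1} (\<lambda>s. ?b [r, s])" if "r \<in> {0, 1}" for r
    using that unfolding insert_iff empty_iff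
    by (elim disjE FalseE; simp only: a(6,7) b(6,7) mono[OF n(2)] mono[OF n(5)])+
  have "corner_family ?a ?b" unfolding corner_family_def
  proof (intro conjI)
    have "?a ` cube 2 \<subseteq> {0..1}" "?b ` cube 2 \<subseteq> {0..1}" by (intro image_subsetI a(3) b(3))+
    moreover have "\<forall>r\<in>{0, 1}. mono_on {0..1} (\<lambda>s. ?a [r, s])" "\<forall>r\<in>{0, 1}. mono_on {0..1} (\<lambda>s. ?b [r, s])" by (rule ballI, rule m, assumption)+
    ultimately show "\<forall>f\<in>{?a, ?b}. smooth_cube 2 f \<and> collared 2 f \<and> f ` cube 2 \<subseteq> {0..1} \<and>
        (\<forall>r\<in>{0..1}. f [r, 0] = 0 \<and> f [r, 1] = 1) \<and> (\<forall>r\<in>{0, 1}. mono_on {0..1} (\<lambda>s. f [r, s]))"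
      using a(1,2) b(1,2) by (simp only: ball_simps ball_triv a(4,5) b(4,5) simp_thms)
    show "\<exists>c\<in>{0..1}. (\<forall>s\<in>{0..c}. ?a [0, s] = 0) \<and> (\<forall>s\<in>{c..1}. ?b [0, s] = 1)"
      unfolding a(6) b(6) by (rule bexI[of _ "1/2"]) (simp_all add: step_eq0 step_eq1)
    show "\<exists>c\<in>{0..1}. (\<forall>s\<in>{0..c}. ?b [1, s] = 0) \<and> (\<forall>s\<in>{c..1}. ?a [1, s] = 1)"
      unfolding a(7) b(7) by (rule bexI[of _ "1/2"]) (simp_all add: step_eq0 step_eq1)
  qed
  then show ?thesis by blast
qed

text \<open>\<open>h\<close> is reparametrized by a function of (r, s), so by the chain rule the
  derivatives in r and s are multiples of \<open>pd 0 h\<close> at the same point.\<close>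

lemma corner_path:
  fixes h :: "'v::euclidean_space path"
  assumes h: "kpath M 2 h" and c: "smooth_cube 2 c" "collared 2 c" "c ` cube 2 \<subseteq> {0..1}"
    and ends: "\<And>r. r \<in> {0..1} \<Longrightarrow> c [r, 0] = 0 \<and> c [r, 1] = 1"
  defines "\<alpha> \<equiv> \<lambda>xs. h [c [xs ! 0, xs ! 1], xs ! 2]"
  shows "good_3path M \<alpha>"
    and "xs \<in> cube 3 \<Longrightarrow> \<exists>a b. (a, b) \<noteq> (0, 0) \<and> a *\<^sub>R pd 0 \<alpha> xs + b *\<^sub>R pd 1 \<alpha> xs = 0"
proof -
  let ?c = "\<lambda>xs. c [xs ! 0, xs ! 1]"
  have x: "xs ! 0 \<in> {0..1}" "xs ! 1 \<in> {0..1}" "xs ! 2 \<in> {0..1}" if "xs \<in> cube 3" for xs :: "real list"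
    by (rule cube_nth[OF that], simp)+
  have x2: "[xs ! 0, xs ! 1] \<in> cube 2" if "xs \<in> cube 3" for xs
    unfolding cube_lit using x(1,2)[OF that] by blast
  have r: "?c xs \<in> {0..1}" if "xs \<in> cube 3" for xs using c(3) x2[OF that] by blast
  have sc: "smooth_cube 3 ?c"
    by (rule smooth_comp2(1)[OF c(1) smooth_nth smooth_nth]) (simp, simp, use x in blast)
  have tc: "tame 3 ?c"
    by (rule tame_collared, rule collared_comp2[OF c(2) tame_nth tame_nth]) (simp, simp, use x in blast)
  let ?p = "\<lambda>j xs. if j = (0::nat) then ?c xs else xs ! 2"
  have e: "map (\<lambda>j. ?p j xs) [0..<2] = [?c xs, xs ! 2]" for xs by (simp add: upt_rec numeral_2_eq_2)
  have "kpath M 3 (\<lambda>xs. h (map (\<lambda>j. ?p j xs) [0..<2]))"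
  proof (rule kpath_comp[OF h])
    show "smooth_cube 3 (?p j)" "tame 3 (?p j)" for j
      using sc tc smooth_nth[of 2 3] tame_nth[of 2 3] by (cases "j = 0"; simp)+
    show "?p j xs \<in> {0..1}" if "xs \<in> cube 3" for j xs using r[OF that] x(3)[OF that] by (cases "j = 0") simp_all
    show "?p (2 - 1) xs = last xs" if "xs \<in> cube 3" for xs using last_cube[OF that] by simp
  qed simp_all
  then have k: "kpath M 3 \<alpha>" unfolding e \<alpha>_def .
  show "good_3path M \<alpha>"
  proof (rule goodI[OF k])
    fix r s t :: real assume "s \<in> {0, 1}" "r \<in> {0..1}" "t \<in> {0..1}"
    then show "\<alpha> [r, s, t] = h [s, t]" using ends[of r] by (auto simp: \<alpha>_def numeral_2_eq_2)
  qed
  assume xs: "xs \<in> cube 3"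
  have "pd i \<alpha> xs = pd i ?c xs *\<^sub>R pd 0 h [?c xs, xs ! 2]" if "i < 2" for i
  proof -
    have "pd i \<alpha> xs = pd i ?c xs *\<^sub>R pd 0 h [?c xs, xs ! 2] + pd i (\<lambda>xs. xs ! 2) xs *\<^sub>R pd 1 h [?c xs, xs ! 2]"
      unfolding \<alpha>_def
      by (rule smooth_comp2(2)[OF kpathD(1)[OF h] sc smooth_nth]) (use r x(3) xs that in simp_all)
    then show ?thesis using pd_nth[OF xs, of i 2] that by simp
  qed
  from this[of 0] this[of 1] have p: "pd 0 \<alpha> xs = pd 0 ?c xs *\<^sub>R pd 0 h [?c xs, xs ! 2]"
    "pd 1 \<alpha> xs = pd 1 ?c xs *\<^sub>R pd 0 h [?c xs, xs ! 2]" by simp_all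
  show "\<exists>a b. (a, b) \<noteq> (0, 0) \<and> a *\<^sub>R pd 0 \<alpha> xs + b *\<^sub>R pd 1 \<alpha> xs = 0"
  proof (cases "pd 0 ?c xs = 0")
    case True then show ?thesis unfolding p by (intro exI[of _ 1] exI[of _ 0]) simp
  next
    case False then show ?thesis unfolding p
      by (intro exI[of _ "pd 1 ?c xs"] exI[of _ "- pd 0 ?c xs"]) (simp add: mult.commute)
  qed
qed

text \<open>The interchange path is the concatenation in t of two corner paths, each of which
  contributes 0.\<close>

lemma interchange_integral:
  fixes B :: "'m::finite odiag set" and h h' :: "((real ^ 'n::{finite,linorder}) ^ 'm) path"
  assumes B: "diagram_basis CARD('n) B" "CARD('n) \<ge> 4" and h: "kpath Conf 2 h" and h': "kpath Conf 2 h'"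
    and ab: "corner_family a b" and e: "h [0, 1] = h' [0, 0]"
  shows "good_3path Conf (interchange_path a b h h')" "T_omega B 3 (interchange_path a b h h') = 0"
proof -
  let ?\<alpha> = "\<lambda>xs. h [a [xs ! 0, xs ! 1], xs ! 2]" and ?\<beta> = "\<lambda>xs. h' [b [xs ! 0, xs ! 1], xs ! 2]"
  have c: "smooth_cube 2 f" "collared 2 f" "f ` cube 2 \<subseteq> {0..1}" "r \<in> {0..1} \<Longrightarrow> f [r, 0] = 0 \<and> f [r, 1] = 1"
    if "f \<in> {a, b}" for f r
    using bspec[OF ab[unfolded corner_family_def, THEN conjunct1] that] by blast+
  have m: "a \<in> {a, b}" "b \<in> {a, b}" by simp_all
  note A = corner_path[OF h c[OF m(1)]] and A' = corner_path[OF h' c[OF m(2)]]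
  have g: "good_3path Conf ?\<alpha>" by (rule A(1))
  have g': "good_3path Conf ?\<beta>" by (rule A'(1))
  have z: "?\<alpha> [0, 0, 1] = ?\<beta> [0, 0, 0]" using c(4)[OF m(1), of 0] c(4)[OF m(2), of 0] e by (simp add: numeral_2_eq_2)
  note P = good_pconcat_2[OF g g' z]
  have ag: "agree 3 (pconcat 2 ?\<alpha> ?\<beta>) (interchange_path a b h h')"
    by (rule agree3I) (simp add: pconcat_def interchange_path_def numeral_2_eq_2)
  show "good_3path Conf (interchange_path a b h h')" by (rule good_cong[OF ag P(2)])
  have "T_omega B 3 (interchange_path a b h h') = T_omega B 3 (pconcat 2 ?\<alpha> ?\<beta>)"
    by (rule T_omega_3_agree[OF B good_kpath[OF P(2)] ag, symmetric])
  also have "\<dots> = T_omega B 3 ?\<alpha> + T_omega B 3 ?\<beta>"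
    by (rule T_omega_3_pconcat[OF B good_kpath[OF g] good_kpath[OF g'] _ P(1)]) simp_all
  also have "T_omega B 3 ?\<alpha> = 0" by (rule T_omega_3_flat[OF B good_kpath[OF g] A(2)])
  also have "T_omega B 3 ?\<beta> = 0" by (rule T_omega_3_flat[OF B good_kpath[OF g'] A'(2)])
  finally show "T_omega B 3 (interchange_path a b h h') = 0" by simp
qed

section \<open>Composable representatives of 3-tracks\<close>

lemma up3_composable:
  assumes X: "is_cell3 (path3_groupoid M) x y f g A A' X" and Y: "is_cell3 (path3_groupoid M) x y f g A' A'' Y"
  shows "\<exists>J\<in>X. \<exists>K\<in>Y. agree 2 (face 0 1 J) (face 0 0 K)"
proof -
  from cell3_representative[OF X] obtain J0 where J0: "X = track3 M J0" "good_3path M J0" "track2 M (face 0 1 J0) = A'" by metis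
  from cell3_representative[OF Y] obtain K where K: "Y = track3 M K" "good_3path M K" "track2 M (face 0 0 K) = A'" by metis
  \<comment> \<open>Both faces represent \<open>A'\<close>, so a laminated homotopy connects them;
    it is grafted onto \<open>J0\<close>, while \<open>K\<close> stays as it is.\<close>
  have "face 0 0 K \<in> track2 M (face 0 1 J0)"
    unfolding J0(3) K(3)[symmetric] by (rule track2_refl[OF kpath_face_3[OF good_kpath[OF K(2)]]]) simp_all
  then obtain \<alpha> where \<alpha>: "rank2_homotopy M \<alpha>" "laminated \<alpha>" "agree 2 (face 0 0 \<alpha>) (face 0 1 J0)" "agree 2 (face 0 1 \<alpha>) (face 0 0 K)"
    unfolding track2_def by blast
  from extend_good_3path[OF J0(2) \<alpha>(1-3)] obtain J where J: "J \<in> track3 M J0" "agree 2 (face 0 1 J) (face 0 1 \<alpha>)" by metis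
  have "agree 2 (face 0 1 J) (face 0 0 K)" by (rule agree_trans[OF J(2) \<alpha>(4)])
  then show ?thesis using J(1) track3_refl[OF K(2)] unfolding J0(1) K(1) by blast
qed

lemma track2_side:
  assumes "g' \<in> track2 M g" "c \<in> {0, 1}"
  obtains h where "rank1_homotopy M h" "agree 1 (face 0 0 h) (face 0 c g)" "agree 1 (face 0 1 h) (face 0 c g')"
proof -
  from assms(1) obtain \<alpha> where \<alpha>: "rank2_homotopy M \<alpha>" "agree 2 (face 0 0 \<alpha>) g" "agree 2 (face 0 1 \<alpha>) g'"
    unfolding track2_def by blast
  have c: "c \<in> {0..1}" using assms(2) by auto
  show ?thesis
  proof (rule that)
    show "rank1_homotopy M (face 1 c \<alpha>)" using \<alpha>(1) assms(2) by (auto simp: rank2_homotopy_def)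
    show "agree 1 (face 0 0 (face 1 c \<alpha>)) (face 0 c g)"
      by (rule agree1I) (use agree2D[OF \<alpha>(2) c] in \<open>simp add: face_lit\<close>)
    show "agree 1 (face 0 1 (face 1 c \<alpha>)) (face 0 c g')"
      by (rule agree1I) (use agree2D[OF \<alpha>(3) c] in \<open>simp add: face_lit\<close>)
  qed
qed

text \<open>The side \<open>s = 1\<close> of a representative of \<open>X\<close> is connected to the side \<open>s = 0\<close> of \<open>K\<close> by three rank-1 homotopies: a side of
  a homotopy in \<open>A\<close>, a homotopy between representatives of \<open>g\<close>, and a side of a homotopy in \<open>B\<close>.\<close>

lemma vert3_composable:
  assumes X: "is_cell3 (path3_groupoid M) x y f g A A' X" and Y: "is_cell3 (path3_groupoid M) x y g k B B' Y"
  shows "\<exists>J\<in>X. \<exists>K\<in>Y. agree 2 (face 1 1 J) (face 1 0 K)"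
proof -
  from cell3_representative[OF X] obtain J0 where J0: "X = track3 M J0" "good_3path M J0" "track2 M (face 0 0 J0) = A"
    "is_cell2 (path3_groupoid M) x y f g A" by metis
  from cell3_representative[OF Y] obtain K where K: "Y = track3 M K" "good_3path M K" "track2 M (face 0 0 K) = B"
    "is_cell2 (path3_groupoid M) x y g k B" by metis
  from cell2_representative[OF J0(4)] obtain ga where ga: "A = track2 M ga" "kpath M 2 ga" "track1 M (face 0 1 ga) = g" by metis
  from cell2_representative[OF K(4)] obtain gb where gb: "B = track2 M gb" "kpath M 2 gb" "track1 M (face 0 0 gb) = g" by metis
  note Jg = good_indep[OF J0(2)] and Kg = good_indep[OF K(2)]
  have 1: "ga \<in> track2 M (face 0 0 J0)" unfolding J0(3) ga(1) by (rule track2_refl[OF ga(2)])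
  have 2: "face 0 0 gb \<in> track1 M (face 0 1 ga)" unfolding ga(3) gb(3)[symmetric]
    by (rule track1_refl[OF kpath_face_2[OF gb(2)]]) simp
  have 3: "face 0 0 K \<in> track2 M gb" unfolding gb(1)[symmetric] K(3)[symmetric]
    by (rule track2_refl[OF kpath_face_3[OF good_kpath[OF K(2)]]]) simp_all
  obtain h1 where h1: "rank1_homotopy M h1" "agree 1 (face 0 0 h1) (face 0 1 (face 0 0 J0))" "agree 1 (face 0 1 h1) (face 0 1 ga)"
    by (rule track2_side[OF 1, of 1]) simp
  obtain h2 where h2: "rank1_homotopy M h2" "agree 1 (face 0 0 h2) (face 0 1 ga)" "agree 1 (face 0 1 h2) (face 0 0 gb)"
    using 2 unfolding track1_def by blast
  obtain h3 where h3: "rank1_homotopy M h3" "agree 1 (face 0 0 h3) (face 0 0 gb)" "agree 1 (face 0 1 h3) (face 0 0 (face 0 0 K))"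
    by (rule track2_side[OF 3, of 0]) simp
  note h12 = rank1_trans[OF h1(1) h2(1) agree_trans[OF h1(3) agree_sym[OF h2(2)]]]
  have m: "agree 1 (face 0 1 (pconcat 0 h1 h2)) (face 0 0 h3)"
    by (rule agree_trans[OF h12(3) agree_trans[OF h2(3) agree_sym[OF h3(2)]]])
  note h123 = rank1_trans[OF h12(1) h3(1) m]
  let ?h = "pconcat 0 (pconcat 0 h1 h2) h3"
  have s: "agree 1 (face 0 0 ?h) (face 0 1 (face 0 0 J0))"
    by (rule agree_trans[OF h123(2) agree_trans[OF h12(2) h1(2)]])
  have t: "agree 1 (face 0 1 ?h) (face 0 0 (face 0 0 K))" by (rule agree_trans[OF h123(3) h3(3)])
  have "agree 1 (face 0 1 (face 0 0 J0)) (face 0 1 (face 0 1 J0))"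
    by (rule agree1I) (simp add: face_lit Jg[of 1 0 1])
  then have s': "agree 1 (face 0 0 ?h) (face 0 1 (face 0 1 J0))" by (rule agree_trans[OF s])
  \<comment> \<open>Two graftings in succession: \<open>?h\<close> moves the side s = 1 of the
    2-path \<open>face 0 1 J0\<close>, and the resulting homotopy \<alpha> moves the end r = 1 of
    \<open>J0\<close>.\<close>
  obtain \<alpha> where \<alpha>: "rank2_homotopy M \<alpha>" "laminated \<alpha>" "agree 2 (face 0 0 \<alpha>) (face 0 1 J0)"
    "agree 1 (face 0 1 (face 0 1 \<alpha>)) (face 0 1 ?h)"
    by (rule extend_2path[OF kpath_face_3[OF good_kpath[OF J0(2)]] h123(1) s']) simp_all
  from extend_good_3path[OF J0(2) \<alpha>(1-3)] obtain J where J: "J \<in> track3 M J0" "good_3path M J" "agree 2 (face 0 1 J) (face 0 1 \<alpha>)" by metis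
  have "agree 2 (face 1 1 J) (face 1 0 K)"
  proof (rule agree2I)
    \<comment> \<open>Both sides are independent of r, so it suffices to compare \<open>J\<close> at
      r = 1 with \<open>K\<close> at r = 0.\<close>
    fix r t' :: real assume r: "r \<in> {0..1}" and t': "t' \<in> {0..1}"
    have z: "(1::real) \<in> {0..1}" by simp
    have "J [r, 1, t'] = J [1, 1, t']" by (rule good_indep[OF J(2) _ r z t']) simp
    also have "\<dots> = \<alpha> [1, 1, t']" using agree2D[OF J(3) z t'] by (simp add: face_lit)
    also have "\<dots> = ?h [1, t']" using agree1D[OF \<alpha>(4) t'] by (simp add: face_lit)
    also have "\<dots> = K [0, 0, t']" using agree1D[OF t t'] by (simp add: face_lit)
    also have "\<dots> = K [r, 0, t']" by (rule Kg) (use r t' in simp_all)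
    finally show "face 1 1 J [r, t'] = face 1 0 K [r, t']" by (simp add: face_lit)
  qed
  then show ?thesis using J(1) track3_refl[OF K(2)] unfolding J0(1) K(1) by blast
qed

section \<open>Transport of composites of 3-tracks\<close>

lemma cell3_image:
  fixes B :: "'m::finite odiag set" and X :: "((real ^ 'n::{finite,linorder}) ^ 'm) path set"
  assumes B: "diagram_basis CARD('n) B" "CARD('n) \<ge> 4" and X: "is_cell3 (path3_groupoid Conf) x y f g A A' X" and J: "J \<in> X"
  shows "T_omega B 3 ` X = {T_omega B 3 J}"
proof -
  from cell3_representative[OF X] obtain J0 where J0: "X = track3 Conf J0" by metis
  have "T_omega B 3 K = T_omega B 3 J0" if "K \<in> X" for K using T_omega_3_track[OF B] that J0 by blast
  then show ?thesis using J by auto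
qed

lemma image_id3:
  fixes B :: "'m::finite odiag set" and A :: "((real ^ 'n::{finite,linorder}) ^ 'm) path set"
  assumes B: "diagram_basis CARD('n) B" "CARD('n) \<ge> 4" and A: "is_cell2 (path3_groupoid Conf) x y f g A"
  shows "T_omega B 3 ` id3 (path3_groupoid Conf) A = {0}"
proof -
  have "T_omega B 3 ` \<Union>((\<lambda>g. track3 Conf (\<lambda>xs. g (tl xs))) ` A) = {0}"
  proof (rule image_tracks[OF B])
    show "(\<lambda>g. track3 Conf (\<lambda>xs. g (tl xs))) ` A \<noteq> {}" using cell2_members(1)[OF A] by blast
    fix X assume "X \<in> (\<lambda>g. track3 Conf (\<lambda>xs. g (tl xs))) ` A"
    then obtain h where h: "h \<in> A" "X = track3 Conf (\<lambda>xs. h (tl xs))" by blast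
    have g: "good_3path Conf (\<lambda>xs. h (tl xs))" using cell2_members(2)[OF A h(1)] by (intro good_tl) simp
    have z: "pd 0 (\<lambda>xs. h (tl xs)) xs = 0" if "xs \<in> cube 3" for xs
      by (rule pd_tl_0[of _ 2]) (use that in \<open>simp add: numeral_3_eq_3\<close>)
    have "T_omega B 3 (\<lambda>xs. h (tl xs)) = 0"
      by (rule T_omega_3_flat[OF B good_kpath[OF g]], intro exI[of _ 1] exI[of _ 0]) (simp add: z)
    then show "\<exists>P. X = track3 Conf P \<and> good_3path Conf P \<and> T_omega B 3 P = 0" using h(2) g by blast
  qed
  then show ?thesis by (simp add: path3_groupoid_def)
qed

lemma image_up3:
  fixes B :: "'m::finite odiag set" and X Y :: "((real ^ 'n::{finite,linorder}) ^ 'm) path set"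
  assumes B: "diagram_basis CARD('n) B" "CARD('n) \<ge> 4"
    and X: "is_cell3 (path3_groupoid Conf) x y f g A A' X" "J0 \<in> X" and Y: "is_cell3 (path3_groupoid Conf) x y f g A' A'' Y" "K0 \<in> Y"
  shows "T_omega B 3 ` up3 (path3_groupoid Conf) X Y = {T_omega B 3 J0 + T_omega B 3 K0}"
proof -
  let ?S = "{track3 Conf (pconcat 0 J K) |J K. J \<in> X \<and> K \<in> Y \<and> agree 2 (face 0 1 J) (face 0 0 K)}"
  have "T_omega B 3 ` \<Union>?S = {T_omega B 3 J0 + T_omega B 3 K0}"
  proof (rule image_tracks[OF B])
    show "?S \<noteq> {}" using up3_composable[OF X(1) Y(1)] by blast
    fix Z assume "Z \<in> ?S"
    then obtain J K where JK: "Z = track3 Conf (pconcat 0 J K)" "J \<in> X" "K \<in> Y" "agree 2 (face 0 1 J) (face 0 0 K)" by blast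
    have g: "good_3path Conf J" "good_3path Conf K" using cell3_members(2)[OF X(1) JK(2)] cell3_members(2)[OF Y(1) JK(3)] by simp_all
    note P = good_pconcat_0[OF g JK(4)]
    have "T_omega B 3 (pconcat 0 J K) = T_omega B 3 J + T_omega B 3 K"
      by (rule T_omega_3_pconcat[OF B good_kpath[OF g(1)] good_kpath[OF g(2)] _ P(1)]) simp_all
    also have "\<dots> = T_omega B 3 J0 + T_omega B 3 K0"
      using cell3_image[OF B X] cell3_image[OF B Y] JK(2,3) by (intro arg_cong2[where f="(+)"]) blast+
    finally show "\<exists>P. Z = track3 Conf P \<and> good_3path Conf P \<and> T_omega B 3 P = T_omega B 3 J0 + T_omega B 3 K0" using JK(1) P(2) by blast
  qed
  then show ?thesis by (simp add: path3_groupoid_def)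
qed

lemma image_vert3:
  fixes B :: "'m::finite odiag set" and X Y :: "((real ^ 'n::{finite,linorder}) ^ 'm) path set"
  assumes B: "diagram_basis CARD('n) B" "CARD('n) \<ge> 4"
    and X: "is_cell3 (path3_groupoid Conf) x y f g A A' X" "J0 \<in> X" and Y: "is_cell3 (path3_groupoid Conf) x y g k C C' Y" "K0 \<in> Y"
  shows "T_omega B 3 ` vert3 (path3_groupoid Conf) X Y = {T_omega B 3 J0 + T_omega B 3 K0}"
proof -
  let ?S = "{track3 Conf (pconcat 1 J K) |J K. J \<in> X \<and> K \<in> Y \<and> agree 2 (face 1 1 J) (face 1 0 K)}"
  have "T_omega B 3 ` \<Union>?S = {T_omega B 3 J0 + T_omega B 3 K0}"
  proof (rule image_tracks[OF B])
    show "?S \<noteq> {}" using vert3_composable[OF X(1) Y(1)] by blast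
    fix Z assume "Z \<in> ?S"
    then obtain J K where JK: "Z = track3 Conf (pconcat 1 J K)" "J \<in> X" "K \<in> Y" "agree 2 (face 1 1 J) (face 1 0 K)" by blast
    have g: "good_3path Conf J" "good_3path Conf K" using cell3_members(2)[OF X(1) JK(2)] cell3_members(2)[OF Y(1) JK(3)] by simp_all
    note P = good_pconcat_1[OF g JK(4)]
    have "T_omega B 3 (pconcat 1 J K) = T_omega B 3 J + T_omega B 3 K"
      by (rule T_omega_3_pconcat[OF B good_kpath[OF g(1)] good_kpath[OF g(2)] _ P(1)]) simp_all
    also have "\<dots> = T_omega B 3 J0 + T_omega B 3 K0"
      using cell3_image[OF B X] cell3_image[OF B Y] JK(2,3) by (intro arg_cong2[where f="(+)"]) blast+
    finally show "\<exists>P. Z = track3 Conf P \<and> good_3path Conf P \<and> T_omega B 3 P = T_omega B 3 J0 + T_omega B 3 K0" using JK(1) P(2) by blast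
  qed
  then show ?thesis by (simp add: path3_groupoid_def)
qed

lemma T_omega_3_spread:
  fixes B :: "'m::finite odiag set" and \<gamma> :: "((real ^ 'n::{finite,linorder}) ^ 'm) path"
  assumes B: "diagram_basis CARD('n) B" "CARD('n) \<ge> 4" and g: "kpath Conf 1 \<gamma>"
  shows "T_omega B 3 (spread \<gamma>) = 0"
  by (rule T_omega_3_flat[OF B good_kpath[OF good_spread[OF g]]], intro exI[of _ 1] exI[of _ 0]) (simp add: pd_spread)

lemma image_lwhisk3:
  fixes B :: "'m::finite odiag set" and X :: "((real ^ 'n::{finite,linorder}) ^ 'm) path set"
  assumes B: "diagram_basis CARD('n) B" "CARD('n) \<ge> 4"
    and f: "is_cell1 (path3_groupoid Conf) x y f" and X: "is_cell3 (path3_groupoid Conf) y z g g' A A' X" "J0 \<in> X"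
  shows "T_omega B 3 ` lwhisk3 (path3_groupoid Conf) f X = {T_omega B 3 J0}"
proof -
  let ?S = "{track3 Conf (pconcat 2 (spread \<gamma>) J) |\<gamma> J. \<gamma> \<in> f \<and> J \<in> X \<and> \<gamma> [1] = J [0, 0, 0]}"
  note fm = cell1_members(2)[OF f] and Xm = cell3_members(2)[OF X(1)]
  have "T_omega B 3 ` \<Union>?S = {T_omega B 3 J0}"
  proof (rule image_tracks[OF B])
    obtain \<gamma> where g: "\<gamma> \<in> f" using cell1_members(1)[OF f] by blast
    then have "\<gamma> [1] = J0 [0, 0, 0]" using fm[of \<gamma>] Xm[OF X(2)] by simp
    then show "?S \<noteq> {}" using g X(2) by blast
    fix Z assume "Z \<in> ?S"
    then obtain \<gamma> J where J: "Z = track3 Conf (pconcat 2 (spread \<gamma>) J)" "\<gamma> \<in> f" "J \<in> X" "\<gamma> [1] = J [0, 0, 0]" by blast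
    have k: "kpath Conf 1 \<gamma>" and g: "good_3path Conf J" using fm[OF J(2)] Xm[OF J(3)] by simp_all
    have e: "spread \<gamma> [0, 0, 1] = J [0, 0, 0]" using J(4) by (simp add: spread_def)
    note s = good_spread[OF k]
    note P = good_pconcat_2[OF s g e]
    have "T_omega B 3 (pconcat 2 (spread \<gamma>) J) = T_omega B 3 (spread \<gamma>) + T_omega B 3 J"
      by (rule T_omega_3_pconcat[OF B good_kpath[OF s] good_kpath[OF g] _ P(1)]) simp_all
    also have "\<dots> = T_omega B 3 J" using T_omega_3_spread[OF B k] by simp
    also have "\<dots> = T_omega B 3 J0" using cell3_image[OF B X] J(3) by blast
    finally show "\<exists>P. Z = track3 Conf P \<and> good_3path Conf P \<and> T_omega B 3 P = T_omega B 3 J0" using J(1) P(2) by blast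
  qed
  then show ?thesis by (simp add: path3_groupoid_def)
qed

lemma image_rwhisk3:
  fixes B :: "'m::finite odiag set" and X :: "((real ^ 'n::{finite,linorder}) ^ 'm) path set"
  assumes B: "diagram_basis CARD('n) B" "CARD('n) \<ge> 4"
    and X: "is_cell3 (path3_groupoid Conf) x y g g' A A' X" "J0 \<in> X" and f: "is_cell1 (path3_groupoid Conf) y z f"
  shows "T_omega B 3 ` rwhisk3 (path3_groupoid Conf) X f = {T_omega B 3 J0}"
proof -
  let ?S = "{track3 Conf (pconcat 2 J (spread \<gamma>)) |J \<gamma>. J \<in> X \<and> \<gamma> \<in> f \<and> J [0, 0, 1] = \<gamma> [0]}"
  note fm = cell1_members(2)[OF f] and Xm = cell3_members(2)[OF X(1)]
  have "T_omega B 3 ` \<Union>?S = {T_omega B 3 J0}"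
  proof (rule image_tracks[OF B])
    obtain \<gamma> where g: "\<gamma> \<in> f" using cell1_members(1)[OF f] by blast
    then have "J0 [0, 0, 1] = \<gamma> [0]" using fm[of \<gamma>] Xm[OF X(2)] by simp
    then show "?S \<noteq> {}" using g X(2) by blast
    fix Z assume "Z \<in> ?S"
    then obtain \<gamma> J where J: "Z = track3 Conf (pconcat 2 J (spread \<gamma>))" "\<gamma> \<in> f" "J \<in> X" "J [0, 0, 1] = \<gamma> [0]" by blast
    have k: "kpath Conf 1 \<gamma>" and g: "good_3path Conf J" using fm[OF J(2)] Xm[OF J(3)] by simp_all
    have e: "J [0, 0, 1] = spread \<gamma> [0, 0, 0]" using J(4) by (simp add: spread_def)
    note s = good_spread[OF k]
    note P = good_pconcat_2[OF g s e]
    have "T_omega B 3 (pconcat 2 J (spread \<gamma>)) = T_omega B 3 J + T_omega B 3 (spread \<gamma>)"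
      by (rule T_omega_3_pconcat[OF B good_kpath[OF g] good_kpath[OF s] _ P(1)]) simp_all
    also have "\<dots> = T_omega B 3 J" using T_omega_3_spread[OF B k] by simp
    also have "\<dots> = T_omega B 3 J0" using cell3_image[OF B X] J(3) by blast
    finally show "\<exists>P. Z = track3 Conf P \<and> good_3path Conf P \<and> T_omega B 3 P = T_omega B 3 J0" using J(1) P(2) by blast
  qed
  then show ?thesis by (simp add: path3_groupoid_def)
qed

lemma image_interchange:
  fixes B :: "'m::finite odiag set" and X Y :: "((real ^ 'n::{finite,linorder}) ^ 'm) path set"
  assumes B: "diagram_basis CARD('n) B" "CARD('n) \<ge> 4"
    and X: "is_cell2 (path3_groupoid Conf) x y f f' X" and Y: "is_cell2 (path3_groupoid Conf) y z g g' Y"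
  shows "T_omega B 3 ` interchange (path3_groupoid Conf) X Y = {0}"
proof -
  let ?S = "{track3 Conf (interchange_path a b h h') |a b h h'. corner_family a b \<and> h \<in> X \<and> h' \<in> Y \<and> h [0, 1] = h' [0, 0]}"
  note Xm = cell2_members(2)[OF X] and Ym = cell2_members(2)[OF Y]
  have "T_omega B 3 ` \<Union>?S = {0}"
  proof (rule image_tracks[OF B])
    obtain h h' where "h \<in> X" "h' \<in> Y" using cell2_members(1)[OF X] cell2_members(1)[OF Y] by blast
    moreover from this have "h [0, 1] = h' [0, 0]" using Xm[of h] Ym[of h'] by simp
    ultimately show "?S \<noteq> {}" using corner_family_exists by blast
    fix Z assume "Z \<in> ?S"
    then obtain a b h h' where h: "Z = track3 Conf (interchange_path a b h h')" "corner_family a b" "h \<in> X" "h' \<in> Y" "h [0, 1] = h' [0, 0]"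
      by blast
    have "kpath Conf 2 h" "kpath Conf 2 h'" using Xm[OF h(3)] Ym[OF h(4)] by simp_all
    from interchange_integral[OF B this h(2,5)] show "\<exists>P. Z = track3 Conf P \<and> good_3path Conf P \<and> T_omega B 3 P = 0"
      using h(1) by blast
  qed
  then show ?thesis by (simp add: path3_groupoid_def)
qed

theorem corollary4:
  fixes B :: "'m::finite odiag set"
  assumes "CARD('n::{finite,linorder}) \<ge> 4"
    and "diagram_basis CARD('n) B"
  shows "\<exists>Hol1 Hol2 Hol3.
    gray_functor (path3_groupoid (Conf :: ((real ^ 'n::_) ^ 'm) set)) (cobar_gray CARD('n) B)
      (\<lambda>_. ()) Hol1 Hol2 Hol3 \<and>
    (\<forall>\<gamma>. kpath Conf 1 \<gamma> \<longrightarrow> Hol1 (track1 Conf \<gamma>) = T_omega B 1 \<gamma>) \<and>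
    (\<forall>g. kpath Conf 2 g \<longrightarrow> Hol2 (track2 Conf g) = T_omega B 2 g) \<and>
    (\<forall>J. good_3path Conf J \<longrightarrow> Hol3 (track3 Conf J) = mod12 CARD('n) B (T_omega B 3 J))"
proof -
  note B = assms(2,1)
  let ?P = "path3_groupoid (Conf :: ((real ^ 'n::_) ^ 'm) set)"
  let ?C = "cobar_gray CARD('n) B"
  let ?T = "\<lambda>X :: ((real ^ 'n::_) ^ 'm) path set. T_omega B 3 ` X"
  note triv = mod12_trivial[OF B]
  \<comment> \<open>The only 2-cell in the image: it runs from 1 to 1, because the transport of
    every 1-path is 1.\<close>
  have c2: "is_cell2 ?C x y 1 1 0" for x y
    using subspace_0[OF subspace_span] linear_0[OF linear_d_Omega[of "CARD('n)" B]]
    by (simp add: is_cell2_def is_cell1_def cobar_gray_def one_in_Omega_0 Omega_def[of _ _ 1])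
  have C: "id1 ?C u = 1" "id2 ?C p = 0" "id3 ?C p = {0}" "comp1 ?C p q = p * q" "vert2 ?C p q = p + q"
    "lwhisk2 ?C p q = p * q" "rwhisk2 ?C p q = p * q" "interchange ?C p q = {p * q}"
    "vert3 ?C {p} {q} = {p + q}" "up3 ?C {p} {q} = {p + q}" "lwhisk3 ?C p {q} = {p * q}" "rwhisk3 ?C {q} p = {q * p}"
    for u p q by (simp_all add: cobar_gray_def triv)
  \<comment> \<open>On 3-tracks the functor is the set of transports of all members; this set is a
    singleton and hence a \<open>mod12\<close> class.\<close>
  have "gray_functor ?P ?C (\<lambda>_. ()) (\<lambda>_. 1) (\<lambda>_. 0) ?T"
    unfolding gray_functor_def C
  proof (intro conjI)
    show "\<forall>x\<in>Obj ?P. () \<in> Obj ?C \<and> (1 :: 'm cobar) = 1" by (simp add: cobar_gray_def)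
    show "\<forall>x y f. is_cell1 ?P x y f \<longrightarrow> is_cell1 ?C () () 1 \<and> (0 :: 'm cobar) = 0"
      using c2 by (simp add: is_cell2_def)
    show "\<forall>x y f g A. is_cell2 ?P x y f g A \<longrightarrow> is_cell2 ?C () () 1 1 0 \<and> ?T (id3 ?P A) = {0}"
      using c2 image_id3[OF B] by blast
    show "\<forall>x y f g A A' J. is_cell3 ?P x y f g A A' J \<longrightarrow> is_cell3 ?C () () 1 1 0 0 (?T J)"
    proof (intro allI impI)
      fix x y f g A A' X assume X: "is_cell3 ?P x y f g A A' X"
      obtain J where J: "J \<in> X" using cell3_members(1)[OF X] by blast
      have "{T_omega B 3 J} \<in> Hom3 ?C 0 0"
        using T_omega_3_Omega[OF B, of J] by (auto simp: cobar_gray_def triv)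
      then show "is_cell3 ?C () () 1 1 0 0 (?T X)" using c2 cell3_image[OF B X J] by (simp add: is_cell3_def)
    qed
    show "\<forall>x y f g h A A' C C' J K. is_cell3 ?P x y f g A A' J \<and> is_cell3 ?P x y g h C C' K \<longrightarrow> ?T (vert3 ?P J K) = vert3 ?C (?T J) (?T K)"
    proof (intro allI impI)
      fix x y f g h A A' C C' X Y assume a: "is_cell3 ?P x y f g A A' X \<and> is_cell3 ?P x y g h C C' Y"
      obtain J K where J: "J \<in> X" and K: "K \<in> Y"
        using cell3_members(1)[OF conjunct1[OF a]] cell3_members(1)[OF conjunct2[OF a]] by blast
      show "?T (vert3 ?P X Y) = vert3 ?C (?T X) (?T Y)"
        using image_vert3[OF B conjunct1[OF a] J conjunct2[OF a] K] cell3_image[OF B conjunct1[OF a] J] cell3_image[OF B conjunct2[OF a] K]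
        by (simp add: C)
    qed
    show "\<forall>x y f g A A' A'' J K. is_cell3 ?P x y f g A A' J \<and> is_cell3 ?P x y f g A' A'' K \<longrightarrow> ?T (up3 ?P J K) = up3 ?C (?T J) (?T K)"
    proof (intro allI impI)
      fix x y f g A A' A'' X Y assume a: "is_cell3 ?P x y f g A A' X \<and> is_cell3 ?P x y f g A' A'' Y"
      obtain J K where J: "J \<in> X" and K: "K \<in> Y"
        using cell3_members(1)[OF conjunct1[OF a]] cell3_members(1)[OF conjunct2[OF a]] by blast
      show "?T (up3 ?P X Y) = up3 ?C (?T X) (?T Y)"
        using image_up3[OF B conjunct1[OF a] J conjunct2[OF a] K] cell3_image[OF B conjunct1[OF a] J] cell3_image[OF B conjunct2[OF a] K]
        by (simp add: C)
    qed
    show "\<forall>x y z f g g' A A' J. is_cell1 ?P x y f \<and> is_cell3 ?P y z g g' A A' J \<longrightarrow> ?T (lwhisk3 ?P f J) = lwhisk3 ?C 1 (?T J)"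
    proof (intro allI impI)
      fix x y z f g g' A A' X assume a: "is_cell1 ?P x y f \<and> is_cell3 ?P y z g g' A A' X"
      obtain J where J: "J \<in> X" using cell3_members(1)[OF conjunct2[OF a]] by blast
      show "?T (lwhisk3 ?P f X) = lwhisk3 ?C 1 (?T X)"
        using image_lwhisk3[OF B conjunct1[OF a] conjunct2[OF a] J] cell3_image[OF B conjunct2[OF a] J] by (simp add: C)
    qed
    show "\<forall>x y z f f' g A A' J. is_cell3 ?P x y f f' A A' J \<and> is_cell1 ?P y z g \<longrightarrow> ?T (rwhisk3 ?P J g) = rwhisk3 ?C (?T J) 1"
    proof (intro allI impI)
      fix x y z f f' g A A' X assume a: "is_cell3 ?P x y f f' A A' X \<and> is_cell1 ?P y z g"
      obtain J where J: "J \<in> X" using cell3_members(1)[OF conjunct1[OF a]] by blast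
      show "?T (rwhisk3 ?P X g) = rwhisk3 ?C (?T X) 1"
        using image_rwhisk3[OF B conjunct1[OF a] J conjunct2[OF a]] cell3_image[OF B conjunct1[OF a] J] by (simp add: C)
    qed
    show "\<forall>x y z f f' g g' A A'. is_cell2 ?P x y f f' A \<and> is_cell2 ?P y z g g' A' \<longrightarrow> ?T (interchange ?P A A') = {0 * 0}"
    proof (intro allI impI)
      fix x y z f f' g g' A A' assume a: "is_cell2 ?P x y f f' A \<and> is_cell2 ?P y z g g' A'"
      show "?T (interchange ?P A A') = {0 * 0}"
        unfolding image_interchange[OF B conjunct1[OF a] conjunct2[OF a]] by simp
    qed
  qed (intro allI impI, simp only: mult_1 add_0 mult_zero_right mult_zero_left)+
  moreover have "?T (track3 Conf J) = {T_omega B 3 J}" if "good_3path Conf J" for J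
  proof -
    have "T_omega B 3 J' = T_omega B 3 J" if "J' \<in> track3 Conf J" for J' by (rule T_omega_3_track[OF B that])
    moreover have "T_omega B 3 J \<in> ?T (track3 Conf J)" by (rule imageI, rule track3_refl[OF that])
    ultimately show ?thesis by blast
  qed
  ultimately show ?thesis unfolding triv
    by (intro exI[of _ "\<lambda>_. 1"] exI[of _ "\<lambda>_. 0"] exI[of _ ?T] conjI allI impI)
      (simp_all only: T_omega_1[OF B] T_omega_2[OF B])
qed

end
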